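(* Assume (A1)–(A4), with $\iota>2$ the constant in (A3), $\Theta_{0,4}(\mathbf L)+\Theta_{0,2}(H)<\infty$, and $\Theta_{n,\iota}(\mathbf L)=O(n^{-\nu})$ as $n\to\infty$ for some $\nu>1/2-1/\iota$. Let $$\varphi_n=(nb_n)^{-1}\{n^{1/\iota}+(nb_n\log n)^{1/2}\}+b_n^2,\qquad \rho_n=n^{-1/2}b_n^{-1}+b_n.$$ If $b_n\asymp n^{-c}$ for some $0<c<1-1/\iota$, and the tuning parameter satisfies $$\chi_n\to0\quad\text{and}\quad\{\varphi_n(\varphi_n+\rho_n)\}^{-1}\chi_n\to\infty,$$ then, for any $D\subseteq\{1,\ldots,p\}$ with $D\ne D_0$, $$\Pr\{\mathrm{VIC}(D)>\mathrm{VIC}(D_0)\}\to1\qquad\text{as }n\to\infty.$$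
   Context: Model: for each $n$, one observes $(\mathbf x_i,y_i)_{i=1}^n$ with $y_i=\mathbf x_i^\top\boldsymbol\beta(i/n)+e_i$, where $\boldsymbol\beta:[0,1]\to\mathbb R^p$ and $E(e_i\mid\mathbf x_i)=0$. The predictors and errors are $\mathbf x_i=\mathbf G(i/n;\boldsymbol{\mathcal F}_i)\in\mathbb R^p$ and $e_i=H(i/n;\boldsymbol{\mathcal F}_i)\in\mathbb R$, where $\boldsymbol{\mathcal F}_i=(\ldots,\boldsymbol\varepsilon_{i-1},\boldsymbol\varepsilon_i)$, $(\boldsymbol\varepsilon_k)_{k\in\mathbb Z}$ are i.i.d., and $\mathbf G,H$ are measurable functions such that $\mathbf G(t;\boldsymbol{\mathcal F}_i)$, $H(t;\boldsymbol{\mathcal F}_i)$ are well defined for every $t\in[0,1]$. Put $\mathbf L(t;\boldsymbol{\mathcal F}_k)=\mathbf G(t;\boldsymbol{\mathcal F}_k)H(t;\boldsymbol{\mathcal F}_k)$. Norms: $|\cdot|$ is the Euclidean norm, $\|\mathbf Z\|_q=\{E|\mathbf Z|^q\}^{1/q}$, $\|\cdot\|=\|\cdot\|_2$. A process $\mathbf J(t;\boldsymbol{\mathcal F}_k)$ is in $\mathrm{Lip}$ if there is $C>0$ with $\|\mathbf J(t_1;\boldsymbol{\mathcal F}_k)-\mathbf J(t_2;\boldsymbol{\mathcal F}_k)\|\le C|t_1-t_2|$ for all $t_1,t_2\in[0,1]$. Dependence measures: let $(\boldsymbol\varepsilon_j')$ be an i.i.d. copy of $(\boldsymbol\varepsilon_j)$,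 and $\boldsymbol{\mathcal F}_{k,\{0\}}=(\ldots,\boldsymbol\varepsilon_{-1},\boldsymbol\varepsilon_0',\boldsymbol\varepsilon_1,\ldots,\boldsymbol\varepsilon_k)$. Then $\delta_{k,q}(\mathbf J)=\sup_{t\in[0,1]}\|\mathbf J(t;\boldsymbol{\mathcal F}_k)-\mathbf J(t;\boldsymbol{\mathcal F}_{k,\{0\}})\|_q$ and $\Theta_{m,q}(\mathbf J)=\sum_{j=m}^\infty\delta_{j,q}(\mathbf J)$. $\mathbf M(\mathbf J,t)=E\{\mathbf J(t;\boldsymbol{\mathcal F}_0)\mathbf J(t;\boldsymbol{\mathcal F}_0)^\top\}$. Assumptions: (A1) $\boldsymbol\beta\in\mathcal C^3[0,1]$; (A2) $\mathbf G,\mathbf L\in\mathrm{Lip}$; (A3) $\Theta_{0,4}(\mathbf G)+\Theta_{0,\iota}(\mathbf L)<\infty$ for some $\iota>2$; (A4) the smallest eigenvalue of $\mathbf M(\mathbf G,t)$ is bounded away from zero over $t\in[0,1]$. Estimator: $K$ is a symmetric bounded kernel supported on $[-1,1]$, in $\mathcal C^1[-1,1]$, with $\int_{-1}^1K(v)\,dv=1$; the bandwidth satisfies $b_n\to0$, $nb_n\to\infty$. The local linear estimator (computed using all $p$ predictors) is $$(\tilde{\boldsymbol\beta}(t),\tilde{\boldsymbol\beta}'(t))=\operatorname*{argmin}_{\boldsymbol\eta_0,\boldsymbol\eta_1\in\mathbb R^p}\sum_{i=1}^n\{y_i-\mathbf x_i^\top\boldsymbol\eta_0-\mathbf x_i^\top\boldsymbol\eta_1(i/n-t)\}^2K\Bigl(\frac{i/n-t}{b_n}\Bigr).$$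 Variable selection: $D_0\subseteq\{1,\ldots,p\}$ is the true set of relevant predictors, i.e. the set of $j$ for which the component $\beta_j(\cdot)$ is not identically zero. For $D\subseteq\{1,\ldots,p\}$, $\mathbf x_{D,i}$ and $\tilde{\boldsymbol\beta}_D(t)$ are the subvectors of $\mathbf x_i$ and $\tilde{\boldsymbol\beta}(t)$ with indices in $D$, $|D|$ is the cardinality of $D$, and $$\mathrm{RSS}(D)=\sum_{i=1}^n\{y_i-\mathbf x_{D,i}^\top\tilde{\boldsymbol\beta}_D(i/n)\}^2,\qquad\mathrm{VIC}(D)=\log\{\mathrm{RSS}(D)\}+\chi_n|D|.$$ $b_n\asymp n^{-c}$ means $b_nn^c$ is bounded away from $0$ and $\infty$.
   Formalization: It is also assumed that the errors are not degenerate, i.e. L(t;F_0)=G(t;F_0)H(t;F_0) is not a.s. zero for some t in [0,1] (with H=0, β=0 every RSS is 0 and VIC is undefined), and that the kernel K is nonnegative, so that the argmin exists. *)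

theory Defs
  imports "HOL-Probability.Probability"
begin

section \<open>Norms, smoothness, eigenvalues\<close>

text \<open>The norm takes values in the extended nonnegative reals, so that it is meaningful
  (and possibly infinite) without any integrability assumption.\<close>

definition Lq_norm :: "'a measure \<Rightarrow> real \<Rightarrow> ('a \<Rightarrow> 'b::real_normed_vector) \<Rightarrow> ennreal" where
  "Lq_norm M q Z =
     (let I = (\<integral>\<^sup>+ \<omega>. ennreal (norm (Z \<omega>) powr q) \<partial>M)
      in if I = \<infinity> then \<infinity> else ennreal (enn2real I powr (1 / q)))"

text \<open>\<open>k\<close> times continuously differentiable on \<open>S\<close>; on a compact interval the derivatives at
  the endpoints are one-sided.\<close>

definition Ck_on :: "nat \<Rightarrow> (real \<Rightarrow> 'b::real_normed_vector) \<Rightarrow> real set \<Rightarrow> bool" where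
  "Ck_on k f S \<longleftrightarrow>
     (\<exists>D. (\<forall>t\<in>S. D 0 t = f t) \<and>
          (\<forall>j<k. \<forall>t\<in>S. (D j has_vector_derivative D (Suc j) t) (at t within S)) \<and>
          (\<forall>j\<le>k. continuous_on S (D j)))"

definition real_eigenvalue :: "real ^ 'n ^ 'n \<Rightarrow> real \<Rightarrow> bool" where
  "real_eigenvalue A l \<longleftrightarrow> (\<exists>v. v \<noteq> 0 \<and> A *v v = l *\<^sub>R v)"

text \<open>Used for symmetric matrices only, whose set of real eigenvalues is finite and nonempty.\<close>

definition smallest_eigenvalue :: "real ^ 'n ^ 'n \<Rightarrow> real" where
  "smallest_eigenvalue A = Min {l. real_eigenvalue A l}"


section \<open>Causal locally stationary processes\<close>

text \<open>The shift process up to time \<open>k\<close> is encoded as a sequence running backwards in time: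
  its \<open>j\<close>-th entry is the innovation at time \<open>k - j\<close>.\<close>

definition past :: "(int \<Rightarrow> 'a \<Rightarrow> 's) \<Rightarrow> int \<Rightarrow> 'a \<Rightarrow> nat \<Rightarrow> 's" where
  "past \<epsilon> k \<omega> = (\<lambda>j. \<epsilon> (k - int j) \<omega>)"

definition past_coupled :: "(int \<Rightarrow> 'a \<Rightarrow> 's) \<Rightarrow> (int \<Rightarrow> 'a \<Rightarrow> 's) \<Rightarrow> int \<Rightarrow> 'a \<Rightarrow> nat \<Rightarrow> 's" where
  "past_coupled \<epsilon> \<epsilon>' k = past (\<epsilon>(0 := \<epsilon>' 0)) k"

text \<open>Both families are i.i.d. with the same law, and they are independent of each other.\<close>

definition iid_with_copy ::
  "'a measure \<Rightarrow> 's measure \<Rightarrow> (int \<Rightarrow> 'a \<Rightarrow> 's) \<Rightarrow> (int \<Rightarrow> 'a \<Rightarrow> 's) \<Rightarrow> bool" where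
  "iid_with_copy M S \<epsilon> \<epsilon>' \<longleftrightarrow>
     prob_space.indep_vars M (\<lambda>_. S) (case_sum \<epsilon> \<epsilon>') (UNIV :: (int + int) set) \<and>
     (\<forall>k. distr M S (\<epsilon> k) = distr M S (\<epsilon> 0) \<and> distr M S (\<epsilon>' k) = distr M S (\<epsilon> 0))"

text \<open>A process is given by its filter \<open>J t\<close>, acting on pasts.\<close>

definition measurable_filter ::
  "'s measure \<Rightarrow> (real \<Rightarrow> (nat \<Rightarrow> 's) \<Rightarrow> 'b::euclidean_space) \<Rightarrow> bool" where
  "measurable_filter S J \<longleftrightarrow>
     (\<lambda>(t, f). J t f) \<in> borel_measurable
        (restrict_space borel {0..1} \<Otimes>\<^sub>M PiM UNIV (\<lambda>_::nat. S))"

definition in_Lip ::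
  "'a measure \<Rightarrow> (int \<Rightarrow> 'a \<Rightarrow> 's) \<Rightarrow> (real \<Rightarrow> (nat \<Rightarrow> 's) \<Rightarrow> 'b::euclidean_space) \<Rightarrow> bool" where
  "in_Lip M \<epsilon> J \<longleftrightarrow>
     (\<exists>C>0. \<forall>k. \<forall>t1\<in>{0..1}. \<forall>t2\<in>{0..1}.
        Lq_norm M 2 (\<lambda>\<omega>. J t1 (past \<epsilon> k \<omega>) - J t2 (past \<epsilon> k \<omega>)) \<le> ennreal (C * \<bar>t1 - t2\<bar>))"

definition dep_delta ::
  "'a measure \<Rightarrow> (int \<Rightarrow> 'a \<Rightarrow> 's) \<Rightarrow> (int \<Rightarrow> 'a \<Rightarrow> 's) \<Rightarrow>
   (real \<Rightarrow> (nat \<Rightarrow> 's) \<Rightarrow> 'b::euclidean_space) \<Rightarrow> nat \<Rightarrow> real \<Rightarrow> ennreal" where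
  "dep_delta M \<epsilon> \<epsilon>' J k q =
     (SUP t\<in>{0..1}. Lq_norm M q (\<lambda>\<omega>. J t (past \<epsilon> (int k) \<omega>) - J t (past_coupled \<epsilon> \<epsilon>' (int k) \<omega>)))"

definition dep_Theta ::
  "'a measure \<Rightarrow> (int \<Rightarrow> 'a \<Rightarrow> 's) \<Rightarrow> (int \<Rightarrow> 'a \<Rightarrow> 's) \<Rightarrow>
   (real \<Rightarrow> (nat \<Rightarrow> 's) \<Rightarrow> 'b::euclidean_space) \<Rightarrow> nat \<Rightarrow> real \<Rightarrow> ennreal" where
  "dep_Theta M \<epsilon> \<epsilon>' J m q = (\<Sum>j. dep_delta M \<epsilon> \<epsilon>' J (m + j) q)"

definition moment_matrix ::
  "'a measure \<Rightarrow> (int \<Rightarrow> 'a \<Rightarrow> 's) \<Rightarrow> (real \<Rightarrow> (nat \<Rightarrow> 's) \<Rightarrow> real ^ 'p) \<Rightarrow> real \<Rightarrow> real ^ 'p ^ 'p" where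
  "moment_matrix M \<epsilon> J t =
     (\<chi> i j. \<integral>\<omega>. J t (past \<epsilon> 0 \<omega>) $ i * J t (past \<epsilon> 0 \<omega>) $ j \<partial>M)"

definition product_filter ::
  "(real \<Rightarrow> (nat \<Rightarrow> 's) \<Rightarrow> real ^ 'p) \<Rightarrow> (real \<Rightarrow> (nat \<Rightarrow> 's) \<Rightarrow> real) \<Rightarrow>
   real \<Rightarrow> (nat \<Rightarrow> 's) \<Rightarrow> real ^ 'p" where
  "product_filter G H t f = H t f *\<^sub>R G t f"


section \<open>The time-varying regression model\<close>

text \<open>The \<open>i\<close>-th observation (\<open>1 \<le> i \<le> n\<close>) in the sample of size \<open>n\<close>; used with \<open>J = G\<close> for the
  predictors and with \<open>J = H\<close> for the errors.\<close>

definition observation ::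
  "(int \<Rightarrow> 'a \<Rightarrow> 's) \<Rightarrow> (real \<Rightarrow> (nat \<Rightarrow> 's) \<Rightarrow> 'b) \<Rightarrow> nat \<Rightarrow> nat \<Rightarrow> 'a \<Rightarrow> 'b" where
  "observation \<epsilon> J n i \<omega> = J (real i / real n) (past \<epsilon> (int i) \<omega>)"

definition response ::
  "(int \<Rightarrow> 'a \<Rightarrow> 's) \<Rightarrow> (real \<Rightarrow> (nat \<Rightarrow> 's) \<Rightarrow> real ^ 'p) \<Rightarrow> (real \<Rightarrow> (nat \<Rightarrow> 's) \<Rightarrow> real) \<Rightarrow>
   (real \<Rightarrow> real ^ 'p) \<Rightarrow> nat \<Rightarrow> nat \<Rightarrow> 'a \<Rightarrow> real" where
  "response \<epsilon> G H \<beta> n i \<omega> =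
     observation \<epsilon> G n i \<omega> \<bullet> \<beta> (real i / real n) + observation \<epsilon> H n i \<omega>"

text \<open>\<open>E (Y | X) = 0\<close>. Integrability is stated explicitly because the library's conditional
  expectation returns junk values for non-integrable variables.\<close>

definition cond_mean_zero :: "'a measure \<Rightarrow> ('a \<Rightarrow> 'b::euclidean_space) \<Rightarrow> ('a \<Rightarrow> real) \<Rightarrow> bool" where
  "cond_mean_zero M X Y \<longleftrightarrow>
     integrable M Y \<and>
     (AE \<omega> in M. real_cond_exp M (vimage_algebra (space M) X borel) Y \<omega> = 0)"

text \<open>Nonnegativity is part of the word ``kernel'': the values are weights in a least squares
  criterion.\<close>

definition smoothing_kernel :: "(real \<Rightarrow> real) \<Rightarrow> bool" where
  "smoothing_kernel K \<longleftrightarrow>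
     (\<forall>v. 0 \<le> K v) \<and> (\<forall>v. K (- v) = K v) \<and> bounded (range K) \<and>
     (\<forall>v. v \<notin> {-1..1} \<longrightarrow> K v = 0) \<and> Ck_on 1 K {-1..1} \<and> (K has_integral 1) {-1..1}"

definition local_linear_criterion ::
  "(real \<Rightarrow> real) \<Rightarrow> real \<Rightarrow> nat \<Rightarrow> (nat \<Rightarrow> real ^ 'p) \<Rightarrow> (nat \<Rightarrow> real) \<Rightarrow> real \<Rightarrow>
   (real ^ 'p) \<times> (real ^ 'p) \<Rightarrow> real" where
  "local_linear_criterion K b n x y t = (\<lambda>(\<eta>0, \<eta>1).
     \<Sum>i=1..n. (y i - x i \<bullet> \<eta>0 - (x i \<bullet> \<eta>1) * (real i / real n - t))\<^sup>2
                 * K ((real i / real n - t) / b))"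

text \<open>A local linear estimator is a random vector that minimizes the criterion. With few
  observations in the window the minimizer may fail to be unique; then any measurable choice
  is admitted.\<close>

definition local_linear_estimator ::
  "'a measure \<Rightarrow> (real \<Rightarrow> real) \<Rightarrow> (nat \<Rightarrow> real) \<Rightarrow> (nat \<Rightarrow> nat \<Rightarrow> 'a \<Rightarrow> real ^ 'p) \<Rightarrow>
   (nat \<Rightarrow> nat \<Rightarrow> 'a \<Rightarrow> real) \<Rightarrow> (nat \<Rightarrow> real \<Rightarrow> 'a \<Rightarrow> real ^ 'p) \<Rightarrow>
   (nat \<Rightarrow> real \<Rightarrow> 'a \<Rightarrow> real ^ 'p) \<Rightarrow> bool" where
  "local_linear_estimator M K b x y \<beta>h \<beta>h' \<longleftrightarrow>
     (\<forall>n\<ge>1. \<forall>t\<in>{0..1}.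
        \<beta>h n t \<in> borel_measurable M \<and> \<beta>h' n t \<in> borel_measurable M \<and>
        (\<forall>\<omega>\<in>space M.
           is_arg_min (local_linear_criterion K (b n) n (\<lambda>i. x n i \<omega>) (\<lambda>i. y n i \<omega>) t)
             (\<lambda>_. True) (\<beta>h n t \<omega>, \<beta>h' n t \<omega>)))"


section \<open>Variable selection\<close>

definition relevant_predictors :: "(real \<Rightarrow> real ^ 'p) \<Rightarrow> 'p set" where
  "relevant_predictors \<beta> = {j. \<not> (\<forall>t\<in>{0..1}. \<beta> t $ j = 0)}"

definition RSS ::
  "nat \<Rightarrow> (nat \<Rightarrow> real ^ 'p) \<Rightarrow> (nat \<Rightarrow> real) \<Rightarrow> (real \<Rightarrow> real ^ 'p) \<Rightarrow> 'p set \<Rightarrow> real" where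
  "RSS n x y \<beta>h D = (\<Sum>i=1..n. (y i - (\<Sum>j\<in>D. x i $ j * \<beta>h (real i / real n) $ j))\<^sup>2)"

definition VIC ::
  "nat \<Rightarrow> (nat \<Rightarrow> real ^ 'p) \<Rightarrow> (nat \<Rightarrow> real) \<Rightarrow> (real \<Rightarrow> real ^ 'p) \<Rightarrow> real \<Rightarrow> 'p set \<Rightarrow> real" where
  "VIC n x y \<beta>h chi D = ln (RSS n x y \<beta>h D) + chi * real (card D)"

definition phi_rate :: "real \<Rightarrow> (nat \<Rightarrow> real) \<Rightarrow> nat \<Rightarrow> real" where
  "phi_rate \<iota> b n =
     inverse (real n * b n) *
       (real n powr (1 / \<iota>) + (real n * b n * ln (real n)) powr (1 / 2)) + (b n)\<^sup>2"

definition rho_rate :: "(nat \<Rightarrow> real) \<Rightarrow> nat \<Rightarrow> real" where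
  "rho_rate b n = real n powr (- 1 / 2) * inverse (b n) + b n"

end

theory Submission imports Defs begin

text \<open>Put \<open>h = n b\<close>. The errors of the local linear fit at observation \<open>i\<close>, a level error and a slope error
  in units of the bandwidth, form a vector \<open>\<Delta> i\<close> that solves normal equations \<open>S i \<Delta> i = T i + B i\<close>
  with a local design \<open>S i\<close>, a noise term \<open>T i\<close> of order \<open>h\<^bsup>-1/2\<^esup>\<close> and a bias term \<open>B i\<close> of order
  \<open>b\<^sup>2\<close>, up to the size of the largest window average of squared regressors. The theorem compares the
  residual sums of squares of two models in terms of these errors.

  If \<open>D\<close> omits a relevant predictor, the omitted signal is uncorrelated with the errors and, as the
  second moment matrices are bounded below, has a mean square bounded away from zero. It raises the
  residual sum of squares by a fixed factor, whereas the penalty tends to zero (\<open>vic_underfit\<close>).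

  If \<open>D\<close> properly contains the true model, then \<open>RSS(D\<^sub>0) - RSS(D)\<close> is at most the sum of
  \<open>(norm (x i))\<^sup>2 * (norm (\<Delta> i))\<^sup>2\<close> plus cross terms of the form \<open>\<Sum>i. e i * x i $ a * \<Delta> i $ a\<close>
  (\<open>rss_full_diff\<close>). Both are of order \<open>n\<close> times a quantity that is negligible against \<open>chi\<close>, while
  the residual sum of squares itself is at least a multiple of \<open>n\<close>; so the gain in the logarithm is
  smaller than the penalty of one superfluous component (\<open>vic_overfit\<close>). For the cross terms a bound
  by the product of the norms would lose a factor \<open>h\<^bsup>1/2\<^esup>\<close>. Instead the random design is replaced by
  its mean (\<open>cross_le\<close>): the leading part becomes a quadratic form with a banded matrix in the centred
  products \<open>e i * x i\<close>, of order \<open>n / h\<close>, and the remainder is a product of two small factors.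

  All probabilistic estimates are for second and fourth moments, and they follow from the effect of
  replacing a single innovation. Averaging out the innovations one by one telescopes variances,
  covariances and fourth moments into sums over these influences (\<open>variance_le_influences\<close>,
  \<open>fourth_moment_le_influences\<close>), which the dependence measures bound. For arrays, Schur's test turns
  summable influences into the rates of independent variables, also for quadratic forms
  (\<open>weak_array_quadratic\<close>).

  The designs have to be invertible for all \<open>i\<close> at once (\<open>design_whp\<close>). Fourth moments over blocks of
  truncated regressors give failure probabilities of order \<open>h\<^bsup>-2\<^esup>\<close> for each of \<open>O(n / h)\<close> blocks, and
  \<open>n / h\<^sup>3\<close> tends to zero because the penalty vanishes and still dominates \<open>\<phi> (\<phi> + \<rho>)\<close>
  (\<open>tuning_rates\<close>).\<close>

section \<open>Bounds on moments\<close>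

text \<open>The bound \<open>a\<close> on the \<open>L\<^sub>q\<close> norm of \<open>f\<close>. Writing the moment as a nonnegative integral makes
  integrability a consequence of the bound instead of a side condition.\<close>

definition Lp_le :: "'a measure \<Rightarrow> nat \<Rightarrow> ('a \<Rightarrow> real) \<Rightarrow> real \<Rightarrow> bool" where
  "Lp_le Q q f a \<longleftrightarrow>
     f \<in> borel_measurable Q \<and> 0 \<le> a \<and> (\<integral>\<^sup>+x. ennreal (\<bar>f x\<bar> ^ q) \<partial>Q) \<le> ennreal (a ^ q)"

lemma Lp_leD:
  assumes "Lp_le Q q f a"
  shows "f \<in> borel_measurable Q" "0 \<le> a" "(\<integral>\<^sup>+x. ennreal (\<bar>f x\<bar> ^ q) \<partial>Q) \<le> ennreal (a ^ q)"
  using assms by (auto simp: Lp_le_def)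

lemma Lp_le_weaken:
  assumes "Lp_le Q q f a" "a \<le> b" shows "Lp_le Q q f b"
proof -
  have "ennreal (a ^ q) \<le> ennreal (b ^ q)"
    using assms by (intro ennreal_leI power_mono) (auto simp: Lp_le_def)
  then show ?thesis using assms unfolding Lp_le_def by (meson order_trans)
qed

lemma Lp_le_dominated:
  assumes "Lp_le Q q g a" "f \<in> borel_measurable Q" "\<And>x. x \<in> space Q \<Longrightarrow> \<bar>f x\<bar> \<le> \<bar>g x\<bar>"
  shows "Lp_le Q q f a"
proof -
  have "(\<integral>\<^sup>+x. ennreal (\<bar>f x\<bar> ^ q) \<partial>Q) \<le> (\<integral>\<^sup>+x. ennreal (\<bar>g x\<bar> ^ q) \<partial>Q)"
    using assms(3) by (intro nn_integral_mono ennreal_leI power_mono) auto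
  then show ?thesis using assms(1,2) unfolding Lp_le_def by auto
qed

lemma Lp_le_cong:
  assumes "\<And>x. x \<in> space Q \<Longrightarrow> f x = g x"
  shows "Lp_le Q q f a \<longleftrightarrow> Lp_le Q q g a"
proof -
  have "(\<integral>\<^sup>+x. ennreal (\<bar>f x\<bar> ^ q) \<partial>Q) = (\<integral>\<^sup>+x. ennreal (\<bar>g x\<bar> ^ q) \<partial>Q)"
    using assms by (intro nn_integral_cong) auto
  moreover have "f \<in> borel_measurable Q \<longleftrightarrow> g \<in> borel_measurable Q"
    using assms by (rule measurable_cong)
  ultimately show ?thesis by (simp add: Lp_le_def)
qed

lemma Lp_le_cmult:
  assumes "Lp_le Q q f a" shows "Lp_le Q q (\<lambda>x. c * f x) (\<bar>c\<bar> * a)"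
proof -
  note [measurable] = Lp_leD(1)[OF assms]
  have "(\<integral>\<^sup>+x. ennreal (\<bar>c * f x\<bar> ^ q) \<partial>Q) = (\<integral>\<^sup>+x. ennreal (\<bar>c\<bar> ^ q) * ennreal (\<bar>f x\<bar> ^ q) \<partial>Q)"
    by (intro nn_integral_cong) (auto simp: abs_mult power_mult_distrib ennreal_mult[symmetric])
  also have "\<dots> = ennreal (\<bar>c\<bar> ^ q) * (\<integral>\<^sup>+x. ennreal (\<bar>f x\<bar> ^ q) \<partial>Q)"
    by (rule nn_integral_cmult) measurable
  also have "\<dots> \<le> ennreal (\<bar>c\<bar> ^ q) * ennreal (a ^ q)"
    using Lp_leD(3)[OF assms] by (intro mult_left_mono) auto
  also have "\<dots> = ennreal ((\<bar>c\<bar> * a) ^ q)"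
    using Lp_leD(2)[OF assms] by (simp add: power_mult_distrib ennreal_mult[symmetric])
  finally show ?thesis using Lp_leD[OF assms] by (auto simp: Lp_le_def)
qed

text \<open>Allows \<open>a > 0\<close> to be assumed where a proof divides by the bound.\<close>

lemma Lp_le_of_larger:
  assumes "0 \<le> a" "\<And>e. e > 0 \<Longrightarrow> Lp_le Q q f (a + e)"
  shows "Lp_le Q q f a"
proof -
  have "(\<integral>\<^sup>+x. ennreal (\<bar>f x\<bar> ^ q) \<partial>Q) \<le> ennreal (a ^ q)"
  proof (rule tendsto_lowerbound)
    show "((\<lambda>e. ennreal ((a + e) ^ q)) \<longlongrightarrow> ennreal (a ^ q)) (at_right 0)"
      by (rule tendsto_eq_intros refl | simp)+
    show "\<forall>\<^sub>F e in at_right 0. (\<integral>\<^sup>+x. ennreal (\<bar>f x\<bar> ^ q) \<partial>Q) \<le> ennreal ((a + e) ^ q)"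
      using Lp_leD(3)[OF assms(2)] by (auto simp: eventually_at_right_field intro!: exI[of _ 1])
  qed simp
  then show ?thesis
    using assms(1) Lp_leD(1)[OF assms(2)[of 1]] by (auto simp: Lp_le_def)
qed

lemma power_convex_combination:
  fixes x y l :: real
  assumes "0 \<le> x" "0 \<le> y" "0 \<le> l" "l \<le> 1"
  shows "(l * x + (1 - l) * y) ^ q \<le> l * x ^ q + (1 - l) * y ^ q"
proof -
  have "convex_on {0..} (\<lambda>x::real. x ^ q)"
    using convex_power_even[of q] convex_power_odd[of q]
    by (cases "even q") (auto intro: convex_on_subset)
  from convex_onD[OF this, of "1 - l" x y] assms show ?thesis by auto
qed

text \<open>Minkowski's inequality, from the convexity of the power: \<open>\<bar>f + g\<bar>\<^sup>q\<close> is at most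
  \<open>(a + b)\<^sup>q\<close> times the convex combination of \<open>(\<bar>f\<bar> / a)\<^sup>q\<close> and \<open>(\<bar>g\<bar> / b)\<^sup>q\<close> with
  weights proportional to \<open>a\<close> and \<open>b\<close>.\<close>

lemma Lp_le_add:
  assumes f: "Lp_le Q q f a" and g: "Lp_le Q q g b"
  shows "Lp_le Q q (\<lambda>x. f x + g x) (a + b)"
proof -
  note [measurable] = Lp_leD(1)[OF f] Lp_leD(1)[OF g]
  have pos: "Lp_le Q q (\<lambda>x. f x + g x) (a + b)"
    if f: "Lp_le Q q f a" and g: "Lp_le Q q g b" and ab: "a > 0" "b > 0" for a b
  proof -
    define l where "l = a / (a + b)"
    have l: "0 \<le> l" "l \<le> 1" "1 - l = b / (a + b)" using ab by (auto simp: l_def field_simps)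
    have point: "\<bar>f x + g x\<bar> ^ q \<le> (a + b) ^ q * (l / a ^ q) * \<bar>f x\<bar> ^ q + (a + b) ^ q * ((1 - l) / b ^ q) * \<bar>g x\<bar> ^ q" for x
    proof -
      have "\<bar>f x + g x\<bar> \<le> (a + b) * (l * (\<bar>f x\<bar> / a) + (1 - l) * (\<bar>g x\<bar> / b))"
      proof -
        have "(a + b) * (l * (\<bar>f x\<bar> / a) + (1 - l) * (\<bar>g x\<bar> / b))
            = ((a + b) * l / a) * \<bar>f x\<bar> + ((a + b) * (1 - l) / b) * \<bar>g x\<bar>"
          by (simp add: algebra_simps)
        moreover have "(a + b) * l / a = 1" "(a + b) * (1 - l) / b = 1"
          using ab unfolding l(3) by (auto simp: l_def)
        ultimately show ?thesis by simp
      qed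
      then have "\<bar>f x + g x\<bar> ^ q \<le> ((a + b) * (l * (\<bar>f x\<bar> / a) + (1 - l) * (\<bar>g x\<bar> / b))) ^ q"
        by (rule power_mono) simp
      also have "\<dots> \<le> (a + b) ^ q * (l * (\<bar>f x\<bar> / a) ^ q + (1 - l) * (\<bar>g x\<bar> / b) ^ q)"
        unfolding power_mult_distrib using ab l
        by (intro mult_left_mono power_convex_combination[unfolded power_mult_distrib]) auto
      also have "\<dots> = (a + b) ^ q * (l / a ^ q) * \<bar>f x\<bar> ^ q + (a + b) ^ q * ((1 - l) / b ^ q) * \<bar>g x\<bar> ^ q"
        by (simp add: power_divide algebra_simps)
      finally show ?thesis .
    qed
    have "(\<integral>\<^sup>+x. ennreal (\<bar>f x + g x\<bar> ^ q) \<partial>Q)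
       \<le> (\<integral>\<^sup>+x. ennreal ((a + b) ^ q * (l / a ^ q)) * ennreal (\<bar>f x\<bar> ^ q)
              + ennreal ((a + b) ^ q * ((1 - l) / b ^ q)) * ennreal (\<bar>g x\<bar> ^ q) \<partial>Q)"
    proof (rule nn_integral_mono)
      fix x
      show "ennreal (\<bar>f x + g x\<bar> ^ q) \<le> ennreal ((a + b) ^ q * (l / a ^ q)) * ennreal (\<bar>f x\<bar> ^ q)
              + ennreal ((a + b) ^ q * ((1 - l) / b ^ q)) * ennreal (\<bar>g x\<bar> ^ q)"
        using ab l point[of x]
        by (simp add: ennreal_mult[symmetric] ennreal_plus[symmetric] ennreal_leI del: ennreal_plus)
    qed
    also have "\<dots> = ennreal ((a + b) ^ q * (l / a ^ q)) * (\<integral>\<^sup>+x. ennreal (\<bar>f x\<bar> ^ q) \<partial>Q)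
              + ennreal ((a + b) ^ q * ((1 - l) / b ^ q)) * (\<integral>\<^sup>+x. ennreal (\<bar>g x\<bar> ^ q) \<partial>Q)"
      by (simp add: nn_integral_add nn_integral_cmult)
    also have "\<dots> \<le> ennreal ((a + b) ^ q * (l / a ^ q)) * ennreal (a ^ q)
              + ennreal ((a + b) ^ q * ((1 - l) / b ^ q)) * ennreal (b ^ q)"
      using Lp_leD(3)[OF f] Lp_leD(3)[OF g] by (intro add_mono mult_left_mono) auto
    also have "\<dots> = ennreal ((a + b) ^ q * (l / a ^ q) * a ^ q + (a + b) ^ q * ((1 - l) / b ^ q) * b ^ q)"
      using ab l by (simp add: ennreal_mult[symmetric] ennreal_plus[symmetric] del: ennreal_plus)
    also have "(a + b) ^ q * (l / a ^ q) * a ^ q + (a + b) ^ q * ((1 - l) / b ^ q) * b ^ q = (a + b) ^ q * (l + (1 - l))"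
      using ab by (simp add: field_simps)
    finally show ?thesis using ab by (auto simp: Lp_le_def)
  qed
  show ?thesis
  proof (rule Lp_le_of_larger)
    fix e :: real assume e: "e > 0"
    have "Lp_le Q q (\<lambda>x. f x + g x) ((a + e / 2) + (b + e / 2))"
      using e Lp_leD(2)[OF f] Lp_leD(2)[OF g]
      by (intro pos Lp_le_weaken[OF f] Lp_le_weaken[OF g]) auto
    then show "Lp_le Q q (\<lambda>x. f x + g x) (a + b + e)" by (simp add: algebra_simps)
  qed (use Lp_leD(2)[OF f] Lp_leD(2)[OF g] in simp)
qed

lemma Lp_le_zero: "q > 0 \<Longrightarrow> Lp_le Q q (\<lambda>_. 0) 0"
  by (simp add: Lp_le_def zero_power)

lemma Lp_le_sum:
  assumes "q > 0" "\<And>i. i \<in> I \<Longrightarrow> Lp_le Q q (f i) (a i)"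
  shows "Lp_le Q q (\<lambda>x. \<Sum>i\<in>I. f i x) (\<Sum>i\<in>I. a i)"
  using assms(2)
  by (induction I rule: infinite_finite_induct) (simp_all add: Lp_le_zero assms(1) Lp_le_add)

text \<open>Cauchy-Schwarz, from \<open>u v \<le> (t u\<^sup>2 + v\<^sup>2 / t) / 2\<close> with the best \<open>t\<close>.\<close>

lemma Lp_le_mult:
  assumes f: "Lp_le Q (2 * q) f a" and g: "Lp_le Q (2 * q) g b"
  shows "Lp_le Q q (\<lambda>x. f x * g x) (a * b)"
proof -
  note [measurable] = Lp_leD(1)[OF f] Lp_leD(1)[OF g]
  have pos: "Lp_le Q q (\<lambda>x. f x * g x) (a * b)"
    if f: "Lp_le Q (2 * q) f a" and g: "Lp_le Q (2 * q) g b" and ab: "a > 0" "b > 0" for a b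
  proof -
    define t where "t = b ^ q / a ^ q"
    have t: "t > 0" using ab by (simp add: t_def)
    have point: "\<bar>f x * g x\<bar> ^ q \<le> t / 2 * \<bar>f x\<bar> ^ (2 * q) + 1 / (2 * t) * \<bar>g x\<bar> ^ (2 * q)" for x
    proof -
      have "0 \<le> (t * \<bar>f x\<bar> ^ q - \<bar>g x\<bar> ^ q)\<^sup>2" by simp
      also have "\<dots> = t\<^sup>2 * \<bar>f x\<bar> ^ (2 * q) + \<bar>g x\<bar> ^ (2 * q) - 2 * t * \<bar>f x * g x\<bar> ^ q"
      proof -
        have "\<bar>u\<bar> ^ (2 * q) = (\<bar>u\<bar> ^ q)\<^sup>2" for u :: real
          by (subst mult.commute) (rule power_mult)
        moreover have "(t * p - r)\<^sup>2 = t\<^sup>2 * p\<^sup>2 + r\<^sup>2 - 2 * t * (p * r)" for p r :: real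
          by algebra
        moreover have "\<bar>f x * g x\<bar> ^ q = \<bar>f x\<bar> ^ q * \<bar>g x\<bar> ^ q"
          by (simp only: abs_mult power_mult_distrib)
        ultimately show ?thesis by (simp only:)
      qed
      finally have "2 * t * \<bar>f x * g x\<bar> ^ q \<le> t\<^sup>2 * \<bar>f x\<bar> ^ (2 * q) + \<bar>g x\<bar> ^ (2 * q)" by simp
      then have "\<bar>f x * g x\<bar> ^ q \<le> (t\<^sup>2 * \<bar>f x\<bar> ^ (2 * q) + \<bar>g x\<bar> ^ (2 * q)) / (2 * t)"
        using t by (simp add: pos_le_divide_eq mult.commute)
      also have "\<dots> = t / 2 * \<bar>f x\<bar> ^ (2 * q) + 1 / (2 * t) * \<bar>g x\<bar> ^ (2 * q)"
        using t by (simp add: add_divide_distrib power2_eq_square)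
      finally show ?thesis .
    qed
    have "(\<integral>\<^sup>+x. ennreal (\<bar>f x * g x\<bar> ^ q) \<partial>Q)
       \<le> (\<integral>\<^sup>+x. ennreal (t / 2) * ennreal (\<bar>f x\<bar> ^ (2 * q))
              + ennreal (1 / (2 * t)) * ennreal (\<bar>g x\<bar> ^ (2 * q)) \<partial>Q)"
    proof (rule nn_integral_mono)
      fix x
      show "ennreal (\<bar>f x * g x\<bar> ^ q) \<le> ennreal (t / 2) * ennreal (\<bar>f x\<bar> ^ (2 * q))
              + ennreal (1 / (2 * t)) * ennreal (\<bar>g x\<bar> ^ (2 * q))"
        using t point[of x]
        by (subst (1 2) ennreal_mult[symmetric], simp_all add: ennreal_leI ennreal_plus[symmetric] del: ennreal_plus)
    qed
    also have "\<dots> = ennreal (t / 2) * (\<integral>\<^sup>+x. ennreal (\<bar>f x\<bar> ^ (2 * q)) \<partial>Q)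
              + ennreal (1 / (2 * t)) * (\<integral>\<^sup>+x. ennreal (\<bar>g x\<bar> ^ (2 * q)) \<partial>Q)"
      by (simp add: nn_integral_add nn_integral_cmult)
    also have "\<dots> \<le> ennreal (t / 2) * ennreal (a ^ (2 * q)) + ennreal (1 / (2 * t)) * ennreal (b ^ (2 * q))"
      using Lp_leD(3)[OF f] Lp_leD(3)[OF g] by (intro add_mono mult_left_mono) auto
    also have "\<dots> = ennreal (t / 2 * a ^ (2 * q) + 1 / (2 * t) * b ^ (2 * q))"
      using ab t by (subst (1 2) ennreal_mult[symmetric], simp_all add: ennreal_plus[symmetric] del: ennreal_plus)
    also have "t / 2 * a ^ (2 * q) + 1 / (2 * t) * b ^ (2 * q) = (a * b) ^ q"
    proof -
      have "u ^ (2 * q) = u ^ q * u ^ q" for u :: real by (simp add: mult_2 power_add)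
      then show ?thesis using ab by (simp add: t_def power_mult_distrib)
    qed
    finally show ?thesis using ab by (auto simp: Lp_le_def)
  qed
  have a0: "0 \<le> a" "0 \<le> b" using f g by (auto dest: Lp_leD)
  show ?thesis
  proof (rule Lp_le_of_larger)
    fix e :: real assume e: "e > 0"
    define r where "r = min 1 (e / (a + b + 1))"
    have "r \<le> e / (a + b + 1)" by (simp add: r_def)
    then have "r * (a + b + 1) \<le> e" using a0 by (simp add: pos_le_divide_eq)
    moreover have "r > 0" "r \<le> 1" using e a0 by (auto simp: r_def)
    ultimately have r: "r > 0" "r \<le> 1" "r * (a + b + 1) \<le> e" by auto
    have "Lp_le Q q (\<lambda>x. f x * g x) ((a + r) * (b + r))"
      using a0 r by (intro pos Lp_le_weaken[OF f] Lp_le_weaken[OF g]) auto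
    moreover have "(a + r) * (b + r) \<le> a * b + e"
    proof -
      have "(a + r) * (b + r) = a * b + r * (a + b + r)" by (simp add: algebra_simps)
      also have "r * (a + b + r) \<le> r * (a + b + 1)" using r by (intro mult_left_mono) auto
      finally show ?thesis using r by simp
    qed
    ultimately show "Lp_le Q q (\<lambda>x. f x * g x) (a * b + e)" by (rule Lp_le_weaken)
  qed (use a0 in simp)
qed

lemma Lp_le_iff_integral:
  assumes f: "f \<in> borel_measurable Q" and a: "0 \<le> a"
  shows "Lp_le Q q f a \<longleftrightarrow> integrable Q (\<lambda>x. \<bar>f x\<bar> ^ q) \<and> (\<integral>x. \<bar>f x\<bar> ^ q \<partial>Q) \<le> a ^ q"
proof
  note [measurable] = f
  assume "Lp_le Q q f a"
  then have le: "(\<integral>\<^sup>+x. ennreal (\<bar>f x\<bar> ^ q) \<partial>Q) \<le> ennreal (a ^ q)" by (rule Lp_leD(3))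
  then have fin: "(\<integral>\<^sup>+x. ennreal (\<bar>f x\<bar> ^ q) \<partial>Q) < \<infinity>" by (rule le_less_trans) simp
  have i: "integrable Q (\<lambda>x. \<bar>f x\<bar> ^ q)"
    by (rule integrableI_nonneg) (use fin in simp_all)
  moreover have "ennreal (\<integral>x. \<bar>f x\<bar> ^ q \<partial>Q) \<le> ennreal (a ^ q)"
    using le by (subst nn_integral_eq_integral[OF i, symmetric]) simp_all
  ultimately show "integrable Q (\<lambda>x. \<bar>f x\<bar> ^ q) \<and> (\<integral>x. \<bar>f x\<bar> ^ q \<partial>Q) \<le> a ^ q"
    using a by (simp add: ennreal_le_iff)
next
  assume i: "integrable Q (\<lambda>x. \<bar>f x\<bar> ^ q) \<and> (\<integral>x. \<bar>f x\<bar> ^ q \<partial>Q) \<le> a ^ q"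
  have "(\<integral>\<^sup>+x. ennreal (\<bar>f x\<bar> ^ q) \<partial>Q) = ennreal (\<integral>x. \<bar>f x\<bar> ^ q \<partial>Q)"
    using i by (intro nn_integral_eq_integral) simp_all
  also have "\<dots> \<le> ennreal (a ^ q)" using i by (intro ennreal_leI) simp
  finally show "Lp_le Q q f a" using f a by (simp add: Lp_le_def)
qed

lemma Lp_le_integral:
  assumes "Lp_le Q q f a"
  shows "integrable Q (\<lambda>x. \<bar>f x\<bar> ^ q)" "(\<integral>x. \<bar>f x\<bar> ^ q \<partial>Q) \<le> a ^ q"
  using Lp_le_iff_integral[of f Q a q] assms Lp_leD[OF assms] by auto

lemma Lp_le_1:
  assumes "Lp_le Q 1 f a"
  shows "integrable Q f" "\<bar>\<integral>x. f x \<partial>Q\<bar> \<le> a"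
proof -
  show i: "integrable Q f"
    using Lp_le_integral(1)[OF assms] Lp_leD(1)[OF assms] by (simp add: integrable_abs_iff)
  have "\<bar>\<integral>x. f x \<partial>Q\<bar> \<le> (\<integral>x. \<bar>f x\<bar> \<partial>Q)" by (rule integral_abs_bound)
  also have "\<dots> \<le> a" using Lp_le_integral(2)[OF assms] by simp
  finally show "\<bar>\<integral>x. f x \<partial>Q\<bar> \<le> a" .
qed

lemma (in prob_space) Lp_le_const: "Lp_le M q (\<lambda>_. c) \<bar>c\<bar>"
  by (simp add: Lp_le_def emeasure_space_1)

lemma (in prob_space) Lp_le_bounded:
  assumes "f \<in> borel_measurable M" "\<And>x. x \<in> space M \<Longrightarrow> \<bar>f x\<bar> \<le> B" "0 \<le> B"
  shows "Lp_le M q f B"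
  using Lp_le_dominated[OF Lp_le_const[of q B] assms(1)] assms(2,3) by auto

lemma (in prob_space) Lp_le_half:
  assumes "Lp_le M (2 * q) f a" shows "Lp_le M q f a"
  using Lp_le_mult[OF assms Lp_le_const[of _ 1]] by simp

lemma (in prob_space) Lp_le_4_2: "Lp_le M 4 f a \<Longrightarrow> Lp_le M 2 f a"
  using Lp_le_half[of 2 f a] by simp

lemma (in prob_space) Lp_le_2_1: "Lp_le M 2 f a \<Longrightarrow> Lp_le M 1 f a"
  using Lp_le_half[of 1 f a] by simp

lemma Lp_le_distr:
  assumes "T \<in> measurable Q R" "f \<in> borel_measurable R"
  shows "Lp_le (distr Q R T) q f a \<longleftrightarrow> Lp_le Q q (\<lambda>x. f (T x)) a"
  using assms by (auto simp: Lp_le_def nn_integral_distr)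

text \<open>Markov's inequality.\<close>

lemma (in prob_space) Lp_le_tail:
  assumes f: "Lp_le M q f a" and t: "t > 0"
  shows "prob {x \<in> space M. \<bar>f x\<bar> > t} \<le> (a / t) ^ q"
proof -
  note [measurable] = Lp_leD(1)[OF f]
  have "prob {x \<in> space M. \<bar>f x\<bar> > t} \<le> prob {x \<in> space M. \<bar>f x\<bar> ^ q \<ge> t ^ q}"
    using t by (intro finite_measure_mono) (auto intro!: power_mono)
  also have "\<dots> \<le> (\<integral>x. \<bar>f x\<bar> ^ q \<partial>M) / t ^ q"
    using t by (intro integral_Markov_inequality_measure[OF Lp_le_integral(1)[OF f], of "{}"]) auto
  also have "\<dots> \<le> (a / t) ^ q"
    using Lp_le_integral(2)[OF f] t by (simp add: power_divide divide_right_mono)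
  finally show ?thesis .
qed

section \<open>Averaging out coordinates of an i.i.d. sequence\<close>

lemma (in prob_space) power_integral_le:
  assumes f: "f \<in> borel_measurable M" and B: "\<And>x. x \<in> space M \<Longrightarrow> \<bar>f x\<bar> \<le> B" and q: "even q"
  shows "ennreal (\<bar>\<integral>x. f x \<partial>M\<bar> ^ q) \<le> (\<integral>\<^sup>+x. ennreal (\<bar>f x\<bar> ^ q) \<partial>M)"
proof -
  note [measurable] = f
  have B': "AE x in M. norm (f x) \<le> B" using B by auto
  have i: "integrable M f" by (rule integrable_const_bound[OF B' f])
  have "AE x in M. norm (f x ^ q) \<le> B ^ q" using B by (auto simp: power_abs intro!: power_mono)
  then have iq: "integrable M (\<lambda>x. f x ^ q)" by (rule integrable_const_bound) measurable
  have "(\<integral>x. f x \<partial>M) ^ q \<le> (\<integral>x. f x ^ q \<partial>M)"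
    by (rule jensens_inequality[where I=UNIV, OF i _ _ iq convex_power_even[OF q]]) auto
  then have "ennreal (\<bar>\<integral>x. f x \<partial>M\<bar> ^ q) \<le> ennreal (\<integral>x. \<bar>f x\<bar> ^ q \<partial>M)"
    by (intro ennreal_leI) (simp add: power_even_abs[OF q])
  also have "\<dots> = (\<integral>\<^sup>+x. ennreal (\<bar>f x\<bar> ^ q) \<partial>M)"
    using iq by (subst nn_integral_eq_integral) (auto simp: power_even_abs[OF q] zero_le_even_power[OF q])
  finally show ?thesis .
qed

context sequence_space
begin

text \<open>Bounded measurable functions can be averaged without integrability conditions; general functions
  are reached from them by clipping.\<close>

definition bmeas :: "((nat \<Rightarrow> 'a) \<Rightarrow> real) \<Rightarrow> bool" where
  "bmeas F \<longleftrightarrow> F \<in> borel_measurable S \<and> (\<exists>B. \<forall>\<xi>\<in>space S. \<bar>F \<xi>\<bar> \<le> B)"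

text \<open>The conditional expectation given the coordinates from \<open>1\<close> on, with the remaining coordinates
  shifted down so that it is again a function of a sequence and can be iterated.\<close>

definition avg :: "((nat \<Rightarrow> 'a) \<Rightarrow> real) \<Rightarrow> (nat \<Rightarrow> 'a) \<Rightarrow> real" where
  "avg F \<xi> = (\<integral>s. F (case_nat s \<xi>) \<partial>M)"

text \<open>Coordinate \<open>k\<close> is replaced by an independent copy. For a causal filter of i.i.d. innovations
  this is the physical dependence measure at lag \<open>k\<close>.\<close>

definition influence :: "nat \<Rightarrow> ((nat \<Rightarrow> 'a) \<Rightarrow> real) \<Rightarrow> nat \<Rightarrow> real \<Rightarrow> bool" where
  "influence q F k a \<longleftrightarrow> Lp_le (M \<Otimes>\<^sub>M S) q (\<lambda>(s, \<xi>). F \<xi> - F ((\<xi>)(k := s))) a"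

lemma case_nat_in_space: "\<xi> \<in> space S \<Longrightarrow> s \<in> space M \<Longrightarrow> case_nat s \<xi> \<in> space S"
  by (auto simp: space_PiM PiE_iff split: nat.split)

lemma measurable_upd[measurable]: "(\<lambda>(s, \<xi>). (\<xi>)(k := s)) \<in> measurable (M \<Otimes>\<^sub>M S) S"
proof (rule measurable_PiM_single')
  show "(\<lambda>\<xi>. (case \<xi> of (s, \<xi>) \<Rightarrow> (\<xi>)(k := s)) i) \<in> measurable (M \<Otimes>\<^sub>M S) M" if "i \<in> UNIV" for i
    by (cases "i = k") (auto simp: split_beta')
qed (auto simp: space_PiM space_pair_measure PiE_iff)

lemma measurable_iter[measurable]: "(\<lambda>(s, \<xi>). case_nat s \<xi>) \<in> measurable (M \<Otimes>\<^sub>M S) S"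
  by measurable

sublocale MS: pair_prob_space M S ..

lemma nn_integral_iter:
  assumes [measurable]: "F \<in> borel_measurable S"
  shows "(\<integral>\<^sup>+\<xi>. F \<xi> \<partial>S) = (\<integral>\<^sup>+\<xi>. (\<integral>\<^sup>+s. F (case_nat s \<xi>) \<partial>M) \<partial>S)"
proof -
  have "(\<integral>\<^sup>+\<xi>. F \<xi> \<partial>S) = (\<integral>\<^sup>+\<xi>. F \<xi> \<partial>distr (M \<Otimes>\<^sub>M S) S (\<lambda>(s, \<xi>). case_nat s \<xi>))"
    by (simp add: PiM_iter)
  also have "\<dots> = (\<integral>\<^sup>+z. F (case_nat (fst z) (snd z)) \<partial>(M \<Otimes>\<^sub>M S))"
    by (subst nn_integral_distr) (auto simp: split_beta')
  also have "\<dots> = (\<integral>\<^sup>+\<xi>. (\<integral>\<^sup>+s. F (case_nat s \<xi>) \<partial>M) \<partial>S)"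
    by (subst MS.nn_integral_snd[symmetric]) auto
  finally show ?thesis .
qed

lemma bmeas_measurable: "bmeas F \<Longrightarrow> F \<in> borel_measurable S" by (simp add: bmeas_def)

lemma bmeasI: "F \<in> borel_measurable S \<Longrightarrow> (\<And>\<xi>. \<xi> \<in> space S \<Longrightarrow> \<bar>F \<xi>\<bar> \<le> B) \<Longrightarrow> bmeas F"
  by (auto simp: bmeas_def)

lemma bmeasE:
  assumes "bmeas F" obtains B where "B \<ge> 0" "\<And>\<xi>. \<xi> \<in> space S \<Longrightarrow> \<bar>F \<xi>\<bar> \<le> B"
  using assms unfolding bmeas_def by (metis abs_ge_zero order_trans P.not_empty all_not_in_conv)

lemma bmeas_add: "bmeas F \<Longrightarrow> bmeas G \<Longrightarrow> bmeas (\<lambda>\<xi>. F \<xi> + G \<xi>)"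
proof -
  assume F: "bmeas F" and G: "bmeas G"
  obtain B where B: "B \<ge> 0" "\<And>\<xi>. \<xi> \<in> space S \<Longrightarrow> \<bar>F \<xi>\<bar> \<le> B" by (rule bmeasE[OF F]) blast
  obtain C where C: "C \<ge> 0" "\<And>\<xi>. \<xi> \<in> space S \<Longrightarrow> \<bar>G \<xi>\<bar> \<le> C" by (rule bmeasE[OF G]) blast
  show ?thesis
    using F G B C by (intro bmeasI[of _ "B + C"]) (auto simp: bmeas_def intro!: abs_triangle_ineq[THEN order_trans] add_mono)
qed

lemma bmeas_mult: "bmeas F \<Longrightarrow> bmeas G \<Longrightarrow> bmeas (\<lambda>\<xi>. F \<xi> * G \<xi>)"
proof -
  assume F: "bmeas F" and G: "bmeas G"
  obtain B where B: "B \<ge> 0" "\<And>\<xi>. \<xi> \<in> space S \<Longrightarrow> \<bar>F \<xi>\<bar> \<le> B" by (rule bmeasE[OF F]) blast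
  obtain C where C: "C \<ge> 0" "\<And>\<xi>. \<xi> \<in> space S \<Longrightarrow> \<bar>G \<xi>\<bar> \<le> C" by (rule bmeasE[OF G]) blast
  show ?thesis
    using F G B C by (intro bmeasI[of _ "B * C"]) (auto simp: bmeas_def abs_mult intro!: mult_mono)
qed

lemma bmeas_const: "bmeas (\<lambda>_. c)" by (rule bmeasI) auto
lemma bmeas_cmult: "bmeas F \<Longrightarrow> bmeas (\<lambda>\<xi>. c * F \<xi>)" by (rule bmeas_mult[OF bmeas_const])
lemma bmeas_diff: "bmeas F \<Longrightarrow> bmeas G \<Longrightarrow> bmeas (\<lambda>\<xi>. F \<xi> - G \<xi>)"
  using bmeas_add[of F "\<lambda>\<xi>. (-1) * G \<xi>"] bmeas_cmult[of G "-1"] by simp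
lemma bmeas_integrable: "bmeas F \<Longrightarrow> integrable S F"
  unfolding bmeas_def by (elim conjE exE, rule P.integrable_const_bound) auto

lemma bmeas_section:
  assumes F: "bmeas F" and w: "\<xi> \<in> space S"
  shows "(\<lambda>s. F (case_nat s \<xi>)) \<in> borel_measurable M" "integrable M (\<lambda>s. F (case_nat s \<xi>))"
proof -
  note [measurable] = bmeas_measurable[OF F]
  show m: "(\<lambda>s. F (case_nat s \<xi>)) \<in> borel_measurable M" using w by measurable
  obtain B where B: "B \<ge> 0" "\<And>\<xi>. \<xi> \<in> space S \<Longrightarrow> \<bar>F \<xi>\<bar> \<le> B" by (rule bmeasE[OF F]) blast
  show "integrable M (\<lambda>s. F (case_nat s \<xi>))"
    by (rule M.integrable_const_bound[where B=B]) (use B case_nat_in_space[OF w] m in auto)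
qed

lemma avg_bound:
  assumes F: "bmeas F" and B: "\<And>\<xi>. \<xi> \<in> space S \<Longrightarrow> \<bar>F \<xi>\<bar> \<le> B" and w: "\<xi> \<in> space S"
  shows "\<bar>avg F \<xi>\<bar> \<le> B"
proof -
  have "\<bar>avg F \<xi>\<bar> \<le> (\<integral>s. \<bar>F (case_nat s \<xi>)\<bar> \<partial>M)" unfolding avg_def by (rule integral_abs_bound)
  also have "\<dots> \<le> (\<integral>s. B \<partial>M)"
    using bmeas_section[OF F w] B case_nat_in_space[OF w] by (intro integral_mono) auto
  finally show ?thesis by (simp add: M.prob_space)
qed

lemma bmeas_avg: assumes F: "bmeas F" shows "bmeas (avg F)"
proof -
  note [measurable] = bmeas_measurable[OF F]
  obtain B where B: "B \<ge> 0" "\<And>\<xi>. \<xi> \<in> space S \<Longrightarrow> \<bar>F \<xi>\<bar> \<le> B" by (rule bmeasE[OF F]) blast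
  have "avg F \<in> borel_measurable S" unfolding avg_def[abs_def] by measurable
  then show ?thesis using avg_bound[OF F B(2)] by (rule bmeasI)
qed

lemma bmeas_pair:
  assumes F: "bmeas F"
  shows "integrable (M \<Otimes>\<^sub>M S) (\<lambda>z. F (case_nat (fst z) (snd z)))"
proof -
  note [measurable] = bmeas_measurable[OF F]
  obtain B where B: "B \<ge> 0" "\<And>\<xi>. \<xi> \<in> space S \<Longrightarrow> \<bar>F \<xi>\<bar> \<le> B" by (rule bmeasE[OF F]) blast
  show ?thesis
    by (rule MS.P.integrable_const_bound[where B=B])
       (use B case_nat_in_space in \<open>auto simp: space_pair_measure\<close>)
qed

lemma integral_iter:
  assumes F: "bmeas F"
  shows "(\<integral>\<xi>. F \<xi> \<partial>S) = (\<integral>\<xi>. (\<integral>s. F (case_nat s \<xi>) \<partial>M) \<partial>S)"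
proof -
  note [measurable] = bmeas_measurable[OF F]
  have "(\<integral>\<xi>. F \<xi> \<partial>S) = (\<integral>\<xi>. F \<xi> \<partial>distr (M \<Otimes>\<^sub>M S) S (\<lambda>(s, \<xi>). case_nat s \<xi>))"
    by (simp add: PiM_iter)
  also have "\<dots> = (\<integral>z. F (case_nat (fst z) (snd z)) \<partial>(M \<Otimes>\<^sub>M S))"
    by (subst integral_distr) (auto simp: split_beta')
  also have "\<dots> = (\<integral>\<xi>. (\<integral>s. F (case_nat s \<xi>) \<partial>M) \<partial>S)"
    using MS.integral_snd[of "\<lambda>s \<xi>. F (case_nat s \<xi>)"] bmeas_pair[OF F] by (simp add: split_beta')
  finally show ?thesis .
qed

lemma integral_avg: "bmeas F \<Longrightarrow> (\<integral>\<xi>. avg F \<xi> \<partial>S) = (\<integral>\<xi>. F \<xi> \<partial>S)"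
  by (simp add: avg_def integral_iter)

lemma upd_case_nat_0: "(case_nat s \<xi>)(0 := t) = case_nat t \<xi>"
  by (auto simp: fun_eq_iff split: nat.split)

lemma case_nat_upd: "case_nat r ((\<xi>)(k := s)) = (case_nat r \<xi>)(Suc k := s)"
  by (auto simp: fun_eq_iff split: nat.split)

lemma nn_integral_influence:
  assumes [measurable]: "F \<in> borel_measurable S"
  shows "(\<integral>\<^sup>+z. ennreal (\<bar>(\<lambda>(s, \<xi>). F \<xi> - F ((\<xi>)(k := s))) z\<bar> ^ q) \<partial>(M \<Otimes>\<^sub>M S))
    = (\<integral>\<^sup>+\<xi>. (\<integral>\<^sup>+r. (\<integral>\<^sup>+s. ennreal (\<bar>F (case_nat r \<xi>) - F ((case_nat r \<xi>)(k := s))\<bar> ^ q) \<partial>M) \<partial>M) \<partial>S)"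
proof -
  have "(\<integral>\<^sup>+z. ennreal (\<bar>(\<lambda>(s, \<xi>). F \<xi> - F ((\<xi>)(k := s))) z\<bar> ^ q) \<partial>(M \<Otimes>\<^sub>M S))
     = (\<integral>\<^sup>+\<xi>. (\<integral>\<^sup>+s. ennreal (\<bar>F \<xi> - F ((\<xi>)(k := s))\<bar> ^ q) \<partial>M) \<partial>S)"
    by (subst MS.nn_integral_snd[symmetric]) (auto simp: split_beta')
  also have "\<dots> = (\<integral>\<^sup>+\<xi>. (\<integral>\<^sup>+r. (\<integral>\<^sup>+s. ennreal (\<bar>F (case_nat r \<xi>) - F ((case_nat r \<xi>)(k := s))\<bar> ^ q) \<partial>M) \<partial>M) \<partial>S)"
    by (subst nn_integral_iter) auto
  finally show ?thesis .
qed

text \<open>Jensen's inequality for the average over the independent copy.\<close>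

lemma influence_residual:
  assumes F: "bmeas F" and i: "influence q F 0 a" and q: "even q"
  shows "Lp_le (M \<Otimes>\<^sub>M S) q (\<lambda>(s, \<xi>). F (case_nat s \<xi>) - avg F \<xi>) a"
proof -
  note [measurable] = bmeas_measurable[OF F] bmeas_measurable[OF bmeas_avg[OF F]]
  obtain B where B: "B \<ge> 0" "\<And>\<xi>. \<xi> \<in> space S \<Longrightarrow> \<bar>F \<xi>\<bar> \<le> B" by (rule bmeasE[OF F]) blast
  have "(\<integral>\<^sup>+z. ennreal (\<bar>(\<lambda>(s, \<xi>). F (case_nat s \<xi>) - avg F \<xi>) z\<bar> ^ q) \<partial>(M \<Otimes>\<^sub>M S))
     = (\<integral>\<^sup>+\<xi>. (\<integral>\<^sup>+s. ennreal (\<bar>F (case_nat s \<xi>) - avg F \<xi>\<bar> ^ q) \<partial>M) \<partial>S)"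
    by (subst MS.nn_integral_snd[symmetric]) (auto simp: split_beta')
  also have "\<dots> \<le> (\<integral>\<^sup>+\<xi>. (\<integral>\<^sup>+r. (\<integral>\<^sup>+s. ennreal (\<bar>F (case_nat r \<xi>) - F ((case_nat r \<xi>)(0 := s))\<bar> ^ q) \<partial>M) \<partial>M) \<partial>S)"
  proof (intro nn_integral_mono)
    fix \<xi> s assume w: "\<xi> \<in> space S" and s: "s \<in> space M"
    have m: "(\<lambda>t. F (case_nat s \<xi>) - F (case_nat t \<xi>)) \<in> borel_measurable M"
      using bmeas_section(1)[OF F w] by measurable
    have "F (case_nat s \<xi>) - avg F \<xi> = (\<integral>t. F (case_nat s \<xi>) - F (case_nat t \<xi>) \<partial>M)"
      using bmeas_section(2)[OF F w] by (simp add: avg_def M.prob_space)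
    then have "ennreal (\<bar>F (case_nat s \<xi>) - avg F \<xi>\<bar> ^ q)
        = ennreal (\<bar>\<integral>t. F (case_nat s \<xi>) - F (case_nat t \<xi>) \<partial>M\<bar> ^ q)" by simp
    also have "\<dots> \<le> (\<integral>\<^sup>+t. ennreal (\<bar>F (case_nat s \<xi>) - F (case_nat t \<xi>)\<bar> ^ q) \<partial>M)"
    proof (rule M.power_integral_le[OF m _ q])
      fix t assume "t \<in> space M"
      then have "\<bar>F (case_nat s \<xi>)\<bar> \<le> B" "\<bar>F (case_nat t \<xi>)\<bar> \<le> B"
        using B(2) case_nat_in_space[OF w] s by auto
      then show "\<bar>F (case_nat s \<xi>) - F (case_nat t \<xi>)\<bar> \<le> 2 * B" by linarith
    qed
    finally show "ennreal (\<bar>F (case_nat s \<xi>) - avg F \<xi>\<bar> ^ q)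
        \<le> (\<integral>\<^sup>+t. ennreal (\<bar>F (case_nat s \<xi>) - F ((case_nat s \<xi>)(0 := t))\<bar> ^ q) \<partial>M)"
      by (simp add: upd_case_nat_0)
  qed
  also have "\<dots> \<le> ennreal (a ^ q)"
    using Lp_leD(3)[OF i[unfolded influence_def]] unfolding nn_integral_influence[OF bmeas_measurable[OF F]] .
  finally show ?thesis using i unfolding influence_def Lp_le_def by auto
qed

text \<open>The average commutes with resampling a later coordinate, so Jensen's inequality applies.\<close>

lemma influence_avg:
  assumes F: "bmeas F" and i: "influence q F (Suc k) a" and q: "even q"
  shows "influence q (avg F) k a"
proof -
  note [measurable] = bmeas_measurable[OF F] bmeas_measurable[OF bmeas_avg[OF F]]
  obtain B where B: "B \<ge> 0" "\<And>\<xi>. \<xi> \<in> space S \<Longrightarrow> \<bar>F \<xi>\<bar> \<le> B" by (rule bmeasE[OF F]) blast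
  have "(\<integral>\<^sup>+z. ennreal (\<bar>(\<lambda>(s, \<xi>). avg F \<xi> - avg F ((\<xi>)(k := s))) z\<bar> ^ q) \<partial>(M \<Otimes>\<^sub>M S))
     = (\<integral>\<^sup>+\<xi>. (\<integral>\<^sup>+s. ennreal (\<bar>avg F \<xi> - avg F ((\<xi>)(k := s))\<bar> ^ q) \<partial>M) \<partial>S)"
    by (subst MS.nn_integral_snd[symmetric]) (auto simp: split_beta')
  also have "\<dots> \<le> (\<integral>\<^sup>+\<xi>. (\<integral>\<^sup>+s. (\<integral>\<^sup>+r. ennreal (\<bar>F (case_nat r \<xi>) - F ((case_nat r \<xi>)(Suc k := s))\<bar> ^ q) \<partial>M) \<partial>M) \<partial>S)"
  proof (intro nn_integral_mono)
    fix \<xi> s assume w: "\<xi> \<in> space S" and s: "s \<in> space M"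
    have w': "(\<xi>)(k := s) \<in> space S" using w s by (auto simp: space_PiM PiE_iff)
    have m: "(\<lambda>r. F (case_nat r \<xi>) - F (case_nat r ((\<xi>)(k := s)))) \<in> borel_measurable M"
      using bmeas_section(1)[OF F w] bmeas_section(1)[OF F w'] by measurable
    have "avg F \<xi> - avg F ((\<xi>)(k := s)) = (\<integral>r. F (case_nat r \<xi>) - F (case_nat r ((\<xi>)(k := s))) \<partial>M)"
      using bmeas_section(2)[OF F w] bmeas_section(2)[OF F w'] by (simp add: avg_def)
    then have "ennreal (\<bar>avg F \<xi> - avg F ((\<xi>)(k := s))\<bar> ^ q)
        = ennreal (\<bar>\<integral>r. F (case_nat r \<xi>) - F (case_nat r ((\<xi>)(k := s))) \<partial>M\<bar> ^ q)" by simp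
    also have "\<dots> \<le> (\<integral>\<^sup>+r. ennreal (\<bar>F (case_nat r \<xi>) - F (case_nat r ((\<xi>)(k := s)))\<bar> ^ q) \<partial>M)"
    proof (rule M.power_integral_le[OF m _ q])
      fix t assume "t \<in> space M"
      then have "\<bar>F (case_nat t \<xi>)\<bar> \<le> B" "\<bar>F (case_nat t ((\<xi>)(k := s)))\<bar> \<le> B"
        using B(2) case_nat_in_space[OF w] case_nat_in_space[OF w'] by auto
      then show "\<bar>F (case_nat t \<xi>) - F (case_nat t ((\<xi>)(k := s)))\<bar> \<le> 2 * B" by linarith
    qed
    finally show "ennreal (\<bar>avg F \<xi> - avg F ((\<xi>)(k := s))\<bar> ^ q)
        \<le> (\<integral>\<^sup>+r. ennreal (\<bar>F (case_nat r \<xi>) - F ((case_nat r \<xi>)(Suc k := s))\<bar> ^ q) \<partial>M)"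
      by (simp only: case_nat_upd)
  qed
  also have "\<dots> = (\<integral>\<^sup>+\<xi>. (\<integral>\<^sup>+r. (\<integral>\<^sup>+s. ennreal (\<bar>F (case_nat r \<xi>) - F ((case_nat r \<xi>)(Suc k := s))\<bar> ^ q) \<partial>M) \<partial>M) \<partial>S)"
  proof (rule nn_integral_cong)
    fix \<xi> assume w: "\<xi> \<in> space S"
    interpret MM: pair_sigma_finite M M ..
    have "(\<lambda>(s, r). (case_nat r \<xi>)(Suc k := s)) \<in> measurable (M \<Otimes>\<^sub>M M) S"
      unfolding case_nat_upd[symmetric]
    proof (rule measurable_PiM_single')
      show "(\<lambda>z. (case z of (s, r) \<Rightarrow> case_nat r ((\<xi>)(k := s))) i) \<in> measurable (M \<Otimes>\<^sub>M M) M" if "i \<in> UNIV" for i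
        using w by (cases i; cases "i = Suc k") (auto simp: split_beta' space_PiM PiE_iff)
    qed (use w in \<open>auto simp: space_PiM space_pair_measure PiE_iff split: nat.split\<close>)
    have "(\<lambda>r. case_nat r \<xi>) \<in> measurable M S"
      using measurable_compose[OF measurable_Pair2'[OF w] measurable_iter] by simp
    from measurable_compose[OF measurable_snd this]
    have "(\<lambda>(s, r). case_nat r \<xi>) \<in> measurable (M \<Otimes>\<^sub>M M) S"
      by (simp add: split_beta')
    have "(\<lambda>(s, r). ennreal (\<bar>F (case_nat r \<xi>) - F ((case_nat r \<xi>)(Suc k := s))\<bar> ^ q)) \<in> borel_measurable (M \<Otimes>\<^sub>M M)"
      using measurable_compose[OF \<open>(\<lambda>(s, r). (case_nat r \<xi>)(Suc k := s)) \<in> measurable (M \<Otimes>\<^sub>M M) S\<close> bmeas_measurable[OF F]]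
        measurable_compose[OF \<open>(\<lambda>(s, r). case_nat r \<xi>) \<in> measurable (M \<Otimes>\<^sub>M M) S\<close> bmeas_measurable[OF F]]
      unfolding split_beta' by (intro measurable_compose[OF _ measurable_ennreal] borel_measurable_power borel_measurable_abs borel_measurable_diff)
    then show "(\<integral>\<^sup>+s. (\<integral>\<^sup>+r. ennreal (\<bar>F (case_nat r \<xi>) - F ((case_nat r \<xi>)(Suc k := s))\<bar> ^ q) \<partial>M) \<partial>M)
       = (\<integral>\<^sup>+r. (\<integral>\<^sup>+s. ennreal (\<bar>F (case_nat r \<xi>) - F ((case_nat r \<xi>)(Suc k := s))\<bar> ^ q) \<partial>M) \<partial>M)"
      by (rule MM.Fubini'[symmetric])
  qed
  also have "\<dots> \<le> ennreal (a ^ q)"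
    using Lp_leD(3)[OF i[unfolded influence_def]] unfolding nn_integral_influence[OF bmeas_measurable[OF F]] .
  finally show ?thesis using i unfolding influence_def Lp_le_def by auto
qed

end

section \<open>A zero-one law\<close>

context sequence_space
begin

lemma bmeas_avg_pow: "bmeas F \<Longrightarrow> bmeas ((avg ^^ N) F)"
  by (induction N) (simp_all add: bmeas_avg)

lemma avg_pow_bound:
  assumes F: "bmeas F" and B: "\<And>\<xi>. \<xi> \<in> space S \<Longrightarrow> \<bar>F \<xi>\<bar> \<le> B" and w: "\<xi> \<in> space S"
  shows "\<bar>(avg ^^ N) F \<xi>\<bar> \<le> B"
  using w
proof (induction N arbitrary: \<xi>)
  case 0 then show ?case using B by simp
next
  case (Suc N)
  show ?case using avg_bound[OF bmeas_avg_pow[OF F] Suc.IH Suc.prems] by simp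
qed

lemma integral_avg_pow: "bmeas F \<Longrightarrow> (\<integral>\<xi>. (avg ^^ N) F \<xi> \<partial>S) = (\<integral>\<xi>. F \<xi> \<partial>S)"
  by (induction N) (simp_all add: integral_avg bmeas_avg_pow)

lemma influence_avg_pow:
  assumes F: "bmeas F" and i: "influence q F (k + N) a" and q: "even q"
  shows "influence q ((avg ^^ N) F) k a"
  using i
proof (induction N arbitrary: k)
  case (Suc N)
  have "influence q ((avg ^^ N) F) (Suc k) a" using Suc.prems by (intro Suc.IH) simp
  then show ?case using influence_avg[OF bmeas_avg_pow[OF F] _ q] by simp
qed simp

lemma avg_pow_lincomb:
  assumes F: "bmeas F" and G: "bmeas G" and w: "\<xi> \<in> space S"
  shows "(avg ^^ N) (\<lambda>\<xi>. F \<xi> + c * G \<xi>) \<xi> = (avg ^^ N) F \<xi> + c * (avg ^^ N) G \<xi>"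
  using w
proof (induction N arbitrary: \<xi>)
  case (Suc N)
  have "(avg ^^ Suc N) (\<lambda>\<xi>. F \<xi> + c * G \<xi>) \<xi> = (\<integral>s. (avg ^^ N) (\<lambda>\<xi>. F \<xi> + c * G \<xi>) (case_nat s \<xi>) \<partial>M)"
    by (simp add: avg_def)
  also have "\<dots> = (\<integral>s. (avg ^^ N) F (case_nat s \<xi>) + c * (avg ^^ N) G (case_nat s \<xi>) \<partial>M)"
    using Suc case_nat_in_space by (intro Bochner_Integration.integral_cong) auto
  also have "\<dots> = (avg ^^ Suc N) F \<xi> + c * (avg ^^ Suc N) G \<xi>"
    using bmeas_section[OF bmeas_avg_pow[OF F] Suc.prems] bmeas_section[OF bmeas_avg_pow[OF G] Suc.prems]
    by (simp add: avg_def)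
  finally show ?case .
qed simp

lemma integral_abs_avg:
  assumes F: "bmeas F" shows "(\<integral>\<xi>. \<bar>avg F \<xi>\<bar> \<partial>S) \<le> (\<integral>\<xi>. \<bar>F \<xi>\<bar> \<partial>S)"
proof -
  have F': "bmeas (\<lambda>\<xi>. \<bar>F \<xi>\<bar>)" using F by (auto simp: bmeas_def)
  have "(\<integral>\<xi>. \<bar>avg F \<xi>\<bar> \<partial>S) \<le> (\<integral>\<xi>. avg (\<lambda>\<xi>. \<bar>F \<xi>\<bar>) \<xi> \<partial>S)"
  proof (rule integral_mono)
    show "\<bar>avg F \<xi>\<bar> \<le> avg (\<lambda>\<xi>. \<bar>F \<xi>\<bar>) \<xi>" for \<xi>
      unfolding avg_def by (rule integral_abs_bound)
  qed (intro integrable_abs bmeas_integrable bmeas_avg F F')+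
  then show ?thesis using integral_avg[OF F'] by simp
qed

lemma integral_abs_avg_pow:
  assumes F: "bmeas F" shows "(\<integral>\<xi>. \<bar>(avg ^^ N) F \<xi>\<bar> \<partial>S) \<le> (\<integral>\<xi>. \<bar>F \<xi>\<bar> \<partial>S)"
  by (induction N) (auto intro: order_trans[OF integral_abs_avg[OF bmeas_avg_pow[OF F]]])

text \<open>Measures how much \<open>F\<close> still depends on the coordinates from \<open>N\<close> on.\<close>

definition dev :: "nat \<Rightarrow> ((nat \<Rightarrow> 'a) \<Rightarrow> real) \<Rightarrow> real" where
  "dev N F = (\<integral>\<xi>. \<bar>(avg ^^ N) F \<xi> - (\<integral>\<xi>. F \<xi> \<partial>S)\<bar> \<partial>S)"

lemma dev_lincomb:
  assumes F: "bmeas F" and G: "bmeas G"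
  shows "dev N (\<lambda>\<xi>. F \<xi> + c * G \<xi>) \<le> dev N F + \<bar>c\<bar> * dev N G"
proof -
  note b = bmeas_diff[OF bmeas_avg_pow bmeas_const, THEN bmeas_integrable, THEN integrable_abs]
  have m: "(\<integral>\<xi>. F \<xi> + c * G \<xi> \<partial>S) = (\<integral>\<xi>. F \<xi> \<partial>S) + c * (\<integral>\<xi>. G \<xi> \<partial>S)"
    using bmeas_integrable[OF F] bmeas_integrable[OF G] by simp
  have "dev N (\<lambda>\<xi>. F \<xi> + c * G \<xi>)
     \<le> (\<integral>\<xi>. \<bar>(avg ^^ N) F \<xi> - (\<integral>\<xi>. F \<xi> \<partial>S)\<bar> + \<bar>c\<bar> * \<bar>(avg ^^ N) G \<xi> - (\<integral>\<xi>. G \<xi> \<partial>S)\<bar> \<partial>S)"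
    unfolding dev_def m
  proof (rule integral_mono)
    fix \<xi> assume w: "\<xi> \<in> space S"
    have eq: "(avg ^^ N) (\<lambda>\<xi>. F \<xi> + c * G \<xi>) \<xi> - ((\<integral>\<xi>. F \<xi> \<partial>S) + c * (\<integral>\<xi>. G \<xi> \<partial>S))
       = ((avg ^^ N) F \<xi> - (\<integral>\<xi>. F \<xi> \<partial>S)) + c * ((avg ^^ N) G \<xi> - (\<integral>\<xi>. G \<xi> \<partial>S))"
      by (simp add: avg_pow_lincomb[OF F G w] algebra_simps)
    show "\<bar>(avg ^^ N) (\<lambda>\<xi>. F \<xi> + c * G \<xi>) \<xi> - ((\<integral>\<xi>. F \<xi> \<partial>S) + c * (\<integral>\<xi>. G \<xi> \<partial>S))\<bar>
       \<le> \<bar>(avg ^^ N) F \<xi> - (\<integral>\<xi>. F \<xi> \<partial>S)\<bar> + \<bar>c\<bar> * \<bar>(avg ^^ N) G \<xi> - (\<integral>\<xi>. G \<xi> \<partial>S)\<bar>"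
      unfolding eq abs_mult[symmetric] by (rule abs_triangle_ineq)
  next
    show "integrable S (\<lambda>\<xi>. \<bar>(avg ^^ N) (\<lambda>\<xi>. F \<xi> + c * G \<xi>) \<xi> - ((\<integral>\<xi>. F \<xi> \<partial>S) + c * (\<integral>\<xi>. G \<xi> \<partial>S))\<bar>)"
      by (intro b bmeas_add F bmeas_cmult G)
    show "integrable S (\<lambda>\<xi>. \<bar>(avg ^^ N) F \<xi> - (\<integral>\<xi>. F \<xi> \<partial>S)\<bar> + \<bar>c\<bar> * \<bar>(avg ^^ N) G \<xi> - (\<integral>\<xi>. G \<xi> \<partial>S)\<bar>)"
      using b[OF F] b[OF G] by simp
  qed
  also have "\<dots> = dev N F + \<bar>c\<bar> * dev N G"
    unfolding dev_def using b[OF F] b[OF G] by simp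
  finally show ?thesis .
qed

lemma dev_nonneg: "0 \<le> dev N F" unfolding dev_def by simp

lemma dev_le:
  assumes F: "bmeas F" shows "dev N F \<le> 2 * (\<integral>\<xi>. \<bar>F \<xi>\<bar> \<partial>S)"
proof -
  note b = bmeas_integrable[OF bmeas_avg_pow[OF F], of N] bmeas_integrable[OF F]
  have "dev N F \<le> (\<integral>\<xi>. \<bar>(avg ^^ N) F \<xi>\<bar> + \<bar>\<integral>\<xi>. F \<xi> \<partial>S\<bar> \<partial>S)"
    unfolding dev_def using b by (intro integral_mono) auto
  also have "\<dots> = (\<integral>\<xi>. \<bar>(avg ^^ N) F \<xi>\<bar> \<partial>S) + \<bar>\<integral>\<xi>. F \<xi> \<partial>S\<bar>"
    using b by (simp add: P.prob_space)
  also have "\<dots> \<le> (\<integral>\<xi>. \<bar>F \<xi>\<bar> \<partial>S) + (\<integral>\<xi>. \<bar>F \<xi>\<bar> \<partial>S)"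
    by (intro add_mono integral_abs_avg_pow[OF F] integral_abs_bound)
  finally show ?thesis by simp
qed

definition tail_trivial :: "((nat \<Rightarrow> 'a) \<Rightarrow> real) \<Rightarrow> bool" where
  "tail_trivial F \<longleftrightarrow> bmeas F \<and> (\<lambda>N. dev N F) \<longlonglongrightarrow> 0"

lemma tail_trivial_lincomb:
  assumes F: "tail_trivial F" and G: "tail_trivial G"
  shows "tail_trivial (\<lambda>\<xi>. F \<xi> + c * G \<xi>)"
  unfolding tail_trivial_def
proof
  show "bmeas (\<lambda>\<xi>. F \<xi> + c * G \<xi>)"
    using F G by (auto simp: tail_trivial_def intro!: bmeas_add bmeas_cmult)
  show "(\<lambda>N. dev N (\<lambda>\<xi>. F \<xi> + c * G \<xi>)) \<longlonglongrightarrow> 0"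
  proof (rule tendsto_sandwich[of "\<lambda>_. 0" _ _ "\<lambda>N. dev N F + \<bar>c\<bar> * dev N G"])
    show "(\<lambda>N. dev N F + \<bar>c\<bar> * dev N G) \<longlonglongrightarrow> 0"
      using tendsto_add[OF _ tendsto_mult_left, of "\<lambda>N. dev N F" 0 _ "\<lambda>N. dev N G" 0 "\<bar>c\<bar>"] F G
      by (simp add: tail_trivial_def)
    show "\<forall>\<^sub>F N in sequentially. dev N (\<lambda>\<xi>. F \<xi> + c * G \<xi>) \<le> dev N F + \<bar>c\<bar> * dev N G"
      using F G by (intro always_eventually allI dev_lincomb) (simp_all add: tail_trivial_def)
  qed (auto simp: dev_nonneg)
qed

lemma tail_trivial_const: "tail_trivial (\<lambda>_. c)"
proof -
  have "(avg ^^ N) (\<lambda>_. c) = (\<lambda>_. c)" for N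
    by (induction N) (auto simp: avg_def[abs_def] M.prob_space)
  then show ?thesis by (simp add: tail_trivial_def dev_def P.prob_space bmeas_const)
qed

lemma tail_trivial_sum:
  "(\<And>i. i \<in> I \<Longrightarrow> tail_trivial (F i)) \<Longrightarrow> tail_trivial (\<lambda>\<xi>. \<Sum>i\<in>I. c i * F i \<xi>)"
proof (induction I rule: infinite_finite_induct)
  case (insert i I)
  then show ?case using tail_trivial_lincomb[of "\<lambda>\<xi>. \<Sum>i\<in>I. c i * F i \<xi>" "F i" "c i"]
    by (simp add: add.commute)
qed (simp_all add: tail_trivial_const)

text \<open>Averaging contracts the \<open>L\<^sub>1\<close> distance.\<close>

lemma tail_trivial_limit:
  assumes F: "bmeas F"
    and approx: "\<And>e. e > 0 \<Longrightarrow> \<exists>G. tail_trivial G \<and> (\<integral>\<xi>. \<bar>F \<xi> - G \<xi>\<bar> \<partial>S) \<le> e"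
  shows "tail_trivial F"
  unfolding tail_trivial_def
proof
  show "(\<lambda>N. dev N F) \<longlonglongrightarrow> 0"
  proof (rule LIMSEQ_I)
    fix r :: real assume r: "r > 0"
    obtain G where G: "tail_trivial G" and FG: "(\<integral>\<xi>. \<bar>F \<xi> - G \<xi>\<bar> \<partial>S) \<le> r / 4"
      using approx[of "r / 4"] r by auto
    have bG: "bmeas G" using G by (simp add: tail_trivial_def)
    have "\<forall>\<^sub>F N in sequentially. dev N G < r / 2"
      using G r by (intro order_tendstoD(2)[of _ 0]) (auto simp: tail_trivial_def)
    then obtain N0 where N0: "\<And>N. N \<ge> N0 \<Longrightarrow> dev N G < r / 2" by (auto simp: eventually_sequentially)
    have "norm (dev N F - 0) < r" if "N \<ge> N0" for N
    proof -
      have "dev N F \<le> dev N G + dev N (\<lambda>\<xi>. F \<xi> - G \<xi>)"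
        using dev_lincomb[OF bG bmeas_diff[OF F bG], of N 1] by simp
      also have "dev N (\<lambda>\<xi>. F \<xi> - G \<xi>) \<le> r / 2"
        using dev_le[OF bmeas_diff[OF F bG], of N] FG by linarith
      finally show ?thesis using N0[OF that] dev_nonneg[of N F] by simp
    qed
    then show "\<exists>no. \<forall>n\<ge>no. norm (dev n F - 0) < r" by blast
  qed
qed (fact F)

lemma avg_pow_finite_dependence:
  assumes F: "bmeas F"
    and dep: "\<And>\<xi> \<xi>'. \<xi> \<in> space S \<Longrightarrow> \<xi>' \<in> space S \<Longrightarrow> (\<forall>j<N. \<xi> j = \<xi>' j) \<Longrightarrow> F \<xi> = F \<xi>'"
    and w: "\<xi> \<in> space S"
  shows "(avg ^^ N) F \<xi> = (\<integral>\<xi>. F \<xi> \<partial>S)"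
  using assms
proof (induction N arbitrary: F \<xi>)
  case 0
  have "F \<eta> = F \<xi>" if "\<eta> \<in> space S" for \<eta>
    by (rule 0(2)[OF that 0(3)]) simp
  then have "(\<integral>\<xi>. F \<xi> \<partial>S) = (\<integral>_. F \<xi> \<partial>S)"
    by (rule Bochner_Integration.integral_cong[OF refl])
  then show ?case by (simp add: P.prob_space)
next
  case (Suc N)
  have "(avg ^^ N) (avg F) \<xi> = (\<integral>\<xi>. avg F \<xi> \<partial>S)"
  proof (rule Suc.IH[OF bmeas_avg[OF Suc.prems(1)] _ Suc.prems(3)])
    fix \<xi> \<xi>' assume w: "\<xi> \<in> space S" "\<xi>' \<in> space S" "\<forall>j<N. \<xi> j = \<xi>' j"
    show "avg F \<xi> = avg F \<xi>'" unfolding avg_def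
    proof (rule Bochner_Integration.integral_cong[OF refl])
      fix s assume "s \<in> space M"
      then show "F (case_nat s \<xi>) = F (case_nat s \<xi>')"
        using w by (intro Suc.prems(2) case_nat_in_space) (auto split: nat.split)
    qed
  qed
  then show ?case by (simp add: funpow_Suc_right integral_avg[OF Suc.prems(1)] del: funpow.simps)
qed

text \<open>A form of Kolmogorov's zero-one law: averaging out more and more of the first coordinates
  sends a bounded function to its mean. A cylinder set depends on finitely many coordinates only,
  and the sets with this property are closed under complements and disjoint unions, so that they
  exhaust the product algebra.\<close>

lemma tail_trivial_indicator:
  assumes A: "A \<in> sets S" shows "tail_trivial (indicator A)"
proof -
  have bm: "bmeas (indicator A :: _ \<Rightarrow> real)" if "A \<in> sets S" for A
    using that by (intro bmeasI[of _ 1]) (auto simp: indicator_def)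
  have "A \<in> sigma_sets (\<Pi>\<^sub>E i\<in>UNIV. space M) (prod_algebra UNIV (\<lambda>_::nat. M))"
    using A by (simp add: sets_PiM)
  then show ?thesis
  proof (induction rule: sigma_sets_induct_disjoint[OF Int_stable_prod_algebra prod_algebra_sets_into_space, consumes 1, case_names basic empty compl union])
    case (basic A)
    from basic obtain J E where J: "A = prod_emb UNIV (\<lambda>_. M) J (\<Pi>\<^sub>E j\<in>J. E j)" "finite J"
      and E: "\<And>i. i \<in> J \<Longrightarrow> E i \<in> sets M"
      by (rule prod_algebraE) auto
    have bA: "bmeas (indicator A :: _ \<Rightarrow> real)"
      using J E by (intro bm) (auto intro!: sets_PiM_I)
    define N0 where "N0 = Suc (Max (insert 0 J))"
    have N0: "j < N0" if "j \<in> J" for j using J(2) that by (auto simp: N0_def less_Suc_eq_le)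
    have "dev N (indicator A) = 0" if N: "N \<ge> N0" for N
    proof -
      have "(avg ^^ N) (indicator A) \<xi> = (\<integral>\<xi>. indicator A \<xi> \<partial>S)" if w: "\<xi> \<in> space S" for \<xi>
      proof (rule avg_pow_finite_dependence[OF bA _ w])
        fix \<xi> \<xi>' :: "nat \<Rightarrow> 'a" assume w: "\<xi> \<in> space S" "\<xi>' \<in> space S" "\<forall>j<N. \<xi> j = \<xi>' j"
        then have "\<forall>j\<in>J. \<xi> j = \<xi>' j" using N0 N by (meson less_le_trans)
        then have "\<xi> \<in> A \<longleftrightarrow> \<xi>' \<in> A"
          using w(1,2) unfolding J(1) by (auto simp: prod_emb_def PiE_iff space_PiM)
        then show "indicator A \<xi> = (indicator A \<xi>' :: real)" by (simp add: indicator_def)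
      qed
      then have "dev N (indicator A) = (\<integral>\<xi>. 0 \<partial>S)"
        unfolding dev_def by (intro Bochner_Integration.integral_cong) auto
      then show ?thesis by simp
    qed
    then have "\<forall>\<^sub>F N in sequentially. 0 = dev N (indicator A)"
      by (auto simp: eventually_sequentially)
    then have "(\<lambda>N. dev N (indicator A)) \<longlonglongrightarrow> 0"
      by (rule Lim_transform_eventually[OF tendsto_const])
    then show ?case using bA by (simp add: tail_trivial_def)
  next
    case empty
    then show ?case using tail_trivial_const[of 0] by (simp add: indicator_def)
  next
    case (compl A)
    have A: "A \<in> sets S" using compl(1) by (simp add: sets_PiM)
    have t: "tail_trivial (\<lambda>\<xi>. 1 + (-1) * indicator A \<xi>)"
      by (rule tail_trivial_lincomb[OF tail_trivial_const compl(2)])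
    show ?case
    proof (rule tail_trivial_limit)
      fix e :: real assume "e > 0"
      have "(\<integral>\<xi>. \<bar>indicator (Pi\<^sub>E UNIV (\<lambda>i. space M) - A) \<xi> - ((1::real) + (-1) * indicator A \<xi>)\<bar> \<partial>S) = (\<integral>\<xi>. 0 \<partial>S)"
        by (intro Bochner_Integration.integral_cong) (auto simp: indicator_def space_PiM)
      then show "\<exists>G. tail_trivial G \<and> (\<integral>\<xi>. \<bar>indicator (Pi\<^sub>E UNIV (\<lambda>i. space M) - A) \<xi> - G \<xi>\<bar> \<partial>S) \<le> e"
        using t \<open>e > 0\<close> by (intro exI[of _ "\<lambda>\<xi>. 1 + (-1) * indicator A \<xi>"]) simp
    qed (use sets.compl_sets[OF A] in \<open>auto intro!: bm simp: space_PiM\<close>)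
  next
    case (union A)
    have A[measurable]: "A i \<in> sets S" for i using union(2) by (auto simp: sets_PiM)
    show ?case
    proof (rule tail_trivial_limit)
      show "bmeas (indicator (\<Union>i. A i))" by (intro bm) measurable
      fix e :: real assume e: "e > 0"
      have "(\<lambda>i. P.prob (A i)) sums P.prob (\<Union>i. A i)"
        using union(1) A by (intro P.finite_measure_UNION) auto
      then have "\<forall>\<^sub>F k in sequentially. dist (\<Sum>i<k. P.prob (A i)) (P.prob (\<Union>i. A i)) < e"
        unfolding sums_def using e by (rule tendstoD)
      then obtain k where k: "dist (\<Sum>i<k. P.prob (A i)) (P.prob (\<Union>i. A i)) < e"
        by (auto simp: eventually_sequentially)
      define G :: "(nat \<Rightarrow> 'a) \<Rightarrow> real" where "G \<xi> = (\<Sum>i<k. 1 * indicator (A i) \<xi>)" for \<xi>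
      have G: "tail_trivial G" unfolding G_def[abs_def] by (rule tail_trivial_sum) (rule union(3))
      have GU: "G \<xi> = indicator (\<Union>i<k. A i) \<xi>" for \<xi>
        unfolding G_def using union(1)
        by (subst indicator_UN_disjoint) (auto simp: disjoint_family_on_def)
      have "(\<integral>\<xi>. \<bar>indicator (\<Union>i. A i) \<xi> - G \<xi>\<bar> \<partial>S) = (\<integral>\<xi>. indicator (\<Union>i. A i) \<xi> - indicator (\<Union>i<k. A i) \<xi> \<partial>S)"
        by (intro Bochner_Integration.integral_cong) (auto simp: GU indicator_def)
      also have "\<dots> = P.prob (\<Union>i. A i) - P.prob (\<Union>i<k. A i)"
      proof -
        have U: "(\<Union>i. A i) \<in> sets S" "(\<Union>i<k. A i) \<in> sets S" by measurable
        show ?thesis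
          using U[THEN bm, THEN bmeas_integrable] U[THEN sets.sets_into_space]
          by (simp add: Int_absorb2)
      qed
      also have "P.prob (\<Union>i<k. A i) = (\<Sum>i<k. P.prob (A i))"
        using union(1) A by (intro P.finite_measure_finite_Union) (auto simp: disjoint_family_on_def)
      also have "P.prob (\<Union>i. A i) - (\<Sum>i<k. P.prob (A i)) \<le> e" using k by (simp add: dist_real_def abs_diff_less_iff)
      finally show "\<exists>G. tail_trivial G \<and> (\<integral>\<xi>. \<bar>indicator (\<Union>i. A i) \<xi> - G \<xi>\<bar> \<partial>S) \<le> e" using G by blast
    qed
  qed
qed

text \<open>Rounding \<open>F\<close> to multiples of \<open>e\<close> approximates it uniformly by combinations of indicators.\<close>

lemma tail_trivial_bmeas:
  assumes F: "bmeas F" shows "tail_trivial F"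
proof (rule tail_trivial_limit[OF F])
  fix e :: real assume e: "e > 0"
  note [measurable] = bmeas_measurable[OF F]
  obtain B where B: "B \<ge> 0" "\<And>\<xi>. \<xi> \<in> space S \<Longrightarrow> \<bar>F \<xi>\<bar> \<le> B" by (rule bmeasE[OF F]) blast
  define K where "K = \<lceil>B / e\<rceil> + 1"
  define A where "A k = {\<xi>\<in>space S. \<lfloor>F \<xi> / e\<rfloor> = k}" for k
  define G where "G \<xi> = (\<Sum>k\<in>{-K..K}. (of_int k * e) * indicator (A k) \<xi>)" for \<xi>
  have "A k \<in> sets S" for k unfolding A_def by measurable
  then have G: "tail_trivial G" unfolding G_def[abs_def] by (intro tail_trivial_sum tail_trivial_indicator)
  have close: "\<bar>F \<xi> - G \<xi>\<bar> \<le> e" if w: "\<xi> \<in> space S" for \<xi>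
  proof -
    define k where "k = \<lfloor>F \<xi> / e\<rfloor>"
    have "\<bar>F \<xi> / e\<bar> \<le> B / e" using B(2)[OF w] e by (simp add: divide_right_mono)
    then have "- (B / e) \<le> F \<xi> / e" "F \<xi> / e \<le> B / e" by linarith+
    then have k: "k \<in> {-K..K}" unfolding k_def K_def atLeastAtMost_iff by linarith
    have "G \<xi> = (\<Sum>j\<in>{-K..K}. if j = k then of_int k * e else 0)"
      unfolding G_def A_def using w by (intro sum.cong) (auto simp: indicator_def k_def)
    then have "G \<xi> = of_int k * e" using k by simp
    moreover have "of_int k \<le> F \<xi> / e" "F \<xi> / e < of_int k + 1" by (auto simp: k_def)
    ultimately show ?thesis using e by (simp add: field_simps abs_le_iff)
  qed
  have "(\<integral>\<xi>. \<bar>F \<xi> - G \<xi>\<bar> \<partial>S) \<le> (\<integral>\<xi>. e \<partial>S)"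
    using F G close by (intro integral_mono integrable_abs bmeas_integrable bmeas_diff bmeas_const) (auto simp: tail_trivial_def)
  then show "\<exists>G. tail_trivial G \<and> (\<integral>\<xi>. \<bar>F \<xi> - G \<xi>\<bar> \<partial>S) \<le> e" using G by (auto simp: P.prob_space)
qed

lemma dev_tendsto_0: "bmeas F \<Longrightarrow> (\<lambda>N. dev N F) \<longlonglongrightarrow> 0"
  using tail_trivial_bmeas by (simp add: tail_trivial_def)

end

section \<open>Moments and covariances bounded by influences\<close>

lemma square_le_imp_le_abs: "(x::real)\<^sup>2 \<le> y\<^sup>2 \<Longrightarrow> 0 \<le> y \<Longrightarrow> x \<le> y"
  using abs_le_square_iff[of x y] by simp

context sequence_space
begin

text \<open>Averaging out the first coordinate changes a covariance by the covariance of the residuals.\<close>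

lemma covariance_avg_step:
  assumes F: "bmeas F" and G: "bmeas G" and a: "influence 2 F 0 a" and b: "influence 2 G 0 b"
  shows "\<bar>(\<integral>\<xi>. F \<xi> * G \<xi> \<partial>S) - (\<integral>\<xi>. avg F \<xi> * avg G \<xi> \<partial>S)\<bar> \<le> a * b"
proof -
  let ?R = "\<lambda>(s, \<xi>). F (case_nat s \<xi>) - avg F \<xi>" and ?T = "\<lambda>(s, \<xi>). G (case_nat s \<xi>) - avg G \<xi>"
  have "Lp_le (M \<Otimes>\<^sub>M S) 1 (\<lambda>z. ?R z * ?T z) (a * b)"
    using Lp_le_mult[of "M \<Otimes>\<^sub>M S" 1 ?R a ?T b] influence_residual[OF F a] influence_residual[OF G b] by simp
  note RT = Lp_le_1[OF this]
  have "(\<integral>\<xi>. F \<xi> * G \<xi> \<partial>S) = (\<integral>\<xi>. (\<integral>s. F (case_nat s \<xi>) * G (case_nat s \<xi>) \<partial>M) \<partial>S)"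
    by (rule integral_iter[OF bmeas_mult[OF F G]])
  also have "\<dots> = (\<integral>\<xi>. avg F \<xi> * avg G \<xi> + (\<integral>s. (F (case_nat s \<xi>) - avg F \<xi>) * (G (case_nat s \<xi>) - avg G \<xi>) \<partial>M) \<partial>S)"
  proof (rule Bochner_Integration.integral_cong[OF refl])
    fix \<xi> assume w: "\<xi> \<in> space S"
    note i = bmeas_section(2)[OF F w] bmeas_section(2)[OF G w] bmeas_section(2)[OF bmeas_mult[OF F G] w]
    have "(\<integral>s. (F (case_nat s \<xi>) - avg F \<xi>) * (G (case_nat s \<xi>) - avg G \<xi>) \<partial>M)
       = (\<integral>s. F (case_nat s \<xi>) * G (case_nat s \<xi>) - avg G \<xi> * F (case_nat s \<xi>) - avg F \<xi> * G (case_nat s \<xi>) + avg F \<xi> * avg G \<xi> \<partial>M)"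
      by (intro Bochner_Integration.integral_cong) (auto simp: algebra_simps)
    also have "\<dots> = (\<integral>s. F (case_nat s \<xi>) * G (case_nat s \<xi>) \<partial>M) - avg F \<xi> * avg G \<xi>"
      using i by (simp add: M.prob_space avg_def[symmetric])
    finally show "(\<integral>s. F (case_nat s \<xi>) * G (case_nat s \<xi>) \<partial>M) = avg F \<xi> * avg G \<xi>
        + (\<integral>s. (F (case_nat s \<xi>) - avg F \<xi>) * (G (case_nat s \<xi>) - avg G \<xi>) \<partial>M)" by simp
  qed
  also have "\<dots> = (\<integral>\<xi>. avg F \<xi> * avg G \<xi> \<partial>S) + (\<integral>z. ?R z * ?T z \<partial>(M \<Otimes>\<^sub>M S))"
  proof -
    have i: "integrable (M \<Otimes>\<^sub>M S) (case_prod (\<lambda>s \<xi>. (F (case_nat s \<xi>) - avg F \<xi>) * (G (case_nat s \<xi>) - avg G \<xi>)))"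
      using RT(1) by (simp add: split_beta')
    show ?thesis
      using MS.integral_snd[OF i] MS.integrable_snd[OF i] bmeas_integrable[OF bmeas_mult[OF bmeas_avg[OF F] bmeas_avg[OF G]]]
      by (simp add: split_beta')
  qed
  finally show ?thesis using RT(2) by simp
qed

lemma covariance_avg_pow:
  assumes F: "bmeas F" and G: "bmeas G" and a: "\<And>k. influence 2 F k (a k)" and b: "\<And>k. influence 2 G k (b k)"
  shows "\<bar>(\<integral>\<xi>. F \<xi> * G \<xi> \<partial>S) - (\<integral>\<xi>. (avg ^^ N) F \<xi> * (avg ^^ N) G \<xi> \<partial>S)\<bar> \<le> (\<Sum>k<N. a k * b k)"
proof (induction N)
  case (Suc N)
  have "\<bar>(\<integral>\<xi>. (avg ^^ N) F \<xi> * (avg ^^ N) G \<xi> \<partial>S) - (\<integral>\<xi>. (avg ^^ Suc N) F \<xi> * (avg ^^ Suc N) G \<xi> \<partial>S)\<bar> \<le> a N * b N"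
    using covariance_avg_step[OF bmeas_avg_pow[OF F, of N] bmeas_avg_pow[OF G, of N] influence_avg_pow[OF F] influence_avg_pow[OF G], of "a N" "b N"] a b
    by simp
  then show ?case using Suc by simp
qed simp

lemma covariance_bounded:
  assumes F: "bmeas F" and G: "bmeas G" and a: "\<And>k. influence 2 F k (a k)" and b: "\<And>k. influence 2 G k (b k)"
    and c: "\<And>N. (\<Sum>k<N. a k * b k) \<le> c"
  shows "\<bar>(\<integral>\<xi>. F \<xi> * G \<xi> \<partial>S) - (\<integral>\<xi>. F \<xi> \<partial>S) * (\<integral>\<xi>. G \<xi> \<partial>S)\<bar> \<le> c"
proof -
  obtain B where B: "B \<ge> 0" "\<And>\<xi>. \<xi> \<in> space S \<Longrightarrow> \<bar>G \<xi>\<bar> \<le> B" by (rule bmeasE[OF G]) blast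
  let ?EF = "\<integral>\<xi>. F \<xi> \<partial>S" and ?EG = "\<integral>\<xi>. G \<xi> \<partial>S"
  have le: "\<bar>(\<integral>\<xi>. F \<xi> * G \<xi> \<partial>S) - ?EF * ?EG\<bar> \<le> c + B * dev N F" for N
  proof -
    note bF = bmeas_avg_pow[OF F, of N] and bG = bmeas_avg_pow[OF G, of N]
    have "\<bar>(\<integral>\<xi>. (avg ^^ N) F \<xi> * (avg ^^ N) G \<xi> \<partial>S) - ?EF * ?EG\<bar> = \<bar>\<integral>\<xi>. ((avg ^^ N) F \<xi> - ?EF) * (avg ^^ N) G \<xi> \<partial>S\<bar>"
      using bmeas_integrable[OF bmeas_mult[OF bF bG]] bmeas_integrable[OF bG] integral_avg_pow[OF G, of N]
      by (simp add: left_diff_distrib)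
    also have "\<dots> \<le> (\<integral>\<xi>. \<bar>((avg ^^ N) F \<xi> - ?EF) * (avg ^^ N) G \<xi>\<bar> \<partial>S)"
      by (rule integral_abs_bound)
    also have "\<dots> \<le> (\<integral>\<xi>. B * \<bar>(avg ^^ N) F \<xi> - ?EF\<bar> \<partial>S)"
    proof (rule integral_mono)
      show "integrable S (\<lambda>\<xi>. \<bar>((avg ^^ N) F \<xi> - ?EF) * (avg ^^ N) G \<xi>\<bar>)"
        by (intro integrable_abs bmeas_integrable bmeas_mult bmeas_diff bF bG bmeas_const)
      show "integrable S (\<lambda>\<xi>. B * \<bar>(avg ^^ N) F \<xi> - ?EF\<bar>)"
        by (intro integrable_mult_right integrable_abs bmeas_integrable bmeas_diff bF bmeas_const)
      fix \<xi> assume w: "\<xi> \<in> space S"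
      have "\<bar>(avg ^^ N) F \<xi> - ?EF\<bar> * \<bar>(avg ^^ N) G \<xi>\<bar> \<le> \<bar>(avg ^^ N) F \<xi> - ?EF\<bar> * B"
        by (intro mult_left_mono avg_pow_bound[OF G B(2) w]) auto
      then show "\<bar>((avg ^^ N) F \<xi> - ?EF) * (avg ^^ N) G \<xi>\<bar> \<le> B * \<bar>(avg ^^ N) F \<xi> - ?EF\<bar>"
        by (simp add: abs_mult mult.commute)
    qed
    also have "\<dots> = B * dev N F" by (simp add: dev_def)
    finally show ?thesis using covariance_avg_pow[OF F G a b, of N] c[of N] by linarith
  qed
  have "(\<lambda>N. c + B * dev N F) \<longlonglongrightarrow> c + B * 0"
    by (intro tendsto_intros dev_tendsto_0[OF F])
  then show ?thesis using le by (intro tendsto_lowerbound[of "\<lambda>N. c + B * dev N F" _ sequentially]) auto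
qed

text \<open>The fourth moment loses its cubic cross term because the residual averages to zero; what
  remains is absorbed into a complete square.\<close>

lemma fourth_moment_avg_step:
  assumes F: "bmeas F" and a: "influence 4 F 0 a"
    and r: "0 \<le> r" "(\<integral>\<xi>. (avg F \<xi> - m) ^ 4 \<partial>S) \<le> r\<^sup>2"
  shows "(\<integral>\<xi>. (F \<xi> - m) ^ 4 \<partial>S) \<le> (r + 4 * a\<^sup>2)\<^sup>2"
proof -
  let ?V = "\<lambda>z. avg F (snd z) - m" and ?A = "\<lambda>(s, \<xi>). F (case_nat s \<xi>) - avg F \<xi>"
  note [measurable] = bmeas_measurable[OF F] bmeas_measurable[OF bmeas_avg[OF F]]
  have A4: "Lp_le (M \<Otimes>\<^sub>M S) 4 ?A a" by (rule influence_residual[OF F a]) simp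
  have V4: "Lp_le (M \<Otimes>\<^sub>M S) 4 ?V (sqrt r)"
  proof -
    have i: "integrable S (\<lambda>\<xi>. (avg F \<xi> - m) ^ 4)"
      using bmeas_integrable[OF bmeas_mult[OF bmeas_mult bmeas_mult]] bmeas_diff[OF bmeas_avg[OF F] bmeas_const]
      by (simp add: power4_eq_xxxx mult.assoc)
    have "(\<integral>\<^sup>+z. ennreal (\<bar>?V z\<bar> ^ 4) \<partial>(M \<Otimes>\<^sub>M S)) = (\<integral>\<^sup>+\<xi>. ennreal ((avg F \<xi> - m) ^ 4) \<partial>S)"
      by (subst MS.nn_integral_snd[symmetric]) (auto simp: M.emeasure_space_1 power_even_abs)
    also have "\<dots> = ennreal (\<integral>\<xi>. (avg F \<xi> - m) ^ 4 \<partial>S)"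
      using i by (intro nn_integral_eq_integral) (auto simp: zero_le_even_power)
    also have "\<dots> \<le> ennreal (sqrt r ^ 4)"
      using r by (intro ennreal_leI) (simp add: power4_eq_xxxx power2_eq_square mult.assoc)
    finally show ?thesis using r by (simp add: Lp_le_def)
  qed
  have VA2: "Lp_le (M \<Otimes>\<^sub>M S) 2 (\<lambda>z. ?V z * ?A z) (sqrt r * a)"
    using Lp_le_mult[of "M \<Otimes>\<^sub>M S" 2 ?V "sqrt r" ?A a] V4 A4 by simp
  have bm: "bmeas (\<lambda>\<xi>. (F \<xi> - m) ^ 4)" "bmeas (\<lambda>\<xi>. (avg F \<xi> - m) ^ 3)"
    using bmeas_mult[OF bmeas_mult bmeas_mult, of "\<lambda>\<xi>. F \<xi> - m" "\<lambda>\<xi>. F \<xi> - m" "\<lambda>\<xi>. F \<xi> - m" "\<lambda>\<xi>. F \<xi> - m"]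
       bmeas_mult[OF bmeas_mult, of "\<lambda>\<xi>. avg F \<xi> - m" "\<lambda>\<xi>. avg F \<xi> - m" "\<lambda>\<xi>. avg F \<xi> - m"]
       bmeas_diff[OF F bmeas_const[of m]] bmeas_diff[OF bmeas_avg[OF F] bmeas_const[of m]]
    by (simp_all add: power4_eq_xxxx power3_eq_cube mult.assoc)
  have iV3A: "integrable (M \<Otimes>\<^sub>M S) (\<lambda>z. ?V z ^ 3 * ?A z)"
  proof -
    obtain B where B: "B \<ge> 0" "\<And>\<xi>. \<xi> \<in> space S \<Longrightarrow> \<bar>F \<xi>\<bar> \<le> B" by (rule bmeasE[OF F]) blast
    obtain C where C: "C \<ge> 0" "\<And>\<xi>. \<xi> \<in> space S \<Longrightarrow> \<bar>(avg F \<xi> - m) ^ 3\<bar> \<le> C" by (rule bmeasE[OF bm(2)]) blast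
    show ?thesis
    proof (rule MS.P.integrable_const_bound[where B="C * (2 * B)"])
      show "AE z in M \<Otimes>\<^sub>M S. norm (?V z ^ 3 * ?A z) \<le> C * (2 * B)"
      proof (rule AE_I2)
        fix z assume "z \<in> space (M \<Otimes>\<^sub>M S)"
        then have z: "snd z \<in> space S" "fst z \<in> space M" by (auto simp: space_pair_measure)
        have "\<bar>?A z\<bar> \<le> 2 * B"
          using B(2)[OF case_nat_in_space[OF z]] avg_bound[OF F B(2) z(1)] by (simp add: split_beta')
        then show "norm (?V z ^ 3 * ?A z) \<le> C * (2 * B)"
          unfolding real_norm_def abs_mult using C(2)[OF z(1)] C(1) by (intro mult_mono) auto
      qed
      show "(\<lambda>z. ?V z ^ 3 * ?A z) \<in> borel_measurable (M \<Otimes>\<^sub>M S)" by (simp add: split_beta')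
    qed
  qed
  have V3A0: "(\<integral>z. ?V z ^ 3 * ?A z \<partial>(M \<Otimes>\<^sub>M S)) = 0"
  proof -
    have i: "integrable (M \<Otimes>\<^sub>M S) (case_prod (\<lambda>s \<xi>. (avg F \<xi> - m) ^ 3 * (F (case_nat s \<xi>) - avg F \<xi>)))"
      using iV3A by (simp add: split_beta')
    have "(\<integral>z. ?V z ^ 3 * ?A z \<partial>(M \<Otimes>\<^sub>M S))
       = (\<integral>\<xi>. (\<integral>s. (avg F \<xi> - m) ^ 3 * (F (case_nat s \<xi>) - avg F \<xi>) \<partial>M) \<partial>S)"
      using MS.integral_snd[OF i] by (simp add: split_beta')
    also have "\<dots> = (\<integral>\<xi>. 0 \<partial>S)"
    proof (rule Bochner_Integration.integral_cong[OF refl])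
      fix \<xi> assume w: "\<xi> \<in> space S"
      show "(\<integral>s. (avg F \<xi> - m) ^ 3 * (F (case_nat s \<xi>) - avg F \<xi>) \<partial>M) = 0"
        using bmeas_section(2)[OF F w] by (simp add: M.prob_space avg_def[symmetric])
    qed
    finally show ?thesis by simp
  qed
  have "(\<integral>\<xi>. (F \<xi> - m) ^ 4 \<partial>S) = (\<integral>z. (F (case_nat (fst z) (snd z)) - m) ^ 4 \<partial>(M \<Otimes>\<^sub>M S))"
    using integral_iter[OF bm(1)] MS.integral_snd[of "\<lambda>s \<xi>. (F (case_nat s \<xi>) - m) ^ 4"] bmeas_pair[OF bm(1)]
    by (simp add: split_beta')
  also have "\<dots> \<le> (\<integral>z. \<bar>?V z\<bar> ^ 4 + 4 * (?V z ^ 3 * ?A z) + 8 * \<bar>?V z * ?A z\<bar> ^ 2 + 3 * \<bar>?A z\<bar> ^ 4 \<partial>(M \<Otimes>\<^sub>M S))"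
  proof (rule integral_mono)
    show "integrable (M \<Otimes>\<^sub>M S) (\<lambda>z. (F (case_nat (fst z) (snd z)) - m) ^ 4)" by (rule bmeas_pair[OF bm(1)])
    show "integrable (M \<Otimes>\<^sub>M S) (\<lambda>z. \<bar>?V z\<bar> ^ 4 + 4 * (?V z ^ 3 * ?A z) + 8 * \<bar>?V z * ?A z\<bar> ^ 2 + 3 * \<bar>?A z\<bar> ^ 4)"
      using iV3A Lp_le_integral(1)[OF V4] Lp_le_integral(1)[OF A4] Lp_le_integral(1)[OF VA2]
      by (intro Bochner_Integration.integrable_add integrable_mult_right)
    fix z
    have alg: "(v + u) ^ 4 \<le> \<bar>v\<bar> ^ 4 + 4 * (v ^ 3 * u) + 8 * \<bar>v * u\<bar> ^ 2 + 3 * \<bar>u\<bar> ^ 4" for u v :: real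
    proof -
      have "\<bar>v\<bar> ^ 4 + 4 * (v ^ 3 * u) + 8 * \<bar>v * u\<bar> ^ 2 + 3 * \<bar>u\<bar> ^ 4 - (v + u) ^ 4 = 2 * (u * (v - u))\<^sup>2"
        by (simp add: power_even_abs) (simp add: power4_eq_xxxx power3_eq_cube power2_eq_square algebra_simps)
      then show ?thesis by (smt (verit) zero_le_power2)
    qed
    show "(F (case_nat (fst z) (snd z)) - m) ^ 4 \<le> \<bar>?V z\<bar> ^ 4 + 4 * (?V z ^ 3 * ?A z) + 8 * \<bar>?V z * ?A z\<bar> ^ 2 + 3 * \<bar>?A z\<bar> ^ 4"
      using alg[of "?V z" "?A z"] by (simp add: split_beta')
  qed
  also have "\<dots> = (\<integral>z. \<bar>?V z\<bar> ^ 4 \<partial>(M \<Otimes>\<^sub>M S)) + 8 * (\<integral>z. \<bar>?V z * ?A z\<bar> ^ 2 \<partial>(M \<Otimes>\<^sub>M S)) + 3 * (\<integral>z. \<bar>?A z\<bar> ^ 4 \<partial>(M \<Otimes>\<^sub>M S))"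
    using iV3A V3A0 Lp_le_integral(1)[OF V4] Lp_le_integral(1)[OF A4] Lp_le_integral(1)[OF VA2]
    by (simp del: power_abs)
  also have "\<dots> \<le> sqrt r ^ 4 + 8 * (sqrt r * a)\<^sup>2 + 3 * a ^ 4"
    using Lp_le_integral(2)[OF V4] Lp_le_integral(2)[OF A4] Lp_le_integral(2)[OF VA2] by linarith
  also have "\<dots> \<le> (r + 4 * a\<^sup>2)\<^sup>2"
  proof -
    have "sqrt r ^ 4 = r\<^sup>2" "(sqrt r * a)\<^sup>2 = r * a\<^sup>2"
      using r(1) by (simp_all add: power4_eq_xxxx power2_eq_square mult.assoc power_mult_distrib)
    moreover have "(r + 4 * a\<^sup>2)\<^sup>2 = r\<^sup>2 + 8 * (r * a\<^sup>2) + 16 * a ^ 4" by algebra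
    moreover have "0 \<le> a ^ 4" by (simp add: zero_le_even_power)
    ultimately show ?thesis by linarith
  qed
  finally show ?thesis .
qed

lemma fourth_moment_avg_pow:
  assumes F: "bmeas F" and a: "\<And>k. influence 4 F k (a k)"
    and r: "0 \<le> r" "(\<integral>\<xi>. ((avg ^^ N) F \<xi> - m) ^ 4 \<partial>S) \<le> r\<^sup>2"
  shows "(\<integral>\<xi>. (F \<xi> - m) ^ 4 \<partial>S) \<le> (r + 4 * (\<Sum>k<N. (a k)\<^sup>2))\<^sup>2"
  using r
proof (induction N arbitrary: r)
  case (Suc N)
  have "(\<integral>\<xi>. ((avg ^^ N) F \<xi> - m) ^ 4 \<partial>S) \<le> (r + 4 * (a N)\<^sup>2)\<^sup>2"
    using Suc.prems influence_avg_pow[OF F, of 4 0 N "a N"] a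
    by (intro fourth_moment_avg_step[OF bmeas_avg_pow[OF F]]) auto
  from Suc.IH[OF _ this] Suc.prems(1) show ?case by (simp add: algebra_simps)
qed simp

lemma fourth_moment_bounded:
  assumes F: "bmeas F" and a: "\<And>k. influence 4 F k (a k)" and c: "\<And>N. (\<Sum>k<N. (a k)\<^sup>2) \<le> c"
  shows "(\<integral>\<xi>. (F \<xi> - (\<integral>\<xi>. F \<xi> \<partial>S)) ^ 4 \<partial>S) \<le> (4 * c)\<^sup>2"
proof -
  let ?m = "\<integral>\<xi>. F \<xi> \<partial>S"
  obtain B where B: "B \<ge> 0" "\<And>\<xi>. \<xi> \<in> space S \<Longrightarrow> \<bar>F \<xi>\<bar> \<le> B" by (rule bmeasE[OF F]) blast
  have mB: "\<bar>?m\<bar> \<le> B"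
  proof -
    have "\<bar>?m\<bar> \<le> (\<integral>\<xi>. \<bar>F \<xi>\<bar> \<partial>S)" by (rule integral_abs_bound)
    also have "\<dots> \<le> (\<integral>\<xi>. B \<partial>S)"
      using B by (intro integral_mono integrable_abs bmeas_integrable[OF F]) auto
    finally show ?thesis by (simp add: P.prob_space)
  qed
  have le: "(\<integral>\<xi>. (F \<xi> - ?m) ^ 4 \<partial>S) \<le> (sqrt ((2 * B) ^ 3 * dev N F) + 4 * c)\<^sup>2" for N
  proof -
    let ?r = "sqrt ((2 * B) ^ 3 * dev N F)"
    note bF = bmeas_avg_pow[OF F, of N]
    note bd = bmeas_diff[OF bF bmeas_const[of ?m]]
    have "(\<integral>\<xi>. ((avg ^^ N) F \<xi> - ?m) ^ 4 \<partial>S) \<le> (\<integral>\<xi>. (2 * B) ^ 3 * \<bar>(avg ^^ N) F \<xi> - ?m\<bar> \<partial>S)"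
    proof (rule integral_mono)
      show "integrable S (\<lambda>\<xi>. ((avg ^^ N) F \<xi> - ?m) ^ 4)"
        using bmeas_integrable[OF bmeas_mult[OF bmeas_mult[OF bd bd] bmeas_mult[OF bd bd]]]
        by (simp add: power4_eq_xxxx mult.assoc)
      show "integrable S (\<lambda>\<xi>. (2 * B) ^ 3 * \<bar>(avg ^^ N) F \<xi> - ?m\<bar>)"
        by (intro integrable_mult_right integrable_abs bmeas_integrable bd)
      fix \<xi> assume w: "\<xi> \<in> space S"
      let ?d = "\<bar>(avg ^^ N) F \<xi> - ?m\<bar>"
      have "?d \<le> 2 * B" using avg_pow_bound[OF F B(2) w, of N] mB by linarith
      then have "?d ^ 3 * ?d \<le> (2 * B) ^ 3 * ?d" by (intro mult_right_mono power_mono) auto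
      moreover have "x ^ 4 = \<bar>x\<bar> ^ 3 * \<bar>x\<bar>" for x :: real
        by (cases "x \<ge> 0") (simp_all add: power4_eq_xxxx power3_eq_cube)
      ultimately show "((avg ^^ N) F \<xi> - ?m) ^ 4 \<le> (2 * B) ^ 3 * ?d" by simp
    qed
    also have "\<dots> = ?r\<^sup>2" using B(1) dev_nonneg[of N F] by (simp add: dev_def)
    finally have "(\<integral>\<xi>. (F \<xi> - ?m) ^ 4 \<partial>S) \<le> (?r + 4 * (\<Sum>k<N. (a k)\<^sup>2))\<^sup>2"
      using B(1) dev_nonneg[of N F] by (intro fourth_moment_avg_pow[OF F a]) auto
    also have "\<dots> \<le> (?r + 4 * c)\<^sup>2"
      using c[of N] B(1) dev_nonneg[of N F] by (intro power_mono) (auto intro!: add_nonneg_nonneg sum_nonneg)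
    finally show ?thesis .
  qed
  have "(\<lambda>N. (sqrt ((2 * B) ^ 3 * dev N F) + 4 * c)\<^sup>2) \<longlonglongrightarrow> (sqrt ((2 * B) ^ 3 * 0) + 4 * c)\<^sup>2"
    by (intro tendsto_intros dev_tendsto_0[OF F])
  then have "(\<lambda>N. (sqrt ((2 * B) ^ 3 * dev N F) + 4 * c)\<^sup>2) \<longlonglongrightarrow> (4 * c)\<^sup>2" by simp
  then show ?thesis using le by (intro tendsto_lowerbound[of "\<lambda>N. (sqrt ((2 * B) ^ 3 * dev N F) + 4 * c)\<^sup>2" _ sequentially]) auto
qed

end

text \<open>Clipping is a contraction, so it does not increase influences.\<close>

definition clip :: "real \<Rightarrow> real \<Rightarrow> real" where
  "clip t x = max (- t) (min t x)"

lemma clip_bound: "0 \<le> t \<Longrightarrow> \<bar>clip t x\<bar> \<le> t" by (auto simp: clip_def)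
lemma clip_le: "0 \<le> t \<Longrightarrow> \<bar>clip t x\<bar> \<le> \<bar>x\<bar>" by (auto simp: clip_def)
lemma clip_lipschitz: "\<bar>clip t x - clip t y\<bar> \<le> \<bar>x - y\<bar>" by (auto simp: clip_def)
lemma clip_id: "\<bar>x\<bar> \<le> t \<Longrightarrow> clip t x = x" by (auto simp: clip_def)
lemma clip_measurable[measurable]: "clip t \<in> borel_measurable borel" unfolding clip_def[abs_def] by measurable

lemma clip_tendsto: "(\<lambda>n. clip (real n) x) \<longlonglongrightarrow> x"
proof (rule Lim_transform_eventually[OF tendsto_const])
  have "\<forall>\<^sub>F n in sequentially. \<bar>x\<bar> \<le> real n" by (rule eventually_ge_at_top[THEN filterlim_real_sequentially[THEN filterlim_iff[THEN iffD1, rule_format]]])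
  then show "\<forall>\<^sub>F n in sequentially. x = clip (real n) x" by eventually_elim (simp add: clip_id)
qed

lemma Lp_le_pointwise_limit:
  assumes lim: "\<And>x. x \<in> space Q \<Longrightarrow> (\<lambda>n. f n x) \<longlonglongrightarrow> g x" and g: "g \<in> borel_measurable Q"
    and le: "\<And>n. Lp_le Q q (f n) a"
  shows "Lp_le Q q g a"
proof -
  have [measurable]: "f n \<in> borel_measurable Q" for n using le by (auto dest: Lp_leD)
  have "(\<integral>\<^sup>+x. ennreal (\<bar>g x\<bar> ^ q) \<partial>Q) = (\<integral>\<^sup>+x. liminf (\<lambda>n. ennreal (\<bar>f n x\<bar> ^ q)) \<partial>Q)"
  proof (rule nn_integral_cong)
    fix x assume x: "x \<in> space Q"
    have "(\<lambda>n. ennreal (\<bar>f n x\<bar> ^ q)) \<longlonglongrightarrow> ennreal (\<bar>g x\<bar> ^ q)"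
      by (intro tendsto_ennrealI tendsto_power tendsto_rabs lim x)
    then show "ennreal (\<bar>g x\<bar> ^ q) = liminf (\<lambda>n. ennreal (\<bar>f n x\<bar> ^ q))"
      by (rule lim_imp_Liminf[OF sequentially_bot, symmetric])
  qed
  also have "\<dots> \<le> liminf (\<lambda>n. \<integral>\<^sup>+x. ennreal (\<bar>f n x\<bar> ^ q) \<partial>Q)"
    by (rule nn_integral_liminf) measurable
  also have "\<dots> \<le> liminf (\<lambda>n. ennreal (a ^ q))"
    using Lp_leD(3)[OF le] by (intro Liminf_mono always_eventually allI)
  also have "\<dots> = ennreal (a ^ q)" by (rule Liminf_const[OF sequentially_bot])
  finally show ?thesis using g Lp_leD(2)[OF le] by (simp add: Lp_le_def)
qed

context sequence_space
begin

lemma influence_measurable: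
  fixes F :: "_ \<Rightarrow> real"
  assumes F[measurable]: "F \<in> borel_measurable S"
  shows "(\<lambda>(s, \<xi>). F \<xi> - F ((\<xi>)(k := s))) \<in> borel_measurable (M \<Otimes>\<^sub>M S)"
proof -
  have "(\<lambda>z. F (snd z) - F ((snd z)(k := fst z))) \<in> borel_measurable (M \<Otimes>\<^sub>M S)"
    using measurable_compose[OF measurable_upd[of k] F]
    by (intro borel_measurable_diff) (simp_all add: split_beta')
  then show ?thesis by (simp add: split_beta')
qed

lemma influence_clip:
  assumes F: "F \<in> borel_measurable S" and i: "influence q F k a"
  shows "influence q (\<lambda>\<xi>. clip t (F \<xi>)) k a"
  unfolding influence_def
proof (rule Lp_le_dominated[OF i[unfolded influence_def]])
  show "(\<lambda>(s, \<xi>). clip t (F \<xi>) - clip t (F ((\<xi>)(k := s)))) \<in> borel_measurable (M \<Otimes>\<^sub>M S)"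
    by (intro influence_measurable measurable_compose[OF F clip_measurable])
qed (auto simp: clip_lipschitz split: prod.split)

lemma bmeas_clip: "F \<in> borel_measurable S \<Longrightarrow> bmeas (\<lambda>\<xi>. clip (real n) (F \<xi>))"
  by (rule bmeasI[of _ "real n"]) (auto simp: clip_bound)

lemma integral_clip_tendsto:
  assumes F: "integrable S F" shows "(\<lambda>n. \<integral>\<xi>. clip (real n) (F \<xi>) \<partial>S) \<longlonglongrightarrow> (\<integral>\<xi>. F \<xi> \<partial>S)"
proof (rule integral_dominated_convergence[where w="\<lambda>\<xi>. \<bar>F \<xi>\<bar>"])
  show "AE x in S. (\<lambda>n. clip (real n) (F x)) \<longlonglongrightarrow> F x" by (simp add: clip_tendsto)
  show "AE x in S. norm (clip (real n) (F x)) \<le> \<bar>F x\<bar>" for n by (simp add: clip_le)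
qed (use F in auto)

text \<open>Bounds for the clipped functions survive in the limit by Fatou's lemma.\<close>

lemma Lp_le_centered_clip_limit:
  assumes F: "integrable S F"
    and le: "\<And>n. Lp_le S q (\<lambda>\<xi>. clip (real n) (F \<xi>) - (\<integral>\<xi>. clip (real n) (F \<xi>) \<partial>S)) a"
  shows "Lp_le S q (\<lambda>\<xi>. F \<xi> - (\<integral>\<xi>. F \<xi> \<partial>S)) a"
  by (rule Lp_le_pointwise_limit[OF _ _ le])
     (use F in \<open>auto intro!: tendsto_diff clip_tendsto integral_clip_tendsto\<close>)

text \<open>The Efron-Stein inequality: the one-step bounds telescope over the coordinates, and the zero-one
  law removes the remainder.\<close>

theorem variance_le_influences:
  assumes F: "integrable S F" and a: "\<And>k. influence 2 F k (a k)" and c: "\<And>N. (\<Sum>k<N. (a k)\<^sup>2) \<le> c"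
  shows "Lp_le S 2 (\<lambda>\<xi>. F \<xi> - (\<integral>\<xi>. F \<xi> \<partial>S)) (sqrt c)"
proof (rule Lp_le_centered_clip_limit[OF F])
  fix n
  let ?f = "\<lambda>\<xi>. clip (real n) (F \<xi>)"
  have Fm: "F \<in> borel_measurable S" using F by auto
  have c0: "0 \<le> c" using c[of 0] by simp
  have b: "bmeas ?f" by (rule bmeas_clip[OF Fm])
  note bd = bmeas_diff[OF b bmeas_const[of "\<integral>\<xi>. ?f \<xi> \<partial>S"]]
  have "\<bar>(\<integral>\<xi>. ?f \<xi> * ?f \<xi> \<partial>S) - (\<integral>\<xi>. ?f \<xi> \<partial>S) * (\<integral>\<xi>. ?f \<xi> \<partial>S)\<bar> \<le> c"
    using c by (intro covariance_bounded[OF b b, of a a] influence_clip[OF Fm a]) (simp add: power2_eq_square)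
  moreover have "(\<integral>\<xi>. (?f \<xi> - (\<integral>\<xi>. ?f \<xi> \<partial>S))\<^sup>2 \<partial>S) = (\<integral>\<xi>. ?f \<xi> * ?f \<xi> \<partial>S) - (\<integral>\<xi>. ?f \<xi> \<partial>S) * (\<integral>\<xi>. ?f \<xi> \<partial>S)"
    using P.variance_eq[OF bmeas_integrable[OF b]] bmeas_integrable[OF bmeas_mult[OF b b]] by (simp add: power2_eq_square)
  ultimately have le: "(\<integral>\<xi>. (?f \<xi> - (\<integral>\<xi>. ?f \<xi> \<partial>S))\<^sup>2 \<partial>S) \<le> c" by simp
  have i: "integrable S (\<lambda>\<xi>. (?f \<xi> - (\<integral>\<xi>. ?f \<xi> \<partial>S))\<^sup>2)"
    using bmeas_integrable[OF bmeas_mult[OF bd bd]] by (simp add: power2_eq_square)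
  show "Lp_le S 2 (\<lambda>\<xi>. ?f \<xi> - (\<integral>\<xi>. ?f \<xi> \<partial>S)) (sqrt c)"
    using le i c0 bmeas_measurable[OF bd] by (subst Lp_le_iff_integral) auto
qed

theorem fourth_moment_le_influences:
  assumes F: "integrable S F" and a: "\<And>k. influence 4 F k (a k)" and c: "\<And>N. (\<Sum>k<N. (a k)\<^sup>2) \<le> c"
  shows "Lp_le S 4 (\<lambda>\<xi>. F \<xi> - (\<integral>\<xi>. F \<xi> \<partial>S)) (2 * sqrt c)"
proof (rule Lp_le_centered_clip_limit[OF F])
  fix n
  let ?f = "\<lambda>\<xi>. clip (real n) (F \<xi>)"
  have Fm: "F \<in> borel_measurable S" using F by auto
  have c0: "0 \<le> c" using c[of 0] by simp
  have b: "bmeas ?f" by (rule bmeas_clip[OF Fm])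
  note bd = bmeas_diff[OF b bmeas_const[of "\<integral>\<xi>. ?f \<xi> \<partial>S"]]
  have le: "(\<integral>\<xi>. (?f \<xi> - (\<integral>\<xi>. ?f \<xi> \<partial>S)) ^ 4 \<partial>S) \<le> (4 * c)\<^sup>2"
    by (rule fourth_moment_bounded[OF b influence_clip[OF Fm a] c])
  have i: "integrable S (\<lambda>\<xi>. (?f \<xi> - (\<integral>\<xi>. ?f \<xi> \<partial>S)) ^ 4)"
    using bmeas_integrable[OF bmeas_mult[OF bmeas_mult[OF bd bd] bmeas_mult[OF bd bd]]]
    by (simp add: power4_eq_xxxx mult.assoc)
  have "(2 * sqrt c) ^ 4 = (4 * c)\<^sup>2"
    using c0 by (simp add: power4_eq_xxxx power2_eq_square mult.assoc)
  then show "Lp_le S 4 (\<lambda>\<xi>. ?f \<xi> - (\<integral>\<xi>. ?f \<xi> \<partial>S)) (2 * sqrt c)"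
    using le i c0 bmeas_measurable[OF bd] by (subst Lp_le_iff_integral) (auto simp: power_even_abs)
qed

text \<open>Keeping the two sequences of influences separate is what makes covariances along an array
  summable: two distant variables share no large influence.\<close>

theorem covariance_le_influences:
  assumes F: "Lp_le S 2 F u" and G: "Lp_le S 2 G v"
    and a: "\<And>k. influence 2 F k (a k)" and b: "\<And>k. influence 2 G k (b k)"
    and c: "\<And>N. (\<Sum>k<N. a k * b k) \<le> c"
  shows "\<bar>(\<integral>\<xi>. F \<xi> * G \<xi> \<partial>S) - (\<integral>\<xi>. F \<xi> \<partial>S) * (\<integral>\<xi>. G \<xi> \<partial>S)\<bar> \<le> c"
proof -
  have Fi: "integrable S F" and Gi: "integrable S G"
    using P.Lp_le_2_1[OF F] P.Lp_le_2_1[OF G] Lp_le_1(1) by auto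
  have FGi: "integrable S (\<lambda>\<xi>. F \<xi> * G \<xi>)" using Lp_le_mult[of S 1] F G Lp_le_1(1) by fastforce
  note [measurable] = Lp_leD(1)[OF F] Lp_leD(1)[OF G]
  have le: "\<bar>(\<integral>\<xi>. clip (real n) (F \<xi>) * clip (real n) (G \<xi>) \<partial>S) - (\<integral>\<xi>. clip (real n) (F \<xi>) \<partial>S) * (\<integral>\<xi>. clip (real n) (G \<xi>) \<partial>S)\<bar> \<le> c" for n
    by (intro covariance_bounded[OF _ _ _ _ c] bmeas_clip influence_clip a b) measurable
  have "(\<lambda>n. \<integral>\<xi>. clip (real n) (F \<xi>) * clip (real n) (G \<xi>) \<partial>S) \<longlonglongrightarrow> (\<integral>\<xi>. F \<xi> * G \<xi> \<partial>S)"
  proof (rule integral_dominated_convergence[where w="\<lambda>\<xi>. \<bar>F \<xi> * G \<xi>\<bar>"])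
    show "AE x in S. (\<lambda>n. clip (real n) (F x) * clip (real n) (G x)) \<longlonglongrightarrow> F x * G x"
      by (intro AE_I2 tendsto_mult clip_tendsto)
    show "AE x in S. norm (clip (real n) (F x) * clip (real n) (G x)) \<le> \<bar>F x * G x\<bar>" for n
      by (auto simp: abs_mult intro!: mult_mono clip_le)
  qed (use FGi in auto)
  then have "(\<lambda>n. \<bar>(\<integral>\<xi>. clip (real n) (F \<xi>) * clip (real n) (G \<xi>) \<partial>S) - (\<integral>\<xi>. clip (real n) (F \<xi>) \<partial>S) * (\<integral>\<xi>. clip (real n) (G \<xi>) \<partial>S)\<bar>)
     \<longlonglongrightarrow> \<bar>(\<integral>\<xi>. F \<xi> * G \<xi> \<partial>S) - (\<integral>\<xi>. F \<xi> \<partial>S) * (\<integral>\<xi>. G \<xi> \<partial>S)\<bar>"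
    by (intro tendsto_rabs tendsto_diff tendsto_mult integral_clip_tendsto Fi Gi)
  then show ?thesis by (rule tendsto_upperbound) (auto simp: le)
qed

end

section \<open>Linear and quadratic statistics of weakly dependent arrays\<close>

lemma Lp_le_mult_4_2: "Lp_le Q 4 f a \<Longrightarrow> Lp_le Q 4 g b \<Longrightarrow> Lp_le Q 2 (\<lambda>x. f x * g x) (a * b)"
  using Lp_le_mult[of Q 2 f a g b] by simp

lemma Lp_le_mult_2_1: "Lp_le Q 2 f a \<Longrightarrow> Lp_le Q 2 g b \<Longrightarrow> Lp_le Q 1 (\<lambda>x. f x * g x) (a * b)"
  using Lp_le_mult[of Q 1 f a g b] by simp

text \<open>The hypotheses of Schur's test for the matrix \<open>w\<close>. Here \<open>w i k\<close> bounds the influence of coordinate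
  \<open>k\<close> on the \<open>i\<close>-th variable of an array: each variable has summable influences, and each coordinate
  has summable effects.\<close>

definition schur_weights :: "nat \<Rightarrow> (nat \<Rightarrow> nat \<Rightarrow> real) \<Rightarrow> real \<Rightarrow> bool" where
  "schur_weights n w \<Theta> \<longleftrightarrow> 0 \<le> \<Theta> \<and> (\<forall>i k. 0 \<le> w i k) \<and>
     (\<forall>i\<in>{1..n}. \<forall>N. (\<Sum>k<N. w i k) \<le> \<Theta>) \<and> (\<forall>k. (\<Sum>i=1..n. w i k) \<le> \<Theta>)"

text \<open>Schur's test, by Cauchy-Schwarz with the weights \<open>w i k\<close>.\<close>

lemma schur_weights_square_sum:
  assumes w: "schur_weights n w \<Theta>"
  shows "(\<Sum>k<N. (\<Sum>i=1..n. \<bar>c i\<bar> * w i k)\<^sup>2) \<le> \<Theta>\<^sup>2 * (\<Sum>i=1..n. (c i)\<^sup>2)"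
proof -
  have w0: "0 \<le> w i k" and \<Theta>: "0 \<le> \<Theta>" for i k using w by (auto simp: schur_weights_def)
  have "(\<Sum>i=1..n. \<bar>c i\<bar> * w i k)\<^sup>2 \<le> \<Theta> * (\<Sum>i=1..n. (c i)\<^sup>2 * w i k)" for k
  proof -
    have "(\<Sum>i=1..n. \<bar>c i\<bar> * w i k)\<^sup>2 = (\<Sum>i=1..n. sqrt (w i k) * (\<bar>c i\<bar> * sqrt (w i k)))\<^sup>2"
      using w0 by (simp add: mult.left_commute)
    also have "\<dots> \<le> (\<Sum>i=1..n. (sqrt (w i k))\<^sup>2) * (\<Sum>i=1..n. (\<bar>c i\<bar> * sqrt (w i k))\<^sup>2)"
      by (rule Cauchy_Schwarz_ineq_sum)
    also have "\<dots> = (\<Sum>i=1..n. w i k) * (\<Sum>i=1..n. (c i)\<^sup>2 * w i k)"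
      using w0 by (simp add: power_mult_distrib)
    also have "\<dots> \<le> \<Theta> * (\<Sum>i=1..n. (c i)\<^sup>2 * w i k)"
      using w w0 by (intro mult_right_mono sum_nonneg) (auto simp: schur_weights_def)
    finally show ?thesis .
  qed
  then have "(\<Sum>k<N. (\<Sum>i=1..n. \<bar>c i\<bar> * w i k)\<^sup>2) \<le> (\<Sum>k<N. \<Theta> * (\<Sum>i=1..n. (c i)\<^sup>2 * w i k))"
    by (intro sum_mono)
  also have "\<dots> = \<Theta> * (\<Sum>i=1..n. (c i)\<^sup>2 * (\<Sum>k<N. w i k))"
    unfolding sum_distrib_left by (rule sum.swap)
  also have "\<dots> \<le> \<Theta> * (\<Sum>i=1..n. (c i)\<^sup>2 * \<Theta>)"
    using w \<Theta> by (intro mult_left_mono sum_mono) (auto simp: schur_weights_def)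
  also have "\<dots> = \<Theta>\<^sup>2 * (\<Sum>i=1..n. (c i)\<^sup>2)"
    by (simp add: sum_distrib_left[symmetric] sum_distrib_right[symmetric] power2_eq_square)
  finally show ?thesis .
qed

context sequence_space
begin

lemma distr_upd: "distr (M \<Otimes>\<^sub>M S) S (\<lambda>(s, \<xi>). (\<xi>)(m := s)) = S" (is "?D = _")
proof (rule PiM_eq)
  let ?I = "UNIV::nat set" and ?M = "\<lambda>n. M"
  let "distr _ _ ?f" = "?D"
  fix J E assume J: "finite J" "J \<subseteq> ?I" "\<And>j. j \<in> J \<Longrightarrow> E j \<in> sets M"
  let ?X = "prod_emb ?I ?M J (\<Pi>\<^sub>E j\<in>J. E j)"
  have "\<And>j x. j \<in> J \<Longrightarrow> x \<in> E j \<Longrightarrow> x \<in> space M"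
    using J(3)[THEN sets.sets_into_space] by (auto simp: space_PiM Pi_iff subset_eq)
  with J have "?f -` ?X \<inter> space (M \<Otimes>\<^sub>M S) = (if m \<in> J then E m else space M) \<times>
    (prod_emb ?I ?M (J - {m}) (\<Pi>\<^sub>E j\<in>J - {m}. E j))" (is "_ = ?E \<times> ?F")
    by (auto simp: space_pair_measure space_PiM PiE_iff prod_emb_def split: if_splits)
  then have "emeasure ?D ?X = emeasure (M \<Otimes>\<^sub>M S) (?E \<times> ?F)"
    by (subst emeasure_distr[OF measurable_upd])
       (auto intro!: sets_PiM_I simp: split_beta' J)
  also have "\<dots> = emeasure M ?E * emeasure S ?F"
    using J by (intro P.emeasure_pair_measure_Times) (auto intro!: sets_PiM_I)
  also have "emeasure S ?F = (\<Prod>j\<in>J - {m}. emeasure M (E j))"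
    using J by (intro emeasure_PiM_emb) simp_all
  also have "emeasure M ?E * \<dots> = (\<Prod>j\<in>J. emeasure M (E j))"
    by (auto simp: M.emeasure_space_1 prod.remove J)
  finally show "emeasure ?D ?X = (\<Prod>j\<in>J. emeasure M (E j))" .
qed simp_all

lemma Lp_le_upd:
  assumes "Lp_le S q F a" shows "Lp_le (M \<Otimes>\<^sub>M S) q (\<lambda>(s, \<xi>). F ((\<xi>)(k := s))) a"
proof -
  have "Lp_le (distr (M \<Otimes>\<^sub>M S) S (\<lambda>(s, \<xi>). (\<xi>)(k := s))) q F a"
    using assms by (simp only: distr_upd)
  then have "Lp_le (M \<Otimes>\<^sub>M S) q (\<lambda>z. F ((\<lambda>(s, \<xi>). (\<xi>)(k := s)) z)) a"
    by (rule Lp_le_distr[OF measurable_upd Lp_leD(1)[OF assms], THEN iffD1])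
  then show ?thesis by (simp add: split_beta')
qed

lemma Lp_le_snd:
  assumes "Lp_le S q F a" shows "Lp_le (M \<Otimes>\<^sub>M S) q (\<lambda>z. F (snd z)) a"
proof -
  note [measurable] = Lp_leD(1)[OF assms]
  have "(\<integral>\<^sup>+z. ennreal (\<bar>F (snd z)\<bar> ^ q) \<partial>(M \<Otimes>\<^sub>M S)) = (\<integral>\<^sup>+\<xi>. ennreal (\<bar>F \<xi>\<bar> ^ q) \<partial>S)"
    by (subst MS.nn_integral_snd[symmetric]) (auto simp: M.emeasure_space_1)
  then show ?thesis using assms by (simp add: Lp_le_def)
qed

lemma influence_4_2: "influence 4 F k a \<Longrightarrow> influence 2 F k a"
  unfolding influence_def by (rule MS.P.Lp_le_4_2)

lemma influence_weaken: "influence q F k a \<Longrightarrow> a \<le> b \<Longrightarrow> influence q F k b"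
  unfolding influence_def by (rule Lp_le_weaken)

lemma influence_sum:
  assumes "q > 0" "\<And>i. i \<in> I \<Longrightarrow> influence q (X i) k (a i)"
  shows "influence q (\<lambda>\<xi>. \<Sum>i\<in>I. c i * X i \<xi>) k (\<Sum>i\<in>I. \<bar>c i\<bar> * a i)"
proof -
  have "Lp_le (M \<Otimes>\<^sub>M S) q (\<lambda>z. \<Sum>i\<in>I. c i * (case z of (s, \<xi>) \<Rightarrow> X i \<xi> - X i ((\<xi>)(k := s)))) (\<Sum>i\<in>I. \<bar>c i\<bar> * a i)"
    using assms(2) unfolding influence_def by (intro Lp_le_sum assms(1) Lp_le_cmult)
  moreover have "(\<lambda>z. \<Sum>i\<in>I. c i * (case z of (s, \<xi>) \<Rightarrow> X i \<xi> - X i ((\<xi>)(k := s))))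
     = (\<lambda>(s, \<xi>). (\<Sum>i\<in>I. c i * X i \<xi>) - (\<Sum>i\<in>I. c i * X i ((\<xi>)(k := s))))"
    by (auto simp: fun_eq_iff sum_subtractf[symmetric] algebra_simps)
  ultimately show ?thesis by (simp add: influence_def)
qed

lemma influence_mult:
  assumes F: "Lp_le S 4 F u" and G: "Lp_le S 4 G v" and a: "influence 4 F k a" and b: "influence 4 G k b"
  shows "influence 2 (\<lambda>\<xi>. F \<xi> * G \<xi>) k (a * v + u * b)"
proof -
  have "Lp_le (M \<Otimes>\<^sub>M S) 2 (\<lambda>z. (\<lambda>(s, \<xi>). F \<xi> - F ((\<xi>)(k := s))) z * G (snd z)
       + (\<lambda>(s, \<xi>). F ((\<xi>)(k := s))) z * (\<lambda>(s, \<xi>). G \<xi> - G ((\<xi>)(k := s))) z) (a * v + u * b)"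
    using a b Lp_le_snd[OF G] Lp_le_upd[OF F, of k] unfolding influence_def
    by (intro Lp_le_add Lp_le_mult) auto
  then show ?thesis
    unfolding influence_def by (rule Lp_le_cong[THEN iffD1, rotated]) (auto simp: algebra_simps)
qed

lemma influence_lipschitz:
  assumes f: "f \<in> borel_measurable borel" "\<And>x y. \<bar>f x - f y\<bar> \<le> C * \<bar>x - y\<bar>" "0 \<le> C"
    and F: "F \<in> borel_measurable S" and i: "influence q F k a"
  shows "influence q (\<lambda>\<xi>. f (F \<xi>)) k (C * a)"
  unfolding influence_def
proof (rule Lp_le_dominated)
  show "Lp_le (M \<Otimes>\<^sub>M S) q (\<lambda>z. C * (\<lambda>(s, \<xi>). F \<xi> - F ((\<xi>)(k := s))) z) (C * a)"
    using Lp_le_cmult[OF i[unfolded influence_def], of C] f(3) by simp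
  show "(\<lambda>(s, \<xi>). f (F \<xi>) - f (F ((\<xi>)(k := s)))) \<in> borel_measurable (M \<Otimes>\<^sub>M S)"
    by (intro influence_measurable measurable_compose[OF F f(1)])
qed (use f(2,3) in \<open>auto simp: abs_mult split: prod.split\<close>)

text \<open>The scale \<open>B\<close> is separate from the weights, because arrays built from the same innovations share
  the weights.\<close>

definition weak_array :: "nat \<Rightarrow> nat \<Rightarrow> (nat \<Rightarrow> nat \<Rightarrow> real) \<Rightarrow> real \<Rightarrow> (nat \<Rightarrow> (nat \<Rightarrow> 'a) \<Rightarrow> real) \<Rightarrow> bool" where
  "weak_array q n w B X \<longleftrightarrow> 0 \<le> B \<and>
     (\<forall>i\<in>{1..n}. integrable S (X i) \<and> (\<forall>k. influence q (X i) k (B * w i k)))"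

lemma weak_array_sum_influence:
  assumes X: "weak_array q n w B X" and q: "q > 0"
  shows "influence q (\<lambda>\<xi>. \<Sum>i=1..n. c i * X i \<xi>) k (B * (\<Sum>i=1..n. \<bar>c i\<bar> * w i k))"
  using influence_sum[OF q, of "{1..n}" X k "\<lambda>i. B * w i k" c] X
  by (auto simp: weak_array_def sum_distrib_left mult.left_commute)

lemma weak_array_integrable: "weak_array q n w B X \<Longrightarrow> integrable S (\<lambda>\<xi>. \<Sum>i=1..n. c i * X i \<xi>)"
  by (auto simp: weak_array_def)

lemma weak_array_square_sum:
  assumes w: "schur_weights n w \<Theta>" and B: "0 \<le> B"
  shows "(\<Sum>k<N. (B * (\<Sum>i=1..n. \<bar>c i\<bar> * w i k))\<^sup>2) \<le> (B * \<Theta>)\<^sup>2 * (\<Sum>i=1..n. (c i)\<^sup>2)"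
  using mult_left_mono[OF schur_weights_square_sum[OF w, of c N], of "B\<^sup>2"]
  unfolding power_mult_distrib sum_distrib_left[symmetric] by (simp add: mult.assoc)

lemma weak_array_centered:
  assumes "weak_array q n w B X"
  shows "(\<Sum>i=1..n. c i * (X i \<xi> - (\<integral>\<xi>. X i \<xi> \<partial>S)))
     = (\<Sum>i=1..n. c i * X i \<xi>) - (\<integral>\<xi>. (\<Sum>i=1..n. c i * X i \<xi>) \<partial>S)"
  using assms by (simp add: weak_array_def Bochner_Integration.integral_sum right_diff_distrib sum_subtractf)

lemma weak_array_linear_2:
  assumes w: "schur_weights n w \<Theta>" and X: "weak_array 2 n w B X"
  shows "Lp_le S 2 (\<lambda>\<xi>. \<Sum>i=1..n. c i * (X i \<xi> - (\<integral>\<xi>. X i \<xi> \<partial>S))) (B * \<Theta> * sqrt (\<Sum>i=1..n. (c i)\<^sup>2))"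
proof -
  have B: "0 \<le> B" "0 \<le> \<Theta>" using X w by (auto simp: weak_array_def schur_weights_def)
  have "Lp_le S 2 (\<lambda>\<xi>. (\<Sum>i=1..n. c i * X i \<xi>) - (\<integral>\<xi>. (\<Sum>i=1..n. c i * X i \<xi>) \<partial>S))
     (sqrt ((B * \<Theta>)\<^sup>2 * (\<Sum>i=1..n. (c i)\<^sup>2)))"
    by (rule variance_le_influences[OF weak_array_integrable[OF X] weak_array_sum_influence[OF X]
          weak_array_square_sum[OF w B(1)]]) simp
  then show ?thesis using B unfolding weak_array_centered[OF X] by (simp add: real_sqrt_mult)
qed

lemma weak_array_linear_4:
  assumes w: "schur_weights n w \<Theta>" and X: "weak_array 4 n w B X"
  shows "Lp_le S 4 (\<lambda>\<xi>. \<Sum>i=1..n. c i * (X i \<xi> - (\<integral>\<xi>. X i \<xi> \<partial>S))) (2 * B * \<Theta> * sqrt (\<Sum>i=1..n. (c i)\<^sup>2))"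
proof -
  have B: "0 \<le> B" "0 \<le> \<Theta>" using X w by (auto simp: weak_array_def schur_weights_def)
  have "Lp_le S 4 (\<lambda>\<xi>. (\<Sum>i=1..n. c i * X i \<xi>) - (\<integral>\<xi>. (\<Sum>i=1..n. c i * X i \<xi>) \<partial>S))
     (2 * sqrt ((B * \<Theta>)\<^sup>2 * (\<Sum>i=1..n. (c i)\<^sup>2)))"
    by (rule fourth_moment_le_influences[OF weak_array_integrable[OF X] weak_array_sum_influence[OF X]
          weak_array_square_sum[OF w B(1)]]) simp
  then show ?thesis using B unfolding weak_array_centered[OF X] by (simp add: real_sqrt_mult mult.assoc)
qed

lemma weak_array_4_2: "weak_array 4 n w B X \<Longrightarrow> weak_array 2 n w B X"
  by (auto simp: weak_array_def intro: influence_4_2)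

text \<open>For centered arrays the expected absolute value of a quadratic form is controlled by its
  mean, of order \<open>n\<close> because covariances are summable, and by its variance. Perturbing one
  coordinate changes the form by \<open>\<Sum>i. (X i - X' i) * T i\<close> with linear statistics \<open>T i\<close>, so that
  only their fourth moments, and not the number of summands, enter the variance.\<close>

lemma weak_array_quadratic:
  assumes w: "schur_weights n w \<Theta>" and X: "weak_array 4 n w B X" and Y: "weak_array 4 n w B Y"
    and X0: "\<And>i. i \<in> {1..n} \<Longrightarrow> (\<integral>\<xi>. X i \<xi> \<partial>S) = 0" and Y0: "\<And>i. i \<in> {1..n} \<Longrightarrow> (\<integral>\<xi>. Y i \<xi> \<partial>S) = 0"
    and a: "\<And>i j. \<bar>a i j\<bar> \<le> \<alpha>" and r: "0 \<le> r"
    and rows: "\<And>i. i \<in> {1..n} \<Longrightarrow> (\<Sum>j=1..n. (a i j)\<^sup>2) \<le> r\<^sup>2"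
    and cols: "\<And>j. j \<in> {1..n} \<Longrightarrow> (\<Sum>i=1..n. (a i j)\<^sup>2) \<le> r\<^sup>2"
  shows "Lp_le S 1 (\<lambda>\<xi>. \<Sum>i=1..n. \<Sum>j=1..n. a i j * X i \<xi> * Y j \<xi>) ((B * \<Theta>)\<^sup>2 * (n * \<alpha> + 4 * r * sqrt n))"
proof -
  have B: "0 \<le> B" "0 \<le> \<Theta>" using X w by (auto simp: weak_array_def schur_weights_def)
  have w0: "0 \<le> w i k" for i k using w by (auto simp: schur_weights_def)
  have \<alpha>: "0 \<le> \<alpha>" using a[of 0 0] by linarith
  define T where "T i \<xi> = (\<Sum>j=1..n. a i j * Y j \<xi>)" for i \<xi>
  define U where "U j \<xi> = (\<Sum>i=1..n. a i j * X i \<xi>)" for j \<xi>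
  define Q where "Q \<xi> = (\<Sum>i=1..n. \<Sum>j=1..n. a i j * X i \<xi> * Y j \<xi>)" for \<xi>
  have QT: "Q \<xi> = (\<Sum>i=1..n. X i \<xi> * T i \<xi>)" for \<xi>
    by (simp add: Q_def T_def sum_distrib_left mult_ac)
  have T4: "Lp_le S 4 (T i) (2 * B * \<Theta> * r)" if i: "i \<in> {1..n}" for i
  proof -
    have "sqrt (\<Sum>j=1..n. (a i j)\<^sup>2) \<le> r" using rows[OF i] r by (simp add: real_le_lsqrt sum_nonneg)
    then have "2 * B * \<Theta> * sqrt (\<Sum>j=1..n. (a i j)\<^sup>2) \<le> 2 * B * \<Theta> * r" using B by (intro mult_left_mono) auto
    from Lp_le_weaken[OF weak_array_linear_4[OF w Y, of "a i"] this] show ?thesis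
      using Y0 unfolding T_def[abs_def] by simp
  qed
  have U4: "Lp_le S 4 (U j) (2 * B * \<Theta> * r)" if j: "j \<in> {1..n}" for j
  proof -
    have "sqrt (\<Sum>i=1..n. (a i j)\<^sup>2) \<le> r" using cols[OF j] r by (simp add: real_le_lsqrt sum_nonneg)
    then have "2 * B * \<Theta> * sqrt (\<Sum>i=1..n. (a i j)\<^sup>2) \<le> 2 * B * \<Theta> * r" using B by (intro mult_left_mono) auto
    from Lp_le_weaken[OF weak_array_linear_4[OF w X, of "\<lambda>i. a i j"] this] show ?thesis
      using X0 unfolding U_def[abs_def] by simp
  qed
  have X4: "Lp_le S 4 (X i) (2 * B * \<Theta>)" if i: "i \<in> {1..n}" for i
  proof -
    have "(\<Sum>j=1..n. (if j = i then 1 else 0) * (X j \<xi> - (\<integral>\<xi>. X j \<xi> \<partial>S))) = X i \<xi>" for \<xi>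
      using i X0 by (subst sum.mono_neutral_right[of _ "{i}"]) auto
    moreover have "(\<Sum>j=1..n. (if j = i then 1 else 0 :: real)\<^sup>2) = 1"
      using i by (subst sum.mono_neutral_right[of _ "{i}"]) auto
    ultimately show ?thesis using weak_array_linear_4[OF w X, of "\<lambda>j. if j = i then 1 else 0"] by simp
  qed
  define s where "s k = (\<Sum>i=1..n. w i k)" for k
  have s: "0 \<le> s k" "s k \<le> \<Theta>" for k using w w0 by (auto simp: s_def schur_weights_def intro: sum_nonneg)
  have infl: "influence 2 Q k (4 * B\<^sup>2 * \<Theta> * r * s k)" for k
  proof -
    let ?dX = "\<lambda>i (s, \<xi>). X i \<xi> - X i ((\<xi>)(k := s))" and ?dY = "\<lambda>j (s, \<xi>). Y j \<xi> - Y j ((\<xi>)(k := s))"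
    have "Lp_le (M \<Otimes>\<^sub>M S) 2 (\<lambda>z. (\<Sum>i=1..n. ?dX i z * T i (snd z)) + (\<Sum>j=1..n. ?dY j z * (\<lambda>(s, \<xi>). U j ((\<xi>)(k := s))) z))
       ((\<Sum>i=1..n. (B * w i k) * (2 * B * \<Theta> * r)) + (\<Sum>i=1..n. (B * w i k) * (2 * B * \<Theta> * r)))"
    proof (intro Lp_le_add Lp_le_sum Lp_le_mult)
      fix i assume i: "i \<in> {1..n}"
      show "Lp_le (M \<Otimes>\<^sub>M S) (2 * 2) (?dX i) (B * w i k)" "Lp_le (M \<Otimes>\<^sub>M S) (2 * 2) (?dY i) (B * w i k)"
        using X Y i unfolding weak_array_def influence_def by simp_all
      show "Lp_le (M \<Otimes>\<^sub>M S) (2 * 2) (\<lambda>z. T i (snd z)) (2 * B * \<Theta> * r)"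
        "Lp_le (M \<Otimes>\<^sub>M S) (2 * 2) (\<lambda>(s, \<xi>). U i ((\<xi>)(k := s))) (2 * B * \<Theta> * r)"
        using Lp_le_snd[OF T4[OF i]] Lp_le_upd[OF U4[OF i]] by simp_all
    qed simp_all
    moreover have "(\<Sum>i=1..n. (B * w i k) * (2 * B * \<Theta> * r)) + (\<Sum>i=1..n. (B * w i k) * (2 * B * \<Theta> * r)) = 4 * B\<^sup>2 * \<Theta> * r * s k"
      by (simp add: s_def sum_distrib_left power2_eq_square sum.distrib[symmetric] mult_ac)
    moreover have "(\<Sum>i=1..n. ?dX i z * T i (snd z)) + (\<Sum>j=1..n. ?dY j z * (\<lambda>(s, \<xi>). U j ((\<xi>)(k := s))) z)
        = (\<lambda>(s, \<xi>). Q \<xi> - Q ((\<xi>)(k := s))) z" for z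
    proof (cases z)
      case (Pair s \<xi>)
      let ?o = "(\<xi>)(k := s)"
      have "(\<Sum>i=1..n. (X i \<xi> - X i ?o) * T i \<xi>) = (\<Sum>i=1..n. \<Sum>j=1..n. a i j * (X i \<xi> - X i ?o) * Y j \<xi>)"
        by (simp add: T_def sum_distrib_left mult_ac)
      moreover have "(\<Sum>j=1..n. (Y j \<xi> - Y j ?o) * U j ?o) = (\<Sum>i=1..n. \<Sum>j=1..n. a i j * X i ?o * (Y j \<xi> - Y j ?o))"
        by (subst sum.swap) (simp add: U_def sum_distrib_left mult_ac)
      ultimately show ?thesis
        by (simp add: Pair Q_def sum.distrib[symmetric] sum_subtractf[symmetric]) (simp add: algebra_simps)
    qed
    ultimately show ?thesis unfolding influence_def by (simp only:)
  qed
  have XT: "Lp_le S 2 (\<lambda>\<xi>. X i \<xi> * T i \<xi>) (2 * B * \<Theta> * (2 * B * \<Theta> * r))" if "i \<in> {1..n}" for i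
    by (rule Lp_le_mult_4_2[OF X4[OF that] T4[OF that]])
  have XTi: "integrable S (\<lambda>\<xi>. X i \<xi> * T i \<xi>)" if "i \<in> {1..n}" for i
    using Lp_le_1(1)[OF P.Lp_le_2_1[OF XT[OF that]]] .
  have Qi: "integrable S Q" unfolding QT[abs_def] using XTi by auto
  have sq: "(\<Sum>k<N. (4 * B\<^sup>2 * \<Theta> * r * s k)\<^sup>2) \<le> (4 * (B * \<Theta>)\<^sup>2 * r)\<^sup>2 * n" for N
  proof -
    have "(\<Sum>k<N. (s k)\<^sup>2) \<le> \<Theta>\<^sup>2 * n"
      using schur_weights_square_sum[OF w, of "\<lambda>_. 1" N] by (simp add: s_def)
    then have "(4 * B\<^sup>2 * \<Theta> * r)\<^sup>2 * (\<Sum>k<N. (s k)\<^sup>2) \<le> (4 * B\<^sup>2 * \<Theta> * r)\<^sup>2 * (\<Theta>\<^sup>2 * n)"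
      by (intro mult_left_mono) auto
    also have "\<dots> = (4 * (B * \<Theta>)\<^sup>2 * r)\<^sup>2 * n" by (simp add: power_mult_distrib power2_eq_square)
    finally show ?thesis by (simp add: power_mult_distrib sum_distrib_left)
  qed
  have var: "Lp_le S 1 (\<lambda>\<xi>. Q \<xi> - (\<integral>\<xi>. Q \<xi> \<partial>S)) (4 * (B * \<Theta>)\<^sup>2 * r * sqrt n)"
    using P.Lp_le_2_1[OF variance_le_influences[OF Qi infl sq]] B r by (simp add: real_sqrt_mult)
  have mean: "\<bar>\<integral>\<xi>. X i \<xi> * T i \<xi> \<partial>S\<bar> \<le> (B * \<Theta>)\<^sup>2 * \<alpha>" if i: "i \<in> {1..n}" for i
  proof -
    have "\<bar>(\<integral>\<xi>. X i \<xi> * T i \<xi> \<partial>S) - (\<integral>\<xi>. X i \<xi> \<partial>S) * (\<integral>\<xi>. T i \<xi> \<partial>S)\<bar> \<le> (B * \<Theta>)\<^sup>2 * \<alpha>"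
    proof (rule covariance_le_influences[OF P.Lp_le_4_2[OF X4[OF i]] P.Lp_le_4_2[OF T4[OF i]]])
      show "influence 2 (X i) k (B * w i k)" for k
        using X i by (auto simp: weak_array_def intro: influence_4_2)
      show "influence 2 (T i) k (B * (\<alpha> * \<Theta>))" for k
      proof (rule influence_weaken[OF influence_4_2])
        show "influence 4 (T i) k (B * (\<Sum>j=1..n. \<bar>a i j\<bar> * w j k))"
          unfolding T_def[abs_def] by (rule weak_array_sum_influence[OF Y]) simp
        have "(\<Sum>j=1..n. \<bar>a i j\<bar> * w j k) \<le> (\<Sum>j=1..n. \<alpha> * w j k)"
          using a w0 by (intro sum_mono mult_right_mono) auto
        also have "\<dots> = \<alpha> * s k" by (simp add: s_def sum_distrib_left)
        also have "\<dots> \<le> \<alpha> * \<Theta>" using s \<alpha> by (intro mult_left_mono) auto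
        finally show "B * (\<Sum>j=1..n. \<bar>a i j\<bar> * w j k) \<le> B * (\<alpha> * \<Theta>)" using B by (intro mult_left_mono) auto
      qed
      show "(\<Sum>k<N. B * w i k * (B * (\<alpha> * \<Theta>))) \<le> (B * \<Theta>)\<^sup>2 * \<alpha>" for N
      proof -
        have "(\<Sum>k<N. B * w i k * (B * (\<alpha> * \<Theta>))) = (B * (B * (\<alpha> * \<Theta>))) * (\<Sum>k<N. w i k)"
          by (simp add: sum_distrib_left mult_ac)
        also have "\<dots> \<le> (B * (B * (\<alpha> * \<Theta>))) * \<Theta>"
          using w i B \<alpha> by (intro mult_left_mono) (auto simp: schur_weights_def)
        finally show ?thesis by (simp add: power2_eq_square mult_ac)
      qed
    qed
    then show ?thesis using X0[OF i] by simp
  qed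
  have "\<bar>\<integral>\<xi>. Q \<xi> \<partial>S\<bar> = \<bar>\<Sum>i=1..n. \<integral>\<xi>. X i \<xi> * T i \<xi> \<partial>S\<bar>"
    unfolding QT[abs_def] using XTi by (subst Bochner_Integration.integral_sum) auto
  also have "\<dots> \<le> (\<Sum>i=1..n. (B * \<Theta>)\<^sup>2 * \<alpha>)"
    using mean by (intro order_trans[OF sum_abs] sum_mono) auto
  finally have m: "\<bar>\<integral>\<xi>. Q \<xi> \<partial>S\<bar> \<le> n * ((B * \<Theta>)\<^sup>2 * \<alpha>)" by simp
  have "Lp_le S 1 (\<lambda>\<xi>. (Q \<xi> - (\<integral>\<xi>. Q \<xi> \<partial>S)) + (\<integral>\<xi>. Q \<xi> \<partial>S)) (4 * (B * \<Theta>)\<^sup>2 * r * sqrt n + n * ((B * \<Theta>)\<^sup>2 * \<alpha>))"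
    by (rule Lp_le_add[OF var Lp_le_weaken[OF P.Lp_le_const m]])
  moreover have "4 * (B * \<Theta>)\<^sup>2 * r * sqrt n + n * ((B * \<Theta>)\<^sup>2 * \<alpha>) = (B * \<Theta>)\<^sup>2 * (n * \<alpha> + 4 * r * sqrt n)"
    by (simp add: algebra_simps)
  ultimately show ?thesis by (simp add: Q_def)
qed

end

section \<open>Bounds in probability, coercive forms and windows\<close>

text \<open>The event is bounded below by a measurable set. Hence statements about every solution of a random
  system of equations can be handled without a proof of their measurability.\<close>

definition likely :: "'a measure \<Rightarrow> real \<Rightarrow> (nat \<Rightarrow> 'a \<Rightarrow> bool) \<Rightarrow> bool" where
  "likely Q \<epsilon> G \<longleftrightarrow> (\<forall>\<^sub>F n in sequentially. \<exists>E\<in>sets Q. 1 - \<epsilon> \<le> measure Q E \<and> (\<forall>\<omega>\<in>E. G n \<omega>))"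

definition whp :: "'a measure \<Rightarrow> (nat \<Rightarrow> 'a \<Rightarrow> bool) \<Rightarrow> bool" where
  "whp Q G \<longleftrightarrow> (\<forall>\<epsilon>>0. likely Q \<epsilon> G)"

text \<open>The stochastic Landau symbol: \<open>Z n / m n\<close> is bounded in probability.\<close>

definition OP :: "'a measure \<Rightarrow> (nat \<Rightarrow> 'a \<Rightarrow> real) \<Rightarrow> (nat \<Rightarrow> real) \<Rightarrow> bool" where
  "OP Q Z m \<longleftrightarrow> (\<forall>\<epsilon>>0. \<exists>C\<ge>0. likely Q \<epsilon> (\<lambda>n \<omega>. \<bar>Z n \<omega>\<bar> \<le> C * m n))"

lemma likely_mono:
  assumes "likely Q \<epsilon> G" "\<forall>\<^sub>F n in sequentially. \<forall>\<omega>\<in>space Q. G n \<omega> \<longrightarrow> G' n \<omega>"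
  shows "likely Q \<epsilon> G'"
  using assms unfolding likely_def
proof eventually_elim
  case (elim n)
  then obtain E where "E \<in> sets Q" "1 - \<epsilon> \<le> measure Q E" "\<forall>\<omega>\<in>E. G n \<omega>" by blast
  with elim(2) sets.sets_into_space show ?case by (intro bexI[of _ E]) blast+
qed

lemma (in prob_space) likely_conj:
  assumes "likely M a G" "likely M b H"
  shows "likely M (a + b) (\<lambda>n \<omega>. G n \<omega> \<and> H n \<omega>)"
  using assms unfolding likely_def
proof eventually_elim
  case (elim n)
  then obtain E F where E: "E \<in> sets M" "1 - a \<le> prob E" "\<forall>\<omega>\<in>E. G n \<omega>"
    and F: "F \<in> sets M" "1 - b \<le> prob F" "\<forall>\<omega>\<in>F. H n \<omega>" by blast
  have "prob (E \<union> F) \<le> 1" by simp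
  then have "1 - (a + b) \<le> prob (E \<inter> F)"
    using E(2) F(2) finite_measure_Union'[OF E(1) F(1)] finite_measure_Diff'[OF F(1) E(1)]
    by (simp add: Int_commute)
  then show ?case using E F by (intro bexI[of _ "E \<inter> F"]) auto
qed

lemma whp_mono:
  assumes "whp Q G" "\<forall>\<^sub>F n in sequentially. \<forall>\<omega>\<in>space Q. G n \<omega> \<longrightarrow> G' n \<omega>"
  shows "whp Q G'"
  using assms likely_mono unfolding whp_def by blast

lemma (in prob_space) whp_conj:
  assumes "whp M G" "whp M H" shows "whp M (\<lambda>n \<omega>. G n \<omega> \<and> H n \<omega>)"
  unfolding whp_def
proof (intro allI impI)
  fix \<epsilon> :: real assume "\<epsilon> > 0"
  then have "likely M (\<epsilon> / 2) G" "likely M (\<epsilon> / 2) H" using assms by (auto simp: whp_def)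
  from likely_conj[OF this] show "likely M \<epsilon> (\<lambda>n \<omega>. G n \<omega> \<and> H n \<omega>)" by simp
qed

lemma whp_measure_tendsto:
  assumes Q: "prob_space Q" and G: "whp Q G" and m: "\<And>n. n \<ge> 1 \<Longrightarrow> {\<omega>\<in>space Q. G n \<omega>} \<in> sets Q"
  shows "(\<lambda>n. measure Q {\<omega>\<in>space Q. G n \<omega>}) \<longlonglongrightarrow> 1"
proof (rule LIMSEQ_I)
  interpret prob_space Q by fact
  fix r :: real assume r: "r > 0"
  then have "\<forall>\<^sub>F n in sequentially. \<exists>E\<in>sets Q. 1 - r / 2 \<le> prob E \<and> (\<forall>\<omega>\<in>E. G n \<omega>)"
    using G by (simp add: whp_def likely_def)
  moreover have "\<forall>\<^sub>F n in sequentially. (1::nat) \<le> n" by (rule eventually_ge_at_top)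
  ultimately have "\<forall>\<^sub>F n in sequentially. norm (prob {\<omega>\<in>space Q. G n \<omega>} - 1) < r"
  proof eventually_elim
    case (elim n)
    then obtain E where E: "E \<in> sets Q" "1 - r / 2 \<le> prob E" "\<forall>\<omega>\<in>E. G n \<omega>" by blast
    have "prob E \<le> prob {\<omega>\<in>space Q. G n \<omega>}"
      using E sets.sets_into_space[OF E(1)] m[OF elim(2)] by (intro finite_measure_mono) auto
    moreover have "prob {\<omega>\<in>space Q. G n \<omega>} \<le> 1" by simp
    ultimately show ?case using E(2) r unfolding real_norm_def by linarith
  qed
  then show "\<exists>no. \<forall>n\<ge>no. norm (prob {\<omega>\<in>space Q. G n \<omega>} - 1) < r" by (simp add: eventually_sequentially)
qed

lemma likely_vimage:
  assumes T: "\<And>n. T n \<in> measurable M Q" "\<And>n. distr M Q (T n) = Q" and G: "likely Q \<epsilon> G"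
  shows "likely M \<epsilon> (\<lambda>n \<omega>. G n (T n \<omega>))"
  using G unfolding likely_def
proof eventually_elim
  case (elim n)
  then obtain E where E: "E \<in> sets Q" "1 - \<epsilon> \<le> measure Q E" "\<forall>\<omega>\<in>E. G n \<omega>" by blast
  have "measure M (T n -` E \<inter> space M) = measure (distr M Q (T n)) E"
    using T(1) E(1) by (simp add: measure_distr)
  then have "1 - \<epsilon> \<le> measure M (T n -` E \<inter> space M)" using E(2) by (simp only: T(2))
  then show ?case using E T(1) by (intro bexI[of _ "T n -` E \<inter> space M"]) auto
qed

lemma whp_vimage:
  assumes "\<And>n. T n \<in> measurable M Q" "\<And>n. distr M Q (T n) = Q" "whp Q G"
  shows "whp M (\<lambda>n \<omega>. G n (T n \<omega>))"
  using assms likely_vimage unfolding whp_def by blast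

lemma (in prob_space) OP_of_Lp_le:
  assumes Z: "\<forall>\<^sub>F n in sequentially. Lp_le M 1 (Z n) (C * m n)" and m: "\<forall>\<^sub>F n in sequentially. 0 < m n"
    and C: "0 \<le> C"
  shows "OP M Z m"
  unfolding OP_def
proof (intro allI impI)
  fix \<epsilon> :: real assume \<epsilon>: "\<epsilon> > 0"
  define D where "D = (C + 1) / \<epsilon>"
  have D: "D > 0" using C \<epsilon> by (simp add: D_def)
  have "likely M \<epsilon> (\<lambda>n \<omega>. \<bar>Z n \<omega>\<bar> \<le> D * m n)"
    unfolding likely_def using Z m
  proof eventually_elim
    case (elim n)
    note [measurable] = Lp_leD(1)[OF elim(1)]
    have "prob {\<omega>\<in>space M. \<bar>Z n \<omega>\<bar> > D * m n} \<le> (C * m n / (D * m n)) ^ 1"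
      using elim D by (intro Lp_le_tail) auto
    also have "\<dots> = C / D" using elim(2) by simp
    also have "\<dots> \<le> \<epsilon>"
    proof -
      have "C \<le> \<epsilon> * D" using \<epsilon> by (simp add: D_def)
      then show ?thesis using D by (simp add: pos_divide_le_eq)
    qed
    finally have "1 - \<epsilon> \<le> 1 - prob {\<omega>\<in>space M. \<bar>Z n \<omega>\<bar> > D * m n}" by simp
    also have "\<dots> = prob {\<omega>\<in>space M. \<not> \<bar>Z n \<omega>\<bar> > D * m n}"
      by (intro prob_neg[symmetric]) measurable
    finally have "1 - \<epsilon> \<le> prob {\<omega>\<in>space M. \<bar>Z n \<omega>\<bar> \<le> D * m n}" by (simp add: not_less)
    then show ?case by (intro bexI[of _ "{\<omega>\<in>space M. \<bar>Z n \<omega>\<bar> \<le> D * m n}"]) auto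
  qed
  then show "\<exists>C\<ge>0. likely M \<epsilon> (\<lambda>n \<omega>. \<bar>Z n \<omega>\<bar> \<le> C * m n)" using D by (intro exI[of _ D]) auto
qed

lemma (in prob_space) OP_add:
  assumes "OP M Z m" "OP M Y m" shows "OP M (\<lambda>n \<omega>. Z n \<omega> + Y n \<omega>) m"
  unfolding OP_def
proof (intro allI impI)
  fix \<epsilon> :: real assume "\<epsilon> > 0"
  then have "\<epsilon> / 2 > 0" by simp
  with assms obtain C D where C: "C \<ge> 0" "likely M (\<epsilon> / 2) (\<lambda>n \<omega>. \<bar>Z n \<omega>\<bar> \<le> C * m n)"
    and D: "D \<ge> 0" "likely M (\<epsilon> / 2) (\<lambda>n \<omega>. \<bar>Y n \<omega>\<bar> \<le> D * m n)" unfolding OP_def by meson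
  have "likely M \<epsilon> (\<lambda>n \<omega>. \<bar>Z n \<omega> + Y n \<omega>\<bar> \<le> (C + D) * m n)"
  proof (rule likely_mono[OF likely_conj[OF C(2) D(2), simplified]], intro always_eventually allI ballI impI)
    fix n \<omega> assume "\<bar>Z n \<omega>\<bar> \<le> C * m n \<and> \<bar>Y n \<omega>\<bar> \<le> D * m n"
    then show "\<bar>Z n \<omega> + Y n \<omega>\<bar> \<le> (C + D) * m n" unfolding distrib_right by linarith
  qed
  then show "\<exists>C\<ge>0. likely M \<epsilon> (\<lambda>n \<omega>. \<bar>Z n \<omega> + Y n \<omega>\<bar> \<le> C * m n)" using C D by (intro exI[of _ "C + D"]) auto
qed

lemma (in prob_space) OP_mult:
  assumes "OP M Z m" "OP M Y k" shows "OP M (\<lambda>n \<omega>. Z n \<omega> * Y n \<omega>) (\<lambda>n. m n * k n)"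
  unfolding OP_def
proof (intro allI impI)
  fix \<epsilon> :: real assume "\<epsilon> > 0"
  then have "\<epsilon> / 2 > 0" by simp
  with assms obtain C D where C: "C \<ge> 0" "likely M (\<epsilon> / 2) (\<lambda>n \<omega>. \<bar>Z n \<omega>\<bar> \<le> C * m n)"
    and D: "D \<ge> 0" "likely M (\<epsilon> / 2) (\<lambda>n \<omega>. \<bar>Y n \<omega>\<bar> \<le> D * k n)" unfolding OP_def by meson
  have "likely M \<epsilon> (\<lambda>n \<omega>. \<bar>Z n \<omega> * Y n \<omega>\<bar> \<le> (C * D) * (m n * k n))"
  proof (rule likely_mono[OF likely_conj[OF C(2) D(2), simplified]], intro always_eventually allI ballI impI)
    fix n \<omega> assume "\<bar>Z n \<omega>\<bar> \<le> C * m n \<and> \<bar>Y n \<omega>\<bar> \<le> D * k n"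
    then have "\<bar>Z n \<omega>\<bar> * \<bar>Y n \<omega>\<bar> \<le> (C * m n) * (D * k n)" by (intro mult_mono) auto
    then show "\<bar>Z n \<omega> * Y n \<omega>\<bar> \<le> (C * D) * (m n * k n)" by (simp add: abs_mult mult_ac)
  qed
  then show "\<exists>C\<ge>0. likely M \<epsilon> (\<lambda>n \<omega>. \<bar>Z n \<omega> * Y n \<omega>\<bar> \<le> C * (m n * k n))" using C D by (intro exI[of _ "C * D"]) auto
qed

lemma OP_rate:
  assumes Z: "OP Q Z m" and le: "\<forall>\<^sub>F n in sequentially. m n \<le> c * k n" and c: "0 \<le> c"
  shows "OP Q Z k"
  unfolding OP_def
proof (intro allI impI)
  fix \<epsilon> :: real assume "\<epsilon> > 0"
  with Z obtain C where C: "C \<ge> 0" "likely Q \<epsilon> (\<lambda>n \<omega>. \<bar>Z n \<omega>\<bar> \<le> C * m n)" unfolding OP_def by meson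
  have "likely Q \<epsilon> (\<lambda>n \<omega>. \<bar>Z n \<omega>\<bar> \<le> (C * c) * k n)"
  proof (rule likely_mono[OF C(2)], use le in eventually_elim)
    case (elim n)
    then have "C * m n \<le> C * c * k n" using C(1) by (simp add: mult_left_mono mult.assoc)
    then show ?case by (auto intro: order_trans)
  qed
  then show "\<exists>C\<ge>0. likely Q \<epsilon> (\<lambda>n \<omega>. \<bar>Z n \<omega>\<bar> \<le> C * k n)" using C c by (intro exI[of _ "C * c"]) auto
qed

lemma (in prob_space) OP_dominated:
  assumes Y: "OP M Y m" and le: "whp M (\<lambda>n \<omega>. \<bar>Z n \<omega>\<bar> \<le> \<bar>Y n \<omega>\<bar>)"
  shows "OP M Z m"
  unfolding OP_def
proof (intro allI impI)
  fix \<epsilon> :: real assume "\<epsilon> > 0"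
  then have "\<epsilon> / 2 > 0" by simp
  with Y le obtain C where C: "C \<ge> 0" "likely M (\<epsilon> / 2) (\<lambda>n \<omega>. \<bar>Y n \<omega>\<bar> \<le> C * m n)"
    and l: "likely M (\<epsilon> / 2) (\<lambda>n \<omega>. \<bar>Z n \<omega>\<bar> \<le> \<bar>Y n \<omega>\<bar>)" unfolding OP_def whp_def by meson
  have "likely M \<epsilon> (\<lambda>n \<omega>. \<bar>Z n \<omega>\<bar> \<le> C * m n)"
    by (rule likely_mono[OF likely_conj[OF C(2) l, simplified]]) auto
  then show "\<exists>C\<ge>0. likely M \<epsilon> (\<lambda>n \<omega>. \<bar>Z n \<omega>\<bar> \<le> C * m n)" using C by auto
qed

lemma (in prob_space) OP_const: "OP M (\<lambda>n \<omega>. c * m n) (\<lambda>n. \<bar>m n\<bar>)"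
proof -
  have "likely M \<epsilon> (\<lambda>n \<omega>. \<bar>c * m n\<bar> \<le> \<bar>c\<bar> * \<bar>m n\<bar>)" if "\<epsilon> > 0" for \<epsilon>
    unfolding likely_def abs_mult using that
    by (intro always_eventually allI bexI[of _ "space M"]) (auto simp: prob_space)
  then show ?thesis unfolding OP_def by (intro allI impI exI[of _ "\<bar>c\<bar>"]) auto
qed

lemma (in prob_space) OP_cmult:
  assumes "OP M Z m" shows "OP M (\<lambda>n \<omega>. c * Z n \<omega>) m"
  using OP_mult[OF OP_const[of c "\<lambda>_. 1"] assms] by simp

lemma (in prob_space) OP_sum:
  assumes "finite I" "I \<noteq> {}" "\<And>i. i \<in> I \<Longrightarrow> OP M (Z i) m" shows "OP M (\<lambda>n \<omega>. \<Sum>i\<in>I. Z i n \<omega>) m"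
  using assms by (induction I rule: finite_ne_induct) (auto intro: OP_add)

lemma OP_small:
  assumes Z: "OP Q Z m" and m: "m \<longlonglongrightarrow> 0" and \<delta>: "0 < \<delta>"
  shows "whp Q (\<lambda>n \<omega>. \<bar>Z n \<omega>\<bar> \<le> \<delta>)"
  unfolding whp_def
proof (intro allI impI)
  fix \<epsilon> :: real assume "\<epsilon> > 0"
  with Z obtain C where C: "C \<ge> 0" "likely Q \<epsilon> (\<lambda>n \<omega>. \<bar>Z n \<omega>\<bar> \<le> C * m n)" unfolding OP_def by meson
  have "(\<lambda>n. C * m n) \<longlonglongrightarrow> C * 0" by (intro tendsto_intros m)
  then have "\<forall>\<^sub>F n in sequentially. C * m n < \<delta>" using \<delta> by (intro order_tendstoD(2)) auto
  then have "\<forall>\<^sub>F n in sequentially. \<forall>\<omega>\<in>space Q. \<bar>Z n \<omega>\<bar> \<le> C * m n \<longrightarrow> \<bar>Z n \<omega>\<bar> \<le> \<delta>"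
    by eventually_elim auto
  from likely_mono[OF C(2) this] show "likely Q \<epsilon> (\<lambda>n \<omega>. \<bar>Z n \<omega>\<bar> \<le> \<delta>)" .
qed

text \<open>The variational form of invertibility (Lax-Milgram in finite dimension).\<close>

lemma coercive_form_represents:
  fixes F :: "'b::euclidean_space \<Rightarrow> 'b \<Rightarrow> real"
  assumes F: "\<And>d. linear (F d)" "\<And>d'. linear (\<lambda>d. F d d')" and c: "0 < c" "\<And>d. c * (norm d)\<^sup>2 \<le> F d d"
  obtains g where "\<And>d. F g d = l \<bullet> d" "norm g \<le> norm l / c"
proof -
  define T where "T g = (\<Sum>b\<in>Basis. F g b *\<^sub>R b)" for g
  have TF: "T g \<bullet> d = F g d" for g d
  proof -
    have "F g d = F g (\<Sum>b\<in>Basis. (d \<bullet> b) *\<^sub>R b)" by (simp add: euclidean_representation)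
    also have "\<dots> = (\<Sum>b\<in>Basis. (d \<bullet> b) * F g b)" by (simp add: linear_sum[OF F(1)] linear_cmul[OF F(1)])
    also have "\<dots> = (\<Sum>b\<in>Basis. F g b * (b \<bullet> d))" by (simp add: inner_commute mult.commute)
    also have "\<dots> = T g \<bullet> d" by (simp add: T_def inner_sum_left)
    finally show ?thesis by simp
  qed
  have lin: "linear T"
    by (rule linearI; rule euclidean_eqI)
       (simp_all add: TF inner_add_left linear_add[OF F(2)] linear_cmul[OF F(2)])
  have "inj T"
  proof (rule linear_injective_0[OF lin, THEN iffD2], intro allI impI)
    fix g assume "T g = 0"
    then have "F g g = 0" using TF[of g g] by simp
    then have "(norm g)\<^sup>2 \<le> 0" using c(2)[of g] c(1) by (simp add: mult_le_0_iff)
    then show "g = 0" by simp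
  qed
  then have "surj T" using linear_injective_imp_surjective[OF lin] by simp
  then obtain g where g: "T g = l" by (metis surjD)
  have 1: "F g d = l \<bullet> d" for d using TF[of g d] g by simp
  have "c * (norm g)\<^sup>2 \<le> norm l * norm g"
    using c(2)[of g] 1[of g] norm_cauchy_schwarz[of l g] by linarith
  then have "norm g \<le> norm l / c"
    using c(1) by (cases "g = 0") (auto simp: power2_eq_square field_simps)
  with 1 show ?thesis by (rule that)
qed

lemma card_window:
  assumes "0 \<le> h" shows "real (card {j\<in>{1..n}. \<bar>real j - c\<bar> \<le> h}) \<le> 2 * h + 1"
proof -
  have sub: "int ` {j\<in>{1..n}. \<bar>real j - c\<bar> \<le> h} \<subseteq> {\<lceil>c - h\<rceil>..\<lfloor>c + h\<rfloor>}"
    by (auto simp: ceiling_le_iff le_floor_iff abs_le_iff)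
  have "card {j\<in>{1..n}. \<bar>real j - c\<bar> \<le> h} = card (int ` {j\<in>{1..n}. \<bar>real j - c\<bar> \<le> h})"
    by (rule card_image[symmetric]) simp
  also have "\<dots> \<le> card {\<lceil>c - h\<rceil>..\<lfloor>c + h\<rfloor>}" by (rule card_mono[OF _ sub]) simp
  finally have "real (card {j\<in>{1..n}. \<bar>real j - c\<bar> \<le> h}) \<le> real (nat (\<lfloor>c + h\<rfloor> - \<lceil>c - h\<rceil> + 1))" by simp
  also have "\<dots> \<le> 2 * h + 1" using assms by linarith
  finally show ?thesis .
qed

text \<open>At most \<open>2 h + 1 \<le> 4 h\<close> terms differ from zero.\<close>

lemma window_square_sum:
  assumes h: "1 \<le> h" and c: "\<And>j. \<bar>a j\<bar> \<le> c" and z: "\<And>j. \<bar>real j - t\<bar> > h \<Longrightarrow> a j = 0"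
  shows "sqrt (\<Sum>j=1..n. (a j)\<^sup>2) \<le> 2 * c * sqrt h"
proof -
  have c0: "0 \<le> c" using c[of 0] by linarith
  have z': "\<bar>real j - t\<bar> \<le> h" if "a j \<noteq> 0" for j using z[of j] that by fastforce
  have "(\<Sum>j=1..n. (a j)\<^sup>2) = (\<Sum>j\<in>{j\<in>{1..n}. \<bar>real j - t\<bar> \<le> h}. (a j)\<^sup>2)"
    by (intro sum.mono_neutral_right) (auto intro: z')
  also have "\<dots> \<le> (\<Sum>j\<in>{j\<in>{1..n}. \<bar>real j - t\<bar> \<le> h}. c\<^sup>2)"
    using c c0 by (intro sum_mono) (simp add: abs_le_square_iff[symmetric])
  also have "\<dots> = real (card {j\<in>{1..n}. \<bar>real j - t\<bar> \<le> h}) * c\<^sup>2" by simp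
  also have "\<dots> \<le> (4 * h) * c\<^sup>2" using card_window[of h n t] h by (intro mult_right_mono) auto
  also have "\<dots> = (2 * c * sqrt h)\<^sup>2" using h by (simp add: power_mult_distrib)
  finally show ?thesis using h c0 by (simp add: real_le_lsqrt)
qed

section \<open>Statistics of the local linear fit\<close>

lemma sum_nested_const_bound:
  "(\<Sum>a\<in>(UNIV::'p::finite set). \<Sum>b\<in>(UNIV::'p set). \<Sum>r<(k::nat). c) = real CARD('p) * real CARD('p) * real k * c"
  by simp

text \<open>Observation \<open>i\<close> of a sample of size \<open>n\<close> as a function of one sequence of i.i.d. innovations. The
  effective window size is \<open>h n\<close>, and \<open>R n i j\<close> is the error at \<open>j\<close> of the linear approximation of
  the coefficient curve around \<open>i\<close>. One constant \<open>A\<close> serves for all upper bounds. The last condition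
  on \<open>h\<close> makes the averages over all windows accurate at once.\<close>

locale regression_array = sequence_space M for M :: "'s measure" +
  fixes x :: "nat \<Rightarrow> nat \<Rightarrow> (nat \<Rightarrow> 's) \<Rightarrow> real ^ 'p"
    and e :: "nat \<Rightarrow> nat \<Rightarrow> (nat \<Rightarrow> 's) \<Rightarrow> real"
    and w :: "nat \<Rightarrow> nat \<Rightarrow> nat \<Rightarrow> real"
    and h s :: "nat \<Rightarrow> real"
    and R :: "nat \<Rightarrow> nat \<Rightarrow> nat \<Rightarrow> real ^ 'p"
    and K :: "real \<Rightarrow> real"
    and A l \<kappa> v1 v2 p :: real
  assumes p: "p = real CARD('p)" and A: "1 \<le> A"
    and w: "schur_weights n (w n) A"
    and x4: "i \<in> {1..n} \<Longrightarrow> Lp_le S 4 (\<lambda>\<xi>. x n i \<xi> $ a) A"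
    and xd: "i \<in> {1..n} \<Longrightarrow> influence 4 (\<lambda>\<xi>. x n i \<xi> $ a) k (w n i k)"
    and e2: "i \<in> {1..n} \<Longrightarrow> Lp_le S 2 (e n i) A"
    and L0: "i \<in> {1..n} \<Longrightarrow> (\<integral>\<xi>. e n i \<xi> * x n i \<xi> $ a \<partial>S) = 0"
    and Ld: "i \<in> {1..n} \<Longrightarrow> influence 4 (\<lambda>\<xi>. e n i \<xi> * x n i \<xi> $ a) k (w n i k)"
    and l: "0 < l"
    and coercive: "i \<in> {1..n} \<Longrightarrow> l * (norm u)\<^sup>2 \<le> (\<integral>\<xi>. (x n i \<xi> \<bullet> u)\<^sup>2 \<partial>S)"
    and K: "0 \<le> K v" "K v \<le> A" "\<bar>v\<bar> > 1 \<Longrightarrow> K v = 0"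
    and \<kappa>: "0 < \<kappa>" "v1 \<le> \<bar>v\<bar> \<Longrightarrow> \<bar>v\<bar> \<le> v2 \<Longrightarrow> \<kappa> \<le> K v"
    and v12: "0 \<le> v1" "v1 < v2" "v2 \<le> 1"
    and s: "0 < s n"
    and R: "\<bar>real j - real i\<bar> \<le> h n \<Longrightarrow> i \<in> {1..n} \<Longrightarrow> j \<in> {1..n} \<Longrightarrow> norm (R n i j) \<le> A * s n"
    and h: "filterlim h at_top sequentially" "(\<lambda>n. h n / real n) \<longlonglongrightarrow> 0" "(\<lambda>n. real n / h n ^ 3) \<longlonglongrightarrow> 0"
begin

lemma p1: "1 \<le> p" by (simp add: p Suc_leI)

lemma xm[measurable]: "i \<in> {1..n} \<Longrightarrow> (\<lambda>\<xi>. x n i \<xi> $ a) \<in> borel_measurable S"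
  using x4 Lp_leD(1) by blast
lemma em[measurable]: "i \<in> {1..n} \<Longrightarrow> e n i \<in> borel_measurable S"
  using e2 Lp_leD(1) by blast

lemma xx2: "i \<in> {1..n} \<Longrightarrow> Lp_le S 2 (\<lambda>\<xi>. x n i \<xi> $ a * x n i \<xi> $ b) (A * A)"
  by (intro Lp_le_mult_4_2 x4)

lemma weak_xx: "weak_array 2 n (w n) (2 * A) (\<lambda>i \<xi>. x n i \<xi> $ a * x n i \<xi> $ b)"
  unfolding weak_array_def
proof (intro conjI ballI allI)
  fix i k assume i: "i \<in> {1..n}"
  show "integrable S (\<lambda>\<xi>. x n i \<xi> $ a * x n i \<xi> $ b)"
    by (rule Lp_le_1(1)[OF P.Lp_le_2_1[OF xx2[OF i]]])
  show "influence 2 (\<lambda>\<xi>. x n i \<xi> $ a * x n i \<xi> $ b) k (2 * A * w n i k)"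
    using influence_mult[OF x4[OF i] x4[OF i] xd[OF i] xd[OF i], of a b k] by (simp add: algebra_simps)
qed (use A in simp)

lemma weak_L: "weak_array 4 n (w n) 1 (\<lambda>i \<xi>. e n i \<xi> * x n i \<xi> $ a)"
  unfolding weak_array_def
proof (intro conjI ballI allI)
  fix i k assume i: "i \<in> {1..n}"
  show "integrable S (\<lambda>\<xi>. e n i \<xi> * x n i \<xi> $ a)"
    by (rule Lp_le_1(1)[OF Lp_le_mult_2_1[OF e2[OF i] P.Lp_le_4_2[OF x4[OF i]]]])
  show "influence 4 (\<lambda>\<xi>. e n i \<xi> * x n i \<xi> $ a) k (1 * w n i k)" using Ld[OF i] by simp
qed simp

text \<open>The errors have two moments only, but their products with the regressors are centred and inherit
  fourth moments from their influences.\<close>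

lemma L4: assumes i: "i \<in> {1..n}" shows "Lp_le S 4 (\<lambda>\<xi>. e n i \<xi> * x n i \<xi> $ a) (2 * A)"
proof -
  let ?X = "\<lambda>i \<xi>. e n i \<xi> * x n i \<xi> $ a"
  have "(\<Sum>j=1..n. (if j = i then 1 else 0) * (?X j \<xi> - (\<integral>\<xi>. ?X j \<xi> \<partial>S))) = ?X i \<xi>" for \<xi>
    using i L0 by (subst sum.mono_neutral_right[of _ "{i}"]) auto
  moreover have "(\<Sum>j=1..n. (if j = i then 1 else 0 :: real)\<^sup>2) = 1"
    using i by (subst sum.mono_neutral_right[of _ "{i}"]) auto
  ultimately show ?thesis using weak_array_linear_4[OF w weak_L[of n a], of "\<lambda>j. if j = i then 1 else 0"] by simp
qed

lemma Lm[measurable]: "i \<in> {1..n} \<Longrightarrow> (\<lambda>\<xi>. e n i \<xi> * x n i \<xi> $ a) \<in> borel_measurable S"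
  using L4 Lp_leD(1) by blast

text \<open>A centred local average of the observations in a window of \<open>h\<close> steps is of order \<open>h\<^bsup>-1/2\<^esup>\<close>.\<close>

lemma window_xx:
  assumes h1: "1 \<le> h n" and c: "\<And>j. \<bar>c j\<bar> \<le> C / h n" and z: "\<And>j. \<bar>real j - t\<bar> > h n \<Longrightarrow> c j = 0"
  shows "Lp_le S 2 (\<lambda>\<xi>. \<Sum>j=1..n. c j * (x n j \<xi> $ a * x n j \<xi> $ b - (\<integral>\<xi>. x n j \<xi> $ a * x n j \<xi> $ b \<partial>S))) (4 * A\<^sup>2 * C / sqrt (h n))"
proof (rule Lp_le_weaken[OF weak_array_linear_2[OF w weak_xx]])
  have "2 * A * A * sqrt (\<Sum>i=1..n. (c i)\<^sup>2) \<le> 2 * A * A * (2 * (C / h n) * sqrt (h n))"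
    using A by (intro mult_left_mono window_square_sum[OF h1 c z]) auto
  also have "\<dots> = 4 * A\<^sup>2 * C * (sqrt (h n) / h n)" by (simp add: power2_eq_square)
  also have "sqrt (h n) / h n = 1 / sqrt (h n)" using h1 by (simp add: real_div_sqrt field_simps)
  finally show "2 * A * A * sqrt (\<Sum>i=1..n. (c i)\<^sup>2) \<le> 4 * A\<^sup>2 * C / sqrt (h n)" by simp
qed

lemma window_L:
  assumes h1: "1 \<le> h n" and c: "\<And>j. \<bar>c j\<bar> \<le> C / h n" and z: "\<And>j. \<bar>real j - t\<bar> > h n \<Longrightarrow> c j = 0"
  shows "Lp_le S 4 (\<lambda>\<xi>. \<Sum>j=1..n. c j * (e n j \<xi> * x n j \<xi> $ a)) (4 * A * C / sqrt (h n))"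
proof -
  have "2 * 1 * A * sqrt (\<Sum>i=1..n. (c i)\<^sup>2) \<le> 2 * 1 * A * (2 * (C / h n) * sqrt (h n))"
    using A by (intro mult_left_mono window_square_sum[OF h1 c z]) auto
  also have "\<dots> = 4 * A * C * (sqrt (h n) / h n)" by simp
  also have "sqrt (h n) / h n = 1 / sqrt (h n)" using h1 by (simp add: real_div_sqrt field_simps)
  finally have "2 * 1 * A * sqrt (\<Sum>i=1..n. (c i)\<^sup>2) \<le> 4 * A * C / sqrt (h n)" by simp
  from Lp_le_weaken[OF weak_array_linear_4[OF w weak_L, of c n a] this] show ?thesis using L0 by simp
qed

text \<open>Positions are measured in units of the bandwidth. With slopes in the same units the local design
  is well conditioned.\<close>

definition pos :: "nat \<Rightarrow> nat \<Rightarrow> nat \<Rightarrow> real" where "pos n i j = (real j - real i) / h n"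
definition kw :: "nat \<Rightarrow> nat \<Rightarrow> nat \<Rightarrow> nat \<Rightarrow> real" where "kw n i r j = K (pos n i j) * pos n i j ^ r / h n"

text \<open>The local design form, the noise term and the bias term of the normal equations at \<open>i\<close>. A
  direction \<open>d\<close> consists of a level and a slope.\<close>

definition Sf where
  "Sf n i \<xi> d d' = (\<Sum>j=1..n. kw n i 0 j * (x n j \<xi> \<bullet> (fst d + pos n i j *\<^sub>R snd d)) * (x n j \<xi> \<bullet> (fst d' + pos n i j *\<^sub>R snd d')))"
definition Tf where
  "Tf n i \<xi> d = (\<Sum>j=1..n. kw n i 0 j * e n j \<xi> * (x n j \<xi> \<bullet> (fst d + pos n i j *\<^sub>R snd d)))"
definition Bf where
  "Bf n i \<xi> d = (\<Sum>j=1..n. kw n i 0 j * (x n j \<xi> \<bullet> R n i j) * (x n j \<xi> \<bullet> (fst d + pos n i j *\<^sub>R snd d)))"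

definition SE where "SE n i d d' = (\<integral>\<xi>. Sf n i \<xi> d d' \<partial>S)"
definition BE where "BE n i d = (\<integral>\<xi>. Bf n i \<xi> d \<partial>S)"

text \<open>Component sums from which these forms are assembled. \<open>Ndev\<close>, \<open>Bdev\<close> and \<open>Udev\<close> add up their
  deviations, so that one random variable controls a form in all directions.\<close>

definition mom where "mom n i a b r \<xi> = (\<Sum>j=1..n. kw n i r j * (x n j \<xi> $ a * x n j \<xi> $ b))"
definition bmom where "bmom n i a b r \<xi> = (\<Sum>j=1..n. (kw n i r j * R n i j $ b) * (x n j \<xi> $ a * x n j \<xi> $ b))"
definition tau where "tau n i a r \<xi> = (\<Sum>j=1..n. kw n i r j * (e n j \<xi> * x n j \<xi> $ a))"

definition Ndev where "Ndev n i \<xi> = (\<Sum>a\<in>UNIV. \<Sum>b\<in>UNIV. \<Sum>r<3. \<bar>mom n i a b r \<xi> - (\<integral>\<xi>. mom n i a b r \<xi> \<partial>S)\<bar>)"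
definition Bdev where "Bdev n i \<xi> = (\<Sum>a\<in>UNIV. \<Sum>b\<in>UNIV. \<Sum>r<2. \<bar>bmom n i a b r \<xi> - (\<integral>\<xi>. bmom n i a b r \<xi> \<partial>S)\<bar>)"
definition Udev where "Udev n i \<xi> = (\<Sum>a\<in>UNIV. \<Sum>r<2. \<bar>tau n i a r \<xi>\<bar>)"
definition Wsum where "Wsum n i \<xi> = (\<Sum>j=1..n. if \<bar>real j - real i\<bar> \<le> h n then (norm (x n j \<xi>))\<^sup>2 / h n else 0)"

lemma pos_le: "1 \<le> h n \<Longrightarrow> \<bar>pos n i j\<bar> \<le> 1 \<longleftrightarrow> \<bar>real j - real i\<bar> \<le> h n"
  by (simp add: pos_def)

lemma kw_zero: "1 \<le> h n \<Longrightarrow> \<bar>real j - real i\<bar> > h n \<Longrightarrow> kw n i r j = 0"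
  using pos_le[of n i j] K(3)[of "pos n i j"] by (auto simp: kw_def not_le)

lemma kw_nonneg0: "1 \<le> h n \<Longrightarrow> 0 \<le> kw n i 0 j" using K(1) by (simp add: kw_def)

lemma kw_bound: assumes h1: "1 \<le> h n" shows "\<bar>kw n i r j\<bar> \<le> A / h n"
proof (cases "\<bar>pos n i j\<bar> \<le> 1")
  case True
  have "\<bar>K (pos n i j)\<bar> * \<bar>pos n i j\<bar> ^ r \<le> A * 1"
  proof (intro mult_mono power_le_one)
    show "\<bar>K (pos n i j)\<bar> \<le> A" using K(1,2)[of "pos n i j"] by simp
  qed (use True A in auto)
  then show ?thesis using h1 by (simp add: kw_def abs_mult power_abs divide_right_mono)
next
  case False
  then have "kw n i r j = 0" using kw_zero[OF h1] pos_le[OF h1] by (auto simp: not_le)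
  then show ?thesis using A h1 by simp
qed

lemma mom_integrable: "integrable S (mom n i a b r)"
  unfolding mom_def[abs_def] using weak_xx by (auto simp: weak_array_def)
lemma bmom_integrable: "integrable S (bmom n i a b r)"
  unfolding bmom_def[abs_def] using weak_xx by (auto simp: weak_array_def)

lemma mom_dev: "mom n i a b r \<xi> - (\<integral>\<xi>. mom n i a b r \<xi> \<partial>S)
   = (\<Sum>j=1..n. kw n i r j * (x n j \<xi> $ a * x n j \<xi> $ b - (\<integral>\<xi>. x n j \<xi> $ a * x n j \<xi> $ b \<partial>S)))"
  unfolding mom_def by (rule weak_array_centered[OF weak_xx, symmetric])
lemma bmom_dev: "bmom n i a b r \<xi> - (\<integral>\<xi>. bmom n i a b r \<xi> \<partial>S)
   = (\<Sum>j=1..n. (kw n i r j * R n i j $ b) * (x n j \<xi> $ a * x n j \<xi> $ b - (\<integral>\<xi>. x n j \<xi> $ a * x n j \<xi> $ b \<partial>S)))"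
  unfolding bmom_def by (rule weak_array_centered[OF weak_xx, symmetric])

lemma Lp_le_abs: "Lp_le Q q f a \<Longrightarrow> Lp_le Q q (\<lambda>x. \<bar>f x\<bar>) a"
  by (rule Lp_le_dominated[where g=f]) (auto dest: Lp_leD)

lemma Ndev_Lp: assumes h1: "1 \<le> h n" shows "Lp_le S 2 (Ndev n i) (12 * p\<^sup>2 * A ^ 3 / sqrt (h n))"
proof -
  have "Lp_le S 2 (Ndev n i) (\<Sum>a\<in>(UNIV::'p set). \<Sum>b\<in>(UNIV::'p set). \<Sum>r<(3::nat). 4 * A\<^sup>2 * A / sqrt (h n))"
    unfolding Ndev_def[abs_def] mom_dev
    by (intro Lp_le_sum Lp_le_abs window_xx[OF h1, where t="real i"] kw_bound[OF h1] kw_zero[OF h1]) auto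
  then show ?thesis unfolding sum_nested_const_bound p[symmetric]
    by (simp add: power2_eq_square power3_eq_cube mult_ac)
qed

lemma Bdev_Lp: assumes h1: "1 \<le> h n" and i: "i \<in> {1..n}" shows "Lp_le S 2 (Bdev n i) (8 * p\<^sup>2 * A ^ 4 * s n / sqrt (h n))"
proof -
  have c: "\<bar>if j \<in> {1..n} then kw n i r j * R n i j $ b else 0\<bar> \<le> (A * (A * s n)) / h n" for r b j
  proof (cases "\<bar>real j - real i\<bar> \<le> h n \<and> j \<in> {1..n}")
    case True
    then have "\<bar>R n i j $ b\<bar> \<le> A * s n" using component_le_norm_cart[of "R n i j" b] R[of j i n] i by linarith
    then have "\<bar>kw n i r j\<bar> * \<bar>R n i j $ b\<bar> \<le> (A / h n) * (A * s n)"
      using A h1 s[of n] by (intro mult_mono kw_bound[OF h1]) auto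
    then show ?thesis using True by (simp add: abs_mult)
  next
    case False
    then have "(if j \<in> {1..n} then kw n i r j * R n i j $ b else 0) = 0" using kw_zero[OF h1] by (auto simp: not_le)
    then show ?thesis using A h1 s[of n] by simp
  qed
  have "Lp_le S 2 (\<lambda>\<xi>. bmom n i a b r \<xi> - (\<integral>\<xi>. bmom n i a b r \<xi> \<partial>S)) (4 * A\<^sup>2 * (A * (A * s n)) / sqrt (h n))" for a b r
  proof -
    have "Lp_le S 2 (\<lambda>\<xi>. \<Sum>j=1..n. (if j \<in> {1..n} then kw n i r j * R n i j $ b else 0) * (x n j \<xi> $ a * x n j \<xi> $ b - (\<integral>\<xi>. x n j \<xi> $ a * x n j \<xi> $ b \<partial>S))) (4 * A\<^sup>2 * (A * (A * s n)) / sqrt (h n))"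
      by (rule window_xx[OF h1 c, where t="real i"]) (simp add: kw_zero[OF h1])
    moreover have "(\<Sum>j=1..n. (if j \<in> {1..n} then kw n i r j * R n i j $ b else 0) * (x n j \<xi> $ a * x n j \<xi> $ b - (\<integral>\<xi>. x n j \<xi> $ a * x n j \<xi> $ b \<partial>S)))
      = bmom n i a b r \<xi> - (\<integral>\<xi>. bmom n i a b r \<xi> \<partial>S)" for \<xi>
      unfolding bmom_dev by (rule sum.cong) auto
    ultimately show ?thesis by simp
  qed
  then have "Lp_le S 2 (Bdev n i) (\<Sum>a\<in>(UNIV::'p set). \<Sum>b\<in>(UNIV::'p set). \<Sum>r<(2::nat). 4 * A\<^sup>2 * (A * (A * s n)) / sqrt (h n))"
    unfolding Bdev_def[abs_def] by (intro Lp_le_sum Lp_le_abs) auto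
  then show ?thesis unfolding sum_nested_const_bound p[symmetric]
    by (simp add: power2_eq_square power4_eq_xxxx mult_ac)
qed

lemma Udev_Lp: assumes h1: "1 \<le> h n" shows "Lp_le S 4 (Udev n i) (8 * p * A\<^sup>2 / sqrt (h n))"
proof -
  have "Lp_le S 4 (Udev n i) (\<Sum>a\<in>(UNIV::'p set). \<Sum>r<(2::nat). 4 * A * A / sqrt (h n))"
    unfolding Udev_def[abs_def] tau_def[abs_def]
    by (intro Lp_le_sum Lp_le_abs window_L[OF h1, where t="real i"] kw_bound[OF h1] kw_zero[OF h1]) auto
  then show ?thesis by (simp add: p[symmetric] power2_eq_square mult_ac)
qed

lemma Ndev_nonneg: "0 \<le> Ndev n i \<xi>" unfolding Ndev_def by (intro sum_nonneg) auto
lemma Bdev_nonneg: "0 \<le> Bdev n i \<xi>" unfolding Bdev_def by (intro sum_nonneg) auto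
lemma Udev_nonneg: "0 \<le> Udev n i \<xi>" unfolding Udev_def by (intro sum_nonneg) auto
lemma Sf_expand: "Sf n i \<xi> d d' = (\<Sum>a\<in>UNIV. \<Sum>b\<in>UNIV. fst d $ a * fst d' $ b * mom n i a b 0 \<xi>
    + (fst d $ a * snd d' $ b + snd d $ a * fst d' $ b) * mom n i a b 1 \<xi> + snd d $ a * snd d' $ b * mom n i a b 2 \<xi>)"
proof -
  have eq: "kw n i 0 j * (x n j \<xi> \<bullet> (fst d + pos n i j *\<^sub>R snd d)) * (x n j \<xi> \<bullet> (fst d' + pos n i j *\<^sub>R snd d'))
    = (\<Sum>a\<in>UNIV. \<Sum>b\<in>UNIV. fst d $ a * fst d' $ b * (kw n i 0 j * (x n j \<xi> $ a * x n j \<xi> $ b))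
        + (fst d $ a * snd d' $ b + snd d $ a * fst d' $ b) * (kw n i 1 j * (x n j \<xi> $ a * x n j \<xi> $ b))
        + snd d $ a * snd d' $ b * (kw n i 2 j * (x n j \<xi> $ a * x n j \<xi> $ b)))" for j
  proof -
    have k: "kw n i 1 j = kw n i 0 j * pos n i j" "kw n i 2 j = kw n i 0 j * pos n i j * pos n i j"
      by (simp_all add: kw_def power2_eq_square)
    have "kw n i 0 j * (x n j \<xi> \<bullet> (fst d + pos n i j *\<^sub>R snd d)) * (x n j \<xi> \<bullet> (fst d' + pos n i j *\<^sub>R snd d'))
       = (\<Sum>a\<in>UNIV. \<Sum>b\<in>UNIV. kw n i 0 j * ((x n j \<xi> $ a * (fst d $ a + pos n i j * snd d $ a)) * (x n j \<xi> $ b * (fst d' $ b + pos n i j * snd d' $ b))))"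
      by (simp add: inner_vec_def mult.assoc[of "kw n i 0 j"] sum_product sum_distrib_left[symmetric])
    also have "\<dots> = (\<Sum>a\<in>UNIV. \<Sum>b\<in>UNIV. fst d $ a * fst d' $ b * (kw n i 0 j * (x n j \<xi> $ a * x n j \<xi> $ b))
        + (fst d $ a * snd d' $ b + snd d $ a * fst d' $ b) * (kw n i 1 j * (x n j \<xi> $ a * x n j \<xi> $ b))
        + snd d $ a * snd d' $ b * (kw n i 2 j * (x n j \<xi> $ a * x n j \<xi> $ b)))"
      unfolding k by (intro sum.cong refl) (simp add: algebra_simps)
    finally show ?thesis .
  qed
  show ?thesis
    unfolding Sf_def eq
    apply (subst sum.swap, rule sum.cong[OF refl], subst sum.swap, rule sum.cong[OF refl])
    by (simp add: mom_def sum.distrib sum_distrib_left)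
qed

lemma SE_expand: "SE n i d d' = (\<Sum>a\<in>UNIV. \<Sum>b\<in>UNIV. fst d $ a * fst d' $ b * (\<integral>\<xi>. mom n i a b 0 \<xi> \<partial>S)
    + (fst d $ a * snd d' $ b + snd d $ a * fst d' $ b) * (\<integral>\<xi>. mom n i a b 1 \<xi> \<partial>S) + snd d $ a * snd d' $ b * (\<integral>\<xi>. mom n i a b 2 \<xi> \<partial>S))"
  unfolding SE_def Sf_expand using mom_integrable by simp

lemma Sf_integrable: "integrable S (\<lambda>\<xi>. Sf n i \<xi> d d')"
  unfolding Sf_expand using mom_integrable by simp

lemma component_le: "\<bar>fst d $ a\<bar> \<le> norm d" "\<bar>snd d $ a\<bar> \<le> norm d" for d :: "(real ^ 'p) \<times> (real ^ 'p)"
  using component_le_norm_cart[of "fst d" a] component_le_norm_cart[of "snd d" a] norm_fst_le[of "fst d" "snd d"] norm_snd_le[of "snd d" "fst d"]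
  by simp_all

lemma Sf_diff: "\<bar>Sf n i \<xi> d d' - SE n i d d'\<bar> \<le> 2 * norm d * norm d' * Ndev n i \<xi>"
proof -
  define D where "D a b r = mom n i a b r \<xi> - (\<integral>\<xi>. mom n i a b r \<xi> \<partial>S)" for a b r
  have prod: "\<bar>u * v\<bar> \<le> norm d * norm d'" if "\<bar>u\<bar> \<le> norm d" "\<bar>v\<bar> \<le> norm d'" for u v
    unfolding abs_mult using that by (intro mult_mono) auto
  have "\<bar>Sf n i \<xi> d d' - SE n i d d'\<bar> = \<bar>\<Sum>a\<in>UNIV. \<Sum>b\<in>UNIV. fst d $ a * fst d' $ b * D a b 0
      + (fst d $ a * snd d' $ b + snd d $ a * fst d' $ b) * D a b 1 + snd d $ a * snd d' $ b * D a b 2\<bar>"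
    unfolding Sf_expand SE_expand sum_subtractf[symmetric] D_def by (simp add: algebra_simps)
  also have "\<dots> \<le> (\<Sum>a\<in>UNIV. \<Sum>b\<in>UNIV. (2 * norm d * norm d') * (\<Sum>r<3. \<bar>D a b r\<bar>))"
  proof (intro order_trans[OF sum_abs] sum_mono)
    fix a b
    have 0: "\<bar>fst d $ a * fst d' $ b * D a b 0\<bar> \<le> norm d * norm d' * \<bar>D a b 0\<bar>"
      unfolding abs_mult[of _ "D a b 0"] by (intro mult_right_mono prod component_le) auto
    have "\<bar>fst d $ a * snd d' $ b + snd d $ a * fst d' $ b\<bar> \<le> 2 * norm d * norm d'"
      using prod[of "fst d $ a" "snd d' $ b"] prod[of "snd d $ a" "fst d' $ b"] component_le[of d a] component_le[of d' b] by linarith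
    then have 1: "\<bar>(fst d $ a * snd d' $ b + snd d $ a * fst d' $ b) * D a b 1\<bar> \<le> 2 * norm d * norm d' * \<bar>D a b 1\<bar>"
      unfolding abs_mult[of _ "D a b 1"] by (intro mult_right_mono) auto
    have 2: "\<bar>snd d $ a * snd d' $ b * D a b 2\<bar> \<le> norm d * norm d' * \<bar>D a b 2\<bar>"
      unfolding abs_mult[of _ "D a b 2"] by (intro mult_right_mono prod component_le) auto
    have z: "0 \<le> norm d * norm d' * \<bar>D a b 0\<bar>" "0 \<le> norm d * norm d' * \<bar>D a b 2\<bar>" by auto
    have e: "(2 * norm d * norm d') * (\<Sum>r<3. \<bar>D a b r\<bar>) = 2 * (norm d * norm d' * \<bar>D a b 0\<bar>) + 2 * norm d * norm d' * \<bar>D a b 1\<bar> + 2 * (norm d * norm d' * \<bar>D a b 2\<bar>)"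
      by (simp add: eval_nat_numeral algebra_simps)
    show "\<bar>fst d $ a * fst d' $ b * D a b 0 + (fst d $ a * snd d' $ b + snd d $ a * fst d' $ b) * D a b 1 + snd d $ a * snd d' $ b * D a b 2\<bar>
      \<le> (2 * norm d * norm d') * (\<Sum>r<3. \<bar>D a b r\<bar>)"
      unfolding e using 0 1 2 z by linarith
  qed
  also have "\<dots> = 2 * norm d * norm d' * Ndev n i \<xi>"
    by (simp add: Ndev_def D_def sum_distrib_left)
  finally show ?thesis .
qed

lemma Tf_expand: "Tf n i \<xi> d = (\<Sum>a\<in>UNIV. fst d $ a * tau n i a 0 \<xi> + snd d $ a * tau n i a 1 \<xi>)"
proof -
  have "kw n i 0 j * e n j \<xi> * (x n j \<xi> \<bullet> (fst d + pos n i j *\<^sub>R snd d))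
    = (\<Sum>a\<in>UNIV. fst d $ a * (kw n i 0 j * (e n j \<xi> * x n j \<xi> $ a)) + snd d $ a * (kw n i 1 j * (e n j \<xi> * x n j \<xi> $ a)))" for j
  proof -
    have k: "kw n i 1 j = kw n i 0 j * pos n i j" by (simp add: kw_def)
    show ?thesis unfolding inner_vec_def sum_distrib_left k by (intro sum.cong refl) (simp add: algebra_simps)
  qed
  then show ?thesis
    unfolding Tf_def by (simp only: ) (subst sum.swap, simp add: tau_def sum.distrib sum_distrib_left)
qed

lemma Tf_le: "\<bar>Tf n i \<xi> d\<bar> \<le> norm d * Udev n i \<xi>"
proof -
  have "\<bar>Tf n i \<xi> d\<bar> \<le> (\<Sum>a\<in>UNIV. norm d * (\<Sum>r<2. \<bar>tau n i a r \<xi>\<bar>))"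
    unfolding Tf_expand
  proof (intro order_trans[OF sum_abs] sum_mono)
    fix a
    have "\<bar>fst d $ a * tau n i a 0 \<xi>\<bar> \<le> norm d * \<bar>tau n i a 0 \<xi>\<bar>" "\<bar>snd d $ a * tau n i a 1 \<xi>\<bar> \<le> norm d * \<bar>tau n i a 1 \<xi>\<bar>"
      unfolding abs_mult by (intro mult_right_mono component_le; simp)+
    then show "\<bar>fst d $ a * tau n i a 0 \<xi> + snd d $ a * tau n i a 1 \<xi>\<bar> \<le> norm d * (\<Sum>r<2. \<bar>tau n i a r \<xi>\<bar>)"
      by (simp add: eval_nat_numeral distrib_left)
  qed
  then show ?thesis by (simp add: Udev_def sum_distrib_left)
qed

lemma Bf_expand: "Bf n i \<xi> d = (\<Sum>a\<in>UNIV. \<Sum>b\<in>UNIV. fst d $ a * bmom n i a b 0 \<xi> + snd d $ a * bmom n i a b 1 \<xi>)"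
proof -
  have eq: "kw n i 0 j * (x n j \<xi> \<bullet> R n i j) * (x n j \<xi> \<bullet> (fst d + pos n i j *\<^sub>R snd d))
    = (\<Sum>a\<in>UNIV. \<Sum>b\<in>UNIV. fst d $ a * ((kw n i 0 j * R n i j $ b) * (x n j \<xi> $ a * x n j \<xi> $ b))
       + snd d $ a * ((kw n i 1 j * R n i j $ b) * (x n j \<xi> $ a * x n j \<xi> $ b)))" for j
  proof -
    have k: "kw n i 1 j = kw n i 0 j * pos n i j" by (simp add: kw_def)
    have "kw n i 0 j * (x n j \<xi> \<bullet> R n i j) * (x n j \<xi> \<bullet> (fst d + pos n i j *\<^sub>R snd d))
       = kw n i 0 j * ((x n j \<xi> \<bullet> (fst d + pos n i j *\<^sub>R snd d)) * (x n j \<xi> \<bullet> R n i j))" by simp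
    also have "\<dots> = (\<Sum>a\<in>UNIV. \<Sum>b\<in>UNIV. kw n i 0 j * ((x n j \<xi> $ a * (fst d $ a + pos n i j * snd d $ a)) * (x n j \<xi> $ b * R n i j $ b)))"
      by (simp add: inner_vec_def sum_product sum_distrib_left[symmetric])
    also have "\<dots> = (\<Sum>a\<in>UNIV. \<Sum>b\<in>UNIV. fst d $ a * ((kw n i 0 j * R n i j $ b) * (x n j \<xi> $ a * x n j \<xi> $ b))
       + snd d $ a * ((kw n i 1 j * R n i j $ b) * (x n j \<xi> $ a * x n j \<xi> $ b)))"
      unfolding k by (intro sum.cong refl) (simp add: algebra_simps)
    finally show ?thesis .
  qed
  show ?thesis
    unfolding Bf_def eq
    apply (subst sum.swap, rule sum.cong[OF refl], subst sum.swap, rule sum.cong[OF refl])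
    by (simp add: bmom_def sum.distrib sum_distrib_left)
qed

lemma BE_expand: "BE n i d = (\<Sum>a\<in>UNIV. \<Sum>b\<in>UNIV. fst d $ a * (\<integral>\<xi>. bmom n i a b 0 \<xi> \<partial>S) + snd d $ a * (\<integral>\<xi>. bmom n i a b 1 \<xi> \<partial>S))"
  unfolding BE_def Bf_expand using bmom_integrable by simp

lemma Bf_integrable: "integrable S (\<lambda>\<xi>. Bf n i \<xi> d)"
  unfolding Bf_expand using bmom_integrable by simp

lemma Bf_diff: "\<bar>Bf n i \<xi> d - BE n i d\<bar> \<le> norm d * Bdev n i \<xi>"
proof -
  define D where "D a b r = bmom n i a b r \<xi> - (\<integral>\<xi>. bmom n i a b r \<xi> \<partial>S)" for a b r
  have "Bf n i \<xi> d - BE n i d = (\<Sum>a\<in>UNIV. \<Sum>b\<in>UNIV. fst d $ a * D a b 0 + snd d $ a * D a b 1)"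
    unfolding Bf_expand BE_expand sum_subtractf[symmetric] D_def by (simp add: algebra_simps)
  also have "\<bar>\<dots>\<bar> \<le> (\<Sum>a\<in>UNIV. \<Sum>b\<in>UNIV. norm d * (\<Sum>r<2. \<bar>D a b r\<bar>))"
  proof (intro order_trans[OF sum_abs] sum_mono)
    fix a b
    have "\<bar>fst d $ a * D a b 0\<bar> \<le> norm d * \<bar>D a b 0\<bar>" "\<bar>snd d $ a * D a b 1\<bar> \<le> norm d * \<bar>D a b 1\<bar>"
      unfolding abs_mult by (intro mult_right_mono component_le; simp)+
    then show "\<bar>fst d $ a * D a b 0 + snd d $ a * D a b 1\<bar> \<le> norm d * (\<Sum>r<2. \<bar>D a b r\<bar>)"
      by (simp add: eval_nat_numeral distrib_left)
  qed
  finally show ?thesis by (simp add: Bdev_def D_def sum_distrib_left)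
qed

lemma regressor_le:
  assumes "\<bar>v\<bar> \<le> 1" shows "\<bar>(y :: real ^ 'p) \<bullet> (fst d + v *\<^sub>R snd d)\<bar> \<le> 2 * norm y * norm d"
proof -
  have "\<bar>v\<bar> * norm (snd d) \<le> 1 * norm (snd d)" using assms by (intro mult_right_mono) auto
  then have "norm (fst d + v *\<^sub>R snd d) \<le> norm (fst d) + norm (snd d)"
    using norm_triangle_ineq[of "fst d" "v *\<^sub>R snd d"] by simp
  also have "\<dots> \<le> 2 * norm d" using norm_fst_le[of "fst d" "snd d"] norm_snd_le[of "snd d" "fst d"] by simp
  finally have "norm y * norm (fst d + v *\<^sub>R snd d) \<le> norm y * (2 * norm d)" by (intro mult_left_mono) auto
  then show ?thesis using Cauchy_Schwarz_ineq2[of y "fst d + v *\<^sub>R snd d"] by simp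
qed

text \<open>A crude bound that holds for every outcome; it is used uniformly in \<open>i\<close>.\<close>

lemma Bf_le:
  assumes h1: "1 \<le> h n" and i: "i \<in> {1..n}"
  shows "\<bar>Bf n i \<xi> d\<bar> \<le> 2 * A\<^sup>2 * s n * norm d * Wsum n i \<xi>"
  unfolding Bf_def Wsum_def sum_distrib_left
proof (intro order_trans[OF sum_abs] sum_mono)
  fix j assume j: "j \<in> {1..n}"
  let ?r = "x n j \<xi> \<bullet> (fst d + pos n i j *\<^sub>R snd d)"
  show "\<bar>kw n i 0 j * (x n j \<xi> \<bullet> R n i j) * ?r\<bar>
    \<le> 2 * A\<^sup>2 * s n * norm d * (if \<bar>real j - real i\<bar> \<le> h n then (norm (x n j \<xi>))\<^sup>2 / h n else 0)"
  proof (cases "\<bar>real j - real i\<bar> \<le> h n")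
    case True
    have "\<bar>x n j \<xi> \<bullet> R n i j\<bar> \<le> norm (x n j \<xi>) * (A * s n)"
      using R[OF True i j] Cauchy_Schwarz_ineq2[of "x n j \<xi>" "R n i j"]
      by (meson mult_left_mono norm_ge_zero order_trans)
    moreover have "\<bar>?r\<bar> \<le> 2 * norm (x n j \<xi>) * norm d"
      using True pos_le[OF h1] by (intro regressor_le) auto
    ultimately have "\<bar>kw n i 0 j\<bar> * \<bar>x n j \<xi> \<bullet> R n i j\<bar> * \<bar>?r\<bar> \<le> (A / h n) * (norm (x n j \<xi>) * (A * s n)) * (2 * norm (x n j \<xi>) * norm d)"
      using A h1 s[of n] by (intro mult_mono kw_bound[OF h1]) auto
    also have "\<dots> = 2 * A\<^sup>2 * s n * norm d * ((norm (x n j \<xi>))\<^sup>2 / h n)" by (simp add: power2_eq_square)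
    finally show ?thesis using True by (simp add: abs_mult)
  qed (simp add: kw_zero[OF h1])
qed

lemma norm_x_sq: "(norm (x n j \<xi>))\<^sup>2 = (\<Sum>a\<in>UNIV. x n j \<xi> $ a * x n j \<xi> $ a)"
  by (simp add: power2_norm_eq_inner inner_vec_def)

lemma norm_x_sq_Lp: "i \<in> {1..n} \<Longrightarrow> Lp_le S 2 (\<lambda>\<xi>. (norm (x n i \<xi>))\<^sup>2) (p * A\<^sup>2)"
  using Lp_le_sum[of 2 "UNIV :: 'p set" S "\<lambda>a \<xi>. x n i \<xi> $ a * x n i \<xi> $ a" "\<lambda>_. A * A"] xx2[of i n]
  unfolding norm_x_sq by (simp add: p power2_eq_square)

lemma Wsum_Lp: assumes h1: "1 \<le> h n" shows "Lp_le S 1 (Wsum n i) (3 * p * A\<^sup>2)"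
proof -
  have pA: "0 \<le> p * A\<^sup>2" using p1 by simp
  have f1: "Lp_le S 1 (Wsum n i) (\<Sum>j=1..n. if \<bar>real j - real i\<bar> \<le> h n then p * A\<^sup>2 / h n else 0)"
    unfolding Wsum_def[abs_def]
  proof (rule Lp_le_sum)
    fix j assume j: "j \<in> {1..n}"
    show "Lp_le S 1 (\<lambda>\<xi>. if \<bar>real j - real i\<bar> \<le> h n then (norm (x n j \<xi>))\<^sup>2 / h n else 0) (if \<bar>real j - real i\<bar> \<le> h n then p * A\<^sup>2 / h n else 0)"
      using Lp_le_cmult[OF P.Lp_le_2_1[OF norm_x_sq_Lp[OF j]], of "1 / h n"] h1 Lp_le_zero[of 1 S] by simp
  qed simp
  have f2: "(\<Sum>j=1..n. if \<bar>real j - real i\<bar> \<le> h n then p * A\<^sup>2 / h n else 0) = real (card {j\<in>{1..n}. \<bar>real j - real i\<bar> \<le> h n}) * (p * A\<^sup>2 / h n)"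
    by (subst sum.inter_filter[symmetric]) auto
  have f3: "real (card {j\<in>{1..n}. \<bar>real j - real i\<bar> \<le> h n}) * (p * A\<^sup>2 / h n) \<le> (3 * h n) * (p * A\<^sup>2 / h n)"
    using card_window[of "h n" n "real i"] h1 pA by (intro mult_right_mono divide_nonneg_nonneg) auto
  have f4: "(3 * h n) * (p * A\<^sup>2 / h n) = 3 * p * A\<^sup>2" using h1 by simp
  show ?thesis by (rule Lp_le_weaken[OF f1]) (use f2 f3 f4 in linarith)
qed

lemma BE_le:
  assumes h1: "1 \<le> h n" and i: "i \<in> {1..n}"
  shows "\<bar>BE n i d\<bar> \<le> 6 * p * A ^ 4 * s n * norm d"
proof -
  have "Lp_le S 1 (\<lambda>\<xi>. Bf n i \<xi> d) ((2 * A\<^sup>2 * s n * norm d) * (3 * p * A\<^sup>2))"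
  proof (rule Lp_le_dominated)
    show "Lp_le S 1 (\<lambda>\<xi>. (2 * A\<^sup>2 * s n * norm d) * Wsum n i \<xi>) ((2 * A\<^sup>2 * s n * norm d) * (3 * p * A\<^sup>2))"
      using Lp_le_cmult[OF Wsum_Lp[OF h1, of i], of "2 * A\<^sup>2 * s n * norm d"] s[of n] by simp
    show "\<bar>Bf n i \<xi> d\<bar> \<le> \<bar>2 * A\<^sup>2 * s n * norm d * Wsum n i \<xi>\<bar>" for \<xi>
      using Bf_le[OF h1 i] by (rule order_trans) simp
  qed (use Bf_integrable in auto)
  from Lp_le_1(2)[OF this] show ?thesis
    unfolding BE_def by (simp add: power2_eq_square power4_eq_xxxx mult_ac)
qed

lemma Sf_add: "Sf n i \<xi> d (a + b) = Sf n i \<xi> d a + Sf n i \<xi> d b"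
  unfolding Sf_def sum.distrib[symmetric]
  by (intro sum.cong refl) (simp add: inner_add_right scaleR_add_right distrib_left)

lemma Sf_scale: "Sf n i \<xi> d (c *\<^sub>R a) = c * Sf n i \<xi> d a"
  unfolding Sf_def sum_distrib_left
proof (intro sum.cong refl)
  fix j
  have "x n j \<xi> \<bullet> (fst (c *\<^sub>R a) + pos n i j *\<^sub>R snd (c *\<^sub>R a)) = c * (x n j \<xi> \<bullet> (fst a + pos n i j *\<^sub>R snd a))"
    by (simp add: inner_add_right distrib_left)
  then show "kw n i 0 j * (x n j \<xi> \<bullet> (fst d + pos n i j *\<^sub>R snd d)) * (x n j \<xi> \<bullet> (fst (c *\<^sub>R a) + pos n i j *\<^sub>R snd (c *\<^sub>R a)))
    = c * (kw n i 0 j * (x n j \<xi> \<bullet> (fst d + pos n i j *\<^sub>R snd d)) * (x n j \<xi> \<bullet> (fst a + pos n i j *\<^sub>R snd a)))" by simp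
qed

lemma Sf_commute: "Sf n i \<xi> d d' = Sf n i \<xi> d' d"
  unfolding Sf_def by (intro sum.cong refl) simp

lemma SE_commute: "SE n i d d' = SE n i d' d" unfolding SE_def by (simp add: Sf_commute)

lemma SE_linear: "linear (SE n i d)" "linear (\<lambda>d. SE n i d d')"
proof -
  show lin: "linear (SE n i d)" for d
    by (rule linearI; simp add: SE_def Sf_add Sf_scale Sf_integrable)
  show "linear (\<lambda>d. SE n i d d')" using lin[of d'] by (simp add: SE_commute[of n i _ d'])
qed

end

section \<open>Truncated regressors on blocks\<close>

lemma abs_product_diff: "\<bar>a * b - a' * b'\<bar> \<le> \<bar>a - a'\<bar> * \<bar>b\<bar> + \<bar>a'\<bar> * \<bar>b - b'\<bar>" for a b a' b' :: real
proof -
  have eq: "a * b - a' * b' = (a - a') * b + a' * (b - b')" by algebra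
  show ?thesis unfolding eq abs_mult[symmetric] by (rule abs_triangle_ineq)
qed

text \<open>Radial truncation shrinks \<open>y \<bullet> u\<close> in every direction \<open>u\<close>, so that lower bounds for the truncated
  regressors are lower bounds for the regressors.\<close>

definition trunc :: "real \<Rightarrow> 'b::real_inner \<Rightarrow> 'b" where
  "trunc \<tau> y = min 1 (\<tau> / norm y) *\<^sub>R y"

lemma trunc_norm: assumes "0 < \<tau>" shows "norm (trunc \<tau> y) \<le> \<tau>"
  using assms by (cases "y = 0") (auto simp: trunc_def min_def field_simps)

lemma trunc_factor: assumes "0 < \<tau>" shows "0 \<le> min 1 (\<tau> / norm y)" "min 1 (\<tau> / norm y) \<le> 1"
  using assms by auto

lemma trunc_inner_le: assumes "0 < \<tau>" shows "(trunc \<tau> y \<bullet> u)\<^sup>2 \<le> (y \<bullet> u)\<^sup>2"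
proof -
  have "(min 1 (\<tau> / norm y))\<^sup>2 * (y \<bullet> u)\<^sup>2 \<le> 1 * (y \<bullet> u)\<^sup>2"
    using trunc_factor[OF assms, of y] by (intro mult_right_mono power_le_one) auto
  then show ?thesis by (simp add: trunc_def power_mult_distrib)
qed

lemma trunc_lipschitz: assumes \<tau>: "0 < \<tau>" shows "norm (trunc \<tau> x - trunc \<tau> y) \<le> 2 * norm (x - y)"
proof -
  have *: "norm (trunc \<tau> x - trunc \<tau> y) \<le> 2 * norm (x - y)" if le: "norm x \<le> norm y" for x y :: 'a
  proof (cases "x = 0")
    case True
    have "norm (trunc \<tau> y) = min 1 (\<tau> / norm y) * norm y" using trunc_factor[OF \<tau>, of y] by (simp add: trunc_def)
    also have "\<dots> \<le> 1 * norm y" using trunc_factor[OF \<tau>, of y] by (intro mult_right_mono) auto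
    finally have "norm (trunc \<tau> y) \<le> 2 * norm y" using norm_ge_zero[of y] by linarith
    then show ?thesis using True by (simp add: trunc_def[of \<tau> 0])
  next
    case False
    define a where "a = min 1 (\<tau> / norm x)"
    define b where "b = min 1 (\<tau> / norm y)"
    have x0: "norm x > 0" "norm y > 0" using False le by (auto intro: less_le_trans)
    have "\<tau> / norm y \<le> \<tau> / norm x" using \<tau> x0 le by (intro divide_left_mono) auto
    then have ba: "b \<le> a" by (auto simp: a_def b_def)
    have a: "0 \<le> a" "a \<le> 1" using trunc_factor[OF \<tau>] by (auto simp: a_def)
    have key: "(a - b) * norm y \<le> norm y - norm x"
    proof (cases "norm x \<le> \<tau>")
      case True
      then have "a = 1" using x0 by (simp add: a_def)
      moreover have "norm x \<le> b * norm y" using x0 True le by (auto simp: b_def min_def field_simps)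
      ultimately show ?thesis by (simp add: algebra_simps)
    next
      case False
      then have "a = \<tau> / norm x" "b = \<tau> / norm y" using x0 le by (auto simp: a_def b_def min_def field_simps)
      then have "(a - b) * norm y = (\<tau> / norm x) * (norm y - norm x)" using x0 by (simp add: field_simps)
      also have "\<dots> \<le> 1 * (norm y - norm x)" using False \<tau> le x0 by (intro mult_right_mono) (auto simp: field_simps)
      finally show ?thesis by simp
    qed
    have "trunc \<tau> x - trunc \<tau> y = a *\<^sub>R (x - y) + (a - b) *\<^sub>R y"
      by (simp add: trunc_def a_def[symmetric] b_def[symmetric] algebra_simps)
    then have "norm (trunc \<tau> x - trunc \<tau> y) \<le> a * norm (x - y) + (a - b) * norm y"
      using norm_triangle_ineq[of "a *\<^sub>R (x - y)" "(a - b) *\<^sub>R y"] a ba by simp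
    also have "a * norm (x - y) \<le> 1 * norm (x - y)" using a by (intro mult_right_mono) auto
    finally show ?thesis using key norm_triangle_ineq2[of y x] by (simp add: norm_minus_commute)
  qed
  show ?thesis
    using *[of x y] *[of y x] by (cases "norm x \<le> norm y") (auto simp: norm_minus_commute)
qed

text \<open>Truncation acts only where \<open>norm y > \<tau>\<close>, and there \<open>1 \<le> (norm y)\<^sup>2 / \<tau>\<^sup>2\<close>.\<close>

lemma trunc_loss:
  assumes \<tau>: "0 < \<tau>" shows "(y \<bullet> u)\<^sup>2 - (trunc \<tau> y \<bullet> u)\<^sup>2 \<le> (norm u)\<^sup>2 / \<tau>\<^sup>2 * ((norm y)\<^sup>2)\<^sup>2"
proof (cases "norm y \<le> \<tau>")
  case True
  then have "trunc \<tau> y = y" by (cases "y = 0") (auto simp: trunc_def min_def)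
  then show ?thesis by simp
next
  case False
  then have ge: "1 \<le> (norm y)\<^sup>2 / \<tau>\<^sup>2" using \<tau> by (simp add: power_mono)
  have "(y \<bullet> u)\<^sup>2 \<le> (norm y * norm u)\<^sup>2" using Cauchy_Schwarz_ineq2[of y u] by (simp add: abs_le_square_iff[symmetric])
  also have "\<dots> = 1 * ((norm y)\<^sup>2 * (norm u)\<^sup>2)" by (simp add: power_mult_distrib)
  also have "\<dots> \<le> (norm y)\<^sup>2 / \<tau>\<^sup>2 * ((norm y)\<^sup>2 * (norm u)\<^sup>2)" by (intro mult_right_mono ge) simp
  also have "\<dots> = (norm u)\<^sup>2 / \<tau>\<^sup>2 * ((norm y)\<^sup>2)\<^sup>2" by (simp add: power2_eq_square)
  finally show ?thesis using zero_le_power2[of "trunc \<tau> y \<bullet> u"] by linarith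
qed

text \<open>An interval of length \<open>2 m\<close> contains a full cell of the partition into cells of length \<open>m\<close>.\<close>

lemma block_inside:
  fixes \<alpha> \<beta> :: real
  assumes m: "1 \<le> (m::nat)" and ab: "0 \<le> \<alpha>" "\<alpha> + 2 * real m \<le> \<beta>" "\<beta> \<le> real n"
  obtains k where "k < n div m" "\<And>j. j \<in> {k * m<..k * m + m} \<Longrightarrow> \<alpha> < real j \<and> real j \<le> \<beta>"
proof -
  define k where "k = nat \<lceil>\<alpha> / real m\<rceil>"
  have "0 \<le> \<alpha> / real m" using ab by simp
  then have k1: "\<alpha> / real m \<le> real k" and k2: "real k < \<alpha> / real m + 1" unfolding k_def by linarith+
  have le: "\<alpha> \<le> real k * real m" using k1 m by (simp add: pos_divide_le_eq)
  have "real k * real m < (\<alpha> / real m + 1) * real m" using k2 m by (intro mult_strict_right_mono) auto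
  then have lt: "real k * real m < \<alpha> + real m" using m by (simp add: distrib_right)
  have in_block: "\<alpha> < real j \<and> real j \<le> \<beta>" if "j \<in> {k * m<..k * m + m}" for j
  proof -
    have "real (k * m) < real j" "real j \<le> real (k * m + m)" using that by (simp_all only: of_nat_less_iff of_nat_le_iff) auto
    then show ?thesis using le lt ab by simp
  qed
  have "real ((k + 1) * m) \<le> real n" using lt ab by (simp add: distrib_right)
  then have "(k + 1) * m \<le> n" by (simp only: of_nat_le_iff)
  then have "k + 1 \<le> n div m" using m by (simp add: less_eq_div_iff_mult_less_eq)
  then show ?thesis using in_block by (intro that[of k]) auto
qed

lemma norm_prod_sq: "(norm d)\<^sup>2 = (norm (fst d))\<^sup>2 + (norm (snd d))\<^sup>2"
  by (simp add: norm_prod_def)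

text \<open>Values of the affine map \<open>v \<mapsto> u + v *\<^sub>R z\<close> at two separated points determine \<open>u\<close> and \<open>z\<close>.\<close>

lemma two_point_bound:
  fixes u z :: "'b::real_inner"
  assumes d: "0 < \<delta>" "\<delta> \<le> 1" "\<delta> \<le> \<bar>v - v'\<bar>" and v: "\<bar>v\<bar> \<le> 1"
  shows "\<delta>\<^sup>2 / 8 * ((norm u)\<^sup>2 + (norm z)\<^sup>2) \<le> (norm (u + v *\<^sub>R z))\<^sup>2 + (norm (u + v' *\<^sub>R z))\<^sup>2"
proof -
  define q where "q = (norm (u + v *\<^sub>R z))\<^sup>2 + (norm (u + v' *\<^sub>R z))\<^sup>2"
  have par: "(norm (a - b))\<^sup>2 \<le> 2 * (norm a)\<^sup>2 + 2 * (norm b)\<^sup>2" for a b :: 'b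
    using zero_le_power2[of "norm (a + b)"] by (simp add: power2_norm_eq_inner inner_diff_left inner_diff_right inner_add_left inner_add_right inner_commute)
  have "\<delta>\<^sup>2 * (norm z)\<^sup>2 \<le> \<bar>v - v'\<bar>\<^sup>2 * (norm z)\<^sup>2" using d by (intro mult_right_mono power_mono) auto
  also have "\<dots> = (norm ((u + v *\<^sub>R z) - (u + v' *\<^sub>R z)))\<^sup>2"
    by (simp add: scaleR_diff_left[symmetric] power_mult_distrib)
  also have "\<dots> \<le> 2 * q" using par[of "u + v *\<^sub>R z" "u + v' *\<^sub>R z"] by (simp add: q_def)
  finally have z: "\<delta>\<^sup>2 * (norm z)\<^sup>2 \<le> 2 * q" .
  have "v\<^sup>2 * (norm z)\<^sup>2 \<le> 1 * (norm z)\<^sup>2" using v by (intro mult_right_mono) (auto simp: abs_square_le_1)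
  then have "(norm (v *\<^sub>R z))\<^sup>2 \<le> (norm z)\<^sup>2" by (simp add: power_mult_distrib)
  moreover have "(norm u)\<^sup>2 \<le> 2 * (norm (u + v *\<^sub>R z))\<^sup>2 + 2 * (norm (v *\<^sub>R z))\<^sup>2"
    using par[of "u + v *\<^sub>R z" "v *\<^sub>R z"] by simp
  moreover have "(norm (u + v *\<^sub>R z))\<^sup>2 \<le> q" by (simp add: q_def)
  ultimately have "(norm u)\<^sup>2 \<le> 2 * q + 2 * (norm z)\<^sup>2"
    by (meson add_mono mult_left_mono order_trans zero_le_numeral)
  then have "\<delta>\<^sup>2 * (norm u)\<^sup>2 \<le> \<delta>\<^sup>2 * (2 * q + 2 * (norm z)\<^sup>2)" by (intro mult_left_mono) auto
  moreover have "\<delta>\<^sup>2 * q \<le> 1 * q" using d by (intro mult_right_mono power_le_one) (auto simp: q_def)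
  ultimately have "\<delta>\<^sup>2 * (norm u)\<^sup>2 + \<delta>\<^sup>2 * (norm z)\<^sup>2 \<le> 8 * q" using z by (simp add: algebra_simps)
  then show ?thesis by (simp add: q_def algebra_simps)
qed

context regression_array
begin

text \<open>At this radius truncation loses at most half of the coercivity constant \<open>l\<close>.\<close>

definition "\<tau> = p * A\<^sup>2 * sqrt (2 / l)"

lemma \<tau>: "0 < \<tau>" "\<tau>\<^sup>2 = 2 * (p * A\<^sup>2)\<^sup>2 / l"
  using p1 A l by (auto simp: \<tau>_def power_mult_distrib)

abbreviation "xt n i \<xi> \<equiv> trunc \<tau> (x n i \<xi>)"

lemma x_measurable[measurable]: "i \<in> {1..n} \<Longrightarrow> x n i \<in> borel_measurable S"
  by (subst borel_measurable_euclidean_space) (auto simp: Basis_vec_def inner_axis xm)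

lemma xt_measurable[measurable]:
  assumes i: "i \<in> {1..n}" shows "(\<lambda>\<xi>. xt n i \<xi> $ a) \<in> borel_measurable S"
proof -
  note [measurable] = x_measurable[OF i] xm[OF i]
  show ?thesis unfolding trunc_def vector_scaleR_component by measurable
qed

lemma xt_bound: "\<bar>xt n i \<xi> $ a\<bar> \<le> \<tau>"
  using component_le_norm_cart[of "xt n i \<xi>" a] trunc_norm[OF \<tau>(1), of "x n i \<xi>"] by linarith

lemma xtxt_bounded: "i \<in> {1..n} \<Longrightarrow> Lp_le S q (\<lambda>\<xi>. xt n i \<xi> $ a * xt n i \<xi> $ b) (\<tau> * \<tau>)"
  using \<tau>(1) by (intro P.Lp_le_bounded) (auto simp: abs_mult intro!: mult_mono xt_bound)

text \<open>Products of regressors have influences in \<open>L\<^sub>2\<close> only. Products of truncated regressors are Lipschitz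
  functions of the regressors, hence have influences in \<open>L\<^sub>4\<close>; the resulting fourth moments are
  needed for a union bound over blocks.\<close>

lemma weak_xt: "weak_array 4 n (w n) (4 * \<tau> * p) (\<lambda>i \<xi>. xt n i \<xi> $ a * xt n i \<xi> $ b)"
  unfolding weak_array_def
proof (intro conjI ballI allI)
  fix i k assume i: "i \<in> {1..n}"
  show "integrable S (\<lambda>\<xi>. xt n i \<xi> $ a * xt n i \<xi> $ b)" by (rule Lp_le_1(1)[OF xtxt_bounded[OF i]])
  show "influence 4 (\<lambda>\<xi>. xt n i \<xi> $ a * xt n i \<xi> $ b) k (4 * \<tau> * p * w n i k)"
    unfolding influence_def
  proof (rule Lp_le_dominated)
    have "Lp_le (M \<Otimes>\<^sub>M S) 4 (\<lambda>z. \<Sum>c\<in>(UNIV :: 'p set). \<bar>(\<lambda>(s, \<xi>). x n i \<xi> $ c - x n i ((\<xi>)(k := s)) $ c) z\<bar>) (\<Sum>c\<in>(UNIV :: 'p set). w n i k)"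
      using xd[OF i] unfolding influence_def by (intro Lp_le_sum Lp_le_abs) auto
    from Lp_le_cmult[OF this, of "4 * \<tau>"]
    show "Lp_le (M \<Otimes>\<^sub>M S) 4 (\<lambda>z. 4 * \<tau> * (\<Sum>c\<in>(UNIV :: 'p set). \<bar>(\<lambda>(s, \<xi>). x n i \<xi> $ c - x n i ((\<xi>)(k := s)) $ c) z\<bar>)) (4 * \<tau> * p * w n i k)"
      using \<tau>(1) by (simp add: p mult_ac)
    show "(\<lambda>(s, \<xi>). xt n i \<xi> $ a * xt n i \<xi> $ b - xt n i ((\<xi>)(k := s)) $ a * xt n i ((\<xi>)(k := s)) $ b) \<in> borel_measurable (M \<Otimes>\<^sub>M S)"
      by (intro influence_measurable borel_measurable_times xt_measurable i)
    fix z :: "'s \<times> (nat \<Rightarrow> 's)"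
    obtain s \<xi> where z: "z = (s, \<xi>)" by fastforce
    let ?y = "x n i \<xi>" and ?y' = "x n i ((\<xi>)(k := s))"
    let ?a = "trunc \<tau> ?y $ a" and ?a' = "trunc \<tau> ?y' $ a" and ?b = "trunc \<tau> ?y $ b" and ?b' = "trunc \<tau> ?y' $ b"
    have lip: "\<bar>trunc \<tau> ?y $ c - trunc \<tau> ?y' $ c\<bar> \<le> 2 * norm (?y - ?y')" for c
      using component_le_norm_cart[of "trunc \<tau> ?y - trunc \<tau> ?y'" c] trunc_lipschitz[OF \<tau>(1), of ?y ?y'] by simp
    have "\<bar>?a * ?b - ?a' * ?b'\<bar> \<le> \<bar>?a - ?a'\<bar> * \<bar>?b\<bar> + \<bar>?a'\<bar> * \<bar>?b - ?b'\<bar>"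
      by (rule abs_product_diff)
    also have "\<dots> \<le> (2 * norm (?y - ?y')) * \<tau> + \<tau> * (2 * norm (?y - ?y'))"
      using \<tau>(1) by (intro add_mono mult_mono lip xt_bound) auto
    also have "\<dots> = 4 * \<tau> * norm (?y - ?y')" by simp
    also have "\<dots> \<le> 4 * \<tau> * (\<Sum>c\<in>UNIV. \<bar>?y $ c - ?y' $ c\<bar>)"
      using norm_le_l1_cart[of "?y - ?y'"] \<tau>(1) by (intro mult_left_mono) auto
    finally show "\<bar>(\<lambda>(s, \<xi>). xt n i \<xi> $ a * xt n i \<xi> $ b - xt n i ((\<xi>)(k := s)) $ a * xt n i ((\<xi>)(k := s)) $ b) z\<bar>
       \<le> \<bar>4 * \<tau> * (\<Sum>c\<in>(UNIV :: 'p set). \<bar>(\<lambda>(s, \<xi>). x n i \<xi> $ c - x n i ((\<xi>)(k := s)) $ c) z\<bar>)\<bar>"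
      by (simp add: z)
  qed
qed (use \<tau>(1) p1 in simp)

lemma xt_coercive: assumes i: "i \<in> {1..n}" shows "l / 2 * (norm u)\<^sup>2 \<le> (\<integral>\<xi>. (xt n i \<xi> \<bullet> u)\<^sup>2 \<partial>S)"
proof -
  note X = norm_x_sq_Lp[OF i]
  have i4: "integrable S (\<lambda>\<xi>. ((norm (x n i \<xi>))\<^sup>2)\<^sup>2)" and m4: "(\<integral>\<xi>. ((norm (x n i \<xi>))\<^sup>2)\<^sup>2 \<partial>S) \<le> (p * A\<^sup>2)\<^sup>2"
    using Lp_le_integral[OF X] by (simp_all add: power2_abs)
  have "integrable S (\<lambda>\<xi>. (norm (x n i \<xi>))\<^sup>2)" by (rule Lp_le_1(1)[OF P.Lp_le_2_1[OF X]])
  then have "integrable S (\<lambda>\<xi>. (norm u)\<^sup>2 * (norm (x n i \<xi>))\<^sup>2)" by simp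
  then have ixu: "integrable S (\<lambda>\<xi>. (x n i \<xi> \<bullet> u)\<^sup>2)"
  proof (rule Bochner_Integration.integrable_bound)
    show "AE \<xi> in S. norm ((x n i \<xi> \<bullet> u)\<^sup>2) \<le> norm ((norm u)\<^sup>2 * (norm (x n i \<xi>))\<^sup>2)"
      using Cauchy_Schwarz_ineq2[of "x n i _" u]
      by (auto simp: abs_le_square_iff[symmetric] power_mult_distrib[symmetric] mult.commute)
  qed (use i in measurable)
  then have ixt: "integrable S (\<lambda>\<xi>. (xt n i \<xi> \<bullet> u)\<^sup>2)"
  proof (rule Bochner_Integration.integrable_bound)
    show "AE \<xi> in S. norm ((xt n i \<xi> \<bullet> u)\<^sup>2) \<le> norm ((x n i \<xi> \<bullet> u)\<^sup>2)"
      using trunc_inner_le[OF \<tau>(1)] by auto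
  qed (use i in \<open>unfold trunc_def, measurable\<close>)
  have "(\<integral>\<xi>. (x n i \<xi> \<bullet> u)\<^sup>2 \<partial>S) \<le> (\<integral>\<xi>. (xt n i \<xi> \<bullet> u)\<^sup>2 + (norm u)\<^sup>2 / \<tau>\<^sup>2 * ((norm (x n i \<xi>))\<^sup>2)\<^sup>2 \<partial>S)"
  proof (rule integral_mono[OF ixu])
    show "integrable S (\<lambda>\<xi>. (xt n i \<xi> \<bullet> u)\<^sup>2 + (norm u)\<^sup>2 / \<tau>\<^sup>2 * ((norm (x n i \<xi>))\<^sup>2)\<^sup>2)"
      by (intro Bochner_Integration.integrable_add ixt integrable_mult_right i4)
    show "(x n i \<xi> \<bullet> u)\<^sup>2 \<le> (xt n i \<xi> \<bullet> u)\<^sup>2 + (norm u)\<^sup>2 / \<tau>\<^sup>2 * ((norm (x n i \<xi>))\<^sup>2)\<^sup>2" for \<xi>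
      using trunc_loss[OF \<tau>(1), of "x n i \<xi>" u] by linarith
  qed
  also have "\<dots> = (\<integral>\<xi>. (xt n i \<xi> \<bullet> u)\<^sup>2 \<partial>S) + (norm u)\<^sup>2 / \<tau>\<^sup>2 * (\<integral>\<xi>. ((norm (x n i \<xi>))\<^sup>2)\<^sup>2 \<partial>S)"
    using ixt i4 by simp
  also have "(norm u)\<^sup>2 / \<tau>\<^sup>2 * (\<integral>\<xi>. ((norm (x n i \<xi>))\<^sup>2)\<^sup>2 \<partial>S) \<le> (norm u)\<^sup>2 / \<tau>\<^sup>2 * (p * A\<^sup>2)\<^sup>2"
    using m4 by (intro mult_left_mono) auto
  also have "\<dots> = l / 2 * (norm u)\<^sup>2" using \<tau> p1 A l by (simp add: field_simps)
  finally show ?thesis using coercive[OF i, of u] by (simp add: algebra_simps)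
qed

lemma xtxt_expand: "(xt n j \<xi> \<bullet> u)\<^sup>2 = (\<Sum>a\<in>UNIV. \<Sum>b\<in>UNIV. (u $ a * u $ b) * (xt n j \<xi> $ a * xt n j \<xi> $ b))"
  by (simp add: inner_vec_def power2_eq_square sum_product mult_ac)

lemma xtxt_expectation: "j \<in> {1..n} \<Longrightarrow> (\<integral>\<xi>. (xt n j \<xi> \<bullet> u)\<^sup>2 \<partial>S) = (\<Sum>a\<in>UNIV. \<Sum>b\<in>UNIV. (u $ a * u $ b) * (\<integral>\<xi>. xt n j \<xi> $ a * xt n j \<xi> $ b \<partial>S))"
  unfolding xtxt_expand using Lp_le_1(1)[OF xtxt_bounded] by simp

definition block :: "nat \<Rightarrow> nat \<Rightarrow> nat set" where "block m k = {k * m<..k * m + m}"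

definition block_dev where
  "block_dev n m k a b \<xi> = (\<Sum>j\<in>block m k. xt n j \<xi> $ a * xt n j \<xi> $ b - (\<integral>\<xi>. xt n j \<xi> $ a * xt n j \<xi> $ b \<partial>S))"

lemma block_card: "card (block m k) = m" by (simp add: block_def)

lemma block_subset: assumes "k < n div m" shows "block m k \<subseteq> {1..n}"
proof -
  have "k * m + m = Suc k * m" by simp
  also have "\<dots> \<le> (n div m) * m" using assms by (intro mult_right_mono) auto
  also have "\<dots> \<le> n" by simp
  finally show ?thesis by (auto simp: block_def)
qed

lemma block_dev_Lp:
  assumes k: "k < n div m" shows "Lp_le S 4 (block_dev n m k a b) (8 * \<tau> * p * A * sqrt m)"
proof -
  let ?c = "\<lambda>j. if j \<in> block m k then 1 else 0 :: real"
  have "(\<Sum>j=1..n. ?c j * (xt n j \<xi> $ a * xt n j \<xi> $ b - (\<integral>\<xi>. xt n j \<xi> $ a * xt n j \<xi> $ b \<partial>S))) = block_dev n m k a b \<xi>" for \<xi>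
    unfolding block_dev_def using block_subset[OF k] by (intro sum.mono_neutral_cong_right) auto
  moreover have "(\<Sum>j=1..n. (?c j)\<^sup>2) = (\<Sum>j\<in>block m k. 1)"
    using block_subset[OF k] by (intro sum.mono_neutral_cong_right) auto
  ultimately show ?thesis using weak_array_linear_4[OF w weak_xt[of n a b], of ?c] by (simp add: block_card mult_ac)
qed

text \<open>The \<open>p\<^sup>2\<close> entries of the empirical second moment matrix deviate so little from their means that
  the form in direction \<open>u\<close> loses at most half of the lower bound of its mean.\<close>

lemma block_lower_bound:
  assumes k: "k < n div m"
    and dev: "\<And>a b. \<bar>block_dev n m k a b \<xi>\<bar> \<le> real m * l / (4 * p\<^sup>2)"
  shows "real m * l / 4 * (norm u)\<^sup>2 \<le> (\<Sum>j\<in>block m k. (xt n j \<xi> \<bullet> u)\<^sup>2)"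
proof -
  have J: "block m k \<subseteq> {1..n}" by (rule block_subset[OF k])
  have "(\<Sum>j\<in>block m k. (xt n j \<xi> \<bullet> u)\<^sup>2) - (\<Sum>j\<in>block m k. (\<integral>\<xi>. (xt n j \<xi> \<bullet> u)\<^sup>2 \<partial>S))
    = (\<Sum>j\<in>block m k. \<Sum>a\<in>UNIV. \<Sum>b\<in>UNIV. (u $ a * u $ b) * (xt n j \<xi> $ a * xt n j \<xi> $ b - (\<integral>\<xi>. xt n j \<xi> $ a * xt n j \<xi> $ b \<partial>S)))"
    unfolding sum_subtractf[symmetric]
  proof (rule sum.cong[OF refl])
    fix j assume "j \<in> block m k"
    then have j: "j \<in> {1..n}" using J by auto
    show "(xt n j \<xi> \<bullet> u)\<^sup>2 - (\<integral>\<xi>. (xt n j \<xi> \<bullet> u)\<^sup>2 \<partial>S)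
      = (\<Sum>a\<in>UNIV. \<Sum>b\<in>UNIV. (u $ a * u $ b) * (xt n j \<xi> $ a * xt n j \<xi> $ b - (\<integral>\<xi>. xt n j \<xi> $ a * xt n j \<xi> $ b \<partial>S)))"
      unfolding xtxt_expectation[OF j] xtxt_expand[of n j \<xi>] by (simp only: sum_subtractf[symmetric] right_diff_distrib)
  qed
  also have "\<dots> = (\<Sum>a\<in>UNIV. \<Sum>b\<in>UNIV. (u $ a * u $ b) * block_dev n m k a b \<xi>)"
    unfolding block_dev_def sum_distrib_left
    apply (subst sum.swap, rule sum.cong[OF refl])
    by (rule sum.swap)
  also have "\<bar>\<dots>\<bar> \<le> (\<Sum>a\<in>(UNIV::'p set). \<Sum>b\<in>(UNIV::'p set). (norm u)\<^sup>2 * (real m * l / (4 * p\<^sup>2)))"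
  proof (intro order_trans[OF sum_abs] sum_mono)
    fix a b
    have "\<bar>u $ a\<bar> * \<bar>u $ b\<bar> \<le> norm u * norm u" by (intro mult_mono component_le_norm_cart) auto
    then show "\<bar>u $ a * u $ b * block_dev n m k a b \<xi>\<bar> \<le> (norm u)\<^sup>2 * (real m * l / (4 * p\<^sup>2))"
      unfolding abs_mult power2_eq_square[of "norm u"] by (rule mult_mono[OF _ dev]) auto
  qed
  also have "\<dots> = real m * l / 4 * (norm u)\<^sup>2" using p1 by (simp add: p[symmetric] power2_eq_square)
  finally have d: "\<bar>(\<Sum>j\<in>block m k. (xt n j \<xi> \<bullet> u)\<^sup>2) - (\<Sum>j\<in>block m k. (\<integral>\<xi>. (xt n j \<xi> \<bullet> u)\<^sup>2 \<partial>S))\<bar> \<le> real m * l / 4 * (norm u)\<^sup>2" .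
  have "real m * (l / 2 * (norm u)\<^sup>2) = (\<Sum>j\<in>block m k. l / 2 * (norm u)\<^sup>2)" by (simp add: block_card)
  also have "\<dots> \<le> (\<Sum>j\<in>block m k. (\<integral>\<xi>. (xt n j \<xi> \<bullet> u)\<^sup>2 \<partial>S))"
    using J by (intro sum_mono xt_coercive) auto
  finally have "real m * (l / 2 * (norm u)\<^sup>2) \<le> (\<Sum>j\<in>block m k. (\<integral>\<xi>. (xt n j \<xi> \<bullet> u)\<^sup>2 \<partial>S))" .
  moreover have "real m * (l / 2 * (norm u)\<^sup>2) = 2 * (real m * l / 4 * (norm u)\<^sup>2)" by simp
  ultimately show ?thesis using d by linarith
qed

text \<open>The kernel is at least \<open>\<kappa>\<close> between \<open>v1\<close> and \<open>v2\<close>. Two blocks are placed in the outer thirds of this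
  range, so that they are \<open>\<delta>\<close> apart. Their relative length \<open>\<eta>\<close> is so small that replacing the positions
  within a block by a single one costs at most half of the lower bound for the design.\<close>

definition "\<delta> = (v2 - v1) / 3"
definition "\<eta> = min (\<delta> / 2) (\<delta> * sqrt l / (16 * \<tau>))"
definition "c0 = \<kappa> * (\<eta> / 2) * l * \<delta>\<^sup>2 / 128"
definition "bl n = nat \<lfloor>\<eta> * h n\<rfloor>"

lemma \<delta>: "0 < \<delta>" "\<delta> \<le> 1" using v12 by (auto simp: \<delta>_def)
lemma \<eta>: "0 < \<eta>" "\<eta> \<le> \<delta> / 2" "2 * \<tau>\<^sup>2 * \<eta>\<^sup>2 \<le> l * \<delta>\<^sup>2 / 128"
proof -
  show "0 < \<eta>" using \<delta> \<tau>(1) l by (simp add: \<eta>_def)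
  then have "\<eta>\<^sup>2 \<le> (\<delta> * sqrt l / (16 * \<tau>))\<^sup>2" by (intro power_mono) (auto simp: \<eta>_def)
  also have "\<dots> = \<delta>\<^sup>2 * l / (256 * \<tau>\<^sup>2)" using l by (simp add: power_divide power_mult_distrib)
  finally have "2 * \<tau>\<^sup>2 * \<eta>\<^sup>2 \<le> 2 * \<tau>\<^sup>2 * (\<delta>\<^sup>2 * l / (256 * \<tau>\<^sup>2))" by (intro mult_left_mono) auto
  also have "\<dots> = l * \<delta>\<^sup>2 / 128" using \<tau>(1) by simp
  finally show "2 * \<tau>\<^sup>2 * \<eta>\<^sup>2 \<le> l * \<delta>\<^sup>2 / 128" .
qed (simp add: \<eta>_def)

lemma c0: "0 < c0" using \<kappa>(1) \<eta>(1) l \<delta>(1) by (simp add: c0_def)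

text \<open>Within a block the affine function of the position is almost the constant vector \<open>u + v0 *\<^sub>R z\<close>.\<close>

lemma block_affine_bound:
  assumes k: "k < n div m" and dev: "\<And>a b. \<bar>block_dev n m k a b \<xi>\<bar> \<le> real m * l / (4 * p\<^sup>2)"
    and near: "\<And>j. j \<in> block m k \<Longrightarrow> \<bar>v j - v0\<bar> \<le> \<eta>"
  shows "real m * (l / 8 * (norm (u + v0 *\<^sub>R z))\<^sup>2 - \<tau>\<^sup>2 * \<eta>\<^sup>2 * (norm z)\<^sup>2) \<le> (\<Sum>j\<in>block m k. (x n j \<xi> \<bullet> (u + v j *\<^sub>R z))\<^sup>2)"
proof -
  have each: "(xt n j \<xi> \<bullet> (u + v0 *\<^sub>R z))\<^sup>2 / 2 - \<tau>\<^sup>2 * \<eta>\<^sup>2 * (norm z)\<^sup>2 \<le> (x n j \<xi> \<bullet> (u + v j *\<^sub>R z))\<^sup>2" if j: "j \<in> block m k" for j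
  proof -
    let ?p = "xt n j \<xi> \<bullet> (u + v0 *\<^sub>R z)" and ?q = "xt n j \<xi> \<bullet> ((v j - v0) *\<^sub>R z)"
    have "\<bar>?q\<bar> \<le> norm (xt n j \<xi>) * (\<bar>v j - v0\<bar> * norm z)"
      using Cauchy_Schwarz_ineq2[of "xt n j \<xi>" "(v j - v0) *\<^sub>R z"] by simp
    also have "\<dots> \<le> \<tau> * (\<eta> * norm z)"
      using \<tau>(1) near[OF j] by (intro mult_mono trunc_norm) auto
    finally have "?q\<^sup>2 \<le> (\<tau> * (\<eta> * norm z))\<^sup>2" by (subst power2_abs[symmetric]) (rule power_mono, auto)
    moreover have "?p\<^sup>2 / 2 - ?q\<^sup>2 \<le> (?p + ?q)\<^sup>2"
    proof -
      have "(?p + ?q)\<^sup>2 - (?p\<^sup>2 / 2 - ?q\<^sup>2) = (?p + 2 * ?q)\<^sup>2 / 2" by (simp add: power2_eq_square field_simps)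
      then show ?thesis using zero_le_power2[of "?p + 2 * ?q"] by linarith
    qed
    moreover have "?p + ?q = xt n j \<xi> \<bullet> (u + v j *\<^sub>R z)"
      by (simp add: inner_add_right[symmetric] scaleR_diff_left)
    moreover have "(xt n j \<xi> \<bullet> (u + v j *\<^sub>R z))\<^sup>2 \<le> (x n j \<xi> \<bullet> (u + v j *\<^sub>R z))\<^sup>2"
      by (rule trunc_inner_le[OF \<tau>(1)])
    ultimately show ?thesis by (simp add: power_mult_distrib mult_ac)
  qed
  have "real m * (l / 8 * (norm (u + v0 *\<^sub>R z))\<^sup>2 - \<tau>\<^sup>2 * \<eta>\<^sup>2 * (norm z)\<^sup>2)
     = (real m * l / 4 * (norm (u + v0 *\<^sub>R z))\<^sup>2) / 2 - real m * (\<tau>\<^sup>2 * \<eta>\<^sup>2 * (norm z)\<^sup>2)"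
    by (simp add: algebra_simps)
  also have "\<dots> \<le> (\<Sum>j\<in>block m k. (xt n j \<xi> \<bullet> (u + v0 *\<^sub>R z))\<^sup>2) / 2 - real m * (\<tau>\<^sup>2 * \<eta>\<^sup>2 * (norm z)\<^sup>2)"
    using block_lower_bound[OF k dev, of "u + v0 *\<^sub>R z"] by (intro diff_right_mono divide_right_mono) auto
  also have "\<dots> = (\<Sum>j\<in>block m k. (xt n j \<xi> \<bullet> (u + v0 *\<^sub>R z))\<^sup>2 / 2 - \<tau>\<^sup>2 * \<eta>\<^sup>2 * (norm z)\<^sup>2)"
    by (simp add: sum_subtractf sum_divide_distrib block_card)
  also have "\<dots> \<le> (\<Sum>j\<in>block m k. (x n j \<xi> \<bullet> (u + v j *\<^sub>R z))\<^sup>2)" by (intro sum_mono each)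
  finally show ?thesis .
qed

end

section \<open>Invertibility of the local design\<close>

context regression_array
begin

lemma Sf_nonneg: "1 \<le> h n \<Longrightarrow> 0 \<le> Sf n i \<xi> d d"
  unfolding Sf_def by (intro sum_nonneg) (simp add: kw_nonneg0 mult.assoc)

text \<open>The sign \<open>\<sigma>\<close> selects the half of the window that points into the sample, since the other half may
  be cut off at the boundary.\<close>

lemma block_in_band:
  assumes m: "1 \<le> m" "2 * real m \<le> \<delta> * h n" and hn: "1 \<le> h n" "2 * h n \<le> real n" and i: "i \<in> {1..n}"
    and a: "0 \<le> a" "a + \<delta> \<le> 1" and \<sigma>: "\<sigma> = (if 2 * i \<le> n then 1 else -1 :: real)"
  obtains k where "k < n div m" "\<And>j. j \<in> block m k \<Longrightarrow> a \<le> \<sigma> * pos n i j \<and> \<sigma> * pos n i j \<le> a + \<delta>"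
proof -
  have ah: "0 \<le> a * h n" "a * h n + \<delta> * h n \<le> h n"
    using a hn mult_right_mono[OF a(2), of "h n"] by (simp_all add: distrib_right)
  show thesis
  proof (cases "2 * i \<le> n")
    case True
    then have iR: "2 * real i \<le> real n" by linarith
    obtain k where k: "k < n div m" "\<And>j. j \<in> {k * m<..k * m + m} \<Longrightarrow> real i + a * h n < real j \<and> real j \<le> real i + a * h n + \<delta> * h n"
      by (rule block_inside[OF m(1), of "real i + a * h n" "real i + a * h n + \<delta> * h n" n]) (use ah iR hn m in auto)
    show thesis
    proof (rule that[OF k(1)])
      fix j assume "j \<in> block m k"
      then show "a \<le> \<sigma> * pos n i j \<and> \<sigma> * pos n i j \<le> a + \<delta>"
        using k(2)[of j] hn True by (simp add: \<sigma> block_def pos_def pos_le_divide_eq pos_divide_le_eq distrib_right)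
    qed
  next
    case False
    then have iR: "real n \<le> 2 * real i" "real i \<le> real n" using i by auto
    obtain k where k: "k < n div m" "\<And>j. j \<in> {k * m<..k * m + m} \<Longrightarrow> real i - a * h n - \<delta> * h n < real j \<and> real j \<le> real i - a * h n"
      by (rule block_inside[OF m(1), of "real i - a * h n - \<delta> * h n" "real i - a * h n" n]) (use ah iR hn m in auto)
    have neg: "a' \<le> -1 * pos n i j \<longleftrightarrow> real j \<le> real i - a' * h n" "-1 * pos n i j \<le> a' \<longleftrightarrow> real i - a' * h n \<le> real j" for a' j
      using hn by (auto simp: pos_def field_simps)
    show thesis
    proof (rule that[OF k(1)])
      fix j assume "j \<in> block m k"
      then have "real i - (a + \<delta>) * h n \<le> real j" "real j \<le> real i - a * h n"
        using k(2)[of j] by (auto simp: block_def distrib_right)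
      then show "a \<le> \<sigma> * pos n i j \<and> \<sigma> * pos n i j \<le> a + \<delta>" unfolding \<sigma> if_not_P[OF False] neg by blast
    qed
  qed
qed

text \<open>The form is bounded below by the contributions of two blocks at separated positions, and the
  values of an affine function at two positions determine its level and its slope.\<close>

lemma design_lower_bound:
  assumes m: "1 \<le> bl n" and hn: "1 \<le> h n" "2 * h n \<le> real n" and i: "i \<in> {1..n}"
    and dev: "\<And>k a b. k < n div bl n \<Longrightarrow> \<bar>block_dev n (bl n) k a b \<xi>\<bar> \<le> real (bl n) * l / (4 * p\<^sup>2)"
  shows "c0 * (norm d)\<^sup>2 \<le> Sf n i \<xi> d d"
proof -
  define m where "m = bl n"
  define u where "u = fst d"
  define z where "z = snd d"
  define q where "q j = (x n j \<xi> \<bullet> (u + pos n i j *\<^sub>R z))\<^sup>2" for j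
  have m1: "1 \<le> m" using assms(1) by (simp add: m_def)
  have eh: "0 < \<eta> * h n" using \<eta>(1) hn by simp
  have ml: "real m \<le> \<eta> * h n" and mu: "\<eta> / 2 * h n \<le> real m"
    using m1 eh unfolding m_def bl_def by linarith+
  have "\<eta> * h n \<le> \<delta> / 2 * h n" using \<eta>(2) hn by (intro mult_right_mono) auto
  then have m2: "2 * real m \<le> \<delta> * h n" using ml by simp
  define \<sigma> where "\<sigma> = (if 2 * i \<le> n then 1 else -1 :: real)"
  have \<sigma>: "\<sigma> = 1 \<or> \<sigma> = -1" by (simp add: \<sigma>_def)
  have v3: "v2 - \<delta> = v1 + 2 * \<delta>" by (simp add: \<delta>_def field_simps)
  have a1: "v1 + \<delta> \<le> 1" and a2: "0 \<le> v2 - \<delta>" "v2 - \<delta> + \<delta> \<le> 1" using v3 v12 \<delta>(1) by linarith+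
  obtain k1 where k1: "k1 < n div m" "\<And>j. j \<in> block m k1 \<Longrightarrow> v1 \<le> \<sigma> * pos n i j \<and> \<sigma> * pos n i j \<le> v1 + \<delta>"
    using block_in_band[OF m1 m2 hn i v12(1) a1 \<sigma>_def] by blast
  obtain k2 where k2: "k2 < n div m" "\<And>j. j \<in> block m k2 \<Longrightarrow> v2 - \<delta> \<le> \<sigma> * pos n i j \<and> \<sigma> * pos n i j \<le> v2"
    using block_in_band[OF m1 m2 hn i a2 \<sigma>_def] by auto
  note k = k1(1) k2(1) and b1 = k1(2) and b2 = k2(2)
  have abs: "\<bar>pos n i j\<bar> = \<bar>\<sigma> * pos n i j\<bar>" for j using \<sigma> by auto
  have kap: "\<kappa> / h n \<le> kw n i 0 j" if "j \<in> block m k1 \<union> block m k2" for j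
  proof -
    have "v1 \<le> \<bar>pos n i j\<bar>" "\<bar>pos n i j\<bar> \<le> v2"
      using that b1[of j] b2[of j] v12 \<delta> v3 unfolding abs by auto
    then show ?thesis using \<kappa>(2) hn by (simp add: kw_def divide_right_mono)
  qed
  have near: "\<bar>pos n i j - pos n i (k * m + 1)\<bar> \<le> \<eta>" if "j \<in> block m k" for j k
  proof -
    have "pos n i j - pos n i (k * m + 1) = (real j - real (k * m + 1)) / h n"
      using hn by (simp add: pos_def diff_divide_distrib)
    moreover have "\<bar>real j - real (k * m + 1)\<bar> \<le> real m"
    proof -
      have "k * m + 1 \<le> j" "j \<le> k * m + m" using that by (auto simp: block_def)
      then have "real (k * m + 1) \<le> real j" "real j \<le> real (k * m + m)" by (simp_all only: of_nat_le_iff)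
      then show ?thesis by simp
    qed
    ultimately have "\<bar>pos n i j - pos n i (k * m + 1)\<bar> \<le> real m / h n" using hn by (simp add: divide_right_mono)
    also have "\<dots> \<le> \<eta>" using ml hn by (simp add: pos_divide_le_eq)
    finally show ?thesis .
  qed
  have start: "k * m + 1 \<in> block m k" for k using m1 by (simp add: block_def)
  let ?p1 = "pos n i (k1 * m + 1)" and ?p2 = "pos n i (k2 * m + 1)"
  have sep: "\<delta> \<le> \<bar>?p1 - ?p2\<bar>"
  proof -
    have "\<delta> \<le> \<sigma> * ?p2 - \<sigma> * ?p1" using b1[OF start] b2[OF start] v3 by linarith
    also have "\<dots> \<le> \<bar>?p1 - ?p2\<bar>" using \<sigma> by auto
    finally show ?thesis .
  qed
  have p1: "\<bar>?p1\<bar> \<le> 1" unfolding abs using b1[OF start] v12 v3 \<delta> by auto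
  have disj: "block m k1 \<inter> block m k2 = {}" using b1 b2 v3 \<delta>(1) by fastforce
  have "\<delta>\<^sup>2 / 8 * (norm d)\<^sup>2 \<le> (norm (u + ?p1 *\<^sub>R z))\<^sup>2 + (norm (u + ?p2 *\<^sub>R z))\<^sup>2"
    using two_point_bound[OF \<delta> sep p1, of u z] by (simp add: norm_prod_sq[of d] u_def z_def)
  then have 1: "l / 8 * (\<delta>\<^sup>2 / 8 * (norm d)\<^sup>2) \<le> l / 8 * ((norm (u + ?p1 *\<^sub>R z))\<^sup>2 + (norm (u + ?p2 *\<^sub>R z))\<^sup>2)"
    using l by (intro mult_left_mono) auto
  have "(norm z)\<^sup>2 \<le> (norm d)\<^sup>2" by (simp add: norm_prod_sq[of d] z_def)
  then have "2 * \<tau>\<^sup>2 * \<eta>\<^sup>2 * (norm z)\<^sup>2 \<le> l * \<delta>\<^sup>2 / 128 * (norm d)\<^sup>2" using \<eta>(3) l by (intro mult_mono) auto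
  then have 2: "l * \<delta>\<^sup>2 / 128 * (norm d)\<^sup>2 \<le> (l / 8 * (norm (u + ?p1 *\<^sub>R z))\<^sup>2 - \<tau>\<^sup>2 * \<eta>\<^sup>2 * (norm z)\<^sup>2) + (l / 8 * (norm (u + ?p2 *\<^sub>R z))\<^sup>2 - \<tau>\<^sup>2 * \<eta>\<^sup>2 * (norm z)\<^sup>2)"
    using 1 by (simp add: algebra_simps)
  have "\<kappa> * (\<eta> / 2) * (l * \<delta>\<^sup>2 / 128 * (norm d)\<^sup>2) \<le> \<kappa> * (real m / h n) * (l * \<delta>\<^sup>2 / 128 * (norm d)\<^sup>2)"
    using mu hn \<kappa>(1) l by (intro mult_right_mono mult_left_mono) (auto simp: pos_le_divide_eq)
  then have "c0 * (norm d)\<^sup>2 \<le> (\<kappa> / h n) * (real m * (l * \<delta>\<^sup>2 / 128 * (norm d)\<^sup>2))"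
    by (simp add: c0_def mult_ac)
  also have "\<dots> \<le> (\<kappa> / h n) * ((\<Sum>j\<in>block m k1. q j) + (\<Sum>j\<in>block m k2. q j))"
  proof (rule mult_left_mono)
    have "real m * (l * \<delta>\<^sup>2 / 128 * (norm d)\<^sup>2) \<le> real m * ((l / 8 * (norm (u + ?p1 *\<^sub>R z))\<^sup>2 - \<tau>\<^sup>2 * \<eta>\<^sup>2 * (norm z)\<^sup>2) + (l / 8 * (norm (u + ?p2 *\<^sub>R z))\<^sup>2 - \<tau>\<^sup>2 * \<eta>\<^sup>2 * (norm z)\<^sup>2))"
      by (intro mult_left_mono 2) simp
    also have "\<dots> \<le> (\<Sum>j\<in>block m k1. q j) + (\<Sum>j\<in>block m k2. q j)"
      unfolding distrib_left q_def using k
      by (intro add_mono block_affine_bound[where v="pos n i"] near dev[folded m_def])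
    finally show "real m * (l * \<delta>\<^sup>2 / 128 * (norm d)\<^sup>2) \<le> (\<Sum>j\<in>block m k1. q j) + (\<Sum>j\<in>block m k2. q j)" .
  qed (use \<kappa>(1) hn in simp)
  also have "\<dots> = (\<Sum>j\<in>block m k1 \<union> block m k2. \<kappa> / h n * q j)"
    using disj by (subst sum.union_disjoint) (auto simp: block_def sum_distrib_left distrib_left)
  also have "\<dots> \<le> (\<Sum>j\<in>block m k1 \<union> block m k2. kw n i 0 j * q j)"
    using kap by (intro sum_mono mult_right_mono) (auto simp: q_def)
  also have "\<dots> \<le> (\<Sum>j=1..n. kw n i 0 j * q j)"
    using block_subset[OF k(1)] block_subset[OF k(2)] kw_nonneg0[OF hn(1)] by (intro sum_mono2) (auto simp: q_def)
  also have "\<dots> = Sf n i \<xi> d d" by (simp add: Sf_def q_def u_def z_def power2_eq_square mult.assoc)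
  finally show ?thesis .
qed

lemma h_large: "\<forall>\<^sub>F n in sequentially. c \<le> h n"
  using h(1) by (simp add: filterlim_at_top)

lemma h_small: assumes "0 < c" shows "\<forall>\<^sub>F n in sequentially. h n \<le> c * real n"
proof -
  have "\<forall>\<^sub>F n in sequentially. h n / real n < c" using h(2) assms by (rule order_tendstoD(2))
  moreover have "\<forall>\<^sub>F n in sequentially. (1::nat) \<le> n" by (rule eventually_ge_at_top)
  ultimately show ?thesis by eventually_elim (simp add: pos_divide_less_eq)
qed

text \<open>A block fails with probability \<open>O(h\<^bsup>-2\<^esup>)\<close> by its fourth moment, and there are \<open>O(n / h)\<close> blocks.\<close>

lemma design_whp: "whp S (\<lambda>n \<xi>. \<forall>i\<in>{1..n}. \<forall>d. c0 * (norm d)\<^sup>2 \<le> Sf n i \<xi> d d)"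
  unfolding whp_def
proof (intro allI impI)
  fix \<epsilon> :: real assume \<epsilon>: "\<epsilon> > 0"
  define C where "C = (32 * \<tau> * p ^ 3 * A / l) ^ 4"
  have C: "0 \<le> C" unfolding C_def by (simp add: zero_le_even_power)
  have "(\<lambda>n. (8 * p\<^sup>2 * C / \<eta> ^ 3) * (real n / h n ^ 3)) \<longlonglongrightarrow> (8 * p\<^sup>2 * C / \<eta> ^ 3) * 0"
    by (intro tendsto_intros h(3))
  then have "\<forall>\<^sub>F n in sequentially. (8 * p\<^sup>2 * C / \<eta> ^ 3) * (real n / h n ^ 3) < \<epsilon>"
    using \<epsilon> by (intro order_tendstoD(2)) auto
  moreover have "\<forall>\<^sub>F n in sequentially. 1 \<le> h n" by (rule h_large)
  moreover have "\<forall>\<^sub>F n in sequentially. 1 / \<eta> \<le> h n" by (rule h_large)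
  moreover have "\<forall>\<^sub>F n in sequentially. h n \<le> 1 / 2 * real n" by (rule h_small) simp
  ultimately show "likely S \<epsilon> (\<lambda>n \<xi>. \<forall>i\<in>{1..n}. \<forall>d. c0 * (norm d)\<^sup>2 \<le> Sf n i \<xi> d d)"
    unfolding likely_def
  proof eventually_elim
    case (elim n)
    define m where "m = bl n"
    have eh: "1 \<le> \<eta> * h n" using elim(3) \<eta>(1) by (simp add: pos_divide_le_eq mult.commute)
    have m1: "1 \<le> m" using eh by (simp add: m_def bl_def le_nat_floor)
    have mu: "\<eta> / 2 * h n \<le> real m" using m1 eh unfolding m_def bl_def by linarith
    define t where "t = real m * l / (4 * p\<^sup>2)"
    have t: "t > 0" using m1 l p1 by (simp add: t_def)
    define bad where "bad z = {\<xi>\<in>space S. \<bar>block_dev n m (fst z) (fst (snd z)) (snd (snd z)) \<xi>\<bar> > t}" for z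
    define Z where "Z = {..<n div m} \<times> (UNIV :: ('p \<times> 'p) set)"
    have meas: "bad z \<in> sets S" if "z \<in> Z" for z
    proof -
      have [measurable]: "block_dev n m (fst z) (fst (snd z)) (snd (snd z)) \<in> borel_measurable S"
        using that by (intro Lp_leD(1)[OF block_dev_Lp]) (auto simp: Z_def)
      show ?thesis unfolding bad_def by measurable
    qed
    have prob: "P.prob (bad z) \<le> C / (real m)\<^sup>2" if "z \<in> Z" for z
    proof -
      have "P.prob (bad z) \<le> (8 * \<tau> * p * A * sqrt (real m) / t) ^ 4"
        unfolding bad_def using that t by (intro P.Lp_le_tail[OF block_dev_Lp]) (auto simp: Z_def)
      also have "8 * \<tau> * p * A * sqrt (real m) / t = (32 * \<tau> * p ^ 3 * A / l) * (sqrt (real m) / real m)"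
        using m1 l p1 by (simp add: t_def power2_eq_square power3_eq_cube mult_ac)
      also have "sqrt (real m) / real m = 1 / sqrt (real m)" using m1 by (simp add: real_div_sqrt field_simps)
      also have "((32 * \<tau> * p ^ 3 * A / l) * (1 / sqrt (real m))) ^ 4 = C * (1 / sqrt (real m) ^ 4)"
        by (simp only: C_def power_mult_distrib power_one_over)
      also have "sqrt (real m) ^ 4 = (real m)\<^sup>2" by (simp add: power4_eq_xxxx power2_eq_square mult.assoc)
      finally show ?thesis by simp
    qed
    have "P.prob (\<Union>z\<in>Z. bad z) \<le> (\<Sum>z\<in>Z. P.prob (bad z))"
      using meas by (intro P.finite_measure_subadditive_finite) (auto simp: Z_def)
    also have "\<dots> \<le> (\<Sum>z\<in>Z. C / (real m)\<^sup>2)" by (intro sum_mono prob)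
    also have "\<dots> = real (n div m) * p\<^sup>2 * (C / (real m)\<^sup>2)"
      by (simp add: Z_def card_cartesian_product p power2_eq_square)
    also have "\<dots> \<le> (real n / real m) * p\<^sup>2 * (C / (real m)\<^sup>2)"
    proof (intro mult_right_mono)
      have "real (n div m * m) \<le> real n" by (simp only: of_nat_le_iff div_times_less_eq_dividend)
      then show "real (n div m) \<le> real n / real m" using m1 by (simp add: pos_le_divide_eq)
    qed (use C in auto)
    also have "\<dots> = p\<^sup>2 * C * real n / real m ^ 3" by (simp add: power2_eq_square power3_eq_cube mult_ac)
    also have "\<dots> \<le> p\<^sup>2 * C * real n / (\<eta> / 2 * h n) ^ 3"
      using mu eh \<eta>(1) elim(2) C m1 by (intro divide_left_mono power_mono) auto
    also have "\<dots> = (8 * p\<^sup>2 * C / \<eta> ^ 3) * (real n / h n ^ 3)"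
      by (simp add: power_mult_distrib power_divide)
    finally have bad: "P.prob (\<Union>z\<in>Z. bad z) \<le> \<epsilon>" using elim(1) by linarith
    have mU: "(\<Union>z\<in>Z. bad z) \<in> sets S" using meas by (intro sets.finite_UN) (auto simp: Z_def)
    show ?case
    proof (intro bexI[of _ "space S - (\<Union>z\<in>Z. bad z)"] conjI ballI allI)
      show "1 - \<epsilon> \<le> P.prob (space S - (\<Union>z\<in>Z. bad z))" using bad mU by (simp add: P.prob_compl)
      fix \<xi> i d assume w: "\<xi> \<in> space S - (\<Union>z\<in>Z. bad z)" and i: "i \<in> {1..n}"
      show "c0 * (norm d)\<^sup>2 \<le> Sf n i \<xi> d d"
      proof (rule design_lower_bound[OF m1[unfolded m_def] elim(2) _ i])
        show "2 * h n \<le> real n" using elim(4) by simp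
        fix k a b assume k: "k < n div bl n"
        then have "(k, a, b) \<in> Z" by (simp add: Z_def m_def)
        then have "\<xi> \<notin> bad (k, a, b)" using w by blast
        then show "\<bar>block_dev n (bl n) k a b \<xi>\<bar> \<le> real (bl n) * l / (4 * p\<^sup>2)"
          using w by (simp add: bad_def t_def m_def not_less)
      qed
    qed (use mU in auto)
  qed
qed

text \<open>The random form is nonnegative and exceeds the bound with probability at least one half.\<close>

lemma SE_lower_bound: "\<forall>\<^sub>F n in sequentially. \<forall>i\<in>{1..n}. \<forall>d. c0 / 2 * (norm d)\<^sup>2 \<le> SE n i d d"
proof -
  have "likely S (1 / 2) (\<lambda>n \<xi>. \<forall>i\<in>{1..n}. \<forall>d. c0 * (norm d)\<^sup>2 \<le> Sf n i \<xi> d d)"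
    using design_whp by (simp add: whp_def)
  moreover have "\<forall>\<^sub>F n in sequentially. 1 \<le> h n" by (rule h_large)
  ultimately show ?thesis unfolding likely_def
  proof eventually_elim
    case (elim n)
    then obtain E where E: "E \<in> sets S" "1 / 2 \<le> P.prob E"
      "\<And>\<xi> i (d :: (real ^ 'p) \<times> (real ^ 'p)). \<xi> \<in> E \<Longrightarrow> i \<in> {1..n} \<Longrightarrow> c0 * (norm d)\<^sup>2 \<le> Sf n i \<xi> d d"
      by auto
    show ?case
    proof (intro ballI allI)
      fix i and d :: "(real ^ 'p) \<times> (real ^ 'p)" assume i: "i \<in> {1..n}"
      have "c0 / 2 * (norm d)\<^sup>2 = (c0 * (norm d)\<^sup>2) * (1 / 2)" by simp
      also have "\<dots> \<le> (c0 * (norm d)\<^sup>2) * P.prob E" using c0 E(2) by (intro mult_left_mono) auto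
      also have "\<dots> = (\<integral>\<xi>. (c0 * (norm d)\<^sup>2) * indicator E \<xi> \<partial>S)"
        using sets.sets_into_space[OF E(1)] by (simp add: Int_absorb2)
      also have "\<dots> \<le> (\<integral>\<xi>. Sf n i \<xi> d d \<partial>S)"
      proof (rule integral_mono)
        show "integrable S (\<lambda>\<xi>. (c0 * (norm d)\<^sup>2) * indicator E \<xi>)"
          using E(1) by (intro integrable_mult_right) (auto simp: P.emeasure_eq_measure)
        show "(c0 * (norm d)\<^sup>2) * indicator E \<xi> \<le> Sf n i \<xi> d d" for \<xi>
          using E(3)[OF _ i] Sf_nonneg[OF elim(2)] by (auto simp: indicator_def)
      qed (rule Sf_integrable)
      finally show "c0 / 2 * (norm d)\<^sup>2 \<le> SE n i d d" by (simp add: SE_def)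
    qed
  qed
qed

text \<open>Column \<open>a\<close> of the inverse of the mean design: pairing with it reads off component \<open>a\<close> of the level.\<close>

definition gam :: "nat \<Rightarrow> nat \<Rightarrow> 'p \<Rightarrow> (real ^ 'p) \<times> (real ^ 'p)" where
  "gam n i a = (SOME g. (\<forall>d. SE n i g d = fst d $ a) \<and> norm g \<le> 2 / c0)"

lemma gam: "\<forall>\<^sub>F n in sequentially. \<forall>i\<in>{1..n}. \<forall>a. (\<forall>d. SE n i (gam n i a) d = fst d $ a) \<and> norm (gam n i a) \<le> 2 / c0"
  using SE_lower_bound
proof eventually_elim
  case (elim n)
  show ?case
  proof (intro ballI allI)
    fix i a assume i: "i \<in> {1..n}"
    let ?l = "(axis a 1, 0) :: (real ^ 'p) \<times> (real ^ 'p)"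
    obtain g where g: "\<And>d. SE n i g d = ?l \<bullet> d" "norm g \<le> norm ?l / (c0 / 2)"
      by (rule coercive_form_represents[OF SE_linear, of "c0 / 2" n i ?l]) (use elim i c0 in auto)
    have "?l \<bullet> d = fst d $ a" for d by (cases d) (simp add: inner_axis')
    moreover have "norm ?l = 1" by (simp add: norm_Pair)
    ultimately have "(\<forall>d. SE n i g d = fst d $ a) \<and> norm g \<le> 2 / c0" using g by simp
    then show "(\<forall>d. SE n i (gam n i a) d = fst d $ a) \<and> norm (gam n i a) \<le> 2 / c0"
      unfolding gam_def by (rule someI)
  qed
qed

lemma weak_norm_sq: "weak_array 2 n (w n) (2 * A * p) (\<lambda>i \<xi>. (norm (x n i \<xi>))\<^sup>2)"
  unfolding weak_array_def
proof (intro conjI ballI allI)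
  fix i k assume i: "i \<in> {1..n}"
  show "integrable S (\<lambda>\<xi>. (norm (x n i \<xi>))\<^sup>2)"
    by (rule Lp_le_1(1)[OF P.Lp_le_2_1[OF norm_x_sq_Lp[OF i]]])
  have "influence 2 (\<lambda>\<xi>. \<Sum>a\<in>UNIV. 1 * (x n i \<xi> $ a * x n i \<xi> $ a)) k (\<Sum>a\<in>(UNIV::'p set). \<bar>1\<bar> * (2 * A * w n i k))"
    using weak_xx i by (intro influence_sum) (auto simp: weak_array_def)
  then show "influence 2 (\<lambda>\<xi>. (norm (x n i \<xi>))\<^sup>2) k (2 * A * p * w n i k)"
    unfolding norm_x_sq by (simp add: p mult_ac)
qed (use A p1 in simp)

text \<open>The inserted \<open>0\<close> covers the empty sample.\<close>

definition Wmax :: "nat \<Rightarrow> (nat \<Rightarrow> 's) \<Rightarrow> real" where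
  "Wmax n \<xi> = Max (insert 0 ((\<lambda>i. Wsum n i \<xi>) ` {1..n}))"

lemma Wmax_ge: "i \<in> {1..n} \<Longrightarrow> Wsum n i \<xi> \<le> Wmax n \<xi>" "0 \<le> Wmax n \<xi>"
  unfolding Wmax_def by (rule Max_ge; simp)+

definition cell_dev :: "nat \<Rightarrow> nat \<Rightarrow> (nat \<Rightarrow> 's) \<Rightarrow> real" where
  "cell_dev n k \<xi> = (\<Sum>j=1..n. (if j div nat \<lceil>h n\<rceil> = k then 1 else 0) * ((norm (x n j \<xi>))\<^sup>2 - (\<integral>\<xi>. (norm (x n j \<xi>))\<^sup>2 \<partial>S)))"

text \<open>There are only about \<open>n / h\<close> disjoint cells of length \<open>h\<close>, so the sum of the squared
  deviations of their totals, which bounds the largest one, is of order \<open>n\<close>.\<close>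

lemma cell_dev_OP: "OP S (\<lambda>n \<xi>. \<Sum>k\<le>n+1. (cell_dev n k \<xi>)\<^sup>2) (\<lambda>n. real n)"
proof (rule P.OP_of_Lp_le)
  define C where "C = (2 * A * p * A)\<^sup>2"
  show "0 \<le> C" by (simp add: C_def)
  have ev: "\<forall>\<^sub>F n in sequentially. 1 \<le> h n" by (rule h_large)
  then show "\<forall>\<^sub>F n in sequentially. Lp_le S 1 (\<lambda>\<xi>. \<Sum>k\<le>n+1. (cell_dev n k \<xi>)\<^sup>2) (C * real n)"
  proof eventually_elim
    case (elim n)
    let ?c = "\<lambda>k j. if j div nat \<lceil>h n\<rceil> = k then 1 else 0 :: real"
    have "Lp_le S 1 (\<lambda>\<xi>. \<Sum>k\<le>n+1. (cell_dev n k \<xi>)\<^sup>2) (\<Sum>k\<le>n+1. C * (\<Sum>j=1..n. (?c k j)\<^sup>2))"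
    proof (rule Lp_le_sum)
      fix k
      have "Lp_le S 2 (cell_dev n k) (2 * A * p * A * sqrt (\<Sum>j=1..n. (?c k j)\<^sup>2))"
        unfolding cell_dev_def[abs_def] by (rule weak_array_linear_2[OF w weak_norm_sq])
      from Lp_le_mult_2_1[OF this this]
      show "Lp_le S 1 (\<lambda>\<xi>. (cell_dev n k \<xi>)\<^sup>2) (C * (\<Sum>j=1..n. (?c k j)\<^sup>2))"
        by (simp add: power2_eq_square C_def mult_ac sum_nonneg flip: real_sqrt_mult)
    qed simp
    also have "(\<Sum>k\<le>n+1. C * (\<Sum>j=1..n. (?c k j)\<^sup>2)) = C * (\<Sum>j=1..n. (\<Sum>k\<le>n+1. (?c k j)\<^sup>2))"
      unfolding sum_distrib_left by (rule sum.swap)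
    also have "(\<Sum>j=1..n. (\<Sum>k\<le>n+1. (?c k j)\<^sup>2)) = (\<Sum>j=1..n. 1)"
    proof (rule sum.cong[OF refl])
      fix j assume "j \<in> {1..n}"
      then have "j div nat \<lceil>h n\<rceil> \<le> n + 1" by (auto intro: le_trans[OF div_le_dividend])
      then have "(\<Sum>k\<le>n+1. (?c k j)\<^sup>2) = (\<Sum>k\<in>{j div nat \<lceil>h n\<rceil>}. 1)"
        by (intro sum.mono_neutral_cong_right) auto
      then show "(\<Sum>k\<le>n+1. (?c k j)\<^sup>2) = 1" by simp
    qed
    finally show ?case by simp
  qed
  show "\<forall>\<^sub>F n in sequentially. 0 < real n" using eventually_gt_at_top[of "0::nat"] by eventually_elim simp
qed

text \<open>A window meets at most three cells.\<close>

lemma Wsum_le_cells: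
  assumes h1: "1 \<le> h n" and i: "i \<in> {1..n}" and Y: "(\<Sum>k\<le>n+1. (cell_dev n k \<xi>)\<^sup>2) \<le> C * real n" and C: "0 \<le> C"
  shows "Wsum n i \<xi> \<le> (6 * p * A\<^sup>2 + 3 * sqrt C) * (1 + sqrt (real n) / h n)"
proof -
  define m where "m = nat \<lceil>h n\<rceil>"
  have m: "1 \<le> m" "h n \<le> real m" "real m \<le> 2 * h n" using h1 unfolding m_def by linarith+
  define y where "y j = (norm (x n j \<xi>))\<^sup>2" for j
  define c where "c k j = (if j div m = k then 1 else 0 :: real)" for k j
  define N where "N = {i div m - 1..i div m + 1}"
  have point: "(if \<bar>real j - real i\<bar> \<le> h n then y j / h n else 0) \<le> (1 / h n) * (\<Sum>k\<in>N. c k j * y j)" for j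
  proof (cases "\<bar>real j - real i\<bar> \<le> h n")
    case True
    then have "real j \<le> real (i + m)" "real i \<le> real (j + m)" using m(2) by simp_all
    then have "j \<le> i + m" "i \<le> j + m" by (simp_all only: of_nat_le_iff)
    then have "j div m \<le> (i + m) div m" "i div m \<le> (j + m) div m" by (auto intro: div_le_mono)
    then have N: "j div m \<in> N" using m(1) by (auto simp: N_def)
    have "y j = (\<Sum>k\<in>{j div m}. c k j * y j)" by (simp add: c_def)
    also have "\<dots> \<le> (\<Sum>k\<in>N. c k j * y j)" using N by (intro sum_mono2) (auto simp: N_def c_def y_def)
    finally show ?thesis using True h1 by (simp add: divide_right_mono)
  next
    case False
    then show ?thesis using h1 by (auto intro!: divide_nonneg_nonneg sum_nonneg simp: c_def y_def)
  qed
  have cell: "(\<Sum>j=1..n. c k j * y j) \<le> real m * (p * A\<^sup>2) + sqrt C * sqrt (real n)" if k: "k \<in> N" for k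
  proof -
    have "i div m \<le> n" using i by (auto intro: le_trans[OF div_le_dividend])
    then have "k \<in> {..n+1}" using k by (auto simp: N_def)
    then have "(cell_dev n k \<xi>)\<^sup>2 \<le> (\<Sum>k\<le>n+1. (cell_dev n k \<xi>)\<^sup>2)" by (intro member_le_sum) auto
    also have "\<dots> \<le> (sqrt C * sqrt (real n))\<^sup>2" using Y C by (simp add: power_mult_distrib)
    finally have dev: "cell_dev n k \<xi> \<le> sqrt C * sqrt (real n)" by (rule square_le_imp_le_abs) (use C in simp)
    have "(\<Sum>j=1..n. c k j * (\<integral>\<xi>. (norm (x n j \<xi>))\<^sup>2 \<partial>S)) \<le> (\<Sum>j=1..n. c k j * (p * A\<^sup>2))"
    proof (rule sum_mono)
      fix j assume j: "j \<in> {1..n}"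
      have "(\<integral>\<xi>. (norm (x n j \<xi>))\<^sup>2 \<partial>S) \<le> p * A\<^sup>2"
        using Lp_le_1(2)[OF P.Lp_le_2_1[OF norm_x_sq_Lp[OF j]]] by (rule abs_le_D1)
      then show "c k j * (\<integral>\<xi>. (norm (x n j \<xi>))\<^sup>2 \<partial>S) \<le> c k j * (p * A\<^sup>2)" by (intro mult_left_mono) (auto simp: c_def)
    qed
    also have "\<dots> = real (card {j\<in>{1..n}. j div m = k}) * (p * A\<^sup>2)"
      unfolding sum_distrib_right[symmetric] c_def by (subst sum.inter_filter[symmetric]) auto
    also have "\<dots> \<le> real m * (p * A\<^sup>2)"
    proof (rule mult_right_mono)
      have "{j\<in>{1..n}. j div m = k} \<subseteq> {k * m..<k * m + m}"
      proof clarify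
        fix j assume "k = j div m"
        have "j div m * m \<le> j" by simp
        moreover have "j < j div m * m + m" using dividend_less_div_times[of m j] m(1) by simp
        ultimately show "j \<in> {j div m * m..<j div m * m + m}" by simp
      qed
      then have "card {j\<in>{1..n}. j div m = k} \<le> card {k * m..<k * m + m}" by (intro card_mono) auto
      then show "real (card {j\<in>{1..n}. j div m = k}) \<le> real m" by simp
    qed (use p1 in simp)
    finally have mean: "(\<Sum>j=1..n. c k j * (\<integral>\<xi>. (norm (x n j \<xi>))\<^sup>2 \<partial>S)) \<le> real m * (p * A\<^sup>2)" .
    have "(\<Sum>j=1..n. c k j * y j) = cell_dev n k \<xi> + (\<Sum>j=1..n. c k j * (\<integral>\<xi>. (norm (x n j \<xi>))\<^sup>2 \<partial>S))"
      unfolding cell_dev_def m_def[symmetric] c_def y_def by (simp only: sum.distrib[symmetric] distrib_left[symmetric] diff_add_cancel)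
    then show ?thesis using dev mean by linarith
  qed
  have "Wsum n i \<xi> \<le> (\<Sum>j=1..n. (1 / h n) * (\<Sum>k\<in>N. c k j * y j))"
    unfolding Wsum_def y_def[symmetric] by (intro sum_mono point)
  also have "\<dots> = (1 / h n) * (\<Sum>k\<in>N. \<Sum>j=1..n. c k j * y j)"
    unfolding sum_distrib_left[symmetric] by (subst sum.swap) simp
  also have "\<dots> \<le> (1 / h n) * (\<Sum>k\<in>N. real m * (p * A\<^sup>2) + sqrt C * sqrt (real n))"
    using h1 by (intro mult_left_mono sum_mono cell) auto
  also have "\<dots> \<le> (1 / h n) * (3 * (2 * h n * (p * A\<^sup>2) + sqrt C * sqrt (real n)))"
  proof (rule mult_left_mono)
    have "(\<Sum>k\<in>N. real m * (p * A\<^sup>2) + sqrt C * sqrt (real n)) = real (card N) * (real m * (p * A\<^sup>2) + sqrt C * sqrt (real n))" by simp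
    also have "\<dots> \<le> 3 * (2 * h n * (p * A\<^sup>2) + sqrt C * sqrt (real n))"
      using m p1 C by (intro mult_mono add_mono mult_right_mono) (auto simp: N_def)
    finally show "(\<Sum>k\<in>N. real m * (p * A\<^sup>2) + sqrt C * sqrt (real n)) \<le> 3 * (2 * h n * (p * A\<^sup>2) + sqrt C * sqrt (real n))" .
  qed (use h1 in simp)
  also have "\<dots> = 6 * p * A\<^sup>2 + 3 * sqrt C * (sqrt (real n) / h n)" using h1 by (simp add: field_simps)
  also have "\<dots> \<le> (6 * p * A\<^sup>2 + 3 * sqrt C) * (1 + sqrt (real n) / h n)"
    using h1 p1 C by (simp add: algebra_simps)
  finally show ?thesis .
qed

lemma Wmax_OP: "OP S Wmax (\<lambda>n. 1 + sqrt (real n) / h n)"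
  unfolding OP_def
proof (intro allI impI)
  fix \<epsilon> :: real assume "\<epsilon> > 0"
  with cell_dev_OP obtain C where C: "0 \<le> C" "likely S \<epsilon> (\<lambda>n \<xi>. \<bar>\<Sum>k\<le>n+1. (cell_dev n k \<xi>)\<^sup>2\<bar> \<le> C * real n)"
    unfolding OP_def by meson
  define D where "D = 6 * p * A\<^sup>2 + 3 * sqrt C"
  have D: "0 \<le> D" using p1 C by (simp add: D_def)
  have "likely S \<epsilon> (\<lambda>n \<xi>. \<bar>Wmax n \<xi>\<bar> \<le> D * (1 + sqrt (real n) / h n))"
  proof (rule likely_mono[OF C(2)], use h_large[of 1] in eventually_elim, intro ballI impI)
    fix n \<xi> assume h1: "1 \<le> h n" and Y: "\<bar>\<Sum>k\<le>n+1. (cell_dev n k \<xi>)\<^sup>2\<bar> \<le> C * real n"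
    have "Wsum n i \<xi> \<le> D * (1 + sqrt (real n) / h n)" if "i \<in> {1..n}" for i
      unfolding D_def using Y by (intro Wsum_le_cells[OF h1 that _ C(1)]) simp
    moreover have "0 \<le> D * (1 + sqrt (real n) / h n)" using D h1 by (intro mult_nonneg_nonneg) auto
    ultimately have "Wmax n \<xi> \<le> D * (1 + sqrt (real n) / h n)" unfolding Wmax_def by (intro Max.boundedI) auto
    then show "\<bar>Wmax n \<xi>\<bar> \<le> D * (1 + sqrt (real n) / h n)" using Wmax_ge(2)[of n \<xi>] by simp
  qed
  then show "\<exists>C\<ge>0. likely S \<epsilon> (\<lambda>n \<xi>. \<bar>Wmax n \<xi>\<bar> \<le> C * (1 + sqrt (real n) / h n))" using D by blast
qed

end

section \<open>Estimation errors and cross terms\<close>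

context regression_array
begin

text \<open>\<open>\<Delta> i\<close> is the pair of estimation errors at observation \<open>i\<close>, the slope error multiplied by the
  bandwidth.\<close>

definition normal_equations where
  "normal_equations n \<xi> \<Delta> \<longleftrightarrow> (\<forall>i\<in>{1..n}. \<forall>d. Sf n i \<xi> (\<Delta> i) d = Tf n i \<xi> d + Bf n i \<xi> d)"

definition Lx where "Lx n i a \<xi> = e n i \<xi> * x n i \<xi> $ a"

text \<open>These bounds for the estimation errors and for the cross terms between errors and estimation
  errors do not involve the estimator, so that their moments can be computed.\<close>

definition err_bound where "err_bound n i \<xi> = (Udev n i \<xi> + 2 * A\<^sup>2 * s n * Wmax n \<xi>) / c0"
definition square_bound where "square_bound n \<xi> = (\<Sum>i=1..n. (norm (x n i \<xi>))\<^sup>2 * (err_bound n i \<xi>)\<^sup>2)"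
definition Qstat where "Qstat n a \<xi> = (\<Sum>i=1..n. Lx n i a \<xi> * Tf n i \<xi> (gam n i a))"
definition Pstat where "Pstat n a \<xi> = (\<Sum>i=1..n. BE n i (gam n i a) * Lx n i a \<xi>)"
definition cross_bound where
  "cross_bound n a \<xi> = \<bar>Qstat n a \<xi>\<bar> + \<bar>Pstat n a \<xi>\<bar> + (2 / c0) * (\<Sum>i=1..n. \<bar>Lx n i a \<xi>\<bar> * Bdev n i \<xi>)
     + (4 / c0) * (\<Sum>i=1..n. \<bar>Lx n i a \<xi>\<bar> * Ndev n i \<xi> * err_bound n i \<xi>)"

lemma normal_equationsD:
  "normal_equations n \<xi> \<Delta> \<Longrightarrow> i \<in> {1..n} \<Longrightarrow> Sf n i \<xi> (\<Delta> i) d = Tf n i \<xi> d + Bf n i \<xi> d"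
  unfolding normal_equations_def by blast

text \<open>Testing the normal equations with the solution itself and using coercivity.\<close>

lemma solution_le:
  assumes h1: "1 \<le> h n" and i: "i \<in> {1..n}" and low: "\<And>d. c0 * (norm d)\<^sup>2 \<le> Sf n i \<xi> d d"
    and eq: "normal_equations n \<xi> \<Delta>"
  shows "norm (\<Delta> i) \<le> err_bound n i \<xi>"
proof -
  have "c0 * (norm (\<Delta> i))\<^sup>2 \<le> Tf n i \<xi> (\<Delta> i) + Bf n i \<xi> (\<Delta> i)"
    using low[of "\<Delta> i"] normal_equationsD[OF eq i, of "\<Delta> i"] by simp
  also have "\<dots> \<le> norm (\<Delta> i) * Udev n i \<xi> + 2 * A\<^sup>2 * s n * norm (\<Delta> i) * Wmax n \<xi>"
  proof (rule add_mono)
    show "Tf n i \<xi> (\<Delta> i) \<le> norm (\<Delta> i) * Udev n i \<xi>" using Tf_le by (rule abs_le_D1)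
    have "Bf n i \<xi> (\<Delta> i) \<le> 2 * A\<^sup>2 * s n * norm (\<Delta> i) * Wsum n i \<xi>" using Bf_le[OF h1 i] by (rule abs_le_D1)
    also have "\<dots> \<le> 2 * A\<^sup>2 * s n * norm (\<Delta> i) * Wmax n \<xi>" using s[of n] Wmax_ge(1)[OF i] by (intro mult_left_mono) auto
    finally show "Bf n i \<xi> (\<Delta> i) \<le> 2 * A\<^sup>2 * s n * norm (\<Delta> i) * Wmax n \<xi>" .
  qed
  also have "\<dots> = norm (\<Delta> i) * (Udev n i \<xi> + 2 * A\<^sup>2 * s n * Wmax n \<xi>)" by (simp add: algebra_simps)
  finally have *: "norm (\<Delta> i) * (c0 * norm (\<Delta> i)) \<le> norm (\<Delta> i) * (Udev n i \<xi> + 2 * A\<^sup>2 * s n * Wmax n \<xi>)"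
    by (simp add: power2_eq_square mult_ac)
  have "c0 * norm (\<Delta> i) \<le> Udev n i \<xi> + 2 * A\<^sup>2 * s n * Wmax n \<xi>"
  proof (cases "\<Delta> i = 0")
    case True
    then show ?thesis using Udev_nonneg[of n i \<xi>] Wmax_ge(2)[of n \<xi>] s[of n] by simp
  qed (use * in simp)
  then show ?thesis using c0 by (simp add: err_bound_def pos_le_divide_eq mult.commute)
qed

text \<open>Replacing the random inverse of the local design by the inverse of its mean is what makes
  the cross term small: the leading part becomes a quadratic form in the products of errors and
  regressors, and the remainder is a product of two small factors.\<close>

lemma cross_le:
  assumes h1: "1 \<le> h n" and low: "\<And>i d. i \<in> {1..n} \<Longrightarrow> c0 * (norm d)\<^sup>2 \<le> Sf n i \<xi> d d"
    and g: "\<And>i d. i \<in> {1..n} \<Longrightarrow> SE n i (gam n i a) d = fst d $ a" "\<And>i. i \<in> {1..n} \<Longrightarrow> norm (gam n i a) \<le> 2 / c0"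
    and eq: "normal_equations n \<xi> \<Delta>"
  shows "\<bar>\<Sum>i=1..n. Lx n i a \<xi> * fst (\<Delta> i) $ a\<bar> \<le> cross_bound n a \<xi>"
proof -
  have split: "Lx n i a \<xi> * fst (\<Delta> i) $ a = Lx n i a \<xi> * Tf n i \<xi> (gam n i a) + BE n i (gam n i a) * Lx n i a \<xi>
     + Lx n i a \<xi> * (Bf n i \<xi> (gam n i a) - BE n i (gam n i a))
     - Lx n i a \<xi> * (Sf n i \<xi> (gam n i a) (\<Delta> i) - SE n i (gam n i a) (\<Delta> i))" if i: "i \<in> {1..n}" for i
  proof -
    have "Sf n i \<xi> (gam n i a) (\<Delta> i) = Tf n i \<xi> (gam n i a) + Bf n i \<xi> (gam n i a)"
      using normal_equationsD[OF eq i] by (simp only: Sf_commute[of n i \<xi> "gam n i a"])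
    then show ?thesis using g(1)[OF i, of "\<Delta> i"] by (simp add: algebra_simps)
  qed
  have "(\<Sum>i=1..n. Lx n i a \<xi> * fst (\<Delta> i) $ a) = Qstat n a \<xi> + Pstat n a \<xi>
     + (\<Sum>i=1..n. Lx n i a \<xi> * (Bf n i \<xi> (gam n i a) - BE n i (gam n i a)))
     - (\<Sum>i=1..n. Lx n i a \<xi> * (Sf n i \<xi> (gam n i a) (\<Delta> i) - SE n i (gam n i a) (\<Delta> i)))"
    unfolding Qstat_def Pstat_def sum.distrib[symmetric] sum_subtractf[symmetric]
    by (rule sum.cong[OF refl]) (rule split)
  moreover have "\<bar>\<Sum>i=1..n. Lx n i a \<xi> * (Bf n i \<xi> (gam n i a) - BE n i (gam n i a))\<bar> \<le> (2 / c0) * (\<Sum>i=1..n. \<bar>Lx n i a \<xi>\<bar> * Bdev n i \<xi>)"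
    unfolding sum_distrib_left
  proof (intro order_trans[OF sum_abs] sum_mono)
    fix i assume i: "i \<in> {1..n}"
    have "\<bar>Bf n i \<xi> (gam n i a) - BE n i (gam n i a)\<bar> \<le> norm (gam n i a) * Bdev n i \<xi>" by (rule Bf_diff)
    also have "\<dots> \<le> (2 / c0) * Bdev n i \<xi>" by (intro mult_right_mono g(2)[OF i] Bdev_nonneg)
    finally have "\<bar>Lx n i a \<xi>\<bar> * \<bar>Bf n i \<xi> (gam n i a) - BE n i (gam n i a)\<bar> \<le> \<bar>Lx n i a \<xi>\<bar> * ((2 / c0) * Bdev n i \<xi>)"
      by (rule mult_left_mono) simp
    then show "\<bar>Lx n i a \<xi> * (Bf n i \<xi> (gam n i a) - BE n i (gam n i a))\<bar> \<le> 2 / c0 * (\<bar>Lx n i a \<xi>\<bar> * Bdev n i \<xi>)"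
      by (simp add: abs_mult mult_ac)
  qed
  moreover have "\<bar>\<Sum>i=1..n. Lx n i a \<xi> * (Sf n i \<xi> (gam n i a) (\<Delta> i) - SE n i (gam n i a) (\<Delta> i))\<bar>
     \<le> (4 / c0) * (\<Sum>i=1..n. \<bar>Lx n i a \<xi>\<bar> * Ndev n i \<xi> * err_bound n i \<xi>)"
    unfolding sum_distrib_left
  proof (intro order_trans[OF sum_abs] sum_mono)
    fix i assume i: "i \<in> {1..n}"
    have "\<bar>Sf n i \<xi> (gam n i a) (\<Delta> i) - SE n i (gam n i a) (\<Delta> i)\<bar> \<le> 2 * norm (gam n i a) * norm (\<Delta> i) * Ndev n i \<xi>" by (rule Sf_diff)
    also have "\<dots> \<le> 2 * (2 / c0) * err_bound n i \<xi> * Ndev n i \<xi>"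
      using c0 solution_le[OF h1 i low[OF i] eq] by (intro mult_right_mono mult_mono g(2)[OF i] Ndev_nonneg) auto
    finally have "\<bar>Lx n i a \<xi>\<bar> * \<bar>Sf n i \<xi> (gam n i a) (\<Delta> i) - SE n i (gam n i a) (\<Delta> i)\<bar> \<le> \<bar>Lx n i a \<xi>\<bar> * (2 * (2 / c0) * err_bound n i \<xi> * Ndev n i \<xi>)"
      by (rule mult_left_mono) simp
    then show "\<bar>Lx n i a \<xi> * (Sf n i \<xi> (gam n i a) (\<Delta> i) - SE n i (gam n i a) (\<Delta> i))\<bar> \<le> 4 / c0 * (\<bar>Lx n i a \<xi>\<bar> * Ndev n i \<xi> * err_bound n i \<xi>)"
      by (simp add: abs_mult mult_ac)
  qed
  ultimately show ?thesis unfolding cross_bound_def by linarith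
qed

text \<open>The properties of the estimation errors that decide the comparison of the criteria. They hold for
  all solutions of the normal equations at once.\<close>

definition estimable where
  "estimable n \<xi> \<longleftrightarrow> (\<forall>\<Delta>. normal_equations n \<xi> \<Delta> \<longrightarrow>
     (\<Sum>i=1..n. (norm (x n i \<xi>))\<^sup>2 * (norm (\<Delta> i))\<^sup>2) \<le> square_bound n \<xi> \<and>
     (\<forall>a. \<bar>\<Sum>i=1..n. Lx n i a \<xi> * fst (\<Delta> i) $ a\<bar> \<le> cross_bound n a \<xi>))"

theorem estimation_bounds: "whp S estimable"
  unfolding estimable_def[abs_def]
proof (rule whp_mono[OF design_whp], use h_large[of 1] gam in eventually_elim, intro ballI impI allI)
  fix n \<xi> \<Delta>
  assume h1: "1 \<le> h n" and g: "\<forall>i\<in>{1..n}. \<forall>a. (\<forall>d. SE n i (gam n i a) d = fst d $ a) \<and> norm (gam n i a) \<le> 2 / c0"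
    and low: "\<forall>i\<in>{1..n}. \<forall>d. c0 * (norm d)\<^sup>2 \<le> Sf n i \<xi> d d" and eq: "normal_equations n \<xi> \<Delta>"
  have "(\<Sum>i=1..n. (norm (x n i \<xi>))\<^sup>2 * (norm (\<Delta> i))\<^sup>2) \<le> square_bound n \<xi>"
    unfolding square_bound_def using solution_le[OF h1 _ _ eq] low by (intro sum_mono mult_left_mono power_mono) auto
  moreover have "\<bar>\<Sum>i=1..n. Lx n i a \<xi> * fst (\<Delta> i) $ a\<bar> \<le> cross_bound n a \<xi>" for a
    using g low by (intro cross_le[OF h1 _ _ _ eq]) auto
  ultimately show "(\<Sum>i=1..n. (norm (x n i \<xi>))\<^sup>2 * (norm (\<Delta> i))\<^sup>2) \<le> square_bound n \<xi> \<and>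
     (\<forall>a. \<bar>\<Sum>i=1..n. Lx n i a \<xi> * fst (\<Delta> i) $ a\<bar> \<le> cross_bound n a \<xi>)" by blast
qed

lemma eventually_pos: "\<forall>\<^sub>F n in sequentially. 1 \<le> n \<and> 1 \<le> h n \<and> h n \<le> real n"
  using eventually_ge_at_top[of "1::nat"] h_large[of 1] h_small[of 1, OF zero_less_one] by eventually_elim auto

lemma OP_sum_Lp:
  assumes "\<And>n i. 1 \<le> h n \<Longrightarrow> i \<in> {1..n} \<Longrightarrow> Lp_le S 1 (Z n i) (C * m n)" and m: "\<And>n. 1 \<le> h n \<Longrightarrow> 0 < m n" and C: "0 \<le> C"
  shows "OP S (\<lambda>n \<xi>. \<Sum>i=1..n. Z n i \<xi>) (\<lambda>n. real n * m n)"
proof (rule P.OP_of_Lp_le[OF _ _ C])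
  show "\<forall>\<^sub>F n in sequentially. Lp_le S 1 (\<lambda>\<xi>. \<Sum>i=1..n. Z n i \<xi>) (C * (real n * m n))"
    using eventually_pos
  proof eventually_elim
    case (elim n)
    have "Lp_le S 1 (\<lambda>\<xi>. \<Sum>i=1..n. Z n i \<xi>) (\<Sum>i=1..n. C * m n)"
      using elim assms(1) by (intro Lp_le_sum) auto
    then show ?case by (simp add: mult_ac)
  qed
  show "\<forall>\<^sub>F n in sequentially. 0 < real n * m n"
    using eventually_pos by eventually_elim (auto intro!: mult_pos_pos m)
qed

lemma Lx4: "i \<in> {1..n} \<Longrightarrow> Lp_le S 4 (\<lambda>\<xi>. \<bar>Lx n i a \<xi>\<bar>) (2 * A)"
  unfolding Lx_def by (intro Lp_le_abs L4)
lemma Lx2: "i \<in> {1..n} \<Longrightarrow> Lp_le S 2 (\<lambda>\<xi>. \<bar>Lx n i a \<xi>\<bar>) (2 * A)"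
  by (intro P.Lp_le_4_2 Lx4)

lemma OP_x_sq: "OP S (\<lambda>n \<xi>. \<Sum>i=1..n. (norm (x n i \<xi>))\<^sup>2) (\<lambda>n. real n * 1)"
  using P.Lp_le_2_1[OF norm_x_sq_Lp] p1 by (intro OP_sum_Lp[where C="p * A\<^sup>2"]) auto

lemma OP_x_sq_U: "OP S (\<lambda>n \<xi>. \<Sum>i=1..n. (norm (x n i \<xi>))\<^sup>2 * (Udev n i \<xi>)\<^sup>2) (\<lambda>n. real n * (1 / h n))"
proof (rule OP_sum_Lp)
  fix n i assume h1: "1 \<le> h n" and i: "i \<in> {1..n}"
  have "Lp_le S 1 (\<lambda>\<xi>. (norm (x n i \<xi>))\<^sup>2 * (Udev n i \<xi> * Udev n i \<xi>)) (p * A\<^sup>2 * (8 * p * A\<^sup>2 / sqrt (h n) * (8 * p * A\<^sup>2 / sqrt (h n))))"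
    by (intro Lp_le_mult_2_1 norm_x_sq_Lp i Lp_le_mult_4_2 Udev_Lp h1)
  moreover have "p * A\<^sup>2 * (8 * p * A\<^sup>2 / sqrt (h n) * (8 * p * A\<^sup>2 / sqrt (h n))) = (64 * p ^ 3 * A ^ 6) * (1 / h n)"
    using h1 by (simp add: power2_eq_square eval_nat_numeral mult_ac)
  ultimately show "Lp_le S 1 (\<lambda>\<xi>. (norm (x n i \<xi>))\<^sup>2 * (Udev n i \<xi>)\<^sup>2) ((64 * p ^ 3 * A ^ 6) * (1 / h n))"
    by (simp add: power2_eq_square)
qed (use p1 A in auto)

lemma OP_L_B: "OP S (\<lambda>n \<xi>. \<Sum>i=1..n. \<bar>Lx n i a \<xi>\<bar> * Bdev n i \<xi>) (\<lambda>n. real n * (s n / sqrt (h n)))"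
proof (rule OP_sum_Lp)
  fix n i assume h1: "1 \<le> h n" and i: "i \<in> {1..n}"
  have "Lp_le S 1 (\<lambda>\<xi>. \<bar>Lx n i a \<xi>\<bar> * Bdev n i \<xi>) (2 * A * (8 * p\<^sup>2 * A ^ 4 * s n / sqrt (h n)))"
    by (intro Lp_le_mult_2_1 Lx2 i Bdev_Lp h1)
  then show "Lp_le S 1 (\<lambda>\<xi>. \<bar>Lx n i a \<xi>\<bar> * Bdev n i \<xi>) ((2 * A * (8 * p\<^sup>2 * A ^ 4)) * (s n / sqrt (h n)))"
    by (simp add: mult_ac)
qed (use p1 A s in auto)

lemma OP_L_N: "OP S (\<lambda>n \<xi>. \<Sum>i=1..n. \<bar>Lx n i a \<xi>\<bar> * Ndev n i \<xi>) (\<lambda>n. real n * (1 / sqrt (h n)))"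
proof (rule OP_sum_Lp)
  fix n i assume h1: "1 \<le> h n" and i: "i \<in> {1..n}"
  have "Lp_le S 1 (\<lambda>\<xi>. \<bar>Lx n i a \<xi>\<bar> * Ndev n i \<xi>) (2 * A * (12 * p\<^sup>2 * A ^ 3 / sqrt (h n)))"
    by (intro Lp_le_mult_2_1 Lx2 i Ndev_Lp h1)
  then show "Lp_le S 1 (\<lambda>\<xi>. \<bar>Lx n i a \<xi>\<bar> * Ndev n i \<xi>) ((2 * A * (12 * p\<^sup>2 * A ^ 3)) * (1 / sqrt (h n)))"
    by (simp add: mult_ac)
qed (use p1 A in auto)

lemma OP_L_N_U: "OP S (\<lambda>n \<xi>. \<Sum>i=1..n. \<bar>Lx n i a \<xi>\<bar> * Ndev n i \<xi> * Udev n i \<xi>) (\<lambda>n. real n * (1 / h n))"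
proof (rule OP_sum_Lp)
  fix n i assume h1: "1 \<le> h n" and i: "i \<in> {1..n}"
  have "Lp_le S 1 (\<lambda>\<xi>. (\<bar>Lx n i a \<xi>\<bar> * Udev n i \<xi>) * Ndev n i \<xi>) (2 * A * (8 * p * A\<^sup>2 / sqrt (h n)) * (12 * p\<^sup>2 * A ^ 3 / sqrt (h n)))"
    by (intro Lp_le_mult_2_1 Lp_le_mult_4_2 Lx4 Udev_Lp i Ndev_Lp h1)
  moreover have "2 * A * (8 * p * A\<^sup>2 / sqrt (h n)) * (12 * p\<^sup>2 * A ^ 3 / sqrt (h n)) = (192 * p ^ 3 * A ^ 6) * (1 / h n)"
    using h1 by (simp add: power2_eq_square eval_nat_numeral mult_ac)
  ultimately show "Lp_le S 1 (\<lambda>\<xi>. \<bar>Lx n i a \<xi>\<bar> * Ndev n i \<xi> * Udev n i \<xi>) ((192 * p ^ 3 * A ^ 6) * (1 / h n))"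
    by (simp add: mult_ac)
qed (use p1 A in auto)

text \<open>A linear statistic of the centred products with coefficients of order \<open>s\<close>, hence of order
  \<open>s * sqrt n\<close>; since \<open>h \<le> n\<close>, this is within the stated rate.\<close>

lemma OP_P: "OP S (\<lambda>n. Pstat n a) (\<lambda>n. real n * (s n / sqrt (h n)))"
proof (rule P.OP_of_Lp_le)
  define C where "C = A * (12 * p * A ^ 4 / c0)"
  show "0 \<le> C" using A p1 c0 by (simp add: C_def)
  show "\<forall>\<^sub>F n in sequentially. Lp_le S 1 (Pstat n a) (C * (real n * (s n / sqrt (h n))))"
    using eventually_pos gam
  proof eventually_elim
    case (elim n)
    define c where "c i = BE n i (gam n i a)" for i
    have c: "\<bar>c i\<bar> \<le> 12 * p * A ^ 4 / c0 * s n" if i: "i \<in> {1..n}" for i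
    proof -
      have "\<bar>c i\<bar> \<le> 6 * p * A ^ 4 * s n * norm (gam n i a)" unfolding c_def using elim i by (intro BE_le) auto
      also have "\<dots> \<le> 6 * p * A ^ 4 * s n * (2 / c0)" using elim i p1 A s[of n] by (intro mult_left_mono) auto
      finally show ?thesis by (simp add: mult_ac)
    qed
    have "(\<Sum>i=1..n. (c i)\<^sup>2) \<le> (\<Sum>i=1..n. (12 * p * A ^ 4 / c0 * s n)\<^sup>2)"
      using c by (intro sum_mono) (metis abs_ge_zero power2_abs power_mono)
    also have "\<dots> = real n * (12 * p * A ^ 4 / c0 * s n)\<^sup>2" by simp
    finally have "sqrt (\<Sum>i=1..n. (c i)\<^sup>2) \<le> sqrt (real n * (12 * p * A ^ 4 / c0 * s n)\<^sup>2)" by simp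
    also have "\<dots> = sqrt (real n) * (12 * p * A ^ 4 / c0 * s n)"
      using p1 A c0 s[of n] by (simp add: real_sqrt_mult)
    finally have le1: "sqrt (\<Sum>i=1..n. (c i)\<^sup>2) \<le> sqrt (real n) * (12 * p * A ^ 4 / c0 * s n)" .
    have "sqrt (real n) * sqrt (h n) \<le> sqrt (real n) * sqrt (real n)" using elim by (intro mult_left_mono) auto
    then have "sqrt (real n) \<le> real n / sqrt (h n)" using elim by (simp add: pos_le_divide_eq)
    then have "sqrt (real n) * (12 * p * A ^ 4 / c0 * s n) \<le> real n / sqrt (h n) * (12 * p * A ^ 4 / c0 * s n)"
      using p1 A c0 s[of n] by (intro mult_right_mono) auto
    with le1 have sq: "sqrt (\<Sum>i=1..n. (c i)\<^sup>2) \<le> real n / sqrt (h n) * (12 * p * A ^ 4 / c0 * s n)" by (rule order_trans)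
    have "1 * A * sqrt (\<Sum>i=1..n. (c i)\<^sup>2) \<le> 1 * A * (real n / sqrt (h n) * (12 * p * A ^ 4 / c0 * s n))"
      using A sq by (intro mult_left_mono) auto
    also have "\<dots> = C * (real n * (s n / sqrt (h n)))" by (simp add: C_def mult_ac)
    finally have le: "1 * A * sqrt (\<Sum>i=1..n. (c i)\<^sup>2) \<le> C * (real n * (s n / sqrt (h n)))" .
    have "Lp_le S 2 (\<lambda>\<xi>. \<Sum>i=1..n. c i * (e n i \<xi> * x n i \<xi> $ a)) (1 * A * sqrt (\<Sum>i=1..n. (c i)\<^sup>2))"
      using weak_array_linear_2[OF w weak_array_4_2[OF weak_L], of c n a] L0 by simp
    then have "Lp_le S 2 (Pstat n a) (1 * A * sqrt (\<Sum>i=1..n. (c i)\<^sup>2))"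
      unfolding Pstat_def[abs_def] Lx_def c_def .
    then show ?case using le by (intro P.Lp_le_2_1) (rule Lp_le_weaken)
  qed
  show "\<forall>\<^sub>F n in sequentially. 0 < real n * (s n / sqrt (h n))"
    using eventually_pos by eventually_elim (auto intro!: mult_pos_pos divide_pos_pos s)
qed

text \<open>A quadratic form in the centred products whose coefficients are of order \<open>1 / h\<close> and vanish outside
  a band of width \<open>h\<close>, so that its rows have square sums of order \<open>1 / h\<close>.\<close>

lemma OP_Q: "OP S (\<lambda>n. Qstat n a) (\<lambda>n. real n * (1 / h n))"
proof (rule P.OP_of_Lp_le)
  define C where "C = p * (36 * A ^ 3 / c0)"
  show "0 \<le> C" using A p1 c0 by (simp add: C_def)
  show "\<forall>\<^sub>F n in sequentially. Lp_le S 1 (Qstat n a) (C * (real n * (1 / h n)))"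
    using eventually_pos gam
  proof eventually_elim
    case (elim n)
    then have h1: "1 \<le> h n" by simp
    define c where "c b i j = (if i \<in> {1..n} then kw n i 0 j * (fst (gam n i a) $ b + pos n i j * snd (gam n i a) $ b) else 0)" for b i j
    define \<alpha> where "\<alpha> = (A * (4 / c0)) / h n"
    have \<alpha>: "0 \<le> \<alpha>" using A c0 h1 by (simp add: \<alpha>_def)
    have c: "\<bar>c b i j\<bar> \<le> \<alpha>" for b i j
    proof (cases "i \<in> {1..n} \<and> \<bar>real j - real i\<bar> \<le> h n")
      case True
      have "\<bar>pos n i j\<bar> * \<bar>snd (gam n i a) $ b\<bar> \<le> 1 * norm (gam n i a)"
        using True pos_le[OF h1] by (intro mult_mono component_le) auto
      then have "\<bar>fst (gam n i a) $ b + pos n i j * snd (gam n i a) $ b\<bar> \<le> norm (gam n i a) + 1 * norm (gam n i a)"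
        using component_le(1)[of "gam n i a" b] abs_triangle_ineq[of "fst (gam n i a) $ b" "pos n i j * snd (gam n i a) $ b"]
        unfolding abs_mult by linarith
      also have "\<dots> \<le> 4 / c0"
      proof -
        have "norm (gam n i a) \<le> 2 / c0" using elim True by blast
        then show ?thesis by simp
      qed
      finally have "\<bar>kw n i 0 j\<bar> * \<bar>fst (gam n i a) $ b + pos n i j * snd (gam n i a) $ b\<bar> \<le> (A / h n) * (4 / c0)"
        using A h1 by (intro mult_mono kw_bound[OF h1]) auto
      then show ?thesis using True by (simp add: c_def \<alpha>_def abs_mult mult_ac)
    next
      case False
      then have "c b i j = 0" using kw_zero[OF h1] by (auto simp: c_def not_le)
      then show ?thesis using \<alpha> by simp
    qed
    define r where "r = 2 * \<alpha> * sqrt (h n)"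
    have r: "0 \<le> r" using \<alpha> h1 by (simp add: r_def)
    have sq: "X \<le> r\<^sup>2" if "sqrt X \<le> r" for X
      using that r by (metis real_sqrt_le_iff real_sqrt_abs abs_of_nonneg)
    have rows: "(\<Sum>j=1..n. (c b i j)\<^sup>2) \<le> r\<^sup>2" for b i
      unfolding r_def by (rule sq[unfolded r_def], rule window_square_sum[OF h1 c, where t="real i"]) (simp add: c_def kw_zero[OF h1])
    have cols: "(\<Sum>i=1..n. (c b i j)\<^sup>2) \<le> r\<^sup>2" for b j
      unfolding r_def by (rule sq[unfolded r_def], rule window_square_sum[OF h1 c, where t="real j"]) (simp add: c_def kw_zero[OF h1] abs_minus_commute)
    have each: "Lp_le S 1 (\<lambda>\<xi>. \<Sum>i=1..n. \<Sum>j=1..n. c b i j * (e n i \<xi> * x n i \<xi> $ a) * (e n j \<xi> * x n j \<xi> $ b)) (36 * A ^ 3 / c0 * (real n * (1 / h n)))" for b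
    proof (rule Lp_le_weaken[OF weak_array_quadratic[OF w weak_L weak_L L0 L0 c r rows cols]])
      have "r * sqrt (real n) \<le> 2 * \<alpha> * real n"
      proof -
        have "sqrt (h n) * sqrt (real n) \<le> sqrt (real n) * sqrt (real n)" using elim by (intro mult_right_mono) auto
        then have "2 * \<alpha> * (sqrt (h n) * sqrt (real n)) \<le> 2 * \<alpha> * real n" using \<alpha> by (intro mult_left_mono) auto
        then show ?thesis by (simp add: r_def mult_ac)
      qed
      then have "(1 * A)\<^sup>2 * (real n * \<alpha> + 4 * r * sqrt (real n)) \<le> (1 * A)\<^sup>2 * (9 * (\<alpha> * real n))" by (intro mult_left_mono) auto
      also have "\<dots> = 36 * A ^ 3 / c0 * (real n * (1 / h n))" by (simp add: \<alpha>_def power2_eq_square power3_eq_cube)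
      finally show "(1 * A)\<^sup>2 * (real n * \<alpha> + 4 * r * sqrt (real n)) \<le> 36 * A ^ 3 / c0 * (real n * (1 / h n))" .
    qed
    have Q1: "Qstat n a \<xi> = (\<Sum>b\<in>UNIV. \<Sum>i=1..n. \<Sum>j=1..n. c b i j * (e n i \<xi> * x n i \<xi> $ a) * (e n j \<xi> * x n j \<xi> $ b))" for \<xi>
    proof -
      have "Lx n i a \<xi> * Tf n i \<xi> (gam n i a) = (\<Sum>b\<in>UNIV. \<Sum>j=1..n. c b i j * (e n i \<xi> * x n i \<xi> $ a) * (e n j \<xi> * x n j \<xi> $ b))" if "i \<in> {1..n}" for i
      proof -
        have "Tf n i \<xi> (gam n i a) = (\<Sum>j=1..n. \<Sum>b\<in>UNIV. c b i j * (e n j \<xi> * x n j \<xi> $ b))"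
          unfolding Tf_def inner_vec_def sum_distrib_left c_def using that
          by (intro sum.cong refl) (simp add: mult_ac)
        also have "\<dots> = (\<Sum>b\<in>UNIV. \<Sum>j=1..n. c b i j * (e n j \<xi> * x n j \<xi> $ b))" by (rule sum.swap)
        finally show ?thesis unfolding Lx_def by (simp add: sum_distrib_left mult_ac)
      qed
      then show ?thesis unfolding Qstat_def by (subst sum.swap) (rule sum.cong[OF refl], simp)
    qed
    have "Lp_le S 1 (\<lambda>\<xi>. Qstat n a \<xi>) (\<Sum>b\<in>(UNIV::'p set). 36 * A ^ 3 / c0 * (real n * (1 / h n)))"
      unfolding Q1 by (intro Lp_le_sum each) simp
    then show ?case by (simp add: C_def p[symmetric] mult_ac)
  qed
  show "\<forall>\<^sub>F n in sequentially. 0 < real n * (1 / h n)" using eventually_pos by eventually_elim auto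
qed

text \<open>Sizes of the squared estimation errors and of the cross terms, per observation. The factor
  \<open>1 + sqrt n / h\<close> is the order of the largest window average, which multiplies the bias.\<close>

definition "rate_sq n = 1 / h n + (s n * (1 + sqrt (real n) / h n))\<^sup>2"
definition "rate_cross n = 1 / h n + s n * (1 + sqrt (real n) / h n) / sqrt (h n)"

lemma square_bound_OP: "OP S square_bound (\<lambda>n. real n * rate_sq n)"
proof -
  define Z where "Z n \<xi> = (2 / c0\<^sup>2) * (\<Sum>i=1..n. (norm (x n i \<xi>))\<^sup>2 * (Udev n i \<xi>)\<^sup>2)
     + (8 * A ^ 4 / c0\<^sup>2) * (((s n)\<^sup>2 * (Wmax n \<xi> * Wmax n \<xi>)) * (\<Sum>i=1..n. (norm (x n i \<xi>))\<^sup>2))" for n \<xi>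
  have "OP S (\<lambda>n \<xi>. (\<Sum>i=1..n. (norm (x n i \<xi>))\<^sup>2 * (Udev n i \<xi>)\<^sup>2)) (\<lambda>n. real n * rate_sq n)"
  proof (rule OP_rate[OF OP_x_sq_U, where c=1])
    show "\<forall>\<^sub>F n in sequentially. real n * (1 / h n) \<le> 1 * (real n * rate_sq n)"
      by (intro always_eventually allI) (simp add: rate_sq_def distrib_left)
  qed simp
  moreover have "OP S (\<lambda>n \<xi>. ((s n)\<^sup>2 * (Wmax n \<xi> * Wmax n \<xi>)) * (\<Sum>i=1..n. (norm (x n i \<xi>))\<^sup>2)) (\<lambda>n. real n * rate_sq n)"
  proof (rule OP_rate[where c=1])
    show "OP S (\<lambda>n \<xi>. ((s n)\<^sup>2 * (Wmax n \<xi> * Wmax n \<xi>)) * (\<Sum>i=1..n. (norm (x n i \<xi>))\<^sup>2))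
      (\<lambda>n. (\<bar>(s n)\<^sup>2\<bar> * ((1 + sqrt (real n) / h n) * (1 + sqrt (real n) / h n))) * (real n * 1))"
      using P.OP_const[of 1 "\<lambda>n. (s n)\<^sup>2"] by (intro P.OP_mult Wmax_OP OP_x_sq) simp
    show "\<forall>\<^sub>F n in sequentially. (\<bar>(s n)\<^sup>2\<bar> * ((1 + sqrt (real n) / h n) * (1 + sqrt (real n) / h n))) * (real n * 1) \<le> 1 * (real n * rate_sq n)"
      using eventually_pos
    proof eventually_elim
      case (elim n)
      define W where "W = 1 + sqrt (real n) / h n"
      have "(\<bar>(s n)\<^sup>2\<bar> * (W * W)) * (real n * 1) = real n * (s n * W)\<^sup>2" by (simp add: power2_eq_square mult_ac)
      also have "\<dots> \<le> real n * rate_sq n" using elim unfolding rate_sq_def W_def by (intro mult_left_mono) auto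
      finally show ?case by (simp add: W_def)
    qed
  qed simp
  ultimately have Z: "OP S Z (\<lambda>n. real n * rate_sq n)" unfolding Z_def[abs_def] by (intro P.OP_add P.OP_cmult)
  show ?thesis
  proof (rule P.OP_dominated[OF Z])
    have "square_bound n \<xi> \<le> Z n \<xi>" for n \<xi>
    proof -
      have "(norm (x n i \<xi>))\<^sup>2 * (err_bound n i \<xi>)\<^sup>2 \<le> (2 / c0\<^sup>2) * ((norm (x n i \<xi>))\<^sup>2 * (Udev n i \<xi>)\<^sup>2)
         + (8 * A ^ 4 / c0\<^sup>2) * (((s n)\<^sup>2 * (Wmax n \<xi> * Wmax n \<xi>)) * (norm (x n i \<xi>))\<^sup>2)" for i
      proof -
        have "(u + v)\<^sup>2 \<le> 2 * u\<^sup>2 + 2 * v\<^sup>2" for u v :: real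
          using zero_le_power2[of "u - v"] by (simp add: power2_eq_square algebra_simps)
        then have "(err_bound n i \<xi>)\<^sup>2 \<le> (2 * (Udev n i \<xi>)\<^sup>2 + 2 * (2 * A\<^sup>2 * s n * Wmax n \<xi>)\<^sup>2) / c0\<^sup>2"
          unfolding err_bound_def power_divide by (intro divide_right_mono) auto
        then have "(norm (x n i \<xi>))\<^sup>2 * (err_bound n i \<xi>)\<^sup>2 \<le> (norm (x n i \<xi>))\<^sup>2 * ((2 * (Udev n i \<xi>)\<^sup>2 + 2 * (2 * A\<^sup>2 * s n * Wmax n \<xi>)\<^sup>2) / c0\<^sup>2)"
          by (rule mult_left_mono) simp
        also have "\<dots> = (2 / c0\<^sup>2) * ((norm (x n i \<xi>))\<^sup>2 * (Udev n i \<xi>)\<^sup>2)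
         + (8 * A ^ 4 / c0\<^sup>2) * (((s n)\<^sup>2 * (Wmax n \<xi> * Wmax n \<xi>)) * (norm (x n i \<xi>))\<^sup>2)"
          by (simp add: power_mult_distrib power2_eq_square[of "Wmax n \<xi>"] add_divide_distrib distrib_left mult_ac power_mult[symmetric])
        finally show ?thesis .
      qed
      then have "square_bound n \<xi> \<le> (\<Sum>i=1..n. (2 / c0\<^sup>2) * ((norm (x n i \<xi>))\<^sup>2 * (Udev n i \<xi>)\<^sup>2)
         + (8 * A ^ 4 / c0\<^sup>2) * (((s n)\<^sup>2 * (Wmax n \<xi> * Wmax n \<xi>)) * (norm (x n i \<xi>))\<^sup>2))"
        unfolding square_bound_def by (rule sum_mono)
      then show ?thesis unfolding Z_def by (simp only: sum.distrib sum_distrib_left)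
    qed
    moreover have "0 \<le> square_bound n \<xi>" for n \<xi> unfolding square_bound_def by (intro sum_nonneg) auto
    ultimately show "whp S (\<lambda>n \<xi>. \<bar>square_bound n \<xi>\<bar> \<le> \<bar>Z n \<xi>\<bar>)"
      by (intro whp_mono[OF design_whp] always_eventually allI ballI impI) (smt (verit))
  qed
qed

lemma cross_bound_OP: "OP S (\<lambda>n. cross_bound n a) (\<lambda>n. real n * rate_cross n)"
proof -
  have le1: "\<forall>\<^sub>F n in sequentially. real n * (1 / h n) \<le> 1 * (real n * rate_cross n)"
    using eventually_pos
  proof eventually_elim
    case (elim n)
    then have "0 \<le> s n * (1 + sqrt (real n) / h n) / sqrt (h n)" using s[of n] by (intro divide_nonneg_nonneg mult_nonneg_nonneg) auto
    then show ?case unfolding rate_cross_def mult_1 by (intro mult_left_mono) auto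
  qed
  have le2: "\<forall>\<^sub>F n in sequentially. real n * (s n / sqrt (h n)) \<le> 1 * (real n * rate_cross n)"
    using eventually_pos
  proof eventually_elim
    case (elim n)
    have "s n * 1 \<le> s n * (1 + sqrt (real n) / h n)" using s[of n] elim by (intro mult_left_mono) auto
    then have "s n / sqrt (h n) \<le> s n * (1 + sqrt (real n) / h n) / sqrt (h n)" using elim by (intro divide_right_mono) auto
    moreover have "0 \<le> 1 / h n" using elim by simp
    ultimately have "s n / sqrt (h n) \<le> rate_cross n" unfolding rate_cross_def by linarith
    then show ?case unfolding mult_1 by (intro mult_left_mono) auto
  qed
  have le3: "\<forall>\<^sub>F n in sequentially. (\<bar>s n\<bar> * (1 + sqrt (real n) / h n)) * (real n * (1 / sqrt (h n))) \<le> 1 * (real n * rate_cross n)"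
    using eventually_pos
  proof eventually_elim
    case (elim n)
    have "(\<bar>s n\<bar> * (1 + sqrt (real n) / h n)) * (real n * (1 / sqrt (h n))) = real n * (s n * (1 + sqrt (real n) / h n) / sqrt (h n))"
      using s[of n] by simp
    also have "\<dots> \<le> real n * rate_cross n" using elim unfolding rate_cross_def by (intro mult_left_mono) auto
    finally show ?case by simp
  qed
  have Q: "OP S (\<lambda>n \<xi>. \<bar>Qstat n a \<xi>\<bar>) (\<lambda>n. real n * rate_cross n)"
    using OP_rate[OF OP_Q le1] by (simp add: OP_def)
  have Pp: "OP S (\<lambda>n \<xi>. \<bar>Pstat n a \<xi>\<bar>) (\<lambda>n. real n * rate_cross n)"
    using OP_rate[OF OP_P le2] by (simp add: OP_def)
  have B: "OP S (\<lambda>n \<xi>. (2 / c0) * (\<Sum>i=1..n. \<bar>Lx n i a \<xi>\<bar> * Bdev n i \<xi>)) (\<lambda>n. real n * rate_cross n)"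
    by (intro P.OP_cmult OP_rate[OF OP_L_B le2]) simp
  have N1: "OP S (\<lambda>n \<xi>. (4 / c0\<^sup>2) * (\<Sum>i=1..n. \<bar>Lx n i a \<xi>\<bar> * Ndev n i \<xi> * Udev n i \<xi>)) (\<lambda>n. real n * rate_cross n)"
    by (intro P.OP_cmult OP_rate[OF OP_L_N_U le1]) simp
  have N2: "OP S (\<lambda>n \<xi>. (8 * A\<^sup>2 / c0\<^sup>2) * ((s n * Wmax n \<xi>) * (\<Sum>i=1..n. \<bar>Lx n i a \<xi>\<bar> * Ndev n i \<xi>))) (\<lambda>n. real n * rate_cross n)"
  proof (intro P.OP_cmult OP_rate[OF _ le3])
    show "OP S (\<lambda>n \<xi>. (s n * Wmax n \<xi>) * (\<Sum>i=1..n. \<bar>Lx n i a \<xi>\<bar> * Ndev n i \<xi>)) (\<lambda>n. (\<bar>s n\<bar> * (1 + sqrt (real n) / h n)) * (real n * (1 / sqrt (h n))))"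
      using P.OP_const[of 1 s] by (intro P.OP_mult Wmax_OP OP_L_N) simp
  qed simp
  have ce: "cross_bound n a \<xi> = \<bar>Qstat n a \<xi>\<bar> + \<bar>Pstat n a \<xi>\<bar> + (2 / c0) * (\<Sum>i=1..n. \<bar>Lx n i a \<xi>\<bar> * Bdev n i \<xi>)
      + ((4 / c0\<^sup>2) * (\<Sum>i=1..n. \<bar>Lx n i a \<xi>\<bar> * Ndev n i \<xi> * Udev n i \<xi>)
         + (8 * A\<^sup>2 / c0\<^sup>2) * ((s n * Wmax n \<xi>) * (\<Sum>i=1..n. \<bar>Lx n i a \<xi>\<bar> * Ndev n i \<xi>)))" for n \<xi>
  proof -
    have "(4 / c0) * (\<Sum>i=1..n. \<bar>Lx n i a \<xi>\<bar> * Ndev n i \<xi> * err_bound n i \<xi>)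
       = (\<Sum>i=1..n. (4 / c0\<^sup>2) * (\<bar>Lx n i a \<xi>\<bar> * Ndev n i \<xi> * Udev n i \<xi>)
         + (8 * A\<^sup>2 / c0\<^sup>2) * ((s n * Wmax n \<xi>) * (\<bar>Lx n i a \<xi>\<bar> * Ndev n i \<xi>)))"
      unfolding sum_distrib_left by (intro sum.cong refl) (simp add: err_bound_def power2_eq_square[of c0] add_divide_distrib distrib_left mult_ac)
    also have "\<dots> = (4 / c0\<^sup>2) * (\<Sum>i=1..n. \<bar>Lx n i a \<xi>\<bar> * Ndev n i \<xi> * Udev n i \<xi>)
         + (8 * A\<^sup>2 / c0\<^sup>2) * ((s n * Wmax n \<xi>) * (\<Sum>i=1..n. \<bar>Lx n i a \<xi>\<bar> * Ndev n i \<xi>))"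
      by (simp only: sum.distrib sum_distrib_left)
    finally show ?thesis unfolding cross_bound_def by simp
  qed
  show ?thesis using P.OP_add[OF P.OP_add[OF P.OP_add[OF Q Pp] B] P.OP_add[OF N1 N2]] unfolding ce[symmetric] .
qed

end

section \<open>Comparison of two models\<close>

definition restrict_to :: "'p set \<Rightarrow> real ^ 'p \<Rightarrow> real ^ 'p" where
  "restrict_to D v = (\<chi> a. if a \<in> D then v $ a else 0)"

lemma restrict_to_norm: "norm (restrict_to D v) \<le> norm v"
  unfolding norm_vec_def by (intro L2_set_mono) (auto simp: restrict_to_def)

lemma inner_restrict_to: "y \<bullet> restrict_to D v = (\<Sum>a\<in>D. y $ a * v $ a)" for y :: "real ^ 'p::finite"
proof -
  have "y \<bullet> restrict_to D v = (\<Sum>a\<in>UNIV. if a \<in> D then y $ a * v $ a else 0)"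
    by (auto simp: inner_vec_def restrict_to_def intro!: sum.cong)
  also have "\<dots> = (\<Sum>a\<in>D. y $ a * v $ a)" by (simp add: sum.If_cases)
  finally show ?thesis .
qed

text \<open>\<open>bt n i\<close> is the coefficient vector at observation \<open>i\<close>. The last conditions say that the estimation
  effects are negligible against the penalty.\<close>

locale regression_selection = regression_array M x e w h s R K A l \<kappa> v1 v2 p
  for M :: "'s measure" and x :: "nat \<Rightarrow> nat \<Rightarrow> (nat \<Rightarrow> 's) \<Rightarrow> real ^ 'p" and e w h s R K A l \<kappa> v1 v2 p +
  fixes bt :: "nat \<Rightarrow> nat \<Rightarrow> real ^ 'p" and D0 :: "'p set" and chi :: "nat \<Rightarrow> real"
  assumes ed: "i \<in> {1..n} \<Longrightarrow> influence 2 (e n i) k (w n i k)"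
    and bt: "i \<in> {1..n} \<Longrightarrow> norm (bt n i) \<le> A"
    and bt0: "i \<in> {1..n} \<Longrightarrow> a \<notin> D0 \<Longrightarrow> bt n i $ a = 0"
    and signal: "a \<in> D0 \<Longrightarrow> \<exists>q>0. \<forall>\<^sub>F n in sequentially. q * real n \<le> (\<Sum>i=1..n. (bt n i $ a)\<^sup>2)"
    and noise: "\<exists>\<nu>>0. \<exists>q>0. \<forall>\<^sub>F n in sequentially. q * real n \<le> (\<Sum>i=1..n. \<integral>\<xi>. (clip \<nu> (e n i \<xi>))\<^sup>2 \<partial>PiM UNIV (\<lambda>_::nat. M))"
    and chi: "chi \<longlonglongrightarrow> 0" "\<forall>\<^sub>F n in sequentially. 0 < chi n"
    and rates: "(\<lambda>n. rate_sq n / chi n) \<longlonglongrightarrow> 0" "(\<lambda>n. rate_cross n / chi n) \<longlonglongrightarrow> 0"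
begin

text \<open>The residual of model \<open>D\<close> in terms of the estimation errors: the omitted components of the signal
  stay, and the included ones contribute their estimation errors.\<close>

definition residual where
  "residual n i \<xi> \<Delta> D = e n i \<xi> + x n i \<xi> \<bullet> restrict_to (- D) (bt n i) - x n i \<xi> \<bullet> restrict_to D (fst (\<Delta> i))"
definition rss where "rss n \<xi> \<Delta> D = (\<Sum>i=1..n. (residual n i \<xi> \<Delta> D)\<^sup>2)"
definition vic where "vic n \<xi> \<Delta> D = ln (rss n \<xi> \<Delta> D) + chi n * real (card D)"

lemma OP_e_sq: "OP S (\<lambda>n \<xi>. \<Sum>i=1..n. (e n i \<xi>)\<^sup>2) (\<lambda>n. real n * 1)"
proof (rule OP_sum_Lp)
  fix n i :: nat assume i: "i \<in> {1..n}"
  show "Lp_le S 1 (\<lambda>\<xi>. (e n i \<xi>)\<^sup>2) (A\<^sup>2 * 1)"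
    using Lp_le_mult_2_1[OF e2[OF i] e2[OF i]] by (simp add: power2_eq_square)
qed auto

lemma whp_small_ratio:
  assumes Z: "OP Q Z m" and m: "(\<lambda>n. m n / k n) \<longlonglongrightarrow> 0" and k: "\<forall>\<^sub>F n in sequentially. 0 < k n" and \<zeta>: "0 < \<zeta>"
  shows "whp Q (\<lambda>n \<xi>. \<bar>Z n \<xi>\<bar> \<le> \<zeta> * k n)"
proof -
  have "OP Q (\<lambda>n \<xi>. Z n \<xi> / k n) (\<lambda>n. m n / k n)"
    unfolding OP_def
  proof (intro allI impI)
    fix \<epsilon> :: real assume "\<epsilon> > 0"
    with Z obtain C where C: "C \<ge> 0" "likely Q \<epsilon> (\<lambda>n \<xi>. \<bar>Z n \<xi>\<bar> \<le> C * m n)" unfolding OP_def by meson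
    have "likely Q \<epsilon> (\<lambda>n \<xi>. \<bar>Z n \<xi> / k n\<bar> \<le> C * (m n / k n))"
      by (rule likely_mono[OF C(2)], use k in eventually_elim) (auto simp: divide_right_mono)
    then show "\<exists>C\<ge>0. likely Q \<epsilon> (\<lambda>n \<xi>. \<bar>Z n \<xi> / k n\<bar> \<le> C * (m n / k n))" using C by blast
  qed
  from OP_small[OF this m \<zeta>] show ?thesis
    by (rule whp_mono, use k in eventually_elim) (auto simp: pos_divide_le_eq)
qed

lemma whp_small_average:
  assumes Z: "OP S Z (\<lambda>n. real n * m n)" and m: "m \<longlonglongrightarrow> 0" and \<zeta>: "0 < \<zeta>"
  shows "whp S (\<lambda>n \<xi>. \<bar>Z n \<xi>\<bar> \<le> \<zeta> * real n)"
proof (rule whp_small_ratio[OF Z _ _ \<zeta>])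
  have ev: "\<forall>\<^sub>F n in sequentially. m n = real n * m n / real n"
    using eventually_gt_at_top[of "0::nat"] by eventually_elim simp
  show "(\<lambda>n. real n * m n / real n) \<longlonglongrightarrow> 0" by (rule Lim_transform_eventually[OF m ev])
  show "\<forall>\<^sub>F n in sequentially. 0 < real n" using eventually_gt_at_top[of "0::nat"] by eventually_elim simp
qed

lemma inv_sqrt_tendsto: "(\<lambda>n. 1 / sqrt (real n)) \<longlonglongrightarrow> 0"
  using tendsto_inverse_0_at_top[OF filterlim_compose[OF sqrt_at_top filterlim_real_sequentially]] by (simp add: inverse_eq_divide)

lemma OP_linear:
  assumes X: "\<And>n. weak_array 2 n (w n) B (X n)" and c: "\<And>n i. i \<in> {1..n} \<Longrightarrow> \<bar>c n i\<bar> \<le> C" and C: "0 \<le> C"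
  shows "OP S (\<lambda>n \<xi>. \<Sum>i=1..n. c n i * (X n i \<xi> - (\<integral>\<xi>. X n i \<xi> \<partial>S))) (\<lambda>n. real n * (1 / sqrt (real n)))"
proof (rule P.OP_of_Lp_le)
  have B: "0 \<le> B" using X[of 0] by (simp add: weak_array_def)
  show "0 \<le> B * A * C" using B A C by simp
  show "\<forall>\<^sub>F n in sequentially. 0 < real n * (1 / sqrt (real n))"
    using eventually_gt_at_top[of "0::nat"] by eventually_elim simp
  show "\<forall>\<^sub>F n in sequentially. Lp_le S 1 (\<lambda>\<xi>. \<Sum>i=1..n. c n i * (X n i \<xi> - (\<integral>\<xi>. X n i \<xi> \<partial>S))) (B * A * C * (real n * (1 / sqrt (real n))))"
    using eventually_gt_at_top[of "0::nat"]
  proof eventually_elim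
    case (elim n)
    have "(\<Sum>i=1..n. (c n i)\<^sup>2) \<le> (\<Sum>i=1..n. C\<^sup>2)"
    proof (rule sum_mono)
      fix i assume "i \<in> {1..n}"
      then have "\<bar>c n i\<bar>\<^sup>2 \<le> C\<^sup>2" using c by (intro power_mono) auto
      then show "(c n i)\<^sup>2 \<le> C\<^sup>2" by simp
    qed
    then have "sqrt (\<Sum>i=1..n. (c n i)\<^sup>2) \<le> sqrt (real n * C\<^sup>2)" by simp
    also have "\<dots> = C * (real n * (1 / sqrt (real n)))" using C elim by (simp add: real_sqrt_mult real_div_sqrt)
    finally have "B * A * sqrt (\<Sum>i=1..n. (c n i)\<^sup>2) \<le> B * A * (C * (real n * (1 / sqrt (real n))))"
      using A B by (intro mult_left_mono) auto
    then have "B * A * sqrt (\<Sum>i=1..n. (c n i)\<^sup>2) \<le> B * A * C * (real n * (1 / sqrt (real n)))" by (simp add: mult_ac)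
    from Lp_le_weaken[OF weak_array_linear_2[OF w X] this] show ?case by (rule P.Lp_le_2_1)
  qed
qed

text \<open>The squared errors need not have a variance, but those of the clipped errors do, and clipping only
  decreases them.\<close>

lemma noise_lower: "\<exists>\<theta>>0. whp S (\<lambda>n \<xi>. \<theta> * real n \<le> (\<Sum>i=1..n. (e n i \<xi>)\<^sup>2))"
proof -
  obtain \<nu> q where \<nu>: "\<nu> > 0" and q: "q > 0" "\<forall>\<^sub>F n in sequentially. q * real n \<le> (\<Sum>i=1..n. \<integral>\<xi>. (clip \<nu> (e n i \<xi>))\<^sup>2 \<partial>S)"
    using noise by blast
  have lip: "\<bar>(clip \<nu> a)\<^sup>2 - (clip \<nu> b)\<^sup>2\<bar> \<le> 2 * \<nu> * \<bar>a - b\<bar>" for a b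
  proof -
    have "\<bar>(clip \<nu> a)\<^sup>2 - (clip \<nu> b)\<^sup>2\<bar> = \<bar>clip \<nu> a + clip \<nu> b\<bar> * \<bar>clip \<nu> a - clip \<nu> b\<bar>"
      by (simp add: abs_mult[symmetric] power2_eq_square algebra_simps)
    also have "\<dots> \<le> (2 * \<nu>) * \<bar>a - b\<bar>"
    proof (rule mult_mono)
      show "\<bar>clip \<nu> a + clip \<nu> b\<bar> \<le> 2 * \<nu>" using clip_bound[of \<nu> a] clip_bound[of \<nu> b] \<nu> by linarith
    qed (use clip_lipschitz \<nu> in auto)
    finally show ?thesis .
  qed
  have wa: "weak_array 2 n (w n) (2 * \<nu>) (\<lambda>i \<xi>. (clip \<nu> (e n i \<xi>))\<^sup>2)" for n
    unfolding weak_array_def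
  proof (intro conjI ballI allI)
    fix i k assume i: "i \<in> {1..n}"
    note [measurable] = em[OF i]
    show "integrable S (\<lambda>\<xi>. (clip \<nu> (e n i \<xi>))\<^sup>2)"
    proof (rule P.integrable_const_bound[where B="\<nu>\<^sup>2"])
      have "\<bar>clip \<nu> y\<bar>\<^sup>2 \<le> \<nu>\<^sup>2" for y using clip_bound[of \<nu> y] \<nu> by (intro power_mono) auto
      then show "AE \<xi> in S. norm ((clip \<nu> (e n i \<xi>))\<^sup>2) \<le> \<nu>\<^sup>2" by simp
    qed measurable
    show "influence 2 (\<lambda>\<xi>. (clip \<nu> (e n i \<xi>))\<^sup>2) k (2 * \<nu> * w n i k)"
      by (rule influence_lipschitz[OF _ lip _ em[OF i] ed[OF i]]) (use \<nu> in \<open>auto intro: clip_measurable\<close>)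
  qed (use \<nu> in simp)
  have "OP S (\<lambda>n \<xi>. \<Sum>i=1..n. 1 * ((clip \<nu> (e n i \<xi>))\<^sup>2 - (\<integral>\<xi>. (clip \<nu> (e n i \<xi>))\<^sup>2 \<partial>S))) (\<lambda>n. real n * (1 / sqrt (real n)))"
    by (rule OP_linear[OF wa, of "\<lambda>_ _. 1" 1]) auto
  from whp_small_average[OF this inv_sqrt_tendsto, of "q / 2"] q(1)
  have "whp S (\<lambda>n \<xi>. \<bar>\<Sum>i=1..n. 1 * ((clip \<nu> (e n i \<xi>))\<^sup>2 - (\<integral>\<xi>. (clip \<nu> (e n i \<xi>))\<^sup>2 \<partial>S))\<bar> \<le> q / 2 * real n)"
    by simp
  then have "whp S (\<lambda>n \<xi>. q / 2 * real n \<le> (\<Sum>i=1..n. (e n i \<xi>)\<^sup>2))"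
  proof (rule whp_mono, use q(2) in eventually_elim, intro ballI impI)
    fix n \<xi> assume m: "q * real n \<le> (\<Sum>i=1..n. \<integral>\<xi>. (clip \<nu> (e n i \<xi>))\<^sup>2 \<partial>S)"
      and d: "\<bar>\<Sum>i=1..n. 1 * ((clip \<nu> (e n i \<xi>))\<^sup>2 - (\<integral>\<xi>. (clip \<nu> (e n i \<xi>))\<^sup>2 \<partial>S))\<bar> \<le> q / 2 * real n"
    have "(\<Sum>i=1..n. (clip \<nu> (e n i \<xi>))\<^sup>2) \<le> (\<Sum>i=1..n. (e n i \<xi>)\<^sup>2)"
      using clip_le[of \<nu>] \<nu> by (intro sum_mono) (simp add: abs_le_square_iff[symmetric])
    moreover have "(\<Sum>i=1..n. 1 * ((clip \<nu> (e n i \<xi>))\<^sup>2 - (\<integral>\<xi>. (clip \<nu> (e n i \<xi>))\<^sup>2 \<partial>S))) = (\<Sum>i=1..n. (clip \<nu> (e n i \<xi>))\<^sup>2) - (\<Sum>i=1..n. \<integral>\<xi>. (clip \<nu> (e n i \<xi>))\<^sup>2 \<partial>S)"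
      by (simp add: sum_subtractf)
    ultimately show "q / 2 * real n \<le> (\<Sum>i=1..n. (e n i \<xi>)\<^sup>2)" using m d by linarith
  qed
  then show ?thesis using q(1) by (intro exI[of _ "q / 2"]) auto
qed

text \<open>The part of the signal that a model misses is uncorrelated with the errors and has an
  empirical second moment bounded away from zero.\<close>

lemma missed_signal_cross:
  assumes \<zeta>: "0 < \<zeta>" shows "whp S (\<lambda>n \<xi>. \<bar>\<Sum>i=1..n. e n i \<xi> * (x n i \<xi> \<bullet> restrict_to D (bt n i))\<bar> \<le> \<zeta> * real n)"
proof -
  have "OP S (\<lambda>n \<xi>. \<Sum>a\<in>UNIV. \<Sum>i=1..n. restrict_to D (bt n i) $ a * (e n i \<xi> * x n i \<xi> $ a - (\<integral>\<xi>. e n i \<xi> * x n i \<xi> $ a \<partial>S))) (\<lambda>n. real n * (1 / sqrt (real n)))"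
  proof (intro P.OP_sum OP_linear[OF weak_array_4_2[OF weak_L], where C=A])
    fix a :: 'p and n i :: nat assume "i \<in> {1..n}"
    then show "\<bar>restrict_to D (bt n i) $ a\<bar> \<le> A"
      using component_le_norm_cart[of "restrict_to D (bt n i)" a] restrict_to_norm[of D "bt n i"] bt[of i n] by linarith
  qed (use A in auto)
  from whp_small_average[OF this inv_sqrt_tendsto \<zeta>] show ?thesis
  proof (rule whp_mono, intro always_eventually allI ballI impI)
    fix n \<xi> assume le: "\<bar>\<Sum>a\<in>UNIV. \<Sum>i=1..n. restrict_to D (bt n i) $ a * (e n i \<xi> * x n i \<xi> $ a - (\<integral>\<xi>. e n i \<xi> * x n i \<xi> $ a \<partial>S))\<bar> \<le> \<zeta> * real n"
    have "(\<Sum>a\<in>UNIV. \<Sum>i=1..n. restrict_to D (bt n i) $ a * (e n i \<xi> * x n i \<xi> $ a - (\<integral>\<xi>. e n i \<xi> * x n i \<xi> $ a \<partial>S)))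
       = (\<Sum>i=1..n. e n i \<xi> * (x n i \<xi> \<bullet> restrict_to D (bt n i)))"
      unfolding inner_vec_def sum_distrib_left by (subst sum.swap) (intro sum.cong refl, simp add: L0)
    then show "\<bar>\<Sum>i=1..n. e n i \<xi> * (x n i \<xi> \<bullet> restrict_to D (bt n i))\<bar> \<le> \<zeta> * real n" using le by simp
  qed
qed

lemma missed_signal_square:
  assumes a: "a \<in> D0" "a \<in> D"
  shows "\<exists>\<gamma>>0. whp S (\<lambda>n \<xi>. \<gamma> * real n \<le> (\<Sum>i=1..n. (x n i \<xi> \<bullet> restrict_to D (bt n i))\<^sup>2))"
proof -
  obtain q where q: "q > 0" "\<forall>\<^sub>F n in sequentially. q * real n \<le> (\<Sum>i=1..n. (bt n i $ a)\<^sup>2)" using signal[OF a(1)] by blast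
  define b where "b n i = restrict_to D (bt n i)" for n i
  have bA: "\<bar>b n i $ c\<bar> \<le> A" if "i \<in> {1..n}" for n i c
    using component_le_norm_cart[of "b n i" c] restrict_to_norm[of D "bt n i"] bt[OF that] unfolding b_def by linarith
  define \<gamma> where "\<gamma> = l * q / 2"
  have \<gamma>: "\<gamma> > 0" using l q by (simp add: \<gamma>_def)
  define dev where "dev n \<xi> = (\<Sum>c\<in>UNIV. \<Sum>d\<in>UNIV. \<Sum>i=1..n. (b n i $ c * b n i $ d) * (x n i \<xi> $ c * x n i \<xi> $ d - (\<integral>\<xi>. x n i \<xi> $ c * x n i \<xi> $ d \<partial>S)))" for n \<xi>
  have "OP S dev (\<lambda>n. real n * (1 / sqrt (real n)))"
    unfolding dev_def[abs_def]
  proof (intro P.OP_sum OP_linear[OF weak_xx, where C="A * A"])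
    fix c d :: 'p and n i :: nat assume i: "i \<in> {1..n}"
    show "\<bar>b n i $ c * b n i $ d\<bar> \<le> A * A" unfolding abs_mult using A by (intro mult_mono bA i) auto
  qed (use A in auto)
  from whp_small_average[OF this inv_sqrt_tendsto \<gamma>] have "whp S (\<lambda>n \<xi>. \<bar>dev n \<xi>\<bar> \<le> \<gamma> * real n)" .
  then have "whp S (\<lambda>n \<xi>. \<gamma> * real n \<le> (\<Sum>i=1..n. (x n i \<xi> \<bullet> restrict_to D (bt n i))\<^sup>2))"
  proof (rule whp_mono, use q(2) in eventually_elim, intro ballI impI)
    fix n \<xi> assume m: "q * real n \<le> (\<Sum>i=1..n. (bt n i $ a)\<^sup>2)" and d: "\<bar>dev n \<xi>\<bar> \<le> \<gamma> * real n"
    have ex: "(x n i \<xi> \<bullet> b n i)\<^sup>2 = (\<Sum>c\<in>UNIV. \<Sum>d\<in>UNIV. (b n i $ c * b n i $ d) * (x n i \<xi> $ c * x n i \<xi> $ d))" for i \<xi>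
      by (simp add: inner_vec_def power2_eq_square sum_product mult_ac)
    have E: "(\<integral>\<xi>. (x n i \<xi> \<bullet> b n i)\<^sup>2 \<partial>S) = (\<Sum>c\<in>UNIV. \<Sum>d\<in>UNIV. (b n i $ c * b n i $ d) * (\<integral>\<xi>. x n i \<xi> $ c * x n i \<xi> $ d \<partial>S))" if i: "i \<in> {1..n}" for i
      unfolding ex using weak_xx i by (simp add: weak_array_def)
    have "dev n \<xi> = (\<Sum>i=1..n. \<Sum>c\<in>UNIV. \<Sum>d\<in>UNIV. (b n i $ c * b n i $ d) * (x n i \<xi> $ c * x n i \<xi> $ d - (\<integral>\<xi>. x n i \<xi> $ c * x n i \<xi> $ d \<partial>S)))"
      unfolding dev_def
      by (subst sum.swap[of _ "{1..n}"]) (rule sum.swap)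
    also have "\<dots> = (\<Sum>i=1..n. (x n i \<xi> \<bullet> b n i)\<^sup>2 - (\<integral>\<xi>. (x n i \<xi> \<bullet> b n i)\<^sup>2 \<partial>S))"
      by (rule sum.cong[OF refl]) (simp only: ex[of _ \<xi>] E sum_subtractf[symmetric] right_diff_distrib)
    finally have dev: "dev n \<xi> = (\<Sum>i=1..n. (x n i \<xi> \<bullet> b n i)\<^sup>2) - (\<Sum>i=1..n. \<integral>\<xi>. (x n i \<xi> \<bullet> b n i)\<^sup>2 \<partial>S)"
      by (simp add: sum_subtractf)
    have "2 * \<gamma> * real n = l * (q * real n)" by (simp add: \<gamma>_def)
    also have "\<dots> \<le> l * (\<Sum>i=1..n. (bt n i $ a)\<^sup>2)" using m l by (intro mult_left_mono) auto
    also have "\<dots> \<le> (\<Sum>i=1..n. \<integral>\<xi>. (x n i \<xi> \<bullet> b n i)\<^sup>2 \<partial>S)"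
      unfolding sum_distrib_left
    proof (rule sum_mono)
      fix i assume i: "i \<in> {1..n}"
      have "(bt n i $ a)\<^sup>2 = \<bar>b n i $ a\<bar>\<^sup>2" using a(2) by (simp add: b_def restrict_to_def)
      also have "\<dots> \<le> (norm (b n i))\<^sup>2" by (intro power_mono component_le_norm_cart) simp
      finally have "l * (bt n i $ a)\<^sup>2 \<le> l * (norm (b n i))\<^sup>2" using l by (intro mult_left_mono) auto
      also have "\<dots> \<le> (\<integral>\<xi>. (x n i \<xi> \<bullet> b n i)\<^sup>2 \<partial>S)" by (rule coercive[OF i])
      finally show "l * (bt n i $ a)\<^sup>2 \<le> (\<integral>\<xi>. (x n i \<xi> \<bullet> b n i)\<^sup>2 \<partial>S)" .
    qed
    finally have "2 * \<gamma> * real n \<le> (\<Sum>i=1..n. \<integral>\<xi>. (x n i \<xi> \<bullet> b n i)\<^sup>2 \<partial>S)" .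
    then show "\<gamma> * real n \<le> (\<Sum>i=1..n. (x n i \<xi> \<bullet> restrict_to D (bt n i))\<^sup>2)"
      using d dev unfolding b_def by linarith
  qed
  then show ?thesis using \<gamma> by blast
qed

lemma fitted_sq_le: "(\<Sum>i=1..n. (x n i \<xi> \<bullet> restrict_to D (fst (\<Delta> i)))\<^sup>2) \<le> (\<Sum>i=1..n. (norm (x n i \<xi>))\<^sup>2 * (norm (\<Delta> i))\<^sup>2)"
proof (rule sum_mono)
  fix i
  have "\<bar>x n i \<xi> \<bullet> restrict_to D (fst (\<Delta> i))\<bar> \<le> norm (x n i \<xi>) * norm (restrict_to D (fst (\<Delta> i)))"
    by (rule Cauchy_Schwarz_ineq2)
  also have "\<dots> \<le> norm (x n i \<xi>) * norm (\<Delta> i)"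
    using restrict_to_norm[of D "fst (\<Delta> i)"] norm_fst_le[of "fst (\<Delta> i)" "snd (\<Delta> i)"] by (intro mult_left_mono) auto
  finally have "\<bar>x n i \<xi> \<bullet> restrict_to D (fst (\<Delta> i))\<bar>\<^sup>2 \<le> (norm (x n i \<xi>) * norm (\<Delta> i))\<^sup>2" by (intro power_mono) auto
  then show "(x n i \<xi> \<bullet> restrict_to D (fst (\<Delta> i)))\<^sup>2 \<le> (norm (x n i \<xi>))\<^sup>2 * (norm (\<Delta> i))\<^sup>2"
    by (simp add: power_mult_distrib)
qed

lemma residual_full:
  assumes "D0 \<subseteq> D" "i \<in> {1..n}"
  shows "residual n i \<xi> \<Delta> D = e n i \<xi> - x n i \<xi> \<bullet> restrict_to D (fst (\<Delta> i))"
proof -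
  have "restrict_to (- D) (bt n i) = 0" using assms bt0 by (auto simp: restrict_to_def vec_eq_iff)
  then show ?thesis by (simp add: residual_def)
qed

lemma rss_full_lower:
  assumes D: "D0 \<subseteq> D" and X: "(\<Sum>i=1..n. (norm (x n i \<xi>))\<^sup>2 * (norm (\<Delta> i))\<^sup>2) \<le> X"
  shows "(\<Sum>i=1..n. (e n i \<xi>)\<^sup>2) / 2 - X \<le> rss n \<xi> \<Delta> D"
proof -
  have "(\<Sum>i=1..n. (e n i \<xi>)\<^sup>2 / 2 - (x n i \<xi> \<bullet> restrict_to D (fst (\<Delta> i)))\<^sup>2) \<le> rss n \<xi> \<Delta> D"
    unfolding rss_def
  proof (rule sum_mono)
    fix i assume i: "i \<in> {1..n}"
    have "u\<^sup>2 / 2 - v\<^sup>2 \<le> (u - v)\<^sup>2" for u v :: real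
    proof -
      have "(u - v)\<^sup>2 - (u\<^sup>2 / 2 - v\<^sup>2) = (u - 2 * v)\<^sup>2 / 2" by (simp add: power2_eq_square field_simps)
      then show ?thesis using zero_le_power2[of "u - 2 * v"] by linarith
    qed
    then show "(e n i \<xi>)\<^sup>2 / 2 - (x n i \<xi> \<bullet> restrict_to D (fst (\<Delta> i)))\<^sup>2 \<le> (residual n i \<xi> \<Delta> D)\<^sup>2"
      unfolding residual_full[OF D i] .
  qed
  then show ?thesis using fitted_sq_le[of n \<xi> D \<Delta>] X by (simp add: sum_subtractf sum_divide_distrib)
qed

text \<open>Two models without omitted signal differ only in the fitted noise of the superfluous components.
  The square of the errors cancels, and the cross terms remain.\<close>

lemma rss_full_diff:
  assumes D: "D0 \<subseteq> D" and X: "(\<Sum>i=1..n. (norm (x n i \<xi>))\<^sup>2 * (norm (\<Delta> i))\<^sup>2) \<le> X"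
    and c: "\<And>a. \<bar>\<Sum>i=1..n. Lx n i a \<xi> * fst (\<Delta> i) $ a\<bar> \<le> c a"
  shows "rss n \<xi> \<Delta> D0 - rss n \<xi> \<Delta> D \<le> 2 * (\<Sum>a\<in>D - D0. c a) + X"
proof -
  let ?q = "\<lambda>D i. x n i \<xi> \<bullet> restrict_to D (fst (\<Delta> i))"
  have "rss n \<xi> \<Delta> D0 - rss n \<xi> \<Delta> D = (\<Sum>i=1..n. (residual n i \<xi> \<Delta> D0)\<^sup>2 - (residual n i \<xi> \<Delta> D)\<^sup>2)"
    by (simp add: rss_def sum_subtractf)
  also have "\<dots> = (\<Sum>i=1..n. 2 * (\<Sum>a\<in>D - D0. Lx n i a \<xi> * fst (\<Delta> i) $ a) + (?q D0 i)\<^sup>2 - (?q D i)\<^sup>2)"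
  proof (rule sum.cong[OF refl])
    fix i assume i: "i \<in> {1..n}"
    have "?q D i - ?q D0 i = (\<Sum>a\<in>D - D0. x n i \<xi> $ a * fst (\<Delta> i) $ a)"
      unfolding inner_restrict_to using D by (subst sum_diff) auto
    then have "e n i \<xi> * (?q D i - ?q D0 i) = (\<Sum>a\<in>D - D0. Lx n i a \<xi> * fst (\<Delta> i) $ a)"
      by (simp add: Lx_def sum_distrib_left mult_ac)
    moreover have "(residual n i \<xi> \<Delta> D0)\<^sup>2 - (residual n i \<xi> \<Delta> D)\<^sup>2 = 2 * (e n i \<xi> * (?q D i - ?q D0 i)) + (?q D0 i)\<^sup>2 - (?q D i)\<^sup>2"
      unfolding residual_full[OF D i] residual_full[OF subset_refl i] by (simp add: power2_eq_square algebra_simps)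
    ultimately show "(residual n i \<xi> \<Delta> D0)\<^sup>2 - (residual n i \<xi> \<Delta> D)\<^sup>2
       = 2 * (\<Sum>a\<in>D - D0. Lx n i a \<xi> * fst (\<Delta> i) $ a) + (?q D0 i)\<^sup>2 - (?q D i)\<^sup>2" by simp
  qed
  also have "\<dots> = 2 * (\<Sum>i=1..n. \<Sum>a\<in>D - D0. Lx n i a \<xi> * fst (\<Delta> i) $ a) + (\<Sum>i=1..n. (?q D0 i)\<^sup>2) - (\<Sum>i=1..n. (?q D i)\<^sup>2)"
    by (simp add: sum_subtractf sum.distrib sum_distrib_left)
  also have "(\<Sum>i=1..n. \<Sum>a\<in>D - D0. Lx n i a \<xi> * fst (\<Delta> i) $ a) = (\<Sum>a\<in>D - D0. \<Sum>i=1..n. Lx n i a \<xi> * fst (\<Delta> i) $ a)"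
    by (rule sum.swap)
  also have "\<dots> \<le> (\<Sum>a\<in>D - D0. c a)"
    by (intro sum_mono) (rule abs_le_D1[OF c])
  finally show ?thesis
    using fitted_sq_le[of n \<xi> D0 \<Delta>] X sum_nonneg[of "{1..n}" "\<lambda>i. (?q D i)\<^sup>2"] by fastforce
qed

text \<open>Young's inequality with parameter \<open>t\<close> separates the errors from the estimation errors; the errors
  themselves cancel up to the factor \<open>t\<close>.\<close>

lemma rss_missed_diff:
  assumes X: "(\<Sum>i=1..n. (norm (x n i \<xi>))\<^sup>2 * (norm (\<Delta> i))\<^sup>2) \<le> X" and t: "0 < t" "t \<le> 1 / 2"
  shows "(\<Sum>i=1..n. (x n i \<xi> \<bullet> restrict_to (- D) (bt n i))\<^sup>2) / 2 - 2 * t * (\<Sum>i=1..n. (e n i \<xi>)\<^sup>2)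
      - 2 * \<bar>\<Sum>i=1..n. e n i \<xi> * (x n i \<xi> \<bullet> restrict_to (- D) (bt n i))\<bar> - (1 + 2 / t) * X \<le> rss n \<xi> \<Delta> D - rss n \<xi> \<Delta> D0"
    and "rss n \<xi> \<Delta> D0 \<le> 2 * (\<Sum>i=1..n. (e n i \<xi>)\<^sup>2) + 2 * X"
proof -
  let ?q = "\<lambda>D i. x n i \<xi> \<bullet> restrict_to D (fst (\<Delta> i))" and ?g = "\<lambda>i. x n i \<xi> \<bullet> restrict_to (- D) (bt n i)"
  let ?e = "\<lambda>i. e n i \<xi>"
  have alg: "(1 - t) * g\<^sup>2 - 2 * t * e\<^sup>2 + 2 * (1 - t) * (e * g) - q\<^sup>2 / t - (1 + 1 / t) * q0\<^sup>2 \<le> (e + g - q)\<^sup>2 - (e - q0)\<^sup>2" for e g q q0 :: real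
  proof -
    have "(e + g - q)\<^sup>2 - (e - q0)\<^sup>2 - ((1 - t) * g\<^sup>2 - 2 * t * e\<^sup>2 + 2 * (1 - t) * (e * g) - q\<^sup>2 / t - (1 + 1 / t) * q0\<^sup>2)
       = (t * (e + g) - q)\<^sup>2 / t + q\<^sup>2 + (t * e + q0)\<^sup>2 / t"
      using t by (simp add: power2_eq_square field_simps)
    moreover have "0 \<le> (t * (e + g) - q)\<^sup>2 / t + q\<^sup>2 + (t * e + q0)\<^sup>2 / t" using t by simp
    ultimately show ?thesis by linarith
  qed
  have point: "(1 - t) * (?g i)\<^sup>2 - 2 * t * (?e i)\<^sup>2 + 2 * (1 - t) * (?e i * ?g i) - (?q D i)\<^sup>2 / t - (1 + 1 / t) * (?q D0 i)\<^sup>2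
     \<le> (residual n i \<xi> \<Delta> D)\<^sup>2 - (residual n i \<xi> \<Delta> D0)\<^sup>2" if i: "i \<in> {1..n}" for i
    using alg[of "?g i" "?e i" "?q D i" "?q D0 i"]
    unfolding residual_full[OF subset_refl i] unfolding residual_def .
  have "(1 - t) * (\<Sum>i=1..n. (?g i)\<^sup>2) - 2 * t * (\<Sum>i=1..n. (?e i)\<^sup>2) + 2 * (1 - t) * (\<Sum>i=1..n. ?e i * ?g i) - (\<Sum>i=1..n. (?q D i)\<^sup>2) / t - (1 + 1 / t) * (\<Sum>i=1..n. (?q D0 i)\<^sup>2)
     \<le> rss n \<xi> \<Delta> D - rss n \<xi> \<Delta> D0"
    unfolding rss_def sum_distrib_left sum_divide_distrib sum_subtractf[symmetric] sum.distrib[symmetric]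
    by (intro sum_mono point)
  moreover have "(\<Sum>i=1..n. (?g i)\<^sup>2) / 2 \<le> (1 - t) * (\<Sum>i=1..n. (?g i)\<^sup>2)"
    using mult_right_mono[of "1 / 2" "1 - t" "\<Sum>i=1..n. (?g i)\<^sup>2"] t by (simp add: sum_nonneg)
  moreover have "- (2 * \<bar>\<Sum>i=1..n. ?e i * ?g i\<bar>) \<le> 2 * (1 - t) * (\<Sum>i=1..n. ?e i * ?g i)"
  proof -
    have "\<bar>2 * (1 - t) * (\<Sum>i=1..n. ?e i * ?g i)\<bar> \<le> 2 * \<bar>\<Sum>i=1..n. ?e i * ?g i\<bar>"
      unfolding abs_mult using t by (intro mult_right_mono) auto
    then show ?thesis by linarith
  qed
  moreover have "(\<Sum>i=1..n. (?q D i)\<^sup>2) / t + (1 + 1 / t) * (\<Sum>i=1..n. (?q D0 i)\<^sup>2) \<le> (1 + 2 / t) * X"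
  proof -
    have "(\<Sum>i=1..n. (?q D i)\<^sup>2) / t \<le> X / t" using fitted_sq_le[of n \<xi> D \<Delta>] X t by (intro divide_right_mono) auto
    moreover have "(1 + 1 / t) * (\<Sum>i=1..n. (?q D0 i)\<^sup>2) \<le> (1 + 1 / t) * X"
      using fitted_sq_le[of n \<xi> D0 \<Delta>] X t by (intro mult_left_mono) auto
    moreover have "X / t + (1 + 1 / t) * X = (1 + 2 / t) * X" by (simp add: algebra_simps add_divide_distrib)
    ultimately show ?thesis by linarith
  qed
  ultimately show "(\<Sum>i=1..n. (?g i)\<^sup>2) / 2 - 2 * t * (\<Sum>i=1..n. (?e i)\<^sup>2) - 2 * \<bar>\<Sum>i=1..n. ?e i * ?g i\<bar> - (1 + 2 / t) * X \<le> rss n \<xi> \<Delta> D - rss n \<xi> \<Delta> D0"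
    by linarith
  have "rss n \<xi> \<Delta> D0 \<le> (\<Sum>i=1..n. 2 * (?e i)\<^sup>2 + 2 * (?q D0 i)\<^sup>2)"
    unfolding rss_def
  proof (rule sum_mono)
    fix i assume i: "i \<in> {1..n}"
    have "(u - v)\<^sup>2 \<le> 2 * u\<^sup>2 + 2 * v\<^sup>2" for u v :: real
      using zero_le_power2[of "u + v"] by (simp add: power2_eq_square algebra_simps)
    then show "(residual n i \<xi> \<Delta> D0)\<^sup>2 \<le> 2 * (?e i)\<^sup>2 + 2 * (?q D0 i)\<^sup>2" unfolding residual_full[OF subset_refl i] .
  qed
  also have "\<dots> = 2 * (\<Sum>i=1..n. (?e i)\<^sup>2) + 2 * (\<Sum>i=1..n. (?q D0 i)\<^sup>2)" by (simp add: sum.distrib sum_distrib_left)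
  finally show "rss n \<xi> \<Delta> D0 \<le> 2 * (\<Sum>i=1..n. (?e i)\<^sup>2) + 2 * X" using fitted_sq_le[of n \<xi> D0 \<Delta>] X by linarith
qed

lemma rate_sq_tendsto: "rate_sq \<longlonglongrightarrow> 0"
proof -
  have "(\<lambda>n. rate_sq n / chi n * chi n) \<longlonglongrightarrow> 0 * 0" by (intro tendsto_mult rates(1) chi(1))
  moreover have "\<forall>\<^sub>F n in sequentially. rate_sq n / chi n * chi n = rate_sq n" using chi(2) by eventually_elim simp
  ultimately show ?thesis using Lim_transform_eventually by fastforce
qed

text \<open>Both residual sums of squares are at least of order \<open>n\<close>, and the one of the true model exceeds the
  other by at most \<open>n\<close> times a small multiple of the penalty. The gain in the logarithm is therefore
  below \<open>chi n\<close>, the price of one superfluous component.\<close>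

lemma vic_overfit:
  assumes D: "D0 \<subset> D" shows "whp S (\<lambda>n \<xi>. \<forall>\<Delta>. normal_equations n \<xi> \<Delta> \<longrightarrow> vic n \<xi> \<Delta> D0 < vic n \<xi> \<Delta> D)"
proof -
  obtain \<theta> where \<theta>: "\<theta> > 0" and noise: "whp S (\<lambda>n \<xi>. \<theta> * real n \<le> (\<Sum>i=1..n. (e n i \<xi>)\<^sup>2))" using noise_lower by blast
  define V where "V n \<xi> = 2 * (\<Sum>a\<in>D - D0. cross_bound n a \<xi>) + square_bound n \<xi>" for n \<xi>
  define k where "k n = real n * chi n" for n
  have kpos: "\<forall>\<^sub>F n in sequentially. 0 < k n"
    using chi(2) eventually_gt_at_top[of "0::nat"] unfolding k_def by eventually_elim simp
  have ratio: "\<forall>\<^sub>F n in sequentially. r n / chi n = real n * r n / k n" for r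
    using chi(2) eventually_gt_at_top[of "0::nat"] unfolding k_def by eventually_elim simp
  have c: "whp S (\<lambda>n \<xi>. \<bar>2 * (\<Sum>a\<in>D - D0. cross_bound n a \<xi>)\<bar> \<le> \<theta> / 16 * k n)"
  proof (rule whp_small_ratio)
    show "OP S (\<lambda>n \<xi>. 2 * (\<Sum>a\<in>D - D0. cross_bound n a \<xi>)) (\<lambda>n. real n * rate_cross n)"
      using D by (intro P.OP_cmult P.OP_sum cross_bound_OP) auto
    show "(\<lambda>n. real n * rate_cross n / k n) \<longlonglongrightarrow> 0" by (rule Lim_transform_eventually[OF rates(2) ratio])
  qed (use kpos \<theta> in auto)
  have q: "whp S (\<lambda>n \<xi>. \<bar>square_bound n \<xi>\<bar> \<le> \<theta> / 16 * k n)"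
  proof (rule whp_small_ratio[OF square_bound_OP])
    show "(\<lambda>n. real n * rate_sq n / k n) \<longlonglongrightarrow> 0" by (rule Lim_transform_eventually[OF rates(1) ratio])
  qed (use kpos \<theta> in auto)
  have q2: "whp S (\<lambda>n \<xi>. \<bar>square_bound n \<xi>\<bar> \<le> \<theta> / 4 * real n)"
    by (rule whp_small_average[OF square_bound_OP rate_sq_tendsto]) (use \<theta> in simp)
  have "whp S (\<lambda>n \<xi>. (estimable n \<xi> \<and> \<theta> * real n \<le> (\<Sum>i=1..n. (e n i \<xi>)\<^sup>2)) \<and>
     (\<bar>2 * (\<Sum>a\<in>D - D0. cross_bound n a \<xi>)\<bar> \<le> \<theta> / 16 * k n \<and> \<bar>square_bound n \<xi>\<bar> \<le> \<theta> / 16 * k n) \<and> \<bar>square_bound n \<xi>\<bar> \<le> \<theta> / 4 * real n)"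
    by (intro P.whp_conj estimation_bounds noise c q q2)
  then show ?thesis
  proof (rule whp_mono, use chi(2) eventually_gt_at_top[of "0::nat"] in eventually_elim, intro ballI impI allI, elim conjE)
    fix n \<xi> \<Delta>
    assume chi0: "0 < chi n" and n: "0 < n" and eq: "normal_equations n \<xi> \<Delta>"
      and est: "estimable n \<xi>"
      and e: "\<theta> * real n \<le> (\<Sum>i=1..n. (e n i \<xi>)\<^sup>2)"
      and c: "\<bar>2 * (\<Sum>a\<in>D - D0. cross_bound n a \<xi>)\<bar> \<le> \<theta> / 16 * k n" and q: "\<bar>square_bound n \<xi>\<bar> \<le> \<theta> / 16 * k n"
      and q2: "\<bar>square_bound n \<xi>\<bar> \<le> \<theta> / 4 * real n"
    from est[unfolded estimable_def] eq have X: "(\<Sum>i=1..n. (norm (x n i \<xi>))\<^sup>2 * (norm (\<Delta> i))\<^sup>2) \<le> square_bound n \<xi>"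
      and cr: "\<And>a. \<bar>\<Sum>i=1..n. Lx n i a \<xi> * fst (\<Delta> i) $ a\<bar> \<le> cross_bound n a \<xi>" by blast+
    have DD: "D0 \<subseteq> D" using D by blast
    have low: "\<theta> / 4 * real n \<le> rss n \<xi> \<Delta> D" using rss_full_lower[OF DD X] e q2 by linarith
    have low0: "\<theta> / 4 * real n \<le> rss n \<xi> \<Delta> D0" using rss_full_lower[OF subset_refl X] e q2 by linarith
    have pos: "0 < \<theta> / 4 * real n" using \<theta> n by simp
    have "rss n \<xi> \<Delta> D0 - rss n \<xi> \<Delta> D \<le> \<theta> / 8 * k n"
      using rss_full_diff[OF DD X cr] c q by linarith
    then have "(rss n \<xi> \<Delta> D0 - rss n \<xi> \<Delta> D) / rss n \<xi> \<Delta> D \<le> (\<theta> / 8 * k n) / (\<theta> / 4 * real n)"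
      using low pos chi0 n \<theta> by (intro frac_le) (auto simp: k_def)
    also have "\<dots> = chi n / 2" using \<theta> n by (simp add: k_def)
    finally have r: "rss n \<xi> \<Delta> D0 / rss n \<xi> \<Delta> D - 1 \<le> chi n / 2" using low pos by (simp add: diff_divide_distrib)
    have "ln (rss n \<xi> \<Delta> D0) - ln (rss n \<xi> \<Delta> D) = ln (rss n \<xi> \<Delta> D0 / rss n \<xi> \<Delta> D)"
      using low low0 pos by (simp add: ln_div)
    also have "\<dots> \<le> rss n \<xi> \<Delta> D0 / rss n \<xi> \<Delta> D - 1"
      using low low0 pos by (intro ln_le_minus_one divide_pos_pos) auto
    finally have ln: "ln (rss n \<xi> \<Delta> D0) - ln (rss n \<xi> \<Delta> D) \<le> chi n / 2" using r by linarith
    have "card D0 < card D" using D by (intro psubset_card_mono) auto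
    then have "real (card D0) + 1 \<le> real (card D)" by linarith
    then have "chi n * (real (card D0) + 1) \<le> chi n * real (card D)" using chi0 by (intro mult_left_mono) auto
    then show "vic n \<xi> \<Delta> D0 < vic n \<xi> \<Delta> D" unfolding vic_def using ln chi0 by (simp add: distrib_left)
  qed
qed

text \<open>The omitted signal raises the residual sum of squares by a fixed factor, while the penalty of the
  true model vanishes.\<close>

lemma vic_underfit:
  assumes D: "\<not> D0 \<subseteq> D" shows "whp S (\<lambda>n \<xi>. \<forall>\<Delta>. normal_equations n \<xi> \<Delta> \<longrightarrow> vic n \<xi> \<Delta> D0 < vic n \<xi> \<Delta> D)"
  unfolding whp_def
proof (intro allI impI)
  fix \<epsilon> :: real assume \<epsilon>: "\<epsilon> > 0"
  obtain a where a: "a \<in> D0" "a \<in> - D" using D by blast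
  obtain \<theta> where \<theta>: "\<theta> > 0" and noise: "whp S (\<lambda>n \<xi>. \<theta> * real n \<le> (\<Sum>i=1..n. (e n i \<xi>)\<^sup>2))" using noise_lower by blast
  obtain \<gamma> where \<gamma>: "\<gamma> > 0" and miss: "whp S (\<lambda>n \<xi>. \<gamma> * real n \<le> (\<Sum>i=1..n. (x n i \<xi> \<bullet> restrict_to (- D) (bt n i))\<^sup>2))"
    using missed_signal_square[OF a] by blast
  obtain C where C: "C \<ge> 0" "likely S (\<epsilon> / 2) (\<lambda>n \<xi>. \<bar>\<Sum>i=1..n. (e n i \<xi>)\<^sup>2\<bar> \<le> C * (real n * 1))"
    using OP_e_sq \<epsilon> unfolding OP_def by (meson half_gt_zero)
  \<comment> \<open>The errors, of size \<open>C * n\<close>, then cost only a fraction of the omitted signal \<open>\<gamma> * n\<close>.\<close>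
  define t where "t = min (1 / 2) (\<gamma> / (32 * (C + 1)))"
  have t: "0 < t" using \<gamma> C by (simp add: t_def)
  have t_half: "t \<le> 1 / 2" unfolding t_def by (rule min.cobounded1)
  have tC: "2 * t * C \<le> \<gamma> / 16"
  proof -
    have "t \<le> \<gamma> / (32 * (C + 1))" by (simp add: t_def)
    then have "t * (32 * (C + 1)) \<le> \<gamma>" using C by (simp add: pos_le_divide_eq)
    moreover have "t * (32 * (C + 1)) = 32 * (t * C) + 32 * t" by (simp add: algebra_simps)
    ultimately show ?thesis using t by linarith
  qed
  define z where "z = min (\<theta> / 4) (\<gamma> / (8 * (1 + 2 / t)))"
  have t2: "0 < 1 + 2 / t" using t by (simp add: add_pos_pos)
  have "0 < \<gamma> / (8 * (1 + 2 / t))" using \<gamma> t2 by (intro divide_pos_pos mult_pos_pos) auto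
  then have z: "0 < z" "z \<le> \<theta> / 4" using \<theta> unfolding z_def by (simp_all only: min_less_iff_conj min.cobounded1) simp
  have z2: "(1 + 2 / t) * z \<le> \<gamma> / 8"
  proof -
    have "z \<le> \<gamma> / (8 * (1 + 2 / t))" by (simp add: z_def)
    then have "z * (8 * (1 + 2 / t)) \<le> \<gamma>" using t2 by (simp add: pos_le_divide_eq)
    then show ?thesis by (simp add: mult_ac)
  qed
  have q: "whp S (\<lambda>n \<xi>. \<bar>square_bound n \<xi>\<bar> \<le> z * real n)"
    by (rule whp_small_average[OF square_bound_OP rate_sq_tendsto z(1)])
  have cross: "whp S (\<lambda>n \<xi>. \<bar>\<Sum>i=1..n. e n i \<xi> * (x n i \<xi> \<bullet> restrict_to (- D) (bt n i))\<bar> \<le> \<gamma> / 16 * real n)"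
    by (rule missed_signal_cross) (use \<gamma> in simp)
  have "whp S (\<lambda>n \<xi>. (estimable n \<xi> \<and> \<theta> * real n \<le> (\<Sum>i=1..n. (e n i \<xi>)\<^sup>2)) \<and>
     (\<gamma> * real n \<le> (\<Sum>i=1..n. (x n i \<xi> \<bullet> restrict_to (- D) (bt n i))\<^sup>2) \<and> \<bar>square_bound n \<xi>\<bar> \<le> z * real n) \<and>
     \<bar>\<Sum>i=1..n. e n i \<xi> * (x n i \<xi> \<bullet> restrict_to (- D) (bt n i))\<bar> \<le> \<gamma> / 16 * real n)"
    by (intro P.whp_conj estimation_bounds noise miss q cross)
  then have "likely S (\<epsilon> / 2) (\<lambda>n \<xi>. (estimable n \<xi> \<and> \<theta> * real n \<le> (\<Sum>i=1..n. (e n i \<xi>)\<^sup>2)) \<and>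
     (\<gamma> * real n \<le> (\<Sum>i=1..n. (x n i \<xi> \<bullet> restrict_to (- D) (bt n i))\<^sup>2) \<and> \<bar>square_bound n \<xi>\<bar> \<le> z * real n) \<and>
     \<bar>\<Sum>i=1..n. e n i \<xi> * (x n i \<xi> \<bullet> restrict_to (- D) (bt n i))\<bar> \<le> \<gamma> / 16 * real n)"
    using \<epsilon> by (simp add: whp_def)
  note ev = P.likely_conj[OF C(2) this, unfolded field_sum_of_halves]
  define C' where "C' = 2 * C + 2 * z"
  have C': "0 < C'" using C z by (simp add: C'_def add_nonneg_pos)
  \<comment> \<open>The gain in the logarithm: \<open>C' * n\<close> bounds the residual sum of squares of the true model.\<close>
  define lam where "lam = ln (1 + \<gamma> / (8 * C'))"
  have "0 < \<gamma> / (8 * C')" using \<gamma> C' by simp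
  then have lam: "0 < lam" unfolding lam_def by (intro ln_gt_zero) simp
  have "(\<lambda>n. chi n * real (card D0)) \<longlonglongrightarrow> 0 * real (card D0)" by (intro tendsto_intros chi(1))
  then have small: "\<forall>\<^sub>F n in sequentially. chi n * real (card D0) < lam" using lam by (intro order_tendstoD(2)) auto
  show "likely S \<epsilon> (\<lambda>n \<xi>. \<forall>\<Delta>. normal_equations n \<xi> \<Delta> \<longrightarrow> vic n \<xi> \<Delta> D0 < vic n \<xi> \<Delta> D)"
  proof (rule likely_mono[OF ev], use chi(2) small eventually_gt_at_top[of "0::nat"] in eventually_elim, intro ballI impI allI, elim conjE)
    fix n \<xi> \<Delta>
    assume chi0: "0 < chi n" and sm: "chi n * real (card D0) < lam" and n: "0 < n" and eq: "normal_equations n \<xi> \<Delta>"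
      and eC: "\<bar>\<Sum>i=1..n. (e n i \<xi>)\<^sup>2\<bar> \<le> C * (real n * 1)"
      and est: "estimable n \<xi>"
      and e: "\<theta> * real n \<le> (\<Sum>i=1..n. (e n i \<xi>)\<^sup>2)"
      and g: "\<gamma> * real n \<le> (\<Sum>i=1..n. (x n i \<xi> \<bullet> restrict_to (- D) (bt n i))\<^sup>2)"
      and q: "\<bar>square_bound n \<xi>\<bar> \<le> z * real n"
      and cr: "\<bar>\<Sum>i=1..n. e n i \<xi> * (x n i \<xi> \<bullet> restrict_to (- D) (bt n i))\<bar> \<le> \<gamma> / 16 * real n"
    have X: "(\<Sum>i=1..n. (norm (x n i \<xi>))\<^sup>2 * (norm (\<Delta> i))\<^sup>2) \<le> square_bound n \<xi>"
      using est eq unfolding estimable_def by blast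
    have eC: "(\<Sum>i=1..n. (e n i \<xi>)\<^sup>2) \<le> C * real n" using eC by simp
    have zn: "z * real n \<le> \<theta> / 4 * real n" using z n by (intro mult_right_mono) auto
    have low0: "\<theta> / 4 * real n \<le> rss n \<xi> \<Delta> D0"
      using rss_full_lower[OF subset_refl X] e q zn by linarith
    have pos: "0 < \<theta> / 4 * real n" using \<theta> n by simp
    have b1: "2 * t * (\<Sum>i=1..n. (e n i \<xi>)\<^sup>2) \<le> \<gamma> / 16 * real n"
    proof -
      have "2 * t * (\<Sum>i=1..n. (e n i \<xi>)\<^sup>2) \<le> 2 * t * (C * real n)" using eC t by (intro mult_left_mono) auto
      also have "\<dots> \<le> \<gamma> / 16 * real n" using mult_right_mono[OF tC, of "real n"] by (simp add: mult_ac)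
      finally show ?thesis .
    qed
    have b2: "(1 + 2 / t) * square_bound n \<xi> \<le> \<gamma> / 8 * real n"
    proof -
      have "(1 + 2 / t) * square_bound n \<xi> \<le> (1 + 2 / t) * (z * real n)" using q t2 by (intro mult_left_mono) auto
      also have "\<dots> \<le> \<gamma> / 8 * real n" using mult_right_mono[OF z2, of "real n"] by (simp add: mult_ac)
      finally show ?thesis .
    qed
    have diff: "\<gamma> / 8 * real n \<le> rss n \<xi> \<Delta> D - rss n \<xi> \<Delta> D0"
    proof -
      have "\<gamma> * real n = 16 * (\<gamma> * real n / 16)" "\<gamma> / 16 * real n = \<gamma> * real n / 16" "\<gamma> / 8 * real n = 2 * (\<gamma> * real n / 16)" by simp_all
      moreover have "0 \<le> \<gamma> * real n / 16" using \<gamma> by simp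
      ultimately show ?thesis
        using rss_missed_diff(1)[OF X t t_half, of D] g cr b1 b2 by linarith
    qed
    have up0: "rss n \<xi> \<Delta> D0 \<le> C' * real n"
    proof -
      have "rss n \<xi> \<Delta> D0 \<le> 2 * (C * real n) + 2 * (z * real n)"
        using rss_missed_diff(2)[OF X t t_half] eC q by linarith
      then show ?thesis by (simp add: C'_def algebra_simps)
    qed
    have p0: "0 < rss n \<xi> \<Delta> D0" using low0 pos by linarith
    have "\<gamma> / (8 * C') = (\<gamma> / 8 * real n) / (C' * real n)" using n C' by simp
    also have "\<dots> \<le> (rss n \<xi> \<Delta> D - rss n \<xi> \<Delta> D0) / rss n \<xi> \<Delta> D0"
    proof (rule frac_le)
      have "0 \<le> \<gamma> / 8 * real n" using \<gamma> by simp
      then show "0 \<le> rss n \<xi> \<Delta> D - rss n \<xi> \<Delta> D0" using diff by linarith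
    qed (use diff p0 up0 in auto)
    also have "\<dots> = rss n \<xi> \<Delta> D / rss n \<xi> \<Delta> D0 - 1" using p0 by (simp add: diff_divide_distrib)
    finally have "1 + \<gamma> / (8 * C') \<le> rss n \<xi> \<Delta> D / rss n \<xi> \<Delta> D0" by simp
    moreover have "0 < 1 + \<gamma> / (8 * C')" using \<gamma> C' by (simp add: add_pos_pos)
    ultimately have "lam \<le> ln (rss n \<xi> \<Delta> D / rss n \<xi> \<Delta> D0)" unfolding lam_def by (intro ln_mono) auto
    moreover have "0 < rss n \<xi> \<Delta> D" using diff p0 \<gamma> n by (smt (verit) divide_pos_pos mult_pos_pos of_nat_0_less_iff)
    ultimately have "lam \<le> ln (rss n \<xi> \<Delta> D) - ln (rss n \<xi> \<Delta> D0)" using p0 by (simp add: ln_div)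
    moreover have "0 \<le> chi n * real (card D)" using chi0 by simp
    ultimately show "vic n \<xi> \<Delta> D0 < vic n \<xi> \<Delta> D" unfolding vic_def using sm by linarith
  qed
qed

theorem vic_consistent:
  assumes "D \<noteq> D0" shows "whp S (\<lambda>n \<xi>. \<forall>\<Delta>. normal_equations n \<xi> \<Delta> \<longrightarrow> vic n \<xi> \<Delta> D0 < vic n \<xi> \<Delta> D)"
  using vic_overfit[of D] vic_underfit[of D] assms by blast

end

section \<open>Causal processes on the canonical space\<close>

lemma Lq_norm_Lp_le:
  fixes Z :: "'a \<Rightarrow> 'b::real_normed_vector" and f :: "'a \<Rightarrow> real"
  assumes le: "Lq_norm M (real q) Z \<le> ennreal c" and c: "0 \<le> c" and q: "0 < q"
    and f: "f \<in> borel_measurable M" "\<And>\<xi>. \<xi> \<in> space M \<Longrightarrow> \<bar>f \<xi>\<bar> \<le> norm (Z \<xi>)"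
  shows "Lp_le M q f c"
proof -
  define I where "I = (\<integral>\<^sup>+ \<xi>. ennreal (norm (Z \<xi>) powr real q) \<partial>M)"
  have fin: "I \<noteq> \<infinity>" using le by (auto simp: Lq_norm_def I_def[symmetric] Let_def top_unique split: if_splits)
  then have "ennreal (enn2real I powr (1 / real q)) \<le> ennreal c"
    using le by (simp add: Lq_norm_def I_def[symmetric] Let_def)
  then have "enn2real I powr (1 / real q) \<le> c" using c by (simp add: ennreal_le_iff)
  then have "(enn2real I powr (1 / real q)) powr real q \<le> c powr real q" by (intro powr_mono2) auto
  then have "enn2real I \<le> c ^ q" using q c by (simp add: powr_powr powr_realpow')
  then have "I \<le> ennreal (c ^ q)" using fin by (metis ennreal_enn2real ennreal_leI infinity_ennreal_def less_top)
  moreover have "(\<integral>\<^sup>+\<xi>. ennreal (\<bar>f \<xi>\<bar> ^ q) \<partial>M) \<le> I"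
    unfolding I_def using f(2) q by (intro nn_integral_mono ennreal_leI) (simp add: powr_realpow' power_mono)
  ultimately show ?thesis using f(1) c by (auto simp: Lp_le_def)
qed

context sequence_space
begin

definition shift :: "nat \<Rightarrow> (nat \<Rightarrow> 'a) \<Rightarrow> nat \<Rightarrow> 'a" where "shift r \<xi> = (\<lambda>j. \<xi> (r + j))"

lemma shift_measurable[measurable]: "shift r \<in> measurable S S"
  unfolding shift_def by (rule measurable_PiM_single') (auto simp: space_PiM PiE_iff)

lemma distr_shift: "distr S S (shift r) = S"
proof -
  have "distr S S (\<lambda>\<xi>. \<lambda>n\<in>UNIV. \<xi> (r + n)) = S"
    using distr_PiM_reindex[of UNIV "\<lambda>_. M" "\<lambda>j. r + j" UNIV] M.prob_space_axioms by (simp add: inj_on_def)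
  then show ?thesis by (simp add: shift_def[abs_def] restrict_UNIV)
qed

lemma Lp_le_shift: "Lp_le S q f c \<Longrightarrow> Lp_le S q (\<lambda>\<xi>. f (shift r \<xi>)) c"
  using Lp_le_distr[OF shift_measurable[of r], of f q c] by (auto simp: distr_shift dest: Lp_leD)

lemma integral_shift: "f \<in> borel_measurable S \<Longrightarrow> (\<integral>\<xi>. f (shift r \<xi>) \<partial>S) = (\<integral>\<xi>. f \<xi> \<partial>S)" for f :: "_ \<Rightarrow> real"
  using integral_distr[OF shift_measurable[of r], of f] by (simp add: distr_shift)

lemma shift_upd: "shift r ((\<xi>)(r + l := s)) = (shift r \<xi>)(l := s)" "k < r \<Longrightarrow> shift r ((\<xi>)(k := s)) = shift r \<xi>"
  by (auto simp: shift_def fun_eq_iff)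

text \<open>The shift preserves the law and moves coordinate \<open>l\<close> to \<open>r + l\<close>.\<close>

lemma influence_shift:
  assumes i: "influence q f l c" and f: "f \<in> borel_measurable S"
  shows "influence q (\<lambda>\<xi>. f (shift r \<xi>)) (r + l) c"
proof -
  have T: "(\<lambda>(s, \<xi>). (s, shift r \<xi>)) \<in> measurable (M \<Otimes>\<^sub>M S) (M \<Otimes>\<^sub>M S)" by measurable
  have "distr M M (\<lambda>s. s) \<Otimes>\<^sub>M distr S S (shift r) = distr (M \<Otimes>\<^sub>M S) (M \<Otimes>\<^sub>M S) (\<lambda>(s, \<xi>). (s, shift r \<xi>))"
    by (rule pair_measure_distr) (simp_all add: distr_shift P.sigma_finite_measure_axioms)
  then have d: "distr (M \<Otimes>\<^sub>M S) (M \<Otimes>\<^sub>M S) (\<lambda>(s, \<xi>). (s, shift r \<xi>)) = M \<Otimes>\<^sub>M S" by (simp add: distr_shift)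
  have "Lp_le (distr (M \<Otimes>\<^sub>M S) (M \<Otimes>\<^sub>M S) (\<lambda>(s, \<xi>). (s, shift r \<xi>))) q (\<lambda>(s, \<xi>). f \<xi> - f ((\<xi>)(l := s))) c"
    using i unfolding d influence_def .
  then have "Lp_le (M \<Otimes>\<^sub>M S) q (\<lambda>z. (\<lambda>(s, \<xi>). f \<xi> - f ((\<xi>)(l := s))) ((\<lambda>(s, \<xi>). (s, shift r \<xi>)) z)) c"
    by (rule Lp_le_distr[OF T influence_measurable[OF f], THEN iffD1])
  then show ?thesis unfolding influence_def by (simp add: split_beta' shift_upd)
qed

lemma influence_shift_below:
  assumes k: "k < r" and q: "0 < q" shows "influence q (\<lambda>\<xi>. f (shift r \<xi>)) k 0"
  unfolding influence_def using Lp_le_zero[OF q] by (simp add: split_beta' shift_upd(2)[OF k])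

text \<open>Influence weights of the process at time \<open>i\<close> in a sample of size \<open>n\<close>; coordinate \<open>k\<close> is the
  innovation at time \<open>n - k\<close>.\<close>

definition lag_weights :: "(nat \<Rightarrow> real) \<Rightarrow> nat \<Rightarrow> nat \<Rightarrow> nat \<Rightarrow> real" where
  "lag_weights d n i k = (if n - i \<le> k then d (k - (n - i)) else 0)"

lemma influence_lag:
  assumes i: "\<And>l. influence q f l (d l)" and f: "f \<in> borel_measurable S" and q: "0 < q"
  shows "influence q (\<lambda>\<xi>. f (shift (n - i) \<xi>)) k (lag_weights d n i k)"
proof (cases "n - i \<le> k")
  case True
  then show ?thesis using influence_shift[OF i f, of "n - i" "k - (n - i)"] by (simp add: lag_weights_def)
next
  case False
  then show ?thesis using influence_shift_below[OF _ q] by (simp add: lag_weights_def)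
qed

text \<open>Rows and columns of the weight matrix are both parts of the sequence \<open>d\<close>.\<close>

lemma schur_lag_weights:
  assumes d: "\<And>l. 0 \<le> d l" "\<And>N. (\<Sum>l<N. d l) \<le> \<Theta>"
  shows "schur_weights n (lag_weights d n) \<Theta>"
proof -
  have fin: "sum d F \<le> \<Theta>" if "finite F" for F
  proof -
    have "sum d F \<le> sum d {..<Suc (Max (insert 0 F))}"
      using that d(1) by (intro sum_mono2) (auto simp: less_Suc_eq_le)
    then show ?thesis using d(2) order_trans by blast
  qed
  show ?thesis
    unfolding schur_weights_def
  proof (intro conjI allI ballI)
    show \<Theta>: "0 \<le> \<Theta>" using d(2)[of 0] by simp
    show "0 \<le> lag_weights d n i k" for i k using d(1) by (simp add: lag_weights_def)
    fix i N assume "i \<in> {1..n}"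
    have "(\<Sum>k<N. lag_weights d n i k) = (\<Sum>k\<in>{k. k < N \<and> n - i \<le> k}. d (k - (n - i)))"
      unfolding lag_weights_def by (simp add: sum.If_cases Collect_conj_eq lessThan_def)
    also have "\<dots> = sum d ((\<lambda>k. k - (n - i)) ` {k. k < N \<and> n - i \<le> k})"
      by (subst sum.reindex) (auto simp: inj_on_def)
    also have "\<dots> \<le> \<Theta>" by (rule fin) simp
    finally show "(\<Sum>k<N. lag_weights d n i k) \<le> \<Theta>" .
  next
    fix k
    have "(\<Sum>i=1..n. lag_weights d n i k) = (\<Sum>i\<in>{i\<in>{1..n}. n - i \<le> k}. d (k - (n - i)))"
      unfolding lag_weights_def by (simp only: sum.inter_filter[OF finite_atLeastAtMost])
    also have "\<dots> = sum d ((\<lambda>i. k - (n - i)) ` {i\<in>{1..n}. n - i \<le> k})"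
      by (subst sum.reindex) (auto simp: inj_on_def)
    also have "\<dots> \<le> \<Theta>" by (rule fin) simp
    finally show "(\<Sum>i=1..n. lag_weights d n i k) \<le> \<Theta>" .
  qed
qed

end

locale innovations = prob_space M for M :: "'a measure" +
  fixes S :: "'s measure" and \<epsilon> \<epsilon>' :: "int \<Rightarrow> 'a \<Rightarrow> 's"
  assumes iid: "iid_with_copy M S \<epsilon> \<epsilon>'"
begin

definition N where "N = distr M S (\<epsilon> 0)"

lemma innovation_measurable: "\<epsilon> k \<in> measurable M S" "\<epsilon>' k \<in> measurable M S"
proof -
  have rv: "case_sum \<epsilon> \<epsilon>' i \<in> measurable M S" for i
    using iid unfolding iid_with_copy_def indep_vars_def by blast
  show "\<epsilon> k \<in> measurable M S" "\<epsilon>' k \<in> measurable M S" using rv[of "Inl k"] rv[of "Inr k"] by simp_all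
qed

lemma sets_N[measurable_cong]: "sets N = sets S" by (simp add: N_def)

sublocale N: prob_space N unfolding N_def by (intro prob_space_distr innovation_measurable)
sublocale seq: sequence_space N by unfold_locales

abbreviation "\<Omega> \<equiv> PiM UNIV (\<lambda>_::nat. N)"

lemma distr_innovation: "distr M S (\<epsilon> k) = N" "distr M S (\<epsilon>' k) = N"
  using iid by (auto simp: iid_with_copy_def N_def)

lemma sets_\<Omega>: "sets \<Omega> = sets (PiM UNIV (\<lambda>_::nat. S))" by (intro sets_PiM_cong) (auto simp: sets_N)

lemma distr_joint: "distr M (PiM UNIV (\<lambda>_. S)) (\<lambda>\<omega>. \<lambda>i\<in>UNIV. case_sum \<epsilon> \<epsilon>' i \<omega>) = PiM (UNIV :: (int + int) set) (\<lambda>_. N)"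
proof -
  have rv: "case_sum \<epsilon> \<epsilon>' i \<in> measurable M S" for i by (cases i) (simp_all add: innovation_measurable)
  have "distr M (PiM UNIV (\<lambda>_. S)) (\<lambda>\<omega>. \<lambda>i\<in>UNIV. case_sum \<epsilon> \<epsilon>' i \<omega>) = PiM UNIV (\<lambda>i. distr M S (case_sum \<epsilon> \<epsilon>' i))"
    using iid rv by (subst indep_vars_iff_distr_eq_PiM[symmetric]) (auto simp: iid_with_copy_def)
  also have "\<dots> = PiM UNIV (\<lambda>_. N)"
    by (intro PiM_cong refl) (auto simp: distr_innovation split: sum.split)
  finally show ?thesis .
qed

text \<open>Distinct members of the two families are again i.i.d., in any order.\<close>

lemma distr_selection:
  fixes f :: "nat \<Rightarrow> int + int"
  assumes f: "inj f"
  shows "(\<lambda>\<omega> n. case_sum \<epsilon> \<epsilon>' (f n) \<omega>) \<in> measurable M \<Omega>" "distr M \<Omega> (\<lambda>\<omega> n. case_sum \<epsilon> \<epsilon>' (f n) \<omega>) = \<Omega>"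
proof -
  let ?J = "PiM (UNIV :: (int + int) set) (\<lambda>_. N)" and ?X = "\<lambda>\<omega>. \<lambda>i\<in>UNIV. case_sum \<epsilon> \<epsilon>' i \<omega>"
  have sJ: "sets ?J = sets (PiM UNIV (\<lambda>_. S))" by (intro sets_PiM_cong) (auto simp: sets_N)
  have X: "?X \<in> measurable M ?J"
    unfolding measurable_cong_sets[OF refl sJ]
    by (intro measurable_restrict) (auto simp: innovation_measurable split: sum.split)
  have Y: "(\<lambda>\<omega>. \<lambda>n\<in>UNIV. \<omega> (f n)) \<in> measurable ?J \<Omega>" by (intro measurable_restrict measurable_component_singleton) auto
  have YX: "(\<lambda>\<omega>. \<lambda>n\<in>UNIV. \<omega> (f n)) \<circ> ?X = (\<lambda>\<omega> n. case_sum \<epsilon> \<epsilon>' (f n) \<omega>)" by (simp add: comp_def restrict_UNIV)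
  show "(\<lambda>\<omega> n. case_sum \<epsilon> \<epsilon>' (f n) \<omega>) \<in> measurable M \<Omega>" using measurable_comp[OF X Y] unfolding YX .
  have J: "distr M ?J ?X = ?J"
    unfolding distr_joint[symmetric] by (rule distr_cong) (auto simp: sJ distr_joint)
  have "\<Omega> = distr ?J \<Omega> (\<lambda>\<omega>. \<lambda>n\<in>UNIV. \<omega> (f n))"
    using distr_PiM_reindex[of UNIV "\<lambda>_. N" f UNIV] N.prob_space_axioms f by simp
  also have "\<dots> = distr (distr M ?J ?X) \<Omega> (\<lambda>\<omega>. \<lambda>n\<in>UNIV. \<omega> (f n))" unfolding J ..
  also have "\<dots> = distr M \<Omega> (\<lambda>\<omega> n. case_sum \<epsilon> \<epsilon>' (f n) \<omega>)" unfolding distr_distr[OF Y X] YX ..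
  finally show "distr M \<Omega> (\<lambda>\<omega> n. case_sum \<epsilon> \<epsilon>' (f n) \<omega>) = \<Omega>" by simp
qed

lemma past_measurable[measurable]: "past \<epsilon> k \<in> measurable M \<Omega>"
  and distr_past: "distr M \<Omega> (past \<epsilon> k) = \<Omega>"
  using distr_selection[of "\<lambda>j. Inl (k - int j)"] by (simp_all add: inj_on_def past_def[abs_def])

text \<open>The copy of the innovation at time \<open>0\<close> followed by the past is one i.i.d. sequence, which is split
  after its first entry.\<close>

lemma distr_coupled: "distr M (N \<Otimes>\<^sub>M \<Omega>) (\<lambda>\<omega>. (\<epsilon>' 0 \<omega>, past \<epsilon> k \<omega>)) = N \<Otimes>\<^sub>M \<Omega>"
proof -
  define f where "f = case_nat (Inr 0) (\<lambda>j. Inl (k - int j) :: int + int)"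
  let ?Z = "\<lambda>\<omega> n. case_sum \<epsilon> \<epsilon>' (f n) \<omega>" and ?split = "\<lambda>\<omega>::nat \<Rightarrow> 's. (\<omega> 0, \<lambda>j. \<omega> (Suc j))"
  have f: "inj f" by (auto simp: inj_on_def f_def split: nat.splits)
  have split: "?split \<in> measurable \<Omega> (N \<Otimes>\<^sub>M \<Omega>)"
    by (intro measurable_Pair measurable_component_singleton measurable_PiM_single') (auto simp: space_PiM PiE_iff)
  have join: "(\<lambda>(s, \<omega>). case_nat s \<omega>) \<in> measurable (N \<Otimes>\<^sub>M \<Omega>) \<Omega>" by measurable
  have "N \<Otimes>\<^sub>M \<Omega> = distr (N \<Otimes>\<^sub>M \<Omega>) (N \<Otimes>\<^sub>M \<Omega>) (?split \<circ> (\<lambda>(s, \<omega>). case_nat s \<omega>))"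
    by (subst distr_cong[OF refl refl, of _ _ "\<lambda>z. z"]) (auto simp: split_beta')
  also have "\<dots> = distr \<Omega> (N \<Otimes>\<^sub>M \<Omega>) ?split"
    unfolding distr_distr[OF split join, symmetric] seq.PiM_iter ..
  also have "\<dots> = distr (distr M \<Omega> ?Z) (N \<Otimes>\<^sub>M \<Omega>) ?split" unfolding distr_selection(2)[OF f] ..
  also have "\<dots> = distr M (N \<Otimes>\<^sub>M \<Omega>) (?split \<circ> ?Z)" by (rule distr_distr[OF split distr_selection(1)[OF f]])
  also have "?split \<circ> ?Z = (\<lambda>\<omega>. (\<epsilon>' 0 \<omega>, past \<epsilon> k \<omega>))" by (simp add: f_def comp_def past_def)
  finally show ?thesis by simp
qed

lemma past_coupled_upd: "past_coupled \<epsilon> \<epsilon>' (int l) \<omega> = (past \<epsilon> (int l) \<omega>)(l := \<epsilon>' 0 \<omega>)"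
  by (auto simp: past_coupled_def past_def fun_eq_iff)

lemma Lp_le_past: "f \<in> borel_measurable \<Omega> \<Longrightarrow> Lp_le M q (\<lambda>\<omega>. f (past \<epsilon> k \<omega>)) c \<longleftrightarrow> Lp_le \<Omega> q f c"
  using Lp_le_distr[OF past_measurable, of f k q c] by (simp add: distr_past)

lemma integral_past: "f \<in> borel_measurable \<Omega> \<Longrightarrow> (\<integral>\<omega>. f (past \<epsilon> k \<omega>) \<partial>M) = (\<integral>\<omega>. f \<omega> \<partial>\<Omega>)" for f :: "_ \<Rightarrow> real"
  using integral_distr[OF past_measurable, of f k] by (simp add: distr_past)

lemma integrable_past: "f \<in> borel_measurable \<Omega> \<Longrightarrow> integrable M (\<lambda>\<omega>. f (past \<epsilon> k \<omega>)) \<longleftrightarrow> integrable \<Omega> f" for f :: "_ \<Rightarrow> real"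
  using integrable_distr_eq[OF past_measurable, of f k] by (simp add: distr_past)

text \<open>The physical dependence measure is the influence of a single coordinate.\<close>

lemma influence_of_dependence:
  fixes J :: "real \<Rightarrow> (nat \<Rightarrow> 's) \<Rightarrow> 'b::euclidean_space" and f :: "(nat \<Rightarrow> 's) \<Rightarrow> real"
  assumes t: "t \<in> {0..1}" and d: "dep_delta M \<epsilon> \<epsilon>' J l (real q) \<le> ennreal c" and c: "0 \<le> c" and q: "0 < q"
    and f: "f \<in> borel_measurable \<Omega>" and le: "\<And>\<eta> \<eta>'. \<bar>f \<eta> - f \<eta>'\<bar> \<le> norm (J t \<eta> - J t \<eta>')"
  shows "seq.influence q f l c"
proof -
  have T: "(\<lambda>\<omega>. (\<epsilon>' 0 \<omega>, past \<epsilon> (int l) \<omega>)) \<in> measurable M (N \<Otimes>\<^sub>M \<Omega>)"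
    using innovation_measurable(2)[of 0] measurable_cong_sets[OF refl sets_N] by (intro measurable_Pair past_measurable) blast
  note F = seq.influence_measurable[OF f, of l]
  have "Lq_norm M (real q) (\<lambda>\<omega>. J t (past \<epsilon> (int l) \<omega>) - J t (past_coupled \<epsilon> \<epsilon>' (int l) \<omega>)) \<le> ennreal c"
    using d t unfolding dep_delta_def by (meson SUP_upper order_trans)
  then have "Lp_le M q (\<lambda>\<omega>. (\<lambda>(s, \<omega>). f \<omega> - f ((\<omega>)(l := s))) (\<epsilon>' 0 \<omega>, past \<epsilon> (int l) \<omega>)) c"
    by (rule Lq_norm_Lp_le[OF _ c q measurable_compose[OF T F]]) (auto simp: past_coupled_upd le)
  then have "Lp_le (distr M (N \<Otimes>\<^sub>M \<Omega>) (\<lambda>\<omega>. (\<epsilon>' 0 \<omega>, past \<epsilon> (int l) \<omega>))) q (\<lambda>(s, \<omega>). f \<omega> - f ((\<omega>)(l := s))) c"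
    by (rule Lp_le_distr[OF T F, THEN iffD2])
  then show ?thesis unfolding distr_coupled seq.influence_def .
qed

end

section \<open>Normal equations, eigenvalues, grids and rates\<close>

lemma linear_term_of_nonneg_quadratic:
  fixes a q :: real
  assumes "\<And>t. 0 \<le> t * a + t\<^sup>2 * q" shows "a = 0"
proof (rule ccontr)
  assume a: "a \<noteq> 0"
  define c where "c = \<bar>q\<bar> + 1"
  define t where "t = - a / c"
  have c: "0 < c" "q < c" unfolding c_def by linarith+
  have "t * a + t\<^sup>2 * q = a\<^sup>2 / c\<^sup>2 * (q - c)"
    using c(1) unfolding t_def by (simp add: field_simps power2_eq_square)
  also have "\<dots> < 0" using a c by (intro mult_pos_neg divide_pos_pos) auto
  finally show False using assms[of t] by linarith
qed

text \<open>Along any line through a minimizer the criterion is a parabola with its minimum at the origin.\<close>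

lemma local_linear_normal_equation:
  fixes x :: "nat \<Rightarrow> real ^ 'p::finite"
  assumes min: "is_arg_min (local_linear_criterion K b n x y t) (\<lambda>_. True) (\<eta>0, \<eta>1)"
  shows "(\<Sum>j=1..n. K ((real j / real n - t) / b) * (y j - x j \<bullet> \<eta>0 - (x j \<bullet> \<eta>1) * (real j / real n - t))
            * (x j \<bullet> d0 + (x j \<bullet> d1) * (real j / real n - t))) = 0"
proof -
  define k where "k j = K ((real j / real n - t) / b)" for j
  define u where "u j = real j / real n - t" for j
  define r where "r j = y j - x j \<bullet> \<eta>0 - (x j \<bullet> \<eta>1) * u j" for j
  define z where "z j = x j \<bullet> d0 + (x j \<bullet> d1) * u j" for j
  have "0 \<le> c * (- 2 * (\<Sum>j=1..n. k j * r j * z j)) + c\<^sup>2 * (\<Sum>j=1..n. k j * (z j)\<^sup>2)" for c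
  proof -
    have "(\<Sum>j=1..n. (r j)\<^sup>2 * k j) \<le> (\<Sum>j=1..n. (r j - c * z j)\<^sup>2 * k j)"
    proof -
      have "local_linear_criterion K b n x y t (\<eta>0, \<eta>1) \<le> local_linear_criterion K b n x y t (\<eta>0 + c *\<^sub>R d0, \<eta>1 + c *\<^sub>R d1)"
        using min by (simp add: is_arg_min_def not_less)
      moreover have "y j - x j \<bullet> (\<eta>0 + c *\<^sub>R d0) - (x j \<bullet> (\<eta>1 + c *\<^sub>R d1)) * (real j / real n - t) = r j - c * z j" for j
        by (simp add: r_def z_def u_def inner_add_right algebra_simps)
      ultimately show ?thesis by (simp add: local_linear_criterion_def k_def r_def u_def)
    qed
    also have "\<dots> = (\<Sum>j=1..n. (r j)\<^sup>2 * k j + (c * (- 2 * (k j * r j * z j)) + c\<^sup>2 * (k j * (z j)\<^sup>2)))"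
      by (intro sum.cong refl) (simp add: power2_eq_square algebra_simps)
    finally show ?thesis by (simp only: sum.distrib sum_distrib_left[symmetric])
  qed
  from linear_term_of_nonneg_quadratic[OF this] show ?thesis by (simp add: k_def r_def z_def u_def)
qed

lemma symmetric_dot: "transpose A = A \<Longrightarrow> u \<bullet> (A *v v) = (A *v u) \<bullet> v" for A :: "real ^ 'n::finite ^ 'n"
  by (metis dot_lmul_matrix vector_transpose_matrix)

text \<open>Eigenvectors to different eigenvalues are orthogonal, hence linearly independent.\<close>

lemma finite_real_eigenvalues:
  fixes A :: "real ^ 'n::finite ^ 'n"
  assumes A: "transpose A = A" shows "finite {l. real_eigenvalue A l}"
proof -
  let ?E = "{l. real_eigenvalue A l}"
  have "\<forall>l\<in>?E. \<exists>v. v \<noteq> 0 \<and> A *v v = l *\<^sub>R v" by (simp add: real_eigenvalue_def)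
  from bchoice[OF this] obtain v where v: "\<And>l. l \<in> ?E \<Longrightarrow> v l \<noteq> 0 \<and> A *v v l = l *\<^sub>R v l" by blast
  have ortho: "v l \<bullet> v m = 0" if "l \<in> ?E" "m \<in> ?E" "l \<noteq> m" for l m
  proof -
    have "v l \<bullet> (A *v v m) = (A *v v l) \<bullet> v m" by (rule symmetric_dot[OF A])
    then have "(m - l) * (v l \<bullet> v m) = 0" using v that by (simp add: algebra_simps)
    then show ?thesis using that by simp
  qed
  have inj: "inj_on v ?E"
  proof (rule inj_onI, rule ccontr)
    fix l m assume lm: "l \<in> ?E" "m \<in> ?E" "v l = v m" "l \<noteq> m"
    then have "v l \<bullet> v l = 0" using ortho by metis
    then show False using v lm by simp
  qed
  have "independent (v ` ?E)"
    by (rule pairwise_orthogonal_independent) (use v ortho in \<open>auto simp: pairwise_def orthogonal_def\<close>)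
  then have "finite (v ` ?E)" using independent_bound by blast
  then show ?thesis by (rule finite_imageD[OF _ inj])
qed

text \<open>A minimizer of the quadratic form on the unit sphere is an eigenvector, because the form minus the
  minimum times the squared norm is a parabola with minimum \<open>0\<close> along every line through it.\<close>

lemma smallest_eigenvalue_le_quadratic_form:
  fixes A :: "real ^ 'n::finite ^ 'n"
  assumes A: "transpose A = A"
  shows "smallest_eigenvalue A * (norm u)\<^sup>2 \<le> u \<bullet> (A *v u)"
proof -
  define q where "q u = u \<bullet> (A *v u)" for u
  have ne: "sphere (0 :: real ^ 'n) 1 \<noteq> {}" using norm_axis_1[where 'a='n] by (auto simp: dist_norm)
  have "continuous_on (sphere 0 1) q" unfolding q_def
    by (intro continuous_intros matrix_vector_mult_linear_continuous_on)
  from continuous_attains_inf[OF compact_sphere ne this]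
  obtain u0 where u0: "u0 \<in> sphere 0 1" "\<And>u. u \<in> sphere 0 1 \<Longrightarrow> q u0 \<le> q u" by blast
  define m where "m = q u0"
  have low: "m * (norm u)\<^sup>2 \<le> q u" for u
  proof (cases "u = 0")
    case False
    have "q ((1 / norm u) *\<^sub>R u) = q u / (norm u)\<^sup>2"
      unfolding q_def by (simp add: matrix_vector_mult_scaleR power2_eq_square)
    moreover have "m \<le> q ((1 / norm u) *\<^sub>R u)" unfolding m_def using False by (intro u0) simp
    ultimately have "m * (norm u)\<^sup>2 \<le> q u / (norm u)\<^sup>2 * (norm u)\<^sup>2" by (intro mult_right_mono) auto
    then show ?thesis using False by simp
  qed (simp add: q_def)
  have "d \<bullet> (A *v u0 - m *\<^sub>R u0) = 0" for d
  proof -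
    have n0: "u0 \<bullet> u0 = 1" using u0(1) by (simp add: dot_square_norm)
    have "0 \<le> t * (2 * (d \<bullet> (A *v u0 - m *\<^sub>R u0))) + t\<^sup>2 * (q d - m * (d \<bullet> d))" for t
    proof -
      have sd: "u0 \<bullet> (A *v d) = d \<bullet> (A *v u0)" using symmetric_dot[OF A, of u0 d] by (simp add: inner_commute)
      have "0 \<le> q (u0 + t *\<^sub>R d) - m * ((u0 + t *\<^sub>R d) \<bullet> (u0 + t *\<^sub>R d))"
        using low[of "u0 + t *\<^sub>R d"] by (simp add: dot_square_norm)
      also have "\<dots> = (q u0 - m * (u0 \<bullet> u0)) + t * (2 * (d \<bullet> (A *v u0 - m *\<^sub>R u0))) + t\<^sup>2 * (q d - m * (d \<bullet> d))"
        unfolding q_def by (simp add: matrix_vector_right_distrib matrix_vector_mult_scaleR inner_add_left inner_add_right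
            inner_diff_right sd inner_commute[of u0 d] power2_eq_square algebra_simps)
      finally show ?thesis by (simp add: n0 m_def)
    qed
    from linear_term_of_nonneg_quadratic[OF this] show ?thesis by simp
  qed
  then have "A *v u0 - m *\<^sub>R u0 = 0" by (metis inner_eq_zero_iff)
  moreover have "u0 \<noteq> 0" using u0(1) by auto
  ultimately have "real_eigenvalue A m" unfolding real_eigenvalue_def by (intro exI[of _ u0]) simp
  then have "smallest_eigenvalue A \<le> m" unfolding smallest_eigenvalue_def
    by (intro Min_le finite_real_eigenvalues A) simp
  then have "smallest_eigenvalue A * (norm u)\<^sup>2 \<le> m * (norm u)\<^sup>2" by (rule mult_right_mono) simp
  then show ?thesis using low[of u] by (simp add: q_def)
qed

lemma Ck_on_continuous: "Ck_on k f S \<Longrightarrow> continuous_on S f"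
  unfolding Ck_on_def by (metis continuous_on_cong zero_le)

text \<open>A kernel with integral \<open>1\<close> is positive somewhere, hence by continuity on an interval, and by
  symmetry on its mirror image.\<close>

lemma smoothing_kernel_window:
  assumes K: "smoothing_kernel K"
  obtains B \<kappa> v1 v2 where "\<And>v. K v \<le> B" "0 < \<kappa>" "0 \<le> v1" "v1 < v2" "v2 \<le> 1" "\<And>v. v1 \<le> \<bar>v\<bar> \<Longrightarrow> \<bar>v\<bar> \<le> v2 \<Longrightarrow> \<kappa> \<le> K v"
proof -
  have K0: "0 \<le> K v" and sym: "K (- v) = K v" and cont: "continuous_on {-1..1} K" and I: "(K has_integral 1) {-1..1}" for v
    using K Ck_on_continuous unfolding smoothing_kernel_def by blast+
  have sa: "K \<bar>v\<bar> = K v" for v using sym[of v] by (auto simp: abs_if)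
  obtain B where B: "\<forall>v\<in>range K. norm v \<le> B" using K unfolding smoothing_kernel_def bounded_iff by blast
  have "\<exists>v\<in>{-1..1}. K v \<noteq> 0"
  proof (rule ccontr)
    assume "\<not> (\<exists>v\<in>{-1..1}. K v \<noteq> 0)"
    then have "(K has_integral 0) {-1..1}" by (intro has_integral_is_0) auto
    then show False using has_integral_unique[OF I] by force
  qed
  then obtain v0 where "v0 \<in> {-1..1}" "K v0 \<noteq> 0" by blast
  then have c: "\<bar>v0\<bar> \<in> {-1..1}" "0 < K \<bar>v0\<bar>" using K0[of v0] sa[of v0] by auto
  then obtain d where d: "d > 0" "\<And>v. v \<in> {-1..1} \<Longrightarrow> dist v \<bar>v0\<bar> < d \<Longrightarrow> dist (K v) (K \<bar>v0\<bar>) < K \<bar>v0\<bar> / 2"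
    using cont unfolding continuous_on_iff by (metis half_gt_zero)
  define v1 v2 where "v1 = max 0 (\<bar>v0\<bar> - d / 2)" and "v2 = min 1 (\<bar>v0\<bar> + d / 2)"
  have v: "0 \<le> v1" "v1 < v2" "v2 \<le> 1" using c d(1) by (auto simp: v1_def v2_def)
  show thesis
  proof (rule that[of B "K \<bar>v0\<bar> / 2" v1 v2])
    show "K \<bar>v0\<bar> / 2 \<le> K v" if "v1 \<le> \<bar>v\<bar>" "\<bar>v\<bar> \<le> v2" for v
    proof -
      have "\<bar>v0\<bar> - d / 2 \<le> \<bar>v\<bar>" "\<bar>v\<bar> \<le> \<bar>v0\<bar> + d / 2" using that by (auto simp: v1_def v2_def)
      then have "\<bar>\<bar>v\<bar> - \<bar>v0\<bar>\<bar> \<le> d / 2" by (simp only: abs_le_iff) linarith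
      then have "dist \<bar>v\<bar> \<bar>v0\<bar> < d" using d(1) by (simp add: dist_real_def)
      moreover have "\<bar>v\<bar> \<in> {-1..1}" using that v by auto
      ultimately have "dist (K \<bar>v\<bar>) (K \<bar>v0\<bar>) < K \<bar>v0\<bar> / 2" using d(2) by blast
      then show ?thesis unfolding sa[of v] dist_real_def by linarith
    qed
    show "K v \<le> B" for v using B[rule_format, of "K v"] by auto
  qed (use c v in auto)
qed

lemma vector_derivative_bound:
  fixes f :: "real \<Rightarrow> 'b::real_normed_vector"
  assumes "convex S" "\<And>t. t \<in> S \<Longrightarrow> (f has_vector_derivative f' t) (at t within S)" "\<And>t. t \<in> S \<Longrightarrow> norm (f' t) \<le> B"
    and "u \<in> S" "t \<in> S"
  shows "norm (f u - f t) \<le> B * \<bar>u - t\<bar>"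
proof -
  have "norm (f u - f t) \<le> B * norm (u - t)"
  proof (rule differentiable_bound[OF assms(1) _ _ assms(4,5)])
    show "(f has_derivative (\<lambda>h. h *\<^sub>R f' t)) (at t within S)" if "t \<in> S" for t
      using assms(2)[OF that] by (simp add: has_vector_derivative_def)
    show "onorm (\<lambda>h::real. h *\<^sub>R f' t) \<le> B" if "t \<in> S" for t
      using assms(3)[OF that] by (intro onorm_le) (simp add: mult.commute[of B] mult_left_mono)
  qed
  then show ?thesis by simp
qed

text \<open>By compactness the second derivative is bounded, which makes the remainder uniform.\<close>

lemma Ck_on_taylor:
  fixes f :: "real \<Rightarrow> 'b::real_normed_vector"
  assumes f: "Ck_on 3 f {0..1}"
  obtains f' B where "0 \<le> B" "\<And>t. t \<in> {0..1} \<Longrightarrow> norm (f t) \<le> B"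
    "\<And>t u. t \<in> {0..1} \<Longrightarrow> u \<in> {0..1} \<Longrightarrow> norm (f u - f t - (u - t) *\<^sub>R f' t) \<le> B * (u - t)\<^sup>2"
proof -
  obtain D where D0: "\<And>t. t \<in> {0..1} \<Longrightarrow> D 0 t = f t"
    and D: "\<And>j t. j < 3 \<Longrightarrow> t \<in> {0..1} \<Longrightarrow> (D j has_vector_derivative D (Suc j) t) (at t within {0..1})"
    and C: "\<And>j. j \<le> 3 \<Longrightarrow> continuous_on {0..1} (D j)"
    using f unfolding Ck_on_def by blast
  have "bounded (D j ` {0..1})" if "j \<le> 3" for j by (intro compact_imp_bounded compact_continuous_image C that) simp
  then obtain B0 B2 where B: "\<And>t. t \<in> {0..1} \<Longrightarrow> norm (D 0 t) \<le> B0" "\<And>t. t \<in> {0..1} \<Longrightarrow> norm (D 2 t) \<le> B2"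
    unfolding bounded_iff by (metis imageI numeral_le_iff semiring_norm(68) semiring_norm(72) zero_le one_le_numeral le_numeral_extra(3))
  define B where "B = max B0 B2"
  have B_nn: "0 \<le> B" using B(1)[of 0] norm_ge_zero[of "D 0 0"] unfolding B_def by (simp add: max.coboundedI1 order_trans[OF norm_ge_zero])
  have D1: "norm (D 1 u - D 1 t) \<le> B * \<bar>u - t\<bar>" if "t \<in> {0..1}" "u \<in> {0..1}" for t u
  proof (rule vector_derivative_bound[of "{0..1}" _ "D 2"])
    show "(D 1 has_vector_derivative D 2 z) (at z within {0..1})" if "z \<in> {0..1}" for z
      using D[of 1 z] that by (simp add: numeral_2_eq_2)
    show "norm (D 2 z) \<le> B" if "z \<in> {0..1}" for z using B(2)[OF that] by (simp add: B_def)
  qed (use that in auto)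
  show thesis
  proof (rule that[of B "D 1"])
    show "norm (f t) \<le> B" if "t \<in> {0..1}" for t using B(1)[OF that] D0[OF that] by (simp add: B_def)
    show "norm (f u - f t - (u - t) *\<^sub>R D 1 t) \<le> B * (u - t)\<^sup>2" if tu: "t \<in> {0..1}" "u \<in> {0..1}" for t u
    proof -
      let ?S = "closed_segment t u"
      have S: "?S \<subseteq> {0..1}" using tu by (auto simp: closed_segment_eq_real_ivl split: if_splits)
      have "norm ((D 0 u - (u - t) *\<^sub>R D 1 t) - (D 0 t - (t - t) *\<^sub>R D 1 t)) \<le> (B * \<bar>u - t\<bar>) * \<bar>u - t\<bar>"
      proof (rule vector_derivative_bound[of ?S _ "\<lambda>z. D 1 z - D 1 t"])
        show "((\<lambda>z. D 0 z - (z - t) *\<^sub>R D 1 t) has_vector_derivative D 1 z - D 1 t) (at z within ?S)" if "z \<in> ?S" for z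
        proof -
          have "(D 0 has_vector_derivative D 1 z) (at z within ?S)"
            using has_vector_derivative_within_subset[OF D[of 0 z] S] S that by auto
          moreover have "((\<lambda>z. (z - t) *\<^sub>R D 1 t) has_vector_derivative (1 - 0) *\<^sub>R D 1 t) (at z within ?S)"
            by (auto intro!: derivative_eq_intros simp: has_real_derivative_iff_has_vector_derivative[symmetric])
          ultimately show ?thesis by (auto intro!: has_vector_derivative_diff)
        qed
        show "norm (D 1 z - D 1 t) \<le> B * \<bar>u - t\<bar>" if z: "z \<in> ?S" for z
        proof -
          have "\<bar>z - t\<bar> \<le> \<bar>u - t\<bar>" using z by (auto simp: closed_segment_eq_real_ivl split: if_splits)
          then have "B * \<bar>z - t\<bar> \<le> B * \<bar>u - t\<bar>" using B_nn by (rule mult_left_mono)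
          then show ?thesis using D1[OF tu(1), of z] z S by force
        qed
      qed auto
      then show ?thesis using D0 tu by (simp add: power2_eq_square mult.assoc algebra_simps)
    qed
  qed (use B_nn in auto)
qed

lemma grid_points_near:
  assumes t0: "t0 \<in> {0..1}" and r: "0 < r"
  shows "\<exists>q>0. \<forall>\<^sub>F n in sequentially. q * real n \<le> real (card {i\<in>{1..n}. \<bar>real i / real n - t0\<bar> < r})"
proof -
  define a b where "a = max 0 (t0 - r / 2)" and "b = min 1 (t0 + r / 2)"
  have ab: "0 \<le> a" "a < b" "b \<le> 1" using t0 r by (auto simp: a_def b_def)
  have "\<forall>\<^sub>F n in sequentially. 2 / (b - a) \<le> real n"
    using eventually_ge_at_top[of "nat \<lceil>2 / (b - a)\<rceil>"] by eventually_elim linarith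
  then have "\<forall>\<^sub>F n in sequentially. (b - a) / 2 * real n \<le> real (card {i\<in>{1..n}. \<bar>real i / real n - t0\<bar> < r})"
    using eventually_gt_at_top[of "0::nat"]
  proof eventually_elim
    case (elim n)
    let ?I = "{nat \<lfloor>a * real n\<rfloor> + 1..nat \<lfloor>b * real n\<rfloor>}"
    have "a * real n < b * real n" using ab elim by simp
    have sub: "?I \<subseteq> {i\<in>{1..n}. \<bar>real i / real n - t0\<bar> < r}"
    proof
      fix i assume i: "i \<in> ?I"
      have "\<lfloor>a * real n\<rfloor> < int i" "int i \<le> \<lfloor>b * real n\<rfloor>" using i by auto
      then have lo: "a * real n < real i" and hi: "real i \<le> b * real n" unfolding floor_less_iff le_floor_iff by simp_all
      have "b * real n \<le> 1 * real n" by (rule mult_right_mono) (use ab in auto)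
      then have "i \<le> n" using hi by simp
      moreover have "a < real i / real n" using lo elim(2) by (simp add: pos_less_divide_eq)
      moreover have "real i / real n \<le> b" using hi elim(2) by (simp add: pos_divide_le_eq)
      ultimately show "i \<in> {i\<in>{1..n}. \<bar>real i / real n - t0\<bar> < r}" using i r by (auto simp: a_def b_def abs_less_iff)
    qed
    have "2 \<le> (b - a) * real n" using elim ab by (simp add: field_simps)
    then have "(b - a) / 2 * real n \<le> (b - a) * real n - 1" by (simp add: field_simps)
    also have "\<dots> = (b * real n - 1) - a * real n" by (simp add: algebra_simps)
    also have "\<dots> \<le> real (nat \<lfloor>b * real n\<rfloor>) - real (nat \<lfloor>a * real n\<rfloor>)" using ab by (simp, linarith)
    also have "\<dots> \<le> real (card ?I)" by simp
    also have "\<dots> \<le> real (card {i\<in>{1..n}. \<bar>real i / real n - t0\<bar> < r})" by (intro of_nat_mono card_mono sub) simp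
    finally show ?case .
  qed
  moreover have "0 < (b - a) / 2" using ab by simp
  ultimately show ?thesis by blast
qed

text \<open>The number of grid points near \<open>t0\<close> is proportional to \<open>n\<close>, also when \<open>t0\<close> is an endpoint.\<close>

lemma riemann_sum_lower:
  fixes g :: "real \<Rightarrow> real"
  assumes t0: "t0 \<in> {0..1}" and r: "0 < r" and c: "0 < c"
    and g: "\<And>t. t \<in> {0..1} \<Longrightarrow> 0 \<le> g t" "\<And>t. t \<in> {0..1} \<Longrightarrow> \<bar>t - t0\<bar> < r \<Longrightarrow> c \<le> g t"
  shows "\<exists>q>0. \<forall>\<^sub>F n in sequentially. q * real n \<le> (\<Sum>i=1..n. g (real i / real n))"
proof -
  obtain q where q: "q > 0" "\<forall>\<^sub>F n in sequentially. q * real n \<le> real (card {i\<in>{1..n}. \<bar>real i / real n - t0\<bar> < r})"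
    using grid_points_near[OF t0 r] by blast
  have "\<forall>\<^sub>F n in sequentially. (c * q) * real n \<le> (\<Sum>i=1..n. g (real i / real n))"
    using q(2)
  proof eventually_elim
    case (elim n)
    let ?I = "{i\<in>{1..n}. \<bar>real i / real n - t0\<bar> < r}"
    have in01: "real i / real n \<in> {0..1}" if "i \<in> {1..n}" for i using that by simp
    have "c * (q * real n) \<le> c * real (card ?I)" using elim c by (intro mult_left_mono) auto
    also have "\<dots> = (\<Sum>i\<in>?I. c)" by simp
    also have "\<dots> \<le> (\<Sum>i\<in>?I. g (real i / real n))"
    proof (rule sum_mono)
      fix i assume i: "i \<in> ?I" then show "c \<le> g (real i / real n)" using in01[of i] by (intro g(2)) auto
    qed
    also have "\<dots> \<le> (\<Sum>i=1..n. g (real i / real n))"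
    proof (rule sum_mono2)
      show "0 \<le> g (real i / real n)" if "i \<in> {1..n} - ?I" for i using that in01[of i] by (intro g(1)) auto
    qed auto
    finally show ?case by (simp add: mult.assoc)
  qed
  then show ?thesis using q c by (intro exI[of _ "c * q"]) simp
qed

text \<open>Write \<open>h = n b\<close> and let \<open>P\<close> be the product of \<open>\<phi>\<close> with \<open>\<phi> + \<rho>\<close>. Since \<open>\<phi>\<close> dominates \<open>h\<^bsup>-1/2\<^esup>\<close> and
  \<open>b\<^sup>2\<close>, and \<open>\<rho>\<close> dominates \<open>sqrt n / h\<close>, the rates below are at most multiples of \<open>P\<close> as soon as \<open>P \<le> 1\<close> and
  \<open>h \<ge> 1\<close>. The penalty tends to zero and \<open>P\<close> is negligible against it, so \<open>P\<close> tends to zero as well; then so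
  does \<open>n / h\<^sup>3\<close>, the square of \<open>h\<^bsup>-1/2\<^esup> * (sqrt n / h)\<close>.\<close>

lemma tuning_rates:
  fixes b chi :: "nat \<Rightarrow> real"
  assumes b: "\<forall>n\<ge>1. b n > 0" "b \<longlonglongrightarrow> 0" "filterlim (\<lambda>n. real n * b n) at_top sequentially"
    and chi: "chi \<longlonglongrightarrow> 0"
      "filterlim (\<lambda>n. inverse (phi_rate \<iota> b n * (phi_rate \<iota> b n + rho_rate b n)) * chi n) at_top sequentially"
  shows "\<forall>\<^sub>F n in sequentially. 0 < chi n"
    and "(\<lambda>n. real n / (real n * b n) ^ 3) \<longlonglongrightarrow> 0"
    and "(\<lambda>n. (1 / (real n * b n) + ((b n)\<^sup>2 * (1 + sqrt (real n) / (real n * b n)))\<^sup>2) / chi n) \<longlonglongrightarrow> 0"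
    and "(\<lambda>n. (1 / (real n * b n) + (b n)\<^sup>2 * (1 + sqrt (real n) / (real n * b n)) / sqrt (real n * b n)) / chi n) \<longlonglongrightarrow> 0"
proof -
  define \<phi> where "\<phi> = phi_rate \<iota> b"
  define \<rho> where "\<rho> = rho_rate b"
  define P where "P n = \<phi> n * (\<phi> n + \<rho> n)" for n
  \<comment> \<open>The lower bounds of \<open>\<phi>\<close> and \<open>\<rho>\<close> that are used are \<open>u\<close>, \<open>s\<close> and \<open>\<rho>'\<close>.\<close>
  define u where "u n = 1 / sqrt (real n * b n)" for n
  define \<rho>' where "\<rho>' n = sqrt (real n) / (real n * b n)" for n
  define s where "s n = (b n)\<^sup>2" for n
  have basic: "\<forall>\<^sub>F n in sequentially. 0 < u n \<and> u n \<le> 1 \<and> u n \<le> \<phi> n \<and> 0 < s n \<and> s n \<le> \<phi> n \<and> 0 < \<rho>' n \<and> \<rho>' n \<le> \<rho> n \<and> (u n)\<^sup>2 = 1 / (real n * b n)"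
    using eventually_ge_at_top[of "3::nat"] filterlim_at_top[THEN iffD1, OF b(3), rule_format, of 1]
  proof eventually_elim
    case (elim n)
    have bn: "0 < b n" using b(1) elim by simp
    define h where "h = real n * b n"
    have h: "1 \<le> h" using elim by (simp add: h_def)
    have "exp 1 \<le> (3::real)" by (rule exp_le)
    then have "ln (exp 1) \<le> ln (real n)" using elim by (subst ln_le_cancel_iff) auto
    then have ln1: "1 \<le> ln (real n)" by simp
    have un: "u n = 1 / sqrt h" by (simp add: u_def h_def)
    have "1 / sqrt h = inverse h * sqrt h" using h by (simp add: field_simps real_div_sqrt)
    also have "\<dots> \<le> inverse h * (h * ln (real n)) powr (1 / 2)"
    proof (rule mult_left_mono)
      have "h * 1 \<le> h * ln (real n)" using h ln1 by (intro mult_left_mono) auto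
      then show "sqrt h \<le> (h * ln (real n)) powr (1 / 2)" using h ln1 by (simp add: powr_half_sqrt)
    qed (use h in simp)
    also have "\<dots> \<le> inverse h * (real n powr (1 / \<iota>) + (h * ln (real n)) powr (1 / 2))"
      using h by (intro mult_left_mono) auto
    also have "\<dots> \<le> \<phi> n" by (simp add: \<phi>_def phi_rate_def h_def)
    finally have u\<phi>: "u n \<le> \<phi> n" by (simp add: un)
    have "0 \<le> inverse h * (real n powr (1 / \<iota>) + (h * ln (real n)) powr (1 / 2))" using h by simp
    then have s\<phi>: "s n \<le> \<phi> n" by (simp add: \<phi>_def phi_rate_def h_def s_def)
    have "sqrt (real n) / real n = 1 / sqrt (real n)" using elim by (simp add: field_simps)
    moreover have "real n powr (- (1 / 2)) = 1 / sqrt (real n)" unfolding powr_minus using elim by (simp add: powr_half_sqrt inverse_eq_divide)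
    moreover have "\<rho>' n = sqrt (real n) / real n * inverse (b n)" by (simp add: \<rho>'_def divide_inverse)
    ultimately have "real n powr (- 1 / 2) * inverse (b n) = \<rho>' n" by simp
    then have \<rho>: "\<rho>' n \<le> \<rho> n" using bn by (simp add: \<rho>_def rho_rate_def)
    have "0 < s n" "0 < \<rho>' n" using bn elim by (simp_all add: s_def \<rho>'_def)
    moreover have "0 < u n" "u n \<le> 1" "(u n)\<^sup>2 = 1 / (real n * b n)" using h by (simp_all add: un power_divide h_def)
    ultimately show ?case using u\<phi> s\<phi> \<rho> by blast
  qed
  have Ppos: "\<forall>\<^sub>F n in sequentially. 0 < P n" using basic
    by eventually_elim (auto simp: P_def intro!: mult_pos_pos add_pos_pos)
  have big: "filterlim (\<lambda>n. inverse (P n) * chi n) at_top sequentially" using chi(2) by (simp add: P_def \<phi>_def \<rho>_def)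
  show cpos: "\<forall>\<^sub>F n in sequentially. 0 < chi n"
    using filterlim_at_top[THEN iffD1, OF big, rule_format, of 1] Ppos
  proof eventually_elim
    case (elim n)
    then have "0 < inverse (P n) * chi n" by linarith
    then show ?case using elim by (simp add: zero_less_mult_iff)
  qed
  have "(\<lambda>n. inverse (inverse (P n) * chi n)) \<longlonglongrightarrow> 0" by (rule tendsto_inverse_0_at_top[OF big])
  then have Pc: "(\<lambda>n. P n / chi n) \<longlonglongrightarrow> 0" by (simp add: field_simps)
  have "(\<lambda>n. P n / chi n * chi n) \<longlonglongrightarrow> 0 * 0" by (intro tendsto_mult Pc chi(1))
  moreover have "\<forall>\<^sub>F n in sequentially. P n / chi n * chi n = P n" using cpos by eventually_elim simp
  ultimately have P0: "P \<longlonglongrightarrow> 0" using Lim_transform_eventually by fastforce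
  have bounds: "\<forall>\<^sub>F n in sequentially. (u n)\<^sup>2 \<le> P n \<and> u n * \<rho>' n \<le> P n \<and> (s n)\<^sup>2 \<le> P n \<and> s n * u n \<le> P n \<and> s n * \<rho>' n \<le> P n \<and> P n \<le> 1 \<and> 0 < P n"
    using basic Ppos order_tendstoD(2)[OF P0, of 1, simplified]
  proof eventually_elim
    case (elim n)
    have \<phi>: "0 < \<phi> n" "0 < \<rho> n" using elim by linarith+
    have P: "P n = \<phi> n * \<phi> n + \<phi> n * \<rho> n" by (simp add: P_def algebra_simps)
    have pp: "0 \<le> \<phi> n * \<phi> n" "0 \<le> \<phi> n * \<rho> n" using \<phi> by simp_all
    have "u n * u n \<le> \<phi> n * \<phi> n" "s n * s n \<le> \<phi> n * \<phi> n" "s n * u n \<le> \<phi> n * \<phi> n" "u n * \<rho>' n \<le> \<phi> n * \<rho> n" "s n * \<rho>' n \<le> \<phi> n * \<rho> n"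
      using elim by (auto intro!: mult_mono)
    then have "u n * u n \<le> P n" "u n * \<rho>' n \<le> P n" "s n * s n \<le> P n" "s n * u n \<le> P n" "s n * \<rho>' n \<le> P n"
      using pp unfolding P by linarith+
    moreover have "P n \<le> 1" "0 < P n" using elim by simp_all
    ultimately show ?case unfolding power2_eq_square by blast
  qed
  have squeeze: "(\<lambda>n. f n) \<longlonglongrightarrow> 0" if "\<forall>\<^sub>F n in sequentially. 0 \<le> f n \<and> f n \<le> g n" "g \<longlonglongrightarrow> 0" for f g :: "nat \<Rightarrow> real"
    by (rule tendsto_sandwich[OF _ _ tendsto_const that(2)]) (use that(1) in \<open>auto elim: eventually_mono\<close>)
  show "(\<lambda>n. real n / (real n * b n) ^ 3) \<longlonglongrightarrow> 0"
  proof (rule squeeze[OF _ P0], use basic bounds eventually_gt_at_top[of "0::nat"] in eventually_elim)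
    case (elim n)
    define h where "h = real n * b n"
    have "(u n * \<rho>' n)\<^sup>2 = (u n)\<^sup>2 * (\<rho>' n)\<^sup>2" by (rule power_mult_distrib)
    also have "\<dots> = 1 / h * ((sqrt (real n))\<^sup>2 / h\<^sup>2)" using elim by (simp add: \<rho>'_def power_divide h_def)
    also have "\<dots> = real n / h ^ 3" by (simp add: power2_eq_square power3_eq_cube)
    finally have e: "real n / h ^ 3 = (u n * \<rho>' n)\<^sup>2" by simp
    have "(u n * \<rho>' n) * (u n * \<rho>' n) \<le> P n * 1" using elim by (intro mult_mono) auto
    then show ?case unfolding h_def[symmetric] e by (simp add: power2_eq_square)
  qed
  have lin: "(\<lambda>n. c * (P n / chi n)) \<longlonglongrightarrow> 0" for c using tendsto_mult_right_zero[OF Pc, of c] by simp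
  show "(\<lambda>n. (1 / (real n * b n) + ((b n)\<^sup>2 * (1 + sqrt (real n) / (real n * b n)))\<^sup>2) / chi n) \<longlonglongrightarrow> 0"
  proof (rule squeeze[OF _ lin[of 5]], use basic bounds cpos in eventually_elim)
    case (elim n)
    have sr: "(s n * \<rho>' n)\<^sup>2 \<le> P n"
    proof -
      have "(s n * \<rho>' n) * (s n * \<rho>' n) \<le> P n * 1" using elim by (intro mult_mono) auto
      then show ?thesis by (simp add: power2_eq_square)
    qed
    have "(s n * (1 + \<rho>' n))\<^sup>2 \<le> 2 * (s n)\<^sup>2 + 2 * (s n * \<rho>' n)\<^sup>2"
      using sum_squares_bound[of "s n" "s n * \<rho>' n"] by (simp add: power2_eq_square algebra_simps)
    moreover have "1 / (real n * b n) = (u n)\<^sup>2" using elim by simp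
    ultimately have "1 / (real n * b n) + (s n * (1 + \<rho>' n))\<^sup>2 \<le> 5 * P n" using sr elim by linarith
    moreover have "0 \<le> 1 / (real n * b n) + (s n * (1 + \<rho>' n))\<^sup>2" using \<open>1 / (real n * b n) = (u n)\<^sup>2\<close> by simp
    ultimately show ?case using elim unfolding s_def[symmetric] \<rho>'_def[symmetric]
      by (auto simp: divide_right_mono)
  qed
  show "(\<lambda>n. (1 / (real n * b n) + (b n)\<^sup>2 * (1 + sqrt (real n) / (real n * b n)) / sqrt (real n * b n)) / chi n) \<longlonglongrightarrow> 0"
  proof (rule squeeze[OF _ lin[of 3]], use basic bounds cpos in eventually_elim)
    case (elim n)
    have "(s n * \<rho>' n) * u n \<le> P n * 1" using elim by (intro mult_mono) auto
    moreover have "s n * (1 + \<rho>' n) / sqrt (real n * b n) = s n * u n + (s n * \<rho>' n) * u n" by (simp add: u_def distrib_left add_divide_distrib)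
    moreover have u: "1 / (real n * b n) = (u n)\<^sup>2" using elim by simp
    ultimately have "1 / (real n * b n) + s n * (1 + \<rho>' n) / sqrt (real n * b n) \<le> 3 * P n" using elim by linarith
    moreover have "0 \<le> s n * (1 + \<rho>' n) / sqrt (real n * b n)"
      using \<open>s n * (1 + \<rho>' n) / sqrt (real n * b n) = s n * u n + (s n * \<rho>' n) * u n\<close> elim by simp
    ultimately show ?case using elim unfolding s_def[symmetric] \<rho>'_def[symmetric] u
      by (auto simp: divide_right_mono)
  qed
qed

section \<open>Moments in the locally stationary model\<close>

context sequence_space
begin

text \<open>A single variable is an array of length one.\<close>

lemma centred_moment_of_influences:
  assumes d: "\<And>l. 0 \<le> d l" "\<And>N. (\<Sum>l<N. d l) \<le> \<Theta>" and f: "integrable S f"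
  shows "(\<And>l. influence 2 f l (d l)) \<Longrightarrow> Lp_le S 2 (\<lambda>\<omega>. f \<omega> - (\<integral>\<omega>. f \<omega> \<partial>S)) \<Theta>"
    and "(\<And>l. influence 4 f l (d l)) \<Longrightarrow> Lp_le S 4 (\<lambda>\<omega>. f \<omega> - (\<integral>\<omega>. f \<omega> \<partial>S)) (2 * \<Theta>)"
proof -
  have "d l \<le> \<Theta>" for l
  proof -
    have "d l \<le> (\<Sum>l<Suc l. d l)" using d(1) by (simp add: sum_nonneg)
    then show ?thesis using d(2)[of "Suc l"] by linarith
  qed
  then have w: "schur_weights 1 (\<lambda>_. d) \<Theta>" using d d(2)[of 0] by (auto simp: schur_weights_def)
  have X: "(\<And>l. influence q f l (d l)) \<Longrightarrow> weak_array q 1 (\<lambda>_. d) 1 (\<lambda>_. f)" for q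
    using f by (simp add: weak_array_def)
  show "Lp_le S 2 (\<lambda>\<omega>. f \<omega> - (\<integral>\<omega>. f \<omega> \<partial>S)) \<Theta>" if "\<And>l. influence 2 f l (d l)"
    using weak_array_linear_2[OF w X[OF that], of "\<lambda>_. 1"] by simp
  show "Lp_le S 4 (\<lambda>\<omega>. f \<omega> - (\<integral>\<omega>. f \<omega> \<partial>S)) (2 * \<Theta>)" if "\<And>l. influence 4 f l (d l)"
    using weak_array_linear_4[OF w X[OF that], of "\<lambda>_. 1"] by simp
qed

lemma moment_of_influences:
  assumes d: "\<And>l. 0 \<le> d l" "\<And>N. (\<Sum>l<N. d l) \<le> \<Theta>" and f: "integrable S f" "\<bar>\<integral>\<omega>. f \<omega> \<partial>S\<bar> \<le> m"
  shows "(\<And>l. influence 2 f l (d l)) \<Longrightarrow> Lp_le S 2 f (\<Theta> + m)"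
    and "(\<And>l. influence 4 f l (d l)) \<Longrightarrow> Lp_le S 4 f (2 * \<Theta> + m)"
  using Lp_le_add[OF centred_moment_of_influences(1)[OF d f(1)] Lp_le_weaken[OF P.Lp_le_const[of 2] f(2)]]
    Lp_le_add[OF centred_moment_of_influences(2)[OF d f(1)] Lp_le_weaken[OF P.Lp_le_const[of 4] f(2)]] by simp_all

end

lemma dep_delta_partial_sums:
  assumes fin: "dep_Theta M \<epsilon> \<epsilon>' J 0 q < \<infinity>"
  shows "dep_delta M \<epsilon> \<epsilon>' J l q \<le> ennreal (enn2real (dep_delta M \<epsilon> \<epsilon>' J l q))"
    and "(\<Sum>l<N. enn2real (dep_delta M \<epsilon> \<epsilon>' J l q)) \<le> enn2real (dep_Theta M \<epsilon> \<epsilon>' J 0 q)"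
proof -
  let ?d = "\<lambda>l. dep_delta M \<epsilon> \<epsilon>' J l q"
  have part: "(\<Sum>l\<in>F. ?d l) \<le> dep_Theta M \<epsilon> \<epsilon>' J 0 q" if "finite F" for F
    unfolding dep_Theta_def using sum_le_suminf[of ?d F] that by simp
  have lt: "?d l < \<infinity>" for l using part[of "{l}"] fin by simp
  then show "?d l \<le> ennreal (enn2real (?d l))" by (simp add: ennreal_enn2real)
  have "ennreal (\<Sum>l<N. enn2real (?d l)) = (\<Sum>l<N. ?d l)"
    using lt by (simp add: sum_ennreal[symmetric] ennreal_enn2real)
  also have "\<dots> \<le> ennreal (enn2real (dep_Theta M \<epsilon> \<epsilon>' J 0 q))" using part[of "{..<N}"] fin by (simp add: ennreal_enn2real)
  finally show "(\<Sum>l<N. enn2real (?d l)) \<le> enn2real (dep_Theta M \<epsilon> \<epsilon>' J 0 q)" by (simp add: ennreal_le_iff)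
qed

text \<open>A conditional mean zero is tested against functions of the conditioning variable.\<close>

lemma (in prob_space) cond_mean_zero_moments:
  assumes Y: "cond_mean_zero M X Y" and X: "X \<in> borel_measurable M"
  shows "(\<integral>\<omega>. Y \<omega> \<partial>M) = 0"
    and "f \<in> borel_measurable borel \<Longrightarrow> integrable M (\<lambda>\<omega>. f (X \<omega>) * Y \<omega>) \<Longrightarrow> (\<integral>\<omega>. f (X \<omega>) * Y \<omega> \<partial>M) = 0"
proof -
  let ?F = "vimage_algebra (space M) X borel"
  have sub: "subalgebra M ?F" using X unfolding subalgebra_def by (simp add: sets_vimage_algebra2 measurable_iff_sets)
  interpret finite_measure_subalgebra M ?F by unfold_locales (rule sub)
  have Yi: "integrable M Y" and Y0: "AE \<omega> in M. real_cond_exp M ?F Y \<omega> = 0" using Y by (auto simp: cond_mean_zero_def)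
  have XF: "X \<in> measurable ?F borel" by (rule measurable_vimage_algebra1) auto
  show *: "(\<integral>\<omega>. f (X \<omega>) * Y \<omega> \<partial>M) = 0" if f: "f \<in> borel_measurable borel" and i: "integrable M (\<lambda>\<omega>. f (X \<omega>) * Y \<omega>)" for f
  proof -
    have fX: "(\<lambda>\<omega>. f (X \<omega>)) \<in> borel_measurable ?F" by (rule measurable_compose[OF XF f])
    have "(\<integral>\<omega>. f (X \<omega>) * Y \<omega> \<partial>M) = (\<integral>\<omega>. f (X \<omega>) * real_cond_exp M ?F Y \<omega> \<partial>M)"
      using real_cond_exp_intg(2)[OF i fX] Yi by simp
    also have "\<dots> = 0" by (rule integral_eq_zero_AE) (use Y0 in auto)
    finally show ?thesis .
  qed
  show "(\<integral>\<omega>. Y \<omega> \<partial>M) = 0" using *[of "\<lambda>_. 1"] Yi by simp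
qed

context innovations
begin

lemma measurable_filter_at:
  assumes J: "measurable_filter S J" and t: "t \<in> {0..1}"
  shows "J t \<in> borel_measurable \<Omega>"
proof -
  have "(\<lambda>f. (t, f)) \<in> measurable (PiM UNIV (\<lambda>_::nat. S)) (restrict_space borel {0..1} \<Otimes>\<^sub>M PiM UNIV (\<lambda>_::nat. S))"
    using t by (intro measurable_Pair measurable_const) (auto simp: space_restrict_space)
  from measurable_compose[OF this J[unfolded measurable_filter_def]] have "J t \<in> borel_measurable (PiM UNIV (\<lambda>_::nat. S))" by simp
  then show ?thesis using measurable_cong_sets[OF sets_\<Omega> refl] by blast
qed

lemma component_measurable: "f \<in> borel_measurable Q \<Longrightarrow> (\<lambda>\<omega>. f \<omega> $ a) \<in> borel_measurable Q" for f :: "_ \<Rightarrow> real ^ 'p::finite"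
  by (rule borel_measurable_continuous_on[OF linear_continuous_on[OF bounded_linear_vec_nth]])

text \<open>The integral of a function that is not integrable is \<open>0\<close>. A positive smallest eigenvalue excludes
  this value on the diagonal, and so the predictors are square integrable.\<close>

lemma moment_matrix_coercive:
  fixes G :: "real \<Rightarrow> (nat \<Rightarrow> 's) \<Rightarrow> real ^ 'p::finite"
  assumes G: "measurable_filter S G" and t: "t \<in> {0..1}" and l: "0 < l" "l \<le> smallest_eigenvalue (moment_matrix M \<epsilon> G t)"
  shows "integrable \<Omega> (\<lambda>\<omega>. (G t \<omega> $ a)\<^sup>2)" and "integrable \<Omega> (\<lambda>\<omega>. G t \<omega> $ a)"
    and "l * (norm u)\<^sup>2 \<le> (\<integral>\<omega>. (G t \<omega> \<bullet> u)\<^sup>2 \<partial>\<Omega>)"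
proof -
  let ?M = "moment_matrix M \<epsilon> G t"
  have [measurable]: "(\<lambda>\<omega>. G t \<omega> $ a) \<in> borel_measurable \<Omega>" for a
    by (rule component_measurable[OF measurable_filter_at[OF G t]])
  have ent: "?M $ a $ b = (\<integral>\<omega>. G t \<omega> $ a * G t \<omega> $ b \<partial>\<Omega>)" for a b
    unfolding moment_matrix_def by (simp add: integral_past[of "\<lambda>\<omega>. G t \<omega> $ a * G t \<omega> $ b"])
  have sym: "transpose ?M = ?M" by (simp add: vec_eq_iff transpose_def ent mult.commute)
  have low: "l * (norm u)\<^sup>2 \<le> u \<bullet> (?M *v u)" for u
    using smallest_eigenvalue_le_quadratic_form[OF sym, of u] l mult_right_mono[of l "smallest_eigenvalue ?M" "(norm u)\<^sup>2"] by simp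
  have quad: "u \<bullet> (?M *v u) = (\<Sum>a\<in>UNIV. \<Sum>b\<in>UNIV. u $ a * u $ b * ?M $ a $ b)" for u
    by (simp add: inner_vec_def matrix_vector_mult_def sum_distrib_left mult_ac)
  show sq: "integrable \<Omega> (\<lambda>\<omega>. (G t \<omega> $ a)\<^sup>2)" for a
  proof (rule ccontr)
    assume "\<not> integrable \<Omega> (\<lambda>\<omega>. (G t \<omega> $ a)\<^sup>2)"
    then have z: "?M $ a $ a = 0" by (simp add: ent power2_eq_square not_integrable_integral_eq)
    have "axis a 1 \<bullet> (?M *v axis a 1) = ?M $ a $ a"
      by (simp add: inner_axis' matrix_vector_mult_basis column_def)
    then show False using low[of "axis a 1"] z l by (simp add: norm_axis_1)
  qed
  show "integrable \<Omega> (\<lambda>\<omega>. G t \<omega> $ a)"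
    by (rule seq.P.square_integrable_imp_integrable) (use sq in auto)
  have prod: "integrable \<Omega> (\<lambda>\<omega>. G t \<omega> $ a * G t \<omega> $ b)" for a b
  proof (rule Bochner_Integration.integrable_bound)
    show "integrable \<Omega> (\<lambda>\<omega>. (G t \<omega> $ a)\<^sup>2 + (G t \<omega> $ b)\<^sup>2)" by (intro Bochner_Integration.integrable_add sq)
    show "AE \<omega> in \<Omega>. norm (G t \<omega> $ a * G t \<omega> $ b) \<le> norm ((G t \<omega> $ a)\<^sup>2 + (G t \<omega> $ b)\<^sup>2)"
    proof (rule AE_I2)
      fix \<omega>
      have "2 * \<bar>G t \<omega> $ a\<bar> * \<bar>G t \<omega> $ b\<bar> \<le> (G t \<omega> $ a)\<^sup>2 + (G t \<omega> $ b)\<^sup>2"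
        using sum_squares_bound[of "\<bar>G t \<omega> $ a\<bar>" "\<bar>G t \<omega> $ b\<bar>"] by simp
      moreover have "0 \<le> \<bar>G t \<omega> $ a\<bar> * \<bar>G t \<omega> $ b\<bar>" by simp
      ultimately have "\<bar>G t \<omega> $ a\<bar> * \<bar>G t \<omega> $ b\<bar> \<le> (G t \<omega> $ a)\<^sup>2 + (G t \<omega> $ b)\<^sup>2" unfolding mult.assoc by linarith
      then show "norm (G t \<omega> $ a * G t \<omega> $ b) \<le> norm ((G t \<omega> $ a)\<^sup>2 + (G t \<omega> $ b)\<^sup>2)"
        by (simp add: abs_mult)
    qed
  qed measurable
  have "(\<integral>\<omega>. (G t \<omega> \<bullet> u)\<^sup>2 \<partial>\<Omega>) = (\<integral>\<omega>. (\<Sum>a\<in>UNIV. \<Sum>b\<in>UNIV. u $ a * u $ b * (G t \<omega> $ a * G t \<omega> $ b)) \<partial>\<Omega>)"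
    by (intro Bochner_Integration.integral_cong refl) (simp add: inner_vec_def power2_eq_square sum_product mult_ac)
  also have "\<dots> = u \<bullet> (?M *v u)" unfolding quad ent
    by (simp add: Bochner_Integration.integral_sum Bochner_Integration.integrable_sum prod)
  finally show "l * (norm u)\<^sup>2 \<le> (\<integral>\<omega>. (G t \<omega> \<bullet> u)\<^sup>2 \<partial>\<Omega>)" using low[of u] by simp
qed

lemma in_Lip_Lp_le:
  assumes J: "in_Lip M \<epsilon> J"
  obtains C where "0 < C" "\<And>t u f. t \<in> {0..1} \<Longrightarrow> u \<in> {0..1} \<Longrightarrow> f \<in> borel_measurable \<Omega> \<Longrightarrow>
     (\<And>\<omega>. \<bar>f \<omega>\<bar> \<le> norm (J t \<omega> - J u \<omega>)) \<Longrightarrow> Lp_le \<Omega> 2 f (C * \<bar>t - u\<bar>)"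
proof -
  obtain C where C: "C > 0" "\<And>t u. t \<in> {0..1} \<Longrightarrow> u \<in> {0..1} \<Longrightarrow>
     Lq_norm M 2 (\<lambda>\<omega>. J t (past \<epsilon> 0 \<omega>) - J u (past \<epsilon> 0 \<omega>)) \<le> ennreal (C * \<bar>t - u\<bar>)"
    using J unfolding in_Lip_def by blast
  show thesis
  proof (rule that[OF C(1)])
    fix t u :: real and f :: "(nat \<Rightarrow> 's) \<Rightarrow> real"
    assume tu: "t \<in> {0..1}" "u \<in> {0..1}" and f: "f \<in> borel_measurable \<Omega>" and le: "\<And>\<omega>. \<bar>f \<omega>\<bar> \<le> norm (J t \<omega> - J u \<omega>)"
    have "Lp_le M 2 (\<lambda>\<omega>. f (past \<epsilon> 0 \<omega>)) (C * \<bar>t - u\<bar>)"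
      by (rule Lq_norm_Lp_le[where Z="\<lambda>\<omega>. J t (past \<epsilon> 0 \<omega>) - J u (past \<epsilon> 0 \<omega>)"])
        (use C tu f le in auto)
    then show "Lp_le \<Omega> 2 f (C * \<bar>t - u\<bar>)" by (rule Lp_le_past[OF f, THEN iffD1])
  qed
qed

text \<open>The bounded statistic \<open>min (norm (L t)) 1\<close> has a Lipschitz mean, and
  \<open>min (\<bar>H\<bar> * norm G) 1 \<le> \<bar>clip 1 H\<bar> * (norm G + 1)\<close> bounds this mean by a second moment of
  the clipped error.\<close>

lemma clipped_error_lower:
  fixes G :: "real \<Rightarrow> (nat \<Rightarrow> 's) \<Rightarrow> real ^ 'p::finite" and H :: "real \<Rightarrow> (nat \<Rightarrow> 's) \<Rightarrow> real"
  assumes G: "measurable_filter S G" and H: "measurable_filter S H" and lip: "in_Lip M \<epsilon> (product_filter G H)"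
    and t0: "t0 \<in> {0..1}" and nz: "Lq_norm M 2 (\<lambda>\<omega>. product_filter G H t0 (past \<epsilon> 0 \<omega>)) \<noteq> 0"
    and B: "\<And>t. t \<in> {0..1} \<Longrightarrow> Lp_le \<Omega> 2 (\<lambda>\<omega>. norm (G t \<omega>)) B"
  shows "\<exists>r>0. \<exists>c>0. \<forall>t\<in>{0..1}. \<bar>t - t0\<bar> < r \<longrightarrow> c \<le> (\<integral>\<omega>. (clip 1 (H t \<omega>))\<^sup>2 \<partial>\<Omega>)"
proof -
  let ?L = "product_filter G H"
  define q where "q t \<omega> = min (norm (?L t \<omega>)) 1" for t \<omega>
  define B' where "B' = B + 1"
  have B'1: "1 \<le> B'" using Lp_leD(2)[OF B[OF t0]] by (simp add: B'_def)
  have Gm[measurable]: "G t \<in> borel_measurable \<Omega>" and Hm[measurable]: "H t \<in> borel_measurable \<Omega>" if "t \<in> {0..1}" for t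
    using measurable_filter_at G H that by blast+
  have Lm: "?L t \<in> borel_measurable \<Omega>" if "t \<in> {0..1}" for t
    using Gm[OF that] Hm[OF that] unfolding product_filter_def[abs_def] by measurable
  have qm: "q t \<in> borel_measurable \<Omega>" if "t \<in> {0..1}" for t
    using Lm[OF that] unfolding q_def[abs_def] by measurable
  have q01: "0 \<le> q t \<omega>" "q t \<omega> \<le> 1" for t \<omega> by (auto simp: q_def)
  have qi: "integrable \<Omega> (q t)" if "t \<in> {0..1}" for t
    by (rule seq.P.integrable_const_bound[of _ 1]) (use q01 qm that in auto)
  define m where "m = (\<integral>\<omega>. q t0 \<omega> \<partial>\<Omega>)"
  have m: "0 < m"
  proof (rule ccontr)
    assume "\<not> 0 < m"
    moreover have "0 \<le> m" unfolding m_def using q01 by (intro integral_nonneg_AE) auto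
    ultimately have "(\<integral>\<omega>. q t0 \<omega> \<partial>\<Omega>) = 0" by (simp add: m_def)
    then have "AE \<omega> in \<Omega>. q t0 \<omega> = 0" using integral_nonneg_eq_0_iff_AE[OF qi[OF t0]] q01 by simp
    then have ae: "AE \<omega> in \<Omega>. ?L t0 \<omega> = 0" by eventually_elim (auto simp: q_def min_def split: if_splits)
    have "AE \<omega> in M. ?L t0 (past \<epsilon> 0 \<omega>) = 0"
    proof -
      have "AE \<omega> in distr M \<Omega> (past \<epsilon> 0). ?L t0 \<omega> = 0" unfolding distr_past by (rule ae)
      then show ?thesis by (rule AE_distrD[OF past_measurable])
    qed
    then have "(\<integral>\<^sup>+ \<omega>. ennreal (norm (?L t0 (past \<epsilon> 0 \<omega>)) powr 2) \<partial>M) = (\<integral>\<^sup>+ \<omega>. 0 \<partial>M)"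
      by (intro nn_integral_cong_AE) (auto elim: eventually_mono)
    then show False using nz by (simp add: Lq_norm_def)
  qed
  obtain C where C: "0 < C" and Lip: "\<And>t u f. t \<in> {0..1} \<Longrightarrow> u \<in> {0..1} \<Longrightarrow> f \<in> borel_measurable \<Omega> \<Longrightarrow>
     (\<And>\<omega>. \<bar>f \<omega>\<bar> \<le> norm (?L t \<omega> - ?L u \<omega>)) \<Longrightarrow> Lp_le \<Omega> 2 f (C * \<bar>t - u\<bar>)"
    using in_Lip_Lp_le[OF lip] by blast
  have "m\<^sup>2 / (4 * B'\<^sup>2) \<le> (\<integral>\<omega>. (clip 1 (H t \<omega>))\<^sup>2 \<partial>\<Omega>)" if t: "t \<in> {0..1}" and near: "\<bar>t - t0\<bar> < m / (2 * C)" for t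
  proof -
    note [measurable] = Gm[OF t] Hm[OF t]
    have "Lp_le \<Omega> 2 (\<lambda>\<omega>. q t0 \<omega> - q t \<omega>) (C * \<bar>t0 - t\<bar>)"
    proof (rule Lip[OF t0 t])
      show "(\<lambda>\<omega>. q t0 \<omega> - q t \<omega>) \<in> borel_measurable \<Omega>" using qm t0 t by measurable
      show "\<bar>q t0 \<omega> - q t \<omega>\<bar> \<le> norm (?L t0 \<omega> - ?L t \<omega>)" for \<omega>
        using norm_triangle_ineq3[of "?L t0 \<omega>" "?L t \<omega>"] by (auto simp: q_def min_def abs_if split: if_splits)
    qed
    from Lp_le_1(2)[OF seq.P.Lp_le_2_1[OF this]] have "\<bar>\<integral>\<omega>. q t0 \<omega> - q t \<omega> \<partial>\<Omega>\<bar> \<le> C * \<bar>t0 - t\<bar>" .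
    then have "m - (\<integral>\<omega>. q t \<omega> \<partial>\<Omega>) \<le> C * \<bar>t0 - t\<bar>" unfolding m_def using qi t0 t by simp
    moreover have "C * \<bar>t0 - t\<bar> \<le> m / 2" using near C by (simp add: field_simps abs_minus_commute)
    ultimately have mq: "m / 2 \<le> (\<integral>\<omega>. q t \<omega> \<partial>\<Omega>)" by linarith
    define Y where "Y \<omega> = norm (G t \<omega>) + 1" for \<omega>
    have Y2: "Lp_le \<Omega> 2 Y B'"
      unfolding Y_def[abs_def] B'_def using Lp_le_add[OF B[OF t] seq.P.Lp_le_const[of 2 1]] by simp
    have clip2: "Lp_le \<Omega> 2 (\<lambda>\<omega>. clip 1 (H t \<omega>)) 1"
      by (rule seq.P.Lp_le_bounded) (auto intro!: measurable_compose[OF Hm[OF t] clip_measurable] clip_bound)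
    have ints: "integrable \<Omega> (\<lambda>\<omega>. (Y \<omega>)\<^sup>2)" "integrable \<Omega> (\<lambda>\<omega>. (clip 1 (H t \<omega>))\<^sup>2)"
      using Lp_le_integral(1)[OF Y2] Lp_le_integral(1)[OF clip2] by simp_all
    have YB: "(\<integral>\<omega>. (Y \<omega>)\<^sup>2 \<partial>\<Omega>) \<le> B'\<^sup>2" using Lp_le_integral(2)[OF Y2] by simp
    define z where "z = m / (2 * B'\<^sup>2)"
    have z: "0 < z" using m B'1 by (simp add: z_def)
    have "(\<integral>\<omega>. q t \<omega> \<partial>\<Omega>) \<le> (\<integral>\<omega>. z / 2 * (Y \<omega>)\<^sup>2 + 1 / (2 * z) * (clip 1 (H t \<omega>))\<^sup>2 \<partial>\<Omega>)"
    proof (rule integral_mono[OF qi[OF t]])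
      show "integrable \<Omega> (\<lambda>\<omega>. z / 2 * (Y \<omega>)\<^sup>2 + 1 / (2 * z) * (clip 1 (H t \<omega>))\<^sup>2)"
        by (intro Bochner_Integration.integrable_add integrable_mult_right ints)
      fix \<omega>
      have "q t \<omega> \<le> \<bar>clip 1 (H t \<omega>)\<bar> * Y \<omega>"
      proof (cases "\<bar>H t \<omega>\<bar> \<le> 1")
        case True
        then have "clip 1 (H t \<omega>) = H t \<omega>" by (auto simp: clip_def)
        then show ?thesis by (simp add: q_def Y_def product_filter_def min.coboundedI1 distrib_left)
      next
        case False
        then have "\<bar>clip 1 (H t \<omega>)\<bar> = 1" by (auto simp: clip_def)
        then show ?thesis by (simp add: q_def Y_def min.coboundedI2)
      qed
      also have "\<dots> \<le> z / 2 * (Y \<omega>)\<^sup>2 + 1 / (2 * z) * (clip 1 (H t \<omega>))\<^sup>2"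
      proof -
        have "0 \<le> (z * Y \<omega> - \<bar>clip 1 (H t \<omega>)\<bar>)\<^sup>2 / (2 * z)" using z by simp
        also have "\<dots> = z / 2 * (Y \<omega>)\<^sup>2 + 1 / (2 * z) * (clip 1 (H t \<omega>))\<^sup>2 - \<bar>clip 1 (H t \<omega>)\<bar> * Y \<omega>"
          using z by (simp add: power2_diff field_simps power2_eq_square)
        finally show ?thesis by simp
      qed
      finally show "q t \<omega> \<le> z / 2 * (Y \<omega>)\<^sup>2 + 1 / (2 * z) * (clip 1 (H t \<omega>))\<^sup>2" .
    qed
    also have "\<dots> = z / 2 * (\<integral>\<omega>. (Y \<omega>)\<^sup>2 \<partial>\<Omega>) + 1 / (2 * z) * (\<integral>\<omega>. (clip 1 (H t \<omega>))\<^sup>2 \<partial>\<Omega>)"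
      using ints by (simp add: Bochner_Integration.integral_add)
    also have "\<dots> \<le> z / 2 * B'\<^sup>2 + 1 / (2 * z) * (\<integral>\<omega>. (clip 1 (H t \<omega>))\<^sup>2 \<partial>\<Omega>)"
      using YB z by (intro add_right_mono mult_left_mono) auto
    also have "z / 2 * B'\<^sup>2 = m / 4" using B'1 by (simp add: z_def)
    finally have "m / 4 \<le> 1 / (2 * z) * (\<integral>\<omega>. (clip 1 (H t \<omega>))\<^sup>2 \<partial>\<Omega>)" using mq by linarith
    then have "m / 4 * (2 * z) \<le> (\<integral>\<omega>. (clip 1 (H t \<omega>))\<^sup>2 \<partial>\<Omega>)" using z by (simp add: field_simps)
    moreover have "m / 4 * (2 * z) = m\<^sup>2 / (4 * B'\<^sup>2)" by (simp add: z_def power2_eq_square)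
    ultimately show ?thesis by simp
  qed
  moreover have "0 < m\<^sup>2 / (4 * B'\<^sup>2)" "0 < m / (2 * C)" using m B'1 C by simp_all
  ultimately show ?thesis by blast
qed

end

section \<open>Consistency of the criterion\<close>

context innovations
begin

text \<open>The dependence measure bounds the centred fourth moment, and the Lipschitz condition ties the mean
  at time \<open>t\<close> to the mean at time \<open>0\<close>.\<close>

lemma predictor_fourth_moment:
  fixes G :: "real \<Rightarrow> (nat \<Rightarrow> 's) \<Rightarrow> real ^ 'p::finite"
  assumes G: "measurable_filter S G" "in_Lip M \<epsilon> G" "dep_Theta M \<epsilon> \<epsilon>' G 0 4 < \<infinity>"
    and l: "0 < l" "\<forall>t\<in>{0..1}. l \<le> smallest_eigenvalue (moment_matrix M \<epsilon> G t)"
  shows "\<exists>B. \<forall>t\<in>{0..1}. \<forall>a. Lp_le \<Omega> 4 (\<lambda>\<omega>. G t \<omega> $ a) B"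
proof -
  note int = moment_matrix_coercive(2)[OF G(1) _ l(1) l(2)[rule_format]]
  have Gm: "(\<lambda>\<omega>. G t \<omega> $ a) \<in> borel_measurable \<Omega>" if "t \<in> {0..1}" for t a
    by (rule component_measurable[OF measurable_filter_at[OF G(1) that]])
  have comp: "\<bar>u $ a - v $ a\<bar> \<le> norm (u - v)" for u v :: "real ^ 'p" and a
    using component_le_norm_cart[of "u - v" a] by simp
  obtain C where C: "0 < C" and Lip: "\<And>t u f. t \<in> {0..1} \<Longrightarrow> u \<in> {0..1} \<Longrightarrow> f \<in> borel_measurable \<Omega> \<Longrightarrow>
     (\<And>\<omega>. \<bar>f \<omega>\<bar> \<le> norm (G t \<omega> - G u \<omega>)) \<Longrightarrow> Lp_le \<Omega> 2 f (C * \<bar>t - u\<bar>)"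
    using in_Lip_Lp_le[OF G(2)] by blast
  define m where "m = (\<Sum>a\<in>UNIV. \<bar>\<integral>\<omega>. G 0 \<omega> $ a \<partial>\<Omega>\<bar>) + C"
  have mean: "\<bar>\<integral>\<omega>. G t \<omega> $ a \<partial>\<Omega>\<bar> \<le> m" if t: "t \<in> {0..1}" for t a
  proof -
    have z: "(0::real) \<in> {0..1}" by simp
    have "Lp_le \<Omega> 2 (\<lambda>\<omega>. G t \<omega> $ a - G 0 \<omega> $ a) (C * \<bar>t - 0\<bar>)"
      by (rule Lip[OF t z]) (use Gm[OF t] Gm[OF z] comp in auto)
    from Lp_le_1(2)[OF seq.P.Lp_le_2_1[OF this]]
    have "\<bar>(\<integral>\<omega>. G t \<omega> $ a \<partial>\<Omega>) - (\<integral>\<omega>. G 0 \<omega> $ a \<partial>\<Omega>)\<bar> \<le> C * t"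
      using int[OF t t] int[OF z z] t by simp
    moreover have "C * t \<le> C * 1" using C t by (intro mult_left_mono) auto
    moreover have "\<bar>\<integral>\<omega>. G 0 \<omega> $ a \<partial>\<Omega>\<bar> \<le> (\<Sum>a\<in>UNIV. \<bar>\<integral>\<omega>. G 0 \<omega> $ a \<partial>\<Omega>\<bar>)"
      by (rule member_le_sum) auto
    ultimately show ?thesis unfolding m_def by linarith
  qed
  note dep = dep_delta_partial_sums[OF G(3)]
  show ?thesis
  proof (rule exI, intro ballI allI)
    fix t :: real and a assume t: "t \<in> {0..1}"
    show "Lp_le \<Omega> 4 (\<lambda>\<omega>. G t \<omega> $ a) (2 * enn2real (dep_Theta M \<epsilon> \<epsilon>' G 0 4) + m)"
    proof (rule seq.moment_of_influences(2)[OF _ dep(2) int[OF t t] mean[OF t]])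
      show "seq.influence 4 (\<lambda>\<omega>. G t \<omega> $ a) k (enn2real (dep_delta M \<epsilon> \<epsilon>' G k 4))" for k
        by (rule influence_of_dependence[OF t, of G]) (use dep(1) Gm[OF t] comp in auto)
    qed simp
  qed
qed

end

theorem theorem3p3:
  fixes M :: "'a measure"
    and S :: "'s measure"
    and \<epsilon> \<epsilon>' :: "int \<Rightarrow> 'a \<Rightarrow> 's"
    and G :: "real \<Rightarrow> (nat \<Rightarrow> 's) \<Rightarrow> real ^ 'p"
    and H :: "real \<Rightarrow> (nat \<Rightarrow> 's) \<Rightarrow> real"
    and \<beta> :: "real \<Rightarrow> real ^ 'p"
    and K :: "real \<Rightarrow> real"
    and b chi :: "nat \<Rightarrow> real"
    and \<beta>h \<beta>h' :: "nat \<Rightarrow> real \<Rightarrow> 'a \<Rightarrow> real ^ 'p"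
    and \<iota> \<nu> c :: real
    and D :: "'p set"
  defines "L \<equiv> product_filter G H"
    and "x \<equiv> observation \<epsilon> G"
    and "e \<equiv> observation \<epsilon> H"
    and "y \<equiv> response \<epsilon> G H \<beta>"
    and "D\<^sub>0 \<equiv> relevant_predictors \<beta>"
    and "\<phi> \<equiv> phi_rate \<iota> b"
    and "\<rho> \<equiv> rho_rate b"
  assumes prob: "prob_space M"
    and iid: "iid_with_copy M S \<epsilon> \<epsilon>'"
    and measurable_filters: "measurable_filter S G" "measurable_filter S H"
    and errors: "\<And>n i. 1 \<le> i \<Longrightarrow> i \<le> n \<Longrightarrow> cond_mean_zero M (x n i) (e n i)"
    and nondegenerate_errors: "\<exists>t\<in>{0..1}. Lq_norm M 2 (\<lambda>\<omega>. L t (past \<epsilon> 0 \<omega>)) \<noteq> 0"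
    and A1: "Ck_on 3 \<beta> {0..1}"
    and A2: "in_Lip M \<epsilon> G" "in_Lip M \<epsilon> L"
    and iota: "\<iota> > 2"
    and A3: "dep_Theta M \<epsilon> \<epsilon>' G 0 4 + dep_Theta M \<epsilon> \<epsilon>' L 0 \<iota> < \<infinity>"
    and A4: "\<exists>l>0. \<forall>t\<in>{0..1}. smallest_eigenvalue (moment_matrix M \<epsilon> G t) \<ge> l"
    and kernel: "smoothing_kernel K"
    and bandwidth: "\<And>n. 1 \<le> n \<Longrightarrow> b n > 0"
      "b \<longlonglongrightarrow> 0" "filterlim (\<lambda>n. real n * b n) at_top sequentially"
    and estimator: "local_linear_estimator M K b x y \<beta>h \<beta>h'"
    and dependence: "dep_Theta M \<epsilon> \<epsilon>' L 0 4 + dep_Theta M \<epsilon> \<epsilon>' H 0 2 < \<infinity>"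
    and nu: "\<nu> > 1 / 2 - 1 / \<iota>"
    and decay: "(\<lambda>n. enn2real (dep_Theta M \<epsilon> \<epsilon>' L n \<iota>)) \<in> O(\<lambda>n. real n powr (- \<nu>))"
    and c: "0 < c" "c < 1 - 1 / \<iota>"
    and bandwidth_order:
      "\<exists>l>0. \<exists>u. \<forall>n\<ge>1. l \<le> b n * real n powr c \<and> b n * real n powr c \<le> u"
    and tuning: "chi \<longlonglongrightarrow> 0"
      "filterlim (\<lambda>n. inverse (\<phi> n * (\<phi> n + \<rho> n)) * chi n) at_top sequentially"
    and D: "D \<noteq> D\<^sub>0"
  shows "(\<lambda>n. measure M {\<omega> \<in> space M.
             VIC n (\<lambda>i. x n i \<omega>) (\<lambda>i. y n i \<omega>) (\<lambda>t. \<beta>h n t \<omega>) (chi n) D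
               > VIC n (\<lambda>i. x n i \<omega>) (\<lambda>i. y n i \<omega>) (\<lambda>t. \<beta>h n t \<omega>) (chi n) D\<^sub>0})
         \<longlonglongrightarrow> 1"
proof -
  interpret innovations M S \<epsilon> \<epsilon>' by (intro innovations.intro innovations_axioms.intro prob iid)
  note Gf = measurable_filters(1) and Hf = measurable_filters(2)
  have fin: "dep_Theta M \<epsilon> \<epsilon>' G 0 4 < \<infinity>" "dep_Theta M \<epsilon> \<epsilon>' L 0 4 < \<infinity>" "dep_Theta M \<epsilon> \<epsilon>' H 0 2 < \<infinity>"
    using A3 dependence by auto
  obtain l where l: "0 < l" "\<forall>t\<in>{0..1}. l \<le> smallest_eigenvalue (moment_matrix M \<epsilon> G t)" using A4 by blast
  define d where "d k = enn2real (dep_delta M \<epsilon> \<epsilon>' G k 4) + enn2real (dep_delta M \<epsilon> \<epsilon>' L k 4) + enn2real (dep_delta M \<epsilon> \<epsilon>' H k 2)" for k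
  define \<Theta> where "\<Theta> = enn2real (dep_Theta M \<epsilon> \<epsilon>' G 0 4) + enn2real (dep_Theta M \<epsilon> \<epsilon>' L 0 4) + enn2real (dep_Theta M \<epsilon> \<epsilon>' H 0 2)"
  have d: "0 \<le> d k" "(\<Sum>k<m. d k) \<le> \<Theta>" for k m
    using dep_delta_partial_sums(2)[OF fin(1), of m] dep_delta_partial_sums(2)[OF fin(2), of m] dep_delta_partial_sums(2)[OF fin(3), of m]
    by (simp_all add: d_def \<Theta>_def sum.distrib)
  obtain B4 where B4: "\<And>t a. t \<in> {0..1} \<Longrightarrow> Lp_le \<Omega> 4 (\<lambda>\<omega>. G t \<omega> $ a) B4"
    using predictor_fourth_moment[OF Gf A2(1) fin(1) l] by blast
  obtain BK \<kappa> v1 v2 where BK: "\<And>v. K v \<le> BK" and \<kappa>: "0 < \<kappa>" "\<And>v. v1 \<le> \<bar>v\<bar> \<Longrightarrow> \<bar>v\<bar> \<le> v2 \<Longrightarrow> \<kappa> \<le> K v"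
    and v12: "0 \<le> v1" "v1 < v2" "v2 \<le> 1"
    by (rule smoothing_kernel_window[OF kernel], rule that)
  obtain \<beta>' B\<beta> where B\<beta>: "0 \<le> B\<beta>" "\<And>t. t \<in> {0..1} \<Longrightarrow> norm (\<beta> t) \<le> B\<beta>"
    and taylor: "\<And>t u. t \<in> {0..1} \<Longrightarrow> u \<in> {0..1} \<Longrightarrow> norm (\<beta> u - \<beta> t - (u - t) *\<^sub>R \<beta>' t) \<le> B\<beta> * (u - t)\<^sup>2"
    by (rule Ck_on_taylor[OF A1], rule that)
  define A where "A = 1 + \<Theta> + B4 + \<bar>BK\<bar> + B\<beta>"
  have "0 \<le> B4" using Lp_leD(2)[OF B4[of 0]] by simp
  moreover have "0 \<le> \<Theta>" by (simp add: \<Theta>_def)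
  ultimately have A: "1 \<le> A" "\<Theta> \<le> A" "B4 \<le> A" "BK \<le> A" "B\<beta> \<le> A" using B\<beta>(1) unfolding A_def by linarith+
  have grid: "real i / real n \<in> {0..1}" if "i \<in> {1..n}" for i n using that by simp
  have Gm: "G t \<in> borel_measurable \<Omega>" and Hm: "H t \<in> borel_measurable \<Omega>" and Gam: "(\<lambda>\<omega>. G t \<omega> $ a) \<in> borel_measurable \<Omega>" if "t \<in> {0..1}" for t a
    using measurable_filter_at[OF Gf that] measurable_filter_at[OF Hf that] component_measurable by blast+
  have Lam: "(\<lambda>\<omega>. H t \<omega> * G t \<omega> $ a) \<in> borel_measurable \<Omega>" if "t \<in> {0..1}" for t a
    using Hm[OF that] Gam[OF that] by measurable
  have comp: "\<bar>u $ a - v $ a\<bar> \<le> norm (u - v)" for u v :: "real ^ 'p" and a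
    using component_le_norm_cart[of "u - v" a] by simp
  have Gd: "seq.influence 4 (\<lambda>\<omega>. G t \<omega> $ a) k (d k)" if t: "t \<in> {0..1}" for t a k
    by (rule seq.influence_weaken[OF influence_of_dependence[OF t, of G k 4 "enn2real (dep_delta M \<epsilon> \<epsilon>' G k 4)"]])
      (use dep_delta_partial_sums(1)[OF fin(1)] Gam[OF t] comp in \<open>auto simp: d_def\<close>)
  have LaGH: "L t \<omega> $ a = H t \<omega> * G t \<omega> $ a" for t \<omega> a by (simp add: L_def product_filter_def)
  have Ld: "seq.influence 4 (\<lambda>\<omega>. H t \<omega> * G t \<omega> $ a) k (d k)" if t: "t \<in> {0..1}" for t a k
    by (rule seq.influence_weaken[OF influence_of_dependence[OF t, of L k 4 "enn2real (dep_delta M \<epsilon> \<epsilon>' L k 4)"]])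
      (use dep_delta_partial_sums(1)[OF fin(2)] Lam[OF t] comp in \<open>auto simp: d_def LaGH[symmetric]\<close>)
  have Hd: "seq.influence 2 (H t) k (d k)" if t: "t \<in> {0..1}" for t k
    by (rule seq.influence_weaken[OF influence_of_dependence[OF t, of H k 2 "enn2real (dep_delta M \<epsilon> \<epsilon>' H k 2)"]])
      (use dep_delta_partial_sums(1)[OF fin(3)] Hm[OF t] in \<open>auto simp: d_def\<close>)
  have H_mean: "integrable \<Omega> (H (real i / real n))" "(\<integral>\<omega>. H (real i / real n) \<omega> \<partial>\<Omega>) = 0"
    and L_mean: "(\<integral>\<omega>. H (real i / real n) \<omega> * G (real i / real n) \<omega> $ a \<partial>\<Omega>) = 0"
    and H2: "Lp_le \<Omega> 2 (H (real i / real n)) \<Theta>" if i: "i \<in> {1..n}" for i n a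
  proof -
    let ?t = "real i / real n"
    note t = grid[OF i]
    have cm: "cond_mean_zero M (x n i) (e n i)" using i by (intro errors) auto
    have xe: "x n i = (\<lambda>\<omega>. G ?t (past \<epsilon> (int i) \<omega>))" "e n i = (\<lambda>\<omega>. H ?t (past \<epsilon> (int i) \<omega>))"
      by (simp_all add: x_def e_def observation_def fun_eq_iff)
    have xm: "x n i \<in> borel_measurable M" unfolding xe by (rule measurable_compose[OF past_measurable Gm[OF t]])
    show int: "integrable \<Omega> (H ?t)" using cm integrable_past[OF Hm[OF t], of "int i"] by (simp add: cond_mean_zero_def xe)
    show mean: "(\<integral>\<omega>. H ?t \<omega> \<partial>\<Omega>) = 0"
      using cond_mean_zero_moments(1)[OF cm xm] integral_past[OF Hm[OF t], of "int i"] by (simp add: xe)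
    show H2: "Lp_le \<Omega> 2 (H ?t) \<Theta>"
      using seq.moment_of_influences(1)[OF d int, of 0] mean Hd[OF t] by simp
    have "integrable \<Omega> (\<lambda>\<omega>. H ?t \<omega> * G ?t \<omega> $ a)"
      by (rule Lp_le_1(1)[OF Lp_le_mult_2_1[OF H2 seq.P.Lp_le_4_2[OF B4[OF t]]]])
    then have "integrable M (\<lambda>\<omega>. x n i \<omega> $ a * e n i \<omega>)"
      using integrable_past[OF Lam[OF t], of "int i" a] by (simp add: xe mult.commute)
    from cond_mean_zero_moments(2)[OF cm xm _ this] have "(\<integral>\<omega>. x n i \<omega> $ a * e n i \<omega> \<partial>M) = 0"
      by (simp add: component_measurable[OF measurable_ident_sets[OF refl]])
    then show "(\<integral>\<omega>. H ?t \<omega> * G ?t \<omega> $ a \<partial>\<Omega>) = 0"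
      using integral_past[OF Lam[OF t], of "int i" a] by (simp add: xe mult.commute)
  qed
  \<comment> \<open>Observation \<open>i\<close> as a function of the past of time \<open>n\<close>, which is common to the whole sample.\<close>
  define X where "X n i \<omega> = G (real i / real n) (seq.shift (n - i) \<omega>)" for n i \<omega>
  define E where "E n i \<omega> = H (real i / real n) (seq.shift (n - i) \<omega>)" for n i \<omega>
  define h where "h n = real n * b n" for n
  \<comment> \<open>The value at \<open>n = 0\<close> only has to be positive.\<close>
  define s where "s n = (if n = 0 then 1 else (b n)\<^sup>2)" for n :: nat
  define R where "R n i j = \<beta> (real j / real n) - \<beta> (real i / real n) - (real j / real n - real i / real n) *\<^sub>R \<beta>' (real i / real n)" for n i j :: nat
  have b_pos: "\<forall>n\<ge>1. b n > 0" using bandwidth(1) by blast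
  note rates = tuning_rates[OF b_pos bandwidth(2,3) tuning[unfolded \<phi>_def \<rho>_def]]
  interpret RA: regression_array N X E "seq.lag_weights d" h s R K A l \<kappa> v1 v2 "real CARD('p)"
  proof
    show "schur_weights n (seq.lag_weights d n) A" for n
      using seq.schur_lag_weights[OF d, of n] A(2) unfolding schur_weights_def by (meson order_trans)
    show "Lp_le \<Omega> 4 (\<lambda>\<omega>. X n i \<omega> $ a) A" if "i \<in> {1..n}" for n i a
      unfolding X_def by (rule Lp_le_weaken[OF seq.Lp_le_shift[OF B4[OF grid[OF that]]] A(3)])
    show "seq.influence 4 (\<lambda>\<omega>. X n i \<omega> $ a) k (seq.lag_weights d n i k)" if "i \<in> {1..n}" for n i a k
      unfolding X_def by (rule seq.influence_lag[OF Gd[OF grid[OF that]] Gam[OF grid[OF that]]]) simp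
    show "Lp_le \<Omega> 2 (E n i) A" if "i \<in> {1..n}" for n i
      unfolding E_def[abs_def] by (rule Lp_le_weaken[OF seq.Lp_le_shift[OF H2[OF that]] A(2)])
    show "(\<integral>\<omega>. E n i \<omega> * X n i \<omega> $ a \<partial>\<Omega>) = 0" if "i \<in> {1..n}" for n i a
      unfolding X_def E_def using seq.integral_shift[OF Lam[OF grid[OF that]], of "n - i" a] L_mean[OF that, of a] by simp
    show "seq.influence 4 (\<lambda>\<omega>. E n i \<omega> * X n i \<omega> $ a) k (seq.lag_weights d n i k)" if "i \<in> {1..n}" for n i a k
      unfolding X_def E_def by (rule seq.influence_lag[OF Ld[OF grid[OF that]] Lam[OF grid[OF that]]]) simp
    show "l * (norm u)\<^sup>2 \<le> (\<integral>\<omega>. (X n i \<omega> \<bullet> u)\<^sup>2 \<partial>\<Omega>)" if "i \<in> {1..n}" for n i u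
    proof -
      note t = grid[OF that]
      have "(\<lambda>\<omega>. (G (real i / real n) \<omega> \<bullet> u)\<^sup>2) \<in> borel_measurable \<Omega>" using Gm[OF t] by measurable
      from seq.integral_shift[OF this, of "n - i"] moment_matrix_coercive(3)[OF Gf t l(1) l(2)[rule_format, OF t], of u]
      show ?thesis by (simp add: X_def)
    qed
    show "0 \<le> K v" for v using kernel by (simp add: smoothing_kernel_def)
    show "K v \<le> A" for v using BK[of v] A(4) by linarith
    show "K v = 0" if "\<bar>v\<bar> > 1" for v
    proof -
      have "v \<notin> {-1..1}" using that by auto
      then show ?thesis using kernel unfolding smoothing_kernel_def by blast
    qed
    show "0 < s n" for n using bandwidth(1)[of n] by (auto simp: s_def)
    show "norm (R n i j) \<le> A * s n" if near: "\<bar>real j - real i\<bar> \<le> h n" and i: "i \<in> {1..n}" and j: "j \<in> {1..n}" for n i j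
    proof -
      have n: "0 < real n" using i by simp
      have "\<bar>real j / real n - real i / real n\<bar> = \<bar>real j - real i\<bar> / real n" using n by (simp add: diff_divide_distrib[symmetric] abs_divide)
      also have "\<dots> \<le> b n" using near n by (simp add: h_def pos_divide_le_eq mult.commute)
      finally have "\<bar>real j / real n - real i / real n\<bar>\<^sup>2 \<le> (b n)\<^sup>2" by (rule power_mono) simp
      then have "B\<beta> * (real j / real n - real i / real n)\<^sup>2 \<le> A * s n"
        using A B\<beta>(1) n by (intro mult_mono) (auto simp: s_def)
      then show ?thesis using taylor[OF grid[OF i] grid[OF j]] unfolding R_def by linarith
    qed
    show "filterlim h at_top sequentially" using bandwidth(3) by (simp add: h_def[abs_def])
    show "(\<lambda>n. h n / real n) \<longlonglongrightarrow> 0"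
      by (rule Lim_transform_eventually[OF bandwidth(2)])
        (use eventually_gt_at_top[of "0::nat"] in \<open>eventually_elim, simp add: h_def\<close>)
    show "(\<lambda>n. real n / h n ^ 3) \<longlonglongrightarrow> 0" using rates(2) by (simp add: h_def)
  qed (use A \<kappa> v12 l in auto)
  have s_ev: "\<forall>\<^sub>F n in sequentially. s n = (b n)\<^sup>2"
    using eventually_gt_at_top[of "0::nat"] by eventually_elim (simp add: s_def)
  have eq0: "\<beta> t $ a = 0" if "t \<in> {0..1}" "a \<notin> D\<^sub>0" for t a using that by (auto simp: D\<^sub>0_def relevant_predictors_def)
  interpret RS: regression_selection N X E "seq.lag_weights d" h s R K A l \<kappa> v1 v2 "real CARD('p)" "\<lambda>n i. \<beta> (real i / real n)" D\<^sub>0 chi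
  proof
    show "seq.influence 2 (E n i) k (seq.lag_weights d n i k)" if "i \<in> {1..n}" for n i k
      unfolding E_def[abs_def] by (rule seq.influence_lag[OF Hd[OF grid[OF that]] Hm[OF grid[OF that]]]) simp
    show "norm (\<beta> (real i / real n)) \<le> A" if "i \<in> {1..n}" for i n using B\<beta>(2)[OF grid[OF that]] A by linarith
    show "\<beta> (real i / real n) $ a = 0" if "i \<in> {1..n}" "a \<notin> D\<^sub>0" for i n a using eq0 grid that by blast
    show "\<exists>q>0. \<forall>\<^sub>F n in sequentially. q * real n \<le> (\<Sum>i=1..n. (\<beta> (real i / real n) $ a)\<^sup>2)" if "a \<in> D\<^sub>0" for a
    proof -
      obtain t0 where t0: "t0 \<in> {0..1}" "\<beta> t0 $ a \<noteq> 0" using \<open>a \<in> D\<^sub>0\<close> by (auto simp: D\<^sub>0_def relevant_predictors_def)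
      let ?c = "(\<beta> t0 $ a)\<^sup>2"
      have c0: "0 < ?c / 2" "0 < ?c" using t0 by simp_all
      have "continuous_on {0..1} (\<lambda>t. (\<beta> t $ a)\<^sup>2)"
        by (intro continuous_intros continuous_on_compose2[OF linear_continuous_on[OF bounded_linear_vec_nth] Ck_on_continuous[OF A1]]) auto
      then obtain r where r: "r > 0" "\<And>t. t \<in> {0..1} \<Longrightarrow> dist t t0 < r \<Longrightarrow> dist ((\<beta> t $ a)\<^sup>2) ?c < ?c / 2"
        using t0(1) c0(1) unfolding continuous_on_iff by metis
      show ?thesis
      proof (rule riemann_sum_lower[OF t0(1) r(1) c0(1)])
        show "?c / 2 \<le> (\<beta> t $ a)\<^sup>2" if "t \<in> {0..1}" "\<bar>t - t0\<bar> < r" for t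
          using r(2)[OF that(1)] that(2) unfolding dist_real_def by linarith
      qed simp
    qed
    show "\<exists>\<nu>>0. \<exists>q>0. \<forall>\<^sub>F n in sequentially. q * real n \<le> (\<Sum>i=1..n. \<integral>\<omega>. (clip \<nu> (E n i \<omega>))\<^sup>2 \<partial>\<Omega>)"
    proof -
      obtain t0 where t0: "t0 \<in> {0..1}" "Lq_norm M 2 (\<lambda>\<omega>. product_filter G H t0 (past \<epsilon> 0 \<omega>)) \<noteq> 0"
        using nondegenerate_errors unfolding L_def by blast
      have "Lp_le \<Omega> 2 (\<lambda>\<omega>. norm (G t \<omega>)) (\<Sum>a\<in>(UNIV :: 'p set). B4)" if t: "t \<in> {0..1}" for t
      proof (rule Lp_le_dominated)
        show "Lp_le \<Omega> 2 (\<lambda>\<omega>. \<Sum>a\<in>UNIV. \<bar>G t \<omega> $ a\<bar>) (\<Sum>a\<in>(UNIV :: 'p set). B4)"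
        proof (rule Lp_le_sum)
          show "Lp_le \<Omega> 2 (\<lambda>\<omega>. \<bar>G t \<omega> $ a\<bar>) B4" for a
            by (rule Lp_le_dominated[OF seq.P.Lp_le_4_2[OF B4[OF t, of a]]]) (use Gam[OF t] in auto)
        qed simp
        show "\<bar>norm (G t \<omega>)\<bar> \<le> \<bar>\<Sum>a\<in>UNIV. \<bar>G t \<omega> $ a\<bar>\<bar>" for \<omega>
          using norm_le_l1_cart[of "G t \<omega>"] by (simp add: sum_nonneg)
      qed (use Gm[OF t] in measurable)
      from clipped_error_lower[OF Gf Hf A2(2)[unfolded L_def] t0 this]
      obtain r c where rc: "r > 0" "c > 0" "\<And>t. t \<in> {0..1} \<Longrightarrow> \<bar>t - t0\<bar> < r \<Longrightarrow> c \<le> (\<integral>\<omega>. (clip 1 (H t \<omega>))\<^sup>2 \<partial>\<Omega>)" by blast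
      have "\<exists>q>0. \<forall>\<^sub>F n in sequentially. q * real n \<le> (\<Sum>i=1..n. \<integral>\<omega>. (clip 1 (H (real i / real n) \<omega>))\<^sup>2 \<partial>\<Omega>)"
        by (rule riemann_sum_lower[OF t0(1) rc(1,2)]) (use rc(3) in auto)
      moreover have "(\<Sum>i=1..n. \<integral>\<omega>. (clip 1 (E n i \<omega>))\<^sup>2 \<partial>\<Omega>) = (\<Sum>i=1..n. \<integral>\<omega>. (clip 1 (H (real i / real n) \<omega>))\<^sup>2 \<partial>\<Omega>)" for n
      proof (rule sum.cong[OF refl])
        fix i assume i: "i \<in> {1..n}"
        have "(\<lambda>\<omega>. (clip 1 (H (real i / real n) \<omega>))\<^sup>2) \<in> borel_measurable \<Omega>"
          using measurable_compose[OF Hm[OF grid[OF i]] clip_measurable] by measurable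
        from seq.integral_shift[OF this] show "(\<integral>\<omega>. (clip 1 (E n i \<omega>))\<^sup>2 \<partial>\<Omega>) = (\<integral>\<omega>. (clip 1 (H (real i / real n) \<omega>))\<^sup>2 \<partial>\<Omega>)"
          by (simp add: E_def)
      qed
      ultimately show ?thesis by (intro exI[of _ 1]) simp
    qed
    show "chi \<longlonglongrightarrow> 0" by (rule tuning(1))
    show "\<forall>\<^sub>F n in sequentially. 0 < chi n" by (rule rates(1))
    show "(\<lambda>n. RA.rate_sq n / chi n) \<longlonglongrightarrow> 0"
      by (rule Lim_transform_eventually[OF rates(3)]) (use s_ev in \<open>eventually_elim, simp add: RA.rate_sq_def h_def\<close>)
    show "(\<lambda>n. RA.rate_cross n / chi n) \<longlonglongrightarrow> 0"
      by (rule Lim_transform_eventually[OF rates(4)]) (use s_ev in \<open>eventually_elim, simp add: RA.rate_cross_def h_def\<close>)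
  qed
  have canon: "X n i (past \<epsilon> (int n) \<omega>) = x n i \<omega>" "E n i (past \<epsilon> (int n) \<omega>) = e n i \<omega>" if i: "i \<in> {1..n}" for n i \<omega>
  proof -
    have "seq.shift (n - i) (past \<epsilon> (int n) \<omega>) = past \<epsilon> (int i) \<omega>"
      using i by (auto simp: seq.shift_def past_def fun_eq_iff of_nat_diff algebra_simps)
    then show "X n i (past \<epsilon> (int n) \<omega>) = x n i \<omega>" "E n i (past \<epsilon> (int n) \<omega>) = e n i \<omega>"
      by (simp_all add: X_def E_def x_def e_def observation_def)
  qed
  \<comment> \<open>The solution of the normal equations: slope errors in units of the bandwidth.\<close>
  define \<Delta> where "\<Delta> n \<omega> i = (\<beta>h n (real i / real n) \<omega> - \<beta> (real i / real n), b n *\<^sub>R (\<beta>h' n (real i / real n) \<omega> - \<beta>' (real i / real n)))" for n \<omega> and i :: nat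
  have y: "y n j \<omega> = x n j \<omega> \<bullet> \<beta> (real j / real n) + e n j \<omega>" for n j \<omega>
    by (simp add: y_def x_def e_def response_def)
  have normal: "RA.normal_equations n (past \<epsilon> (int n) \<omega>) (\<Delta> n \<omega>)" if n: "1 \<le> n" and \<omega>: "\<omega> \<in> space M" for n \<omega>
    unfolding RA.normal_equations_def
  proof (intro ballI allI)
    fix i and dir :: "(real ^ 'p) \<times> (real ^ 'p)" assume i: "i \<in> {1..n}"
    let ?t = "real i / real n"
    let ?\<omega> = "past \<epsilon> (int n) \<omega>"
    have bn: "0 < b n" using bandwidth(1) n by simp
    have "is_arg_min (local_linear_criterion K (b n) n (\<lambda>i. x n i \<omega>) (\<lambda>i. y n i \<omega>) ?t) (\<lambda>_. True) (\<beta>h n ?t \<omega>, \<beta>h' n ?t \<omega>)"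
      using estimator n \<omega> grid[OF i] unfolding local_linear_estimator_def by blast
    note ne = local_linear_normal_equation[OF this, of "fst dir" "inverse (b n) *\<^sub>R snd dir"]
    have pos: "(real j / real n - ?t) / b n = RA.pos n i j" for j
      using n bn by (simp add: RA.pos_def h_def diff_divide_distrib)
    have step: "real j / real n - ?t = b n * RA.pos n i j" for j
      using bn by (simp add: pos[symmetric])
    have "(\<Sum>j=1..n. RA.kw n i 0 j * (e n j \<omega> + x n j \<omega> \<bullet> R n i j - x n j \<omega> \<bullet> (fst (\<Delta> n \<omega> i) + RA.pos n i j *\<^sub>R snd (\<Delta> n \<omega> i)))
              * (x n j \<omega> \<bullet> (fst dir + RA.pos n i j *\<^sub>R snd dir))) = 0"
    proof -
      have "RA.kw n i 0 j * (e n j \<omega> + x n j \<omega> \<bullet> R n i j - x n j \<omega> \<bullet> (fst (\<Delta> n \<omega> i) + RA.pos n i j *\<^sub>R snd (\<Delta> n \<omega> i)))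
              * (x n j \<omega> \<bullet> (fst dir + RA.pos n i j *\<^sub>R snd dir))
        = 1 / h n * (K ((real j / real n - ?t) / b n) * (y n j \<omega> - x n j \<omega> \<bullet> \<beta>h n ?t \<omega> - (x n j \<omega> \<bullet> \<beta>h' n ?t \<omega>) * (real j / real n - ?t))
            * (x n j \<omega> \<bullet> fst dir + (x n j \<omega> \<bullet> (inverse (b n) *\<^sub>R snd dir)) * (real j / real n - ?t)))" for j
      proof -
        have r: "e n j \<omega> + x n j \<omega> \<bullet> R n i j - x n j \<omega> \<bullet> (fst (\<Delta> n \<omega> i) + RA.pos n i j *\<^sub>R snd (\<Delta> n \<omega> i))
          = y n j \<omega> - x n j \<omega> \<bullet> \<beta>h n ?t \<omega> - (x n j \<omega> \<bullet> \<beta>h' n ?t \<omega>) * (real j / real n - ?t)"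
          unfolding R_def step y \<Delta>_def by (simp add: inner_diff_right inner_add_right algebra_simps)
        have z: "x n j \<omega> \<bullet> (fst dir + RA.pos n i j *\<^sub>R snd dir) = x n j \<omega> \<bullet> fst dir + (x n j \<omega> \<bullet> (inverse (b n) *\<^sub>R snd dir)) * (real j / real n - ?t)"
          unfolding step using bn by (simp add: inner_add_right)
        have k: "RA.kw n i 0 j = 1 / h n * K ((real j / real n - ?t) / b n)" unfolding pos by (simp add: RA.kw_def)
        show ?thesis unfolding r z k by (simp add: mult.assoc)
      qed
      then show ?thesis using ne by (simp only: sum_distrib_left[symmetric] mult_zero_right)
    qed
    also have "(\<Sum>j=1..n. RA.kw n i 0 j * (e n j \<omega> + x n j \<omega> \<bullet> R n i j - x n j \<omega> \<bullet> (fst (\<Delta> n \<omega> i) + RA.pos n i j *\<^sub>R snd (\<Delta> n \<omega> i)))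
              * (x n j \<omega> \<bullet> (fst dir + RA.pos n i j *\<^sub>R snd dir)))
       = RA.Tf n i ?\<omega> dir + RA.Bf n i ?\<omega> dir - RA.Sf n i ?\<omega> (\<Delta> n \<omega> i) dir"
      unfolding RA.Tf_def RA.Bf_def RA.Sf_def sum.distrib[symmetric] sum_subtractf[symmetric]
      by (intro sum.cong refl) (simp add: canon distrib_left distrib_right left_diff_distrib right_diff_distrib mult_ac)
    finally show "RA.Sf n i ?\<omega> (\<Delta> n \<omega> i) dir = RA.Tf n i ?\<omega> dir + RA.Bf n i ?\<omega> dir" by linarith
  qed
  \<comment> \<open>Replacing the response by its model turns the residuals of the sample into the canonical ones.\<close>
  have vic: "RS.vic n (past \<epsilon> (int n) \<omega>) (\<Delta> n \<omega>) F = VIC n (\<lambda>i. x n i \<omega>) (\<lambda>i. y n i \<omega>) (\<lambda>t. \<beta>h n t \<omega>) (chi n) F" for n \<omega> F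
  proof -
    have "RS.residual n i (past \<epsilon> (int n) \<omega>) (\<Delta> n \<omega>) F = y n i \<omega> - (\<Sum>j\<in>F. x n i \<omega> $ j * \<beta>h n (real i / real n) \<omega> $ j)" if i: "i \<in> {1..n}" for i
    proof -
      let ?b = "\<beta> (real i / real n)"
      have "x n i \<omega> \<bullet> ?b = (\<Sum>a\<in>F. x n i \<omega> $ a * ?b $ a) + (\<Sum>a\<in>- F. x n i \<omega> $ a * ?b $ a)"
        unfolding inner_vec_def inner_real_def by (subst sum.union_disjoint[symmetric]) (auto intro!: sum.cong)
      then show ?thesis
        by (simp add: RS.residual_def canon[OF i] y \<Delta>_def inner_restrict_to right_diff_distrib sum_subtractf)
    qed
    then have "RS.rss n (past \<epsilon> (int n) \<omega>) (\<Delta> n \<omega>) F = RSS n (\<lambda>i. x n i \<omega>) (\<lambda>i. y n i \<omega>) (\<lambda>t. \<beta>h n t \<omega>) F"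
      unfolding RS.rss_def RSS_def by (intro sum.cong refl) simp
    then show ?thesis by (simp add: RS.vic_def VIC_def)
  qed
  have whp: "whp M (\<lambda>n \<omega>. VIC n (\<lambda>i. x n i \<omega>) (\<lambda>i. y n i \<omega>) (\<lambda>t. \<beta>h n t \<omega>) (chi n) D\<^sub>0
      < VIC n (\<lambda>i. x n i \<omega>) (\<lambda>i. y n i \<omega>) (\<lambda>t. \<beta>h n t \<omega>) (chi n) D)"
  proof (rule whp_mono[OF whp_vimage[OF past_measurable distr_past RS.vic_consistent[OF D], of "\<lambda>n. int n"]])
    show "\<forall>\<^sub>F n in sequentially. \<forall>\<omega>\<in>space M.
       (\<forall>\<Delta>. RA.normal_equations n (past \<epsilon> (int n) \<omega>) \<Delta> \<longrightarrow> RS.vic n (past \<epsilon> (int n) \<omega>) \<Delta> D\<^sub>0 < RS.vic n (past \<epsilon> (int n) \<omega>) \<Delta> D) \<longrightarrow>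
       VIC n (\<lambda>i. x n i \<omega>) (\<lambda>i. y n i \<omega>) (\<lambda>t. \<beta>h n t \<omega>) (chi n) D\<^sub>0 < VIC n (\<lambda>i. x n i \<omega>) (\<lambda>i. y n i \<omega>) (\<lambda>t. \<beta>h n t \<omega>) (chi n) D"
      using eventually_ge_at_top[of "1::nat"]
    proof eventually_elim
      case (elim n)
      show ?case using normal[OF elim] vic[of n] by metis
    qed
  qed
  show ?thesis
  proof (rule whp_measure_tendsto[OF prob whp])
    fix n :: nat assume n: "n \<ge> 1"
    have xm: "x n i \<in> borel_measurable M" and em: "e n i \<in> borel_measurable M" and bm: "\<beta>h n (real i / real n) \<in> borel_measurable M" if "i \<in> {1..n}" for i
    proof -
      note t = grid[OF that]
      show "x n i \<in> borel_measurable M" "e n i \<in> borel_measurable M"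
        unfolding x_def e_def observation_def[abs_def] by (rule measurable_compose[OF past_measurable Gm[OF t]] measurable_compose[OF past_measurable Hm[OF t]])+
      show "\<beta>h n (real i / real n) \<in> borel_measurable M" using estimator n t unfolding local_linear_estimator_def by blast
    qed
    have vm: "(\<lambda>\<omega>. VIC n (\<lambda>i. x n i \<omega>) (\<lambda>i. y n i \<omega>) (\<lambda>t. \<beta>h n t \<omega>) (chi n) F) \<in> borel_measurable M" for F
    proof -
      have "(\<lambda>\<omega>. (y n i \<omega> - (\<Sum>j\<in>F. x n i \<omega> $ j * \<beta>h n (real i / real n) \<omega> $ j))\<^sup>2) \<in> borel_measurable M" if i: "i \<in> {1..n}" for i
      proof -
        note [measurable] = xm[OF i] em[OF i] component_measurable[OF xm[OF i]] component_measurable[OF bm[OF i]]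
        show ?thesis unfolding y by measurable
      qed
      then have "(\<lambda>\<omega>. RSS n (\<lambda>i. x n i \<omega>) (\<lambda>i. y n i \<omega>) (\<lambda>t. \<beta>h n t \<omega>) F) \<in> borel_measurable M"
        unfolding RSS_def by (rule borel_measurable_sum)
      then show ?thesis unfolding VIC_def by measurable
    qed
    show "{\<omega> \<in> space M. VIC n (\<lambda>i. x n i \<omega>) (\<lambda>i. y n i \<omega>) (\<lambda>t. \<beta>h n t \<omega>) (chi n) D\<^sub>0
        < VIC n (\<lambda>i. x n i \<omega>) (\<lambda>i. y n i \<omega>) (\<lambda>t. \<beta>h n t \<omega>) (chi n) D} \<in> sets M"
      using vm by measurable
  qed
qed

end
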